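(* Let $s>0$ be a real number and let $\mathcal V$ be a finite-dimensional $\mathcal K^s_x$-vector space with connection. Then there exist $\mathcal K^s_x$-vector spaces with connection $\mathcal V_{<1/s}$, $\mathcal V_{=1/s}$, $\mathcal V_{>1/s}$, whose formal slopes are respectively all strictly smaller than $\frac1s$, all equal to $\frac1s$, all strictly greater than $\frac1s$, and an isomorphism of $\mathcal K^s_x$-vector spaces with connection $$\mathcal V\cong\mathcal V_{<1/s}\oplus\mathcal V_{=1/s}\oplus\mathcal V_{>1/s}.$$
   Context: $\mathcal K^s_x=\mathbb C\{x\}_s[x^{-1}]$ is the field of $s$-Gevrey series: $\mathbb C\{x\}_s$ is the ring of power series $\sum_{i\ge0}a_ix^i$, $a_i\in\mathbb C$, such that $\sum_{i\ge0}\frac{a_i}{(i!)^s}x^i$ has nonzero radius of convergence. A connection on a $\mathcal K^s_x$-vector space $\mathcal V$ is a $\mathbb C$-linear map $\nabla:\mathcal V\to\mathcal V$ with $\nabla(\alpha v)=\frac{d\alpha}{dx}v+\alpha\nabla(v)$; isomorphisms of vector spaces with connection are linear isomorphisms commuting with $\nabla$. The formal slopes of $\mathcal V$ are the slopes (of the Newton polygon, in the usual normalization where a regular singularity has slope $0$ and the rank one connection with $\nabla(1)=x^{-2}$ has slope $1$) of the formal connection $\mathbb C((x))\otimes_{\mathcal K^s_x}\mathcal V$. The zero space is allowed as a summand. *)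

theory Defs
  imports
    "HOL-Analysis.Analysis"
    "HOL-Computational_Algebra.Formal_Laurent_Series"
    "HOL-Algebra.Free_Abelian_Groups"
    "Jordan_Normal_Form.Missing_VectorSpace"
begin

text \<open>
  Vector spaces are those of the locale \<^locale>\<open>vectorspace\<close> (on top of \<open>HOL-Algebra\<close>), with
  explicit carriers: the field of \<open>s\<close>-Gevrey series depends on the real number \<open>s\<close>, so it cannot be
  a type. Both fields of scalars live inside the type of formal Laurent series over the complex
  numbers, whose derivation \<^const>\<open>fls_deriv\<close> is \<open>d/dx\<close>.
\<close>

subsection \<open>Scalars\<close>

definition gevrey_power_series :: "real \<Rightarrow> complex fps set" where
  "gevrey_power_series s =
     {a. fps_conv_radius (Abs_fps (\<lambda>i. fps_nth a i / of_real (fact i powr s))) > 0}"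

definition gevrey_series :: "real \<Rightarrow> complex fls set" where
  "gevrey_series s = {fps_to_fls a * fls_X_inv ^ k | a k. a \<in> gevrey_power_series s}"

definition fls_subring :: "complex fls set \<Rightarrow> complex fls ring" where
  "fls_subring S = \<lparr>carrier = S, mult = (*), one = 1, zero = 0, add = (+)\<rparr>"

abbreviation gevrey_field :: "real \<Rightarrow> complex fls ring" where
  "gevrey_field s \<equiv> fls_subring (gevrey_series s)"

abbreviation laurent_field :: "complex fls ring" where
  "laurent_field \<equiv> fls_subring UNIV"


subsection \<open>Vector spaces with connection\<close>

locale vs_connection = vectorspace K V
  for K :: "complex fls ring" and V :: "(complex fls, 'v, 'm) module_scheme" (structure) +
  fixes nabla :: "'v \<Rightarrow> 'v"
  assumes nabla_closed: "v \<in> carrier V \<Longrightarrow> nabla v \<in> carrier V"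
    and nabla_add: "v \<in> carrier V \<Longrightarrow> w \<in> carrier V \<Longrightarrow> nabla (v \<oplus>\<^bsub>V\<^esub> w) = nabla v \<oplus>\<^bsub>V\<^esub> nabla w"
    and nabla_const: "v \<in> carrier V \<Longrightarrow> nabla (fls_const c \<odot>\<^bsub>V\<^esub> v) = fls_const c \<odot>\<^bsub>V\<^esub> nabla v"
    and nabla_leibniz: "a \<in> carrier K \<Longrightarrow> v \<in> carrier V \<Longrightarrow>
          nabla (a \<odot>\<^bsub>V\<^esub> v) = (fls_deriv a \<odot>\<^bsub>V\<^esub> v) \<oplus>\<^bsub>V\<^esub> (a \<odot>\<^bsub>V\<^esub> nabla v)"

definition connection_iso ::
  "complex fls ring \<Rightarrow> (complex fls, 'v, 'm) module_scheme \<Rightarrow> ('v \<Rightarrow> 'v) \<Rightarrow>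
   (complex fls, 'w, 'n) module_scheme \<Rightarrow> ('w \<Rightarrow> 'w) \<Rightarrow> ('v \<Rightarrow> 'w) \<Rightarrow> bool" where
  "connection_iso K V nablaV W nablaW \<phi> \<longleftrightarrow>
     linear_map K V W \<phi> \<and> bij_betw \<phi> (carrier V) (carrier W) \<and>
     (\<forall>v\<in>carrier V. \<phi> (nablaV v) = nablaW (\<phi> v))"


subsection \<open>The formal connection\<close>

text \<open>
  The tensor product of the field of formal Laurent series with \<open>V\<close> over \<open>K\<close> is the free abelian
  group on pairs \<open>(f, v)\<close> modulo the subgroup generated by the bilinearity relations; its elements
  are cosets. The multiplicative fields of the record are irrelevant for modules.
\<close>

definition tensor_free ::
  "(complex fls, 'v, 'm) module_scheme \<Rightarrow> (complex fls \<times> 'v \<Rightarrow>\<^sub>0 int) monoid" where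
  "tensor_free V = free_Abelian_group (UNIV \<times> carrier V)"

definition tensor_null ::
  "complex fls ring \<Rightarrow> (complex fls, 'v, 'm) module_scheme \<Rightarrow> (complex fls \<times> 'v \<Rightarrow>\<^sub>0 int) set" where
  "tensor_null K V = generate (tensor_free V)
     ({frag_of (f + g, v) - frag_of (f, v) - frag_of (g, v) | f g v. v \<in> carrier V} \<union>
      {frag_of (f, v \<oplus>\<^bsub>V\<^esub> w) - frag_of (f, v) - frag_of (f, w) | f v w.
         v \<in> carrier V \<and> w \<in> carrier V} \<union>
      {frag_of (f * a, v) - frag_of (f, a \<odot>\<^bsub>V\<^esub> v) | f a v. a \<in> carrier K \<and> v \<in> carrier V})"

text \<open>The map induced on cosets by a map of generators that respects the relations.\<close>

definition tensor_induced ::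
  "complex fls ring \<Rightarrow> (complex fls, 'v, 'm) module_scheme \<Rightarrow>
   (complex fls \<Rightarrow> 'v \<Rightarrow> (complex fls \<times> 'v \<Rightarrow>\<^sub>0 int)) \<Rightarrow>
   (complex fls \<times> 'v \<Rightarrow>\<^sub>0 int) set \<Rightarrow> (complex fls \<times> 'v \<Rightarrow>\<^sub>0 int) set" where
  "tensor_induced K V h X =
     (\<Union>p\<in>X. tensor_null K V #>\<^bsub>tensor_free V\<^esub> frag_extend (\<lambda>(f, v). h f v) p)"

definition formal_space ::
  "complex fls ring \<Rightarrow> (complex fls, 'v, 'm) module_scheme \<Rightarrow>
   (complex fls, (complex fls \<times> 'v \<Rightarrow>\<^sub>0 int) set) module" where
  "formal_space K V =
     \<lparr>carrier = carrier (tensor_free V Mod tensor_null K V),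
      mult = (\<lambda>_ _. tensor_null K V),
      one = tensor_null K V,
      zero = \<one>\<^bsub>tensor_free V Mod tensor_null K V\<^esub>,
      add = (\<lambda>X Y. X \<otimes>\<^bsub>tensor_free V Mod tensor_null K V\<^esub> Y),
      smult = (\<lambda>g. tensor_induced K V (\<lambda>f v. frag_of (g * f, v)))\<rparr>"

definition formal_nabla ::
  "complex fls ring \<Rightarrow> (complex fls, 'v, 'm) module_scheme \<Rightarrow> ('v \<Rightarrow> 'v) \<Rightarrow>
   (complex fls \<times> 'v \<Rightarrow>\<^sub>0 int) set \<Rightarrow> (complex fls \<times> 'v \<Rightarrow>\<^sub>0 int) set" where
  "formal_nabla K V nabla =
     tensor_induced K V (\<lambda>f v. frag_of (fls_deriv f, v) + frag_of (f, nabla v))"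


subsection \<open>Newton polygon and slopes\<close>

text \<open>
  Newton polygon of the operator \<open>b 0 + b 1 \<partial> + \<dots> + b n \<partial>\<^sup>n\<close>, where \<open>\<partial> = d/dx\<close>. Since
  \<open>x\<^sup>i \<partial>\<^sup>i\<close> has order \<open>i\<close> in \<open>x d/dx\<close> and coefficients of valuation \<open>0\<close>, the term \<open>b i \<partial>\<^sup>i\<close>
  contributes the point \<open>(i, val (b i) - i)\<close> and everything above and to the left of it. The
  polygon is cut off at abscissa \<open>0\<close>, so that slope \<open>0\<close> occurs iff it has a horizontal edge of
  positive length (and the operators of order \<open>0\<close> have no slopes). For \<open>\<partial> - x\<^sup>-\<^sup>2\<close> the only
  slope is \<open>1\<close>.
\<close>

definition newton_polygon :: "nat \<Rightarrow> (nat \<Rightarrow> complex fls) \<Rightarrow> (real \<times> real) set" where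
  "newton_polygon n b =
     convex hull {(u, v). \<exists>i\<le>n. b i \<noteq> 0 \<and> 0 \<le> u \<and> u \<le> real i \<and>
                            real_of_int (fls_subdegree (b i)) - real i \<le> v}"

text \<open>Slopes of the non-vertical edges: segments of positive length on a supporting line.\<close>

definition polygon_slopes :: "(real \<times> real) set \<Rightarrow> real set" where
  "polygon_slopes P =
     {\<sigma>. \<exists>p\<in>P. \<exists>q\<in>P. fst p < fst q \<and> snd q - snd p = \<sigma> * (fst q - fst p) \<and>
           (\<forall>r\<in>P. \<sigma> * (fst r - fst p) \<le> snd r - snd p)}"

text \<open>
  \<open>w\<close> is a cyclic vector, and \<open>b 0 + b 1 \<partial> + \<dots> + \<partial>\<^sup>n\<close> is the monic operator of order \<open>n = dim W\<close>
  annihilating it.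
\<close>

definition cyclic_operator ::
  "(complex fls, 'w, 'm) module_scheme \<Rightarrow> ('w \<Rightarrow> 'w) \<Rightarrow> 'w \<Rightarrow> nat \<Rightarrow> (nat \<Rightarrow> complex fls) \<Rightarrow> bool" where
  "cyclic_operator W nabla w n b \<longleftrightarrow>
     w \<in> carrier W \<and>
     inj_on (\<lambda>i. (nabla ^^ i) w) {..<n} \<and>
     vectorspace.basis laurent_field W ((\<lambda>i. (nabla ^^ i) w) ` {..<n}) \<and>
     b n = 1 \<and>
     (\<Oplus>\<^bsub>W\<^esub>i\<in>{..n}. b i \<odot>\<^bsub>W\<^esub> (nabla ^^ i) w) = \<zero>\<^bsub>W\<^esub>"

text \<open>
  Every finite-dimensional vector space with connection over the formal Laurent series has a cyclic
  vector, and the slopes of the associated Newton polygon do not depend on the choice of it.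
\<close>

definition connection_slopes ::
  "(complex fls, 'w, 'm) module_scheme \<Rightarrow> ('w \<Rightarrow> 'w) \<Rightarrow> real set" where
  "connection_slopes W nabla =
     {\<sigma>. \<exists>w n b. cyclic_operator W nabla w n b \<and> \<sigma> \<in> polygon_slopes (newton_polygon n b)}"

definition formal_slopes ::
  "complex fls ring \<Rightarrow> (complex fls, 'v, 'm) module_scheme \<Rightarrow> ('v \<Rightarrow> 'v) \<Rightarrow> real set" where
  "formal_slopes K V nabla = connection_slopes (formal_space K V) (formal_nabla K V nabla)"

end

theory Submission imports Defs "Jordan_Normal_Form.Determinant" "HOL-Library.Function_Algebras" begin

text \<open>
  Let \<open>\<kappa> = 1/s\<close>. A vertex of the Newton polygon of a monic operator with \<open>s\<close>-Gevrey coefficients at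
  which a line of slope \<open>\<kappa>\<close> is supporting yields factorisations
  \<open>b\<^sub>r (1 + Q)(\<partial>\<^sup>r + C)\<close> and \<open>b\<^sub>r (\<partial>\<^sup>r + C')(1 + Q')\<close> of the operator. Their coefficients solve a fixed
  point system, formally by a gain of valuation, and in the Gevrey class because the supporting line has
  slope \<open>\<kappa>\<close>: a weighted norm is then preserved by the iteration. In the module of the operator the two
  factorisations span complementary submodules stable under \<open>\<nabla>\<close>. Taking the last or the first vertex on
  the supporting line separates the slopes \<open>\<le> \<kappa>\<close> from those \<open>> \<kappa>\<close>, or those \<open>< \<kappa>\<close> from those \<open>\<ge> \<kappa>\<close>.

  The slopes are recognised without comparing Newton polygons of different cyclic vectors, by the growth of
  the poles of \<open>\<nabla>\<^sup>m v\<close>: these have order at most \<open>(1 + \<kappa>) m + O(1)\<close> on one part of the splitting, and for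
  no nonzero vector of the other. This growth is inherited by direct summands.

  The slopes are defined by formal cyclic vectors. A truncation of such a vector to sufficiently high order
  is a cyclic vector over the Gevrey field, whose operator has the same Newton polygon.
\<close>

subsection \<open>Valuations\<close>

text \<open>A derivative lowers an exponent by one and multiplies a coefficient by its index.
  Measured against the line of slope 1/s, each derivative in a product of operators leaves 1/s of
  spare exponent, which is just what the weight \<open>(1 + d) powr (s * d)\<close> needs to absorb
  that index. On that line, however, other coefficients may be as large as the dominant one, so
  nothing contracts there. Every estimate is therefore made twice: along slope 1/s for Gevrey
  growth, and along a slightly tilted slope \<mu>, for which the chosen vertex is strictly dominant,
  for smallness.

  One factorisation gives a stable submodule and a quotient; the factorisation in the opposite order
  supplies the complement. The sign of \<mu> - 1/s decides which part keeps away from the critical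
  rate 1 + 1/s: the fast part if \<mu> > 1/s, the slow part if \<mu> < 1/s.

  A slope comes together with a cyclic vector, so splittings are constructed from a slope; where the
  set of slopes is empty, the identity and zero serve as projections.\<close>

definition val_ge :: "complex fls \<Rightarrow> real \<Rightarrow> bool" where
  "val_ge f c \<longleftrightarrow> (\<forall>k. real_of_int k < c \<longrightarrow> fls_nth f k = 0)"

lemma val_geD: "val_ge f c \<Longrightarrow> real_of_int k < c \<Longrightarrow> fls_nth f k = 0"
  by (simp add: val_ge_def)

lemma val_ge_0 [simp]: "val_ge 0 c"
  by (simp add: val_ge_def)

lemma val_ge_mono: "val_ge f c \<Longrightarrow> c' \<le> c \<Longrightarrow> val_ge f c'"
  by (simp add: val_ge_def)

lemma val_ge_add: "val_ge f c \<Longrightarrow> val_ge g c \<Longrightarrow> val_ge (f + g) c"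
  by (simp add: val_ge_def)

lemma val_ge_diff: "val_ge f c \<Longrightarrow> val_ge g c \<Longrightarrow> val_ge (f - g) c"
  by (simp add: val_ge_def)

lemma val_ge_uminus [simp]: "val_ge (- f) c \<longleftrightarrow> val_ge f c"
  by (simp add: val_ge_def)

lemma val_ge_sum: "(\<And>i. i \<in> A \<Longrightarrow> val_ge (f i) c) \<Longrightarrow> val_ge (sum f A) c"
  by (induction A rule: infinite_finite_induct) (auto intro: val_ge_add)

lemma val_ge_iff: "f \<noteq> 0 \<Longrightarrow> val_ge f c \<longleftrightarrow> c \<le> real_of_int (fls_subdegree f)"
proof
  assume "f \<noteq> 0" "val_ge f c"
  then show "c \<le> real_of_int (fls_subdegree f)"
    using nth_fls_subdegree_nonzero[of f] val_geD[of f c "fls_subdegree f"] by fastforce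
next
  assume "f \<noteq> 0" "c \<le> real_of_int (fls_subdegree f)"
  then show "val_ge f c"
    by (auto simp: val_ge_def intro!: fls_eq0_below_subdegree)
qed

lemma val_ge_mult: "val_ge f c \<Longrightarrow> val_ge g d \<Longrightarrow> val_ge (f * g) (c + d)"
proof (cases "f = 0 \<or> g = 0")
  case False
  assume "val_ge f c" "val_ge g d"
  with False show ?thesis by (auto simp: val_ge_iff)
qed auto

lemma val_ge_deriv: "val_ge f c \<Longrightarrow> val_ge (fls_deriv f) (c - 1)"
  by (auto simp: val_ge_def)

lemma val_ge_deriv_pow: "val_ge f c \<Longrightarrow> val_ge ((fls_deriv ^^ l) f) (c - real l)"
proof (induction l)
  case (Suc l)
  then show ?case using val_ge_deriv[of "(fls_deriv ^^ l) f" "c - real l"] by (simp add: diff_diff_eq add.commute)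
qed simp

lemma val_ge_const: "c \<le> 0 \<Longrightarrow> val_ge (fls_const a) c"
  by (auto simp: val_ge_def)

lemma val_ge_1: "c \<le> 0 \<Longrightarrow> val_ge 1 c"
  using val_ge_const[of c 1] by simp

lemma val_ge_const_mult: "val_ge f c \<Longrightarrow> val_ge (fls_const a * f) c"
  using val_ge_mult[OF val_ge_const[of 0 a]] by auto

lemma val_ge_exists: "\<exists>c. val_ge f c"
  by (cases "f = 0") (auto simp: val_ge_iff)

lemma val_ge_exists_family:
  assumes "finite A"
  shows "\<exists>c. \<forall>i\<in>A. val_ge (f i) c"
  using assms
proof (induction A rule: finite_induct)
  case (insert x A)
  then obtain c where c: "\<forall>i\<in>A. val_ge (f i) c" by blast
  obtain d where d: "val_ge (f x) d" using val_ge_exists by blast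
  have "\<forall>i\<in>insert x A. val_ge (f i) (min c d)"
    using c d val_ge_mono[of _ c "min c d"] val_ge_mono[of _ d "min c d"] by auto
  then show ?case by blast
qed simp

lemma val_ge_zeroI:
  assumes "\<And>c. \<exists>d\<ge>c. val_ge f d"
  shows "f = 0"
proof (rule ccontr)
  assume "f \<noteq> 0"
  obtain d where "d \<ge> real_of_int (fls_subdegree f) + 1" "val_ge f d" using assms by blast
  with \<open>f \<noteq> 0\<close> show False by (simp add: val_ge_iff)
qed

text \<open>The constant coefficient of \<open>1 + q\<close> is 1 and there are none of negative
  index, so it is a unit of the power series ring.\<close>

lemma one_plus_small:
  assumes "val_ge q e" "e > 0"
  shows "1 + q \<noteq> 0" "val_ge (inverse (1 + q)) 0"
proof -
  have n0: "fls_nth (1 + q) 0 = 1" using val_geD[OF assms(1), of 0] assms(2) by simp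
  then show ne: "1 + q \<noteq> 0" by force
  have "fls_nth (1 + q) k = 0" if "k < 0" for k
    using that assms val_geD[OF assms(1), of k] by simp
  with n0 have "fls_subdegree (1 + q) = 0" by (intro fls_subdegree_eqI) auto
  with ne show "val_ge (inverse (1 + q)) 0" by (subst val_ge_iff) (auto simp: fls_inverse_subdegree)
qed

section \<open>Coefficients of iterated derivatives and of products\<close>

lemma fls_deriv_pow_nth:
  "fls_nth ((fls_deriv ^^ l) f) n = (\<Prod>t=1..l. of_int (n + int t)) * fls_nth f (n + int l)"
  for f :: "complex fls"
proof (induction l arbitrary: n)
  case (Suc l)
  have "(\<Prod>t=1..Suc l. of_int (n + int t)) = (of_int (n + 1) :: complex) * (\<Prod>t=1..l. of_int (n + 1 + int t))"
    using prod.atLeast_Suc_atMost_Suc_shift[of "\<lambda>t. of_int (n + int t) :: complex" 0 l]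
    by (simp add: prod.atLeast_Suc_atMost algebra_simps flip: of_int_add)
  then show ?case by (simp add: Suc algebra_simps)
qed simp

text \<open>The bound is in terms of \<open>n + int l\<close>, the index of the coefficient of f
  that is used: each of the l factors differs from it by less than l.\<close>

lemma norm_fls_deriv_pow_nth_le:
  "norm (fls_nth ((fls_deriv ^^ l) f) n) \<le> (\<bar>real_of_int (n + int l)\<bar> + real l) ^ l * norm (fls_nth f (n + int l))"
  for f :: "complex fls"
proof -
  have "norm (\<Prod>t=1..l. of_int (n + int t) :: complex) \<le> (\<Prod>t=1..l. \<bar>real_of_int (n + int l)\<bar> + real l)"
    unfolding prod_norm[symmetric]
  proof (rule prod_mono)
    fix t assume t: "t \<in> {1..l}"
    have "norm (of_int (n + int t) :: complex) = \<bar>real_of_int (n + int t)\<bar>"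
      by (metis norm_of_int of_int_abs)
    also have "\<dots> \<le> \<bar>real_of_int (n + int l)\<bar> + real l" using t by auto
    finally show "0 \<le> norm (of_int (n + int t) :: complex) \<and>
        norm (of_int (n + int t) :: complex) \<le> \<bar>real_of_int (n + int l)\<bar> + real l" by simp
  qed
  then show ?thesis by (simp add: fls_deriv_pow_nth norm_mult mult_right_mono)
qed

text \<open>The range of summation is independent of the subdegrees, so that one range serves for
  many n and the sums over n and i can be exchanged.\<close>

lemma fls_times_nth_bounds:
  fixes f g :: "complex fls"
  assumes f: "\<And>k. k < lf \<Longrightarrow> fls_nth f k = 0" and g: "\<And>k. k < lg \<Longrightarrow> fls_nth g k = 0"
    and "n - lg \<le> h"
  shows "fls_nth (f * g) n = (\<Sum>i=lf..h. fls_nth f i * fls_nth g (n - i))"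
proof (cases "f = 0 \<or> g = 0")
  case False
  have "lf \<le> fls_subdegree f" "lg \<le> fls_subdegree g"
    using False f g by (auto intro!: fls_subdegree_geI)
  have "(\<Sum>i=fls_subdegree f..n - fls_subdegree g. fls_nth f i * fls_nth g (n - i))
      = (\<Sum>i=lf..h. fls_nth f i * fls_nth g (n - i))"
  proof (rule sum.mono_neutral_left)
    show "\<forall>i\<in>{lf..h} - {fls_subdegree f..n - fls_subdegree g}. fls_nth f i * fls_nth g (n - i) = 0"
    proof
      fix i assume "i \<in> {lf..h} - {fls_subdegree f..n - fls_subdegree g}"
      then have "i < fls_subdegree f \<or> n - i < fls_subdegree g" by auto
      then show "fls_nth f i * fls_nth g (n - i) = 0" by auto
    qed
  qed (use \<open>lf \<le> _\<close> \<open>lg \<le> _\<close> assms(3) in auto)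
  then show ?thesis by (simp add: fls_times_nth(2))
qed auto

subsection \<open>A Gevrey implicit function theorem\<close>

text \<open>Stands for the factorial of d to the power s, up to geometric factors. It is defined at
  real d because exponents are later measured from a supporting line whose heights are not
  integers.\<close>

definition gevrey_weight :: "real \<Rightarrow> real \<Rightarrow> real" where
  "gevrey_weight s d = (1 + d) powr (s * d)"

lemma gevrey_weight_ge_1: "s > 0 \<Longrightarrow> d \<ge> 0 \<Longrightarrow> 1 \<le> gevrey_weight s d"
  unfolding gevrey_weight_def by (rule ge_one_powr_ge_zero) auto

lemma gevrey_weight_pos: "s > 0 \<Longrightarrow> d \<ge> 0 \<Longrightarrow> 0 < gevrey_weight s d"
  using gevrey_weight_ge_1[of s d] by simp

lemma gevrey_weight_mono:
  assumes "s > 0" "0 \<le> d" "d \<le> d'"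
  shows "gevrey_weight s d \<le> gevrey_weight s d'"
  unfolding gevrey_weight_def using assms by (intro powr_mono_both) (auto intro: mult_left_mono)

text \<open>
  This inequality is why \<open>x\<^bsup>1 + 1/s\<^esup> d/dx\<close> is bounded on \<open>s\<close>-Gevrey series: raising the degree by
  \<open>1/s\<close> makes up for one factor produced by a derivative.
\<close>
lemma gevrey_weight_gain:
  assumes "s > 0" "d1 \<ge> 0" "d2 \<ge> 0"
  shows "(1 + d2) ^ l * (gevrey_weight s d1 * gevrey_weight s d2)
    \<le> gevrey_weight s (d1 + d2 + real l / s)"
proof -
  define D where "D = d1 + d2 + real l / s"
  have D: "d1 \<le> D" "d2 \<le> D" using assms by (auto simp: D_def)
  have "gevrey_weight s D = (1 + D) powr (real l + (s * d1 + s * d2))"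
    using assms by (simp add: gevrey_weight_def D_def algebra_simps)
  also have "\<dots> = (1 + D) powr real l * ((1 + D) powr (s * d1) * (1 + D) powr (s * d2))"
    by (simp add: powr_add)
  also have "\<dots> \<ge> (1 + d2) powr real l * ((1 + d1) powr (s * d1) * (1 + d2) powr (s * d2))"
    using assms D by (intro mult_mono powr_mono2) auto
  also have "(1 + d2) powr real l = (1 + d2) ^ l" using assms by (simp add: powr_realpow)
  finally show ?thesis by (simp add: D_def gevrey_weight_def)
qed

text \<open>A shift by q is paid for by a factor geometric in d, which only changes a radius of
  convergence: 1 + d + q is at most (1 + q) * (1 + d), and the mixed power of 1 + d is bounded by an
  exponential.\<close>

lemma gevrey_weight_shift:
  assumes "s > 0" "d \<ge> 0" "q \<ge> 0"
  shows "gevrey_weight s (d + q)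
    \<le> (1 + q) powr (s * q) * ((1 + q) powr s * exp (s * q)) powr d * gevrey_weight s d"
proof -
  have "(1 + d + q) \<le> (1 + q) * (1 + d)" using assms by (simp add: algebra_simps)
  then have "gevrey_weight s (d + q) \<le> ((1 + q) * (1 + d)) powr (s * (d + q))"
    unfolding gevrey_weight_def using assms by (intro powr_mono2) auto
  also have "\<dots> = (1 + q) powr (s * q) * ((1 + q) powr s) powr d * (1 + d) powr (s * q) * gevrey_weight s d"
  proof -
    have "((1 + q) * (1 + d)) powr (s * (d + q))
        = (1 + q) powr (s * q + s * d) * (1 + d) powr (s * q + s * d)"
      using assms powr_mult[of "1 + q" "1 + d"] by (simp add: distrib_left add.commute)
    then show ?thesis by (simp add: powr_add powr_powr gevrey_weight_def)
  qed
  also have "\<dots> \<le> (1 + q) powr (s * q) * ((1 + q) powr s) powr d * (exp d) powr (s * q) * gevrey_weight s d"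
    using assms exp_ge_add_one_self[of d] gevrey_weight_ge_1[of s d]
    by (intro mult_right_mono mult_left_mono powr_mono2) auto
  also have "(exp d) powr (s * q) = (exp (s * q)) powr d"
    by (simp add: exp_powr_real mult_ac)
  finally show ?thesis using assms by (simp add: powr_mult mult_ac)
qed

text \<open>For negative q the weight only decreases. Both signs occur, since the height of the line
  at a is negative before the vertex and positive after it.\<close>

lemma gevrey_weight_shift_bound:
  assumes "s > 0"
  shows "\<exists>C B. C \<ge> 1 \<and> B \<ge> 1 \<and>
    (\<forall>d. d \<ge> 0 \<longrightarrow> d + q \<ge> 0 \<longrightarrow> gevrey_weight s (d + q) \<le> C * B powr d * gevrey_weight s d)"
proof (cases "q \<ge> 0")
  case True
  have "(1 + q) powr (s * q) \<ge> 1" using assms True by (intro ge_one_powr_ge_zero) auto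
  moreover have "1 * 1 \<le> (1 + q) powr s * exp (s * q)"
    using assms True by (intro mult_mono ge_one_powr_ge_zero) auto
  ultimately show ?thesis using gevrey_weight_shift[OF assms _ True] by fastforce
next
  case False
  then have "gevrey_weight s (d + q) \<le> gevrey_weight s d" if "d \<ge> 0" "d + q \<ge> 0" for d
    using that assms by (intro gevrey_weight_mono) auto
  then show ?thesis by (intro exI[of _ 1]) auto
qed

section \<open>Comparison with factorials and membership in the Gevrey field\<close>

lemma fact_powr_le_gevrey_weight: "s > 0 \<Longrightarrow> fact i powr s \<le> gevrey_weight s (real i)"
proof -
  assume s: "s > 0"
  have "fact i \<le> (1 + real i) ^ i"
  proof -
    have "(fact i :: real) \<le> real i ^ i" using fact_le_power[of i, where ?'a=real] by simp
    also have "\<dots> \<le> (1 + real i) ^ i" by (intro power_mono) auto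
    finally show ?thesis .
  qed
  then have "fact i powr s \<le> ((1 + real i) ^ i) powr s" using s by (intro powr_mono2) auto
  also have "\<dots> = gevrey_weight s (real i)"
    by (simp add: gevrey_weight_def powr_powr mult.commute flip: powr_realpow)
  finally show ?thesis .
qed

text \<open>\<open>(1 + real i) ^ i / fact i\<close> is a single term of the exponential series at 1
  + i.\<close>

lemma gevrey_weight_le_fact_powr:
  assumes "s > 0"
  shows "gevrey_weight s (real i) \<le> exp s * exp s ^ i * fact i powr s"
proof -
  have "(1 + real i) ^ i / fact i \<le> suminf (\<lambda>n. (1 + real i) ^ n / fact n)"
    using sum_le_suminf[of "\<lambda>n. (1 + real i) ^ n / fact n" "{i}"] summable_exp[of "1 + real i"]
    by (simp add: field_simps)
  also have "\<dots> = exp (1 + real i)" by (simp add: exp_def field_simps)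
  finally have "(1 + real i) ^ i \<le> exp (1 + real i) * fact i" by (simp add: field_simps)
  then have "((1 + real i) ^ i) powr s \<le> (exp (1 + real i) * fact i) powr s"
    using assms by (intro powr_mono2) auto
  also have "\<dots> = exp s * exp s ^ i * fact i powr s"
  proof -
    have "(exp (1 + real i) * fact i) powr s = exp ((1 + real i) * s) * fact i powr s"
      by (simp add: powr_mult exp_powr_real)
    also have "exp ((1 + real i) * s) = exp s * exp s ^ i"
      by (simp add: distrib_right exp_add exp_of_nat_mult)
    finally show ?thesis .
  qed
  also have "((1 + real i) ^ i) powr s = gevrey_weight s (real i)"
    by (simp add: gevrey_weight_def powr_powr mult.commute flip: powr_realpow)
  finally show ?thesis .
qed

text \<open>Terms of a convergent series are bounded at some positive r, so
  \<open>fps_nth f i\<close> grows at most like a geometric factor times the weight; the shift of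
  indices by k costs another geometric factor. Only nonnegative indices are bounded, as finitely
  many others remain.\<close>

lemma gevrey_series_bound:
  assumes s: "s > 0" and "a \<in> gevrey_series s"
  shows "\<exists>C B. C \<ge> 0 \<and> B \<ge> 1 \<and> (\<forall>m::nat. norm (fls_nth a (int m)) \<le> C * B ^ m * gevrey_weight s (real m))"
proof -
  obtain f k where a: "a = fps_to_fls f * fls_X_inv ^ k" and f: "f \<in> gevrey_power_series s"
    using assms(2) by (auto simp: gevrey_series_def)
  define c where "c = (\<lambda>i. fps_nth f i / of_real (fact i powr s))"
  have "fps_conv_radius (Abs_fps c) > 0" using f by (simp add: gevrey_power_series_def c_def)
  then obtain r where r: "0 < ereal r" "ereal r < fps_conv_radius (Abs_fps c)"
    using ereal_dense2 by metis
  then have "summable (\<lambda>n. norm (c n * of_real r ^ n))"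
    using abs_summable_in_conv_radius[of "of_real r :: complex" c] by (auto simp: fps_conv_radius_def)
  then have "(\<lambda>n. norm (c n * of_real r ^ n)) \<longlonglongrightarrow> 0" by (rule summable_LIMSEQ_zero)
  then have "Bseq (\<lambda>n. norm (c n * of_real r ^ n))" by (auto intro!: convergent_imp_Bseq convergentI)
  then obtain M where M: "M > 0" "\<And>n. norm (c n * of_real r ^ n) \<le> M"
    by (auto simp: Bseq_def)
  have fb: "norm (fps_nth f i) \<le> M * (1 / r) ^ i * gevrey_weight s (real i)" for i
  proof -
    have "norm (fps_nth f i) = norm (c i) * fact i powr s"
      by (simp add: c_def norm_divide)
    also have "\<dots> \<le> (M * (1 / r) ^ i) * gevrey_weight s (real i)"
      using M(2)[of i] M(1) r fact_powr_le_gevrey_weight[OF s, of i]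
      by (intro mult_mono) (auto simp: norm_mult norm_power power_divide field_simps)
    finally show ?thesis .
  qed
  obtain C B where CB: "C \<ge> 1" "B \<ge> 1"
    "\<And>d. d \<ge> 0 \<Longrightarrow> gevrey_weight s (d + real k) \<le> C * B powr d * gevrey_weight s d"
    using gevrey_weight_shift_bound[OF s, of "real k"] by (metis add_nonneg_nonneg of_nat_0_le_iff)
  define B' where "B' = max 1 (1 / r * B)"
  have "norm (fls_nth a (int m)) \<le> (M * (1 / r) ^ k * C) * B' ^ m * gevrey_weight s (real m)" for m
  proof -
    have "fls_nth a (int m) = fps_nth f (m + k)"
      by (simp add: a fls_X_inv_power_times_conv_shift nat_add_distrib)
    then have "norm (fls_nth a (int m)) \<le> M * (1 / r) ^ (m + k) * gevrey_weight s (real m + real k)"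
      using fb[of "m + k"] by simp
    also have "\<dots> \<le> M * (1 / r) ^ (m + k) * (C * B powr real m * gevrey_weight s (real m))"
      using M r CB(3)[of "real m"] by (intro mult_left_mono) auto
    also have "B powr real m = B ^ m" using CB by (simp add: powr_realpow)
    also have "M * (1 / r) ^ (m + k) * (C * B ^ m * gevrey_weight s (real m))
        = (M * (1 / r) ^ k * C) * (1 / r * B) ^ m * gevrey_weight s (real m)"
      by (simp add: power_add power_mult_distrib power_divide field_simps)
    also have "\<dots> \<le> (M * (1 / r) ^ k * C) * B' ^ m * gevrey_weight s (real m)"
      using M r CB gevrey_weight_ge_1[OF s, of "real m"] unfolding B'_def
      by (intro mult_right_mono mult_left_mono power_mono) auto
    finally show ?thesis .
  qed
  moreover have "M * (1 / r) ^ k * C \<ge> 0" "B' \<ge> 1" using M r CB by (auto simp: B'_def)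
  ultimately show ?thesis by blast
qed

text \<open>The converse of the preceding bound. The two replace membership by an estimate of
  coefficients.\<close>

lemma gevrey_seriesI:
  assumes s: "s > 0" and "B \<ge> 1"
    and bd: "\<And>m::nat. norm (fls_nth a (int m)) \<le> C * B powr (real m) * gevrey_weight s (real m)"
  shows "a \<in> gevrey_series s"
proof -
  define B' where "B' = B"
  have B': "B' \<ge> 1" using assms(2) by (simp add: B'_def)
  define C' where "C' = max 0 C"
  have bd': "norm (fls_nth a (int m)) \<le> C' * B' ^ m * gevrey_weight s (real m)" for m
  proof -
    have p: "B powr real m \<le> B' ^ m"
      using B' by (simp add: B'_def powr_realpow)
    have "C * B powr (real m) \<le> C' * B' ^ m"
      using p B' by (intro mult_mono) (auto simp: C'_def)
    then show ?thesis using bd[of m] gevrey_weight_ge_1[OF s, of "real m"]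
      by (smt (verit) mult_right_mono of_nat_0_le_iff)
  qed
  \<comment> \<open>The order of the pole of a, or 0 if there is none; this power of x turns a into
    a power series.\<close>
  define k where "k = nat (- fls_subdegree a)"
  define f where "f = Abs_fps (\<lambda>i. fls_nth a (int i - int k))"
  have a: "a = fps_to_fls f * fls_X_inv ^ k"
  proof (rule fls_eqI)
    fix n
    have "fls_nth (fps_to_fls f * fls_X_inv ^ k) n = (if n + int k < 0 then 0 else fls_nth a (int (nat (n + int k)) - int k))"
      by (simp add: fls_X_inv_power_times_conv_shift f_def)
    also have "\<dots> = fls_nth a n"
      by (auto simp: k_def split: if_splits)
    finally show "fls_nth a n = fls_nth (fps_to_fls f * fls_X_inv ^ k) n" by simp
  qed
  \<comment> \<open>The coefficients below index k come from the polar part, on which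
    \<open>bd\<close> says nothing; there are finitely many of them.\<close>
  define M where "M = (\<Sum>i<k. norm (fps_nth f i))"
  define c where "c = (\<lambda>i. fps_nth f i / of_real (fact i powr s))"
  define B2 where "B2 = B' * exp s"
  have B2: "B2 \<ge> 1" using s B' mult_mono[of 1 B' 1 "exp s"] by (simp add: B2_def)
  have M0: "M \<ge> 0" by (simp add: M_def sum_nonneg)
  have cb: "norm (c i) \<le> (C' * exp s + M) * B2 ^ i" for i
  proof -
    have f1: "(fact i :: real) powr s \<ge> 1"
      using s fact_ge_1[of i, where ?'a=real] by (intro ge_one_powr_ge_zero) auto
    have "norm (fps_nth f i) \<le> (C' * exp s + M) * B2 ^ i * fact i powr s"
    proof (cases "i < k")
      case True
      have "norm (fps_nth f i) \<le> M * 1 * 1" unfolding M_def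
        using True member_le_sum[of i "{..<k}" "\<lambda>i. norm (fps_nth f i)"] by simp
      also have "\<dots> \<le> (C' * exp s + M) * B2 ^ i * fact i powr s"
        using M0 B2 f1 by (intro mult_mono) (auto simp: C'_def)
      finally show ?thesis .
    next
      case False
      have "norm (fps_nth f i) \<le> C' * B' ^ (i - k) * gevrey_weight s (real (i - k))"
        using bd'[of "i - k"] False by (simp add: f_def of_nat_diff)
      also have "\<dots> \<le> C' * B' ^ i * gevrey_weight s (real i)"
        using s B' gevrey_weight_ge_1[OF s, of "real (i - k)"]
        by (intro mult_mono power_increasing gevrey_weight_mono) (auto simp: C'_def)
      also have "\<dots> \<le> C' * B' ^ i * (exp s * exp s ^ i * fact i powr s)"
        using B' gevrey_weight_le_fact_powr[OF s, of i] by (intro mult_left_mono) (auto simp: C'_def)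
      also have "\<dots> = (C' * exp s) * B2 ^ i * fact i powr s"
        by (simp add: B2_def power_mult_distrib)
      also have "\<dots> \<le> (C' * exp s + M) * B2 ^ i * fact i powr s"
        using M0 B2 by (intro mult_right_mono) auto
      finally show ?thesis .
    qed
    then show ?thesis using f1 by (simp add: c_def norm_divide pos_divide_le_eq)
  qed
  \<comment> \<open>Half the reciprocal of the growth rate, so that a geometric series of ratio 1/2
    dominates.\<close>
  define z :: complex where "z = of_real (1 / (2 * B2))"
  have "summable (\<lambda>n. c n * z ^ n)"
  proof (rule summable_comparison_test')
    show "summable (\<lambda>n. (C' * exp s + M) * (1 / 2) ^ n)" by (intro summable_mult summable_geometric) auto
    fix n :: nat
    have "norm (c n * z ^ n) \<le> ((C' * exp s + M) * B2 ^ n) * (1 / (2 * B2)) ^ n"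
      using cb[of n] B2 by (simp add: norm_mult norm_power z_def norm_divide divide_simps)
    then show "norm (c n * z ^ n) \<le> (C' * exp s + M) * (1 / 2) ^ n"
      using B2 by (simp add: power_mult_distrib power_divide)
  qed
  then have "conv_radius c \<ge> norm z" by (rule conv_radius_geI)
  moreover have "norm z > 0" using B2 by (simp add: z_def)
  ultimately have "conv_radius c > 0" by (metis ereal_less(2) order_less_le_trans)
  then have "f \<in> gevrey_power_series s"
    by (simp add: gevrey_power_series_def fps_conv_radius_def c_def)
  with a show ?thesis by (auto simp: gevrey_series_def)
qed

lemma gevrey_series_finite:
  assumes "s > 0" "\<And>m. m > N \<Longrightarrow> fls_nth a m = 0"
  shows "a \<in> gevrey_series s"
proof (rule gevrey_seriesI[OF assms(1), of 1 a "\<Sum>m<nat (N + 1). norm (fls_nth a (int m))"])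
  fix m :: nat
  show "norm (fls_nth a (int m)) \<le> (\<Sum>m<nat (N + 1). norm (fls_nth a (int m))) * 1 powr real m * gevrey_weight s (real m)"
  proof (cases "int m > N")
    case True
    then show ?thesis using assms gevrey_weight_ge_1[OF assms(1), of "real m"] by (simp add: sum_nonneg)
  next
    case False
    then have "norm (fls_nth a (int m)) \<le> (\<Sum>m<nat (N + 1). norm (fls_nth a (int m))) * 1"
      using member_le_sum[of m "{..<nat (N + 1)}" "\<lambda>i. norm (fls_nth a (int i))"] by simp
    also have "\<dots> \<le> (\<Sum>m<nat (N + 1). norm (fls_nth a (int m))) * gevrey_weight s (real m)"
      using gevrey_weight_ge_1[OF assms(1), of "real m"] by (intro mult_left_mono) (auto intro: sum_nonneg)
    finally show ?thesis by simp
  qed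
qed simp

text \<open>The factor m + 1 and the shift of the weight by one are both at most geometric in
  m.\<close>

lemma gevrey_series_deriv:
  assumes s: "s > 0" and a: "a \<in> gevrey_series s"
  shows "fls_deriv a \<in> gevrey_series s"
proof -
  obtain C B where CB: "C \<ge> 0" "B \<ge> 1"
    "\<And>m::nat. norm (fls_nth a (int m)) \<le> C * B ^ m * gevrey_weight s (real m)"
    using gevrey_series_bound[OF s a] by blast
  obtain C1 B1 where CB1: "C1 \<ge> 1" "B1 \<ge> 1"
    "\<And>d. d \<ge> 0 \<Longrightarrow> gevrey_weight s (d + 1) \<le> C1 * B1 powr d * gevrey_weight s d"
    using gevrey_weight_shift_bound[OF s, of 1] by (metis add_nonneg_nonneg zero_le_one)
  show ?thesis
  proof (rule gevrey_seriesI[OF s, of "2 * B * B1" _ "C * B * C1"])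
    show "1 \<le> 2 * B * B1" using CB CB1 mult_mono[of 1 B 1 B1] by simp
    fix m :: nat
    have "norm (fls_nth (fls_deriv a) (int m)) = real (Suc m) * norm (fls_nth a (int (Suc m)))"
      by (simp add: norm_mult add.commute) (metis norm_of_nat of_nat_Suc)
    also have "\<dots> \<le> 2 ^ m * (C * B ^ Suc m * gevrey_weight s (real m + 1))"
    proof (intro mult_mono)
      have "Suc m \<le> 2 ^ m" by (metis Suc_leI less_exp)
      then have "real (Suc m) \<le> real (2 ^ m)" by (simp only: of_nat_le_iff)
      then show "real (Suc m) \<le> 2 ^ m" by simp
    qed (use CB(3)[of "Suc m"] in \<open>auto simp: add.commute\<close>)
    also have "\<dots> \<le> 2 ^ m * (C * B ^ Suc m * (C1 * B1 powr real m * gevrey_weight s (real m)))"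
      using CB CB1(3)[of "real m"] by (intro mult_left_mono) auto
    also have "\<dots> = C * B * C1 * (2 * B * B1) powr real m * gevrey_weight s (real m)"
      using CB CB1 by (simp add: powr_mult powr_realpow mult_ac)
    finally show "norm (fls_nth (fls_deriv a) (int m)) \<le> C * B * C1 * (2 * B * B1) powr real m * gevrey_weight s (real m)" .
  qed
qed

text \<open>A bound on the weighted l1 norm. Finite partial sums take the place of a summability
  condition.\<close>

definition wsum_le :: "(int \<Rightarrow> real) \<Rightarrow> complex fls \<Rightarrow> real \<Rightarrow> bool" where
  "wsum_le w f c \<longleftrightarrow> (\<forall>A. finite A \<longrightarrow> (\<Sum>m\<in>A. norm (fls_nth f m) * w m) \<le> c)"

lemma wsum_le_0: "c \<ge> 0 \<Longrightarrow> wsum_le w 0 c"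
  by (simp add: wsum_le_def)

lemma wsum_le_mono: "wsum_le w f c \<Longrightarrow> c \<le> d \<Longrightarrow> wsum_le w f d"
  unfolding wsum_le_def by (meson order_trans)

lemma wsum_le_add:
  assumes "\<And>m. w m \<ge> 0" "wsum_le w f c" "wsum_le w g d"
  shows "wsum_le w (f + g) (c + d)"
  unfolding wsum_le_def
proof (intro allI impI)
  fix A :: "int set" assume A: "finite A"
  have "(\<Sum>m\<in>A. norm (fls_nth (f + g) m) * w m)
      \<le> (\<Sum>m\<in>A. norm (fls_nth f m) * w m + norm (fls_nth g m) * w m)"
    using assms(1) by (intro sum_mono) (simp add: mult_right_mono norm_triangle_ineq flip: distrib_right)
  also have "\<dots> \<le> c + d"
    using assms(2,3) A by (simp add: sum.distrib wsum_le_def add_mono)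
  finally show "(\<Sum>m\<in>A. norm (fls_nth (f + g) m) * w m) \<le> c + d" .
qed

lemma wsum_le_sum:
  assumes "\<And>m. w m \<ge> 0" "finite I" "\<And>i. i \<in> I \<Longrightarrow> wsum_le w (f i) (c i)"
  shows "wsum_le w (\<Sum>i\<in>I. f i) (\<Sum>i\<in>I. c i)"
  using assms(2,3)
  by (induction I rule: finite_induct) (auto intro: wsum_le_0 wsum_le_add assms(1))

lemma wsum_le_const_mult:
  assumes "wsum_le w f c"
  shows "wsum_le w (fls_const a * f) (norm a * c)"
  unfolding wsum_le_def
proof (intro allI impI)
  fix A :: "int set" assume A: "finite A"
  have "(\<Sum>m\<in>A. norm (fls_nth (fls_const a * f) m) * w m) = norm a * (\<Sum>m\<in>A. norm (fls_nth f m) * w m)"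
    by (simp add: norm_mult sum_distrib_left mult_ac)
  also have "\<dots> \<le> norm a * c" using assms A by (intro mult_left_mono) (auto simp: wsum_le_def)
  finally show "(\<Sum>m\<in>A. norm (fls_nth (fls_const a * f) m) * w m) \<le> norm a * c" .
qed

text \<open>A weighted l1 norm is submultiplicative as soon as the weights are. The hypothesis
  \<open>w\<close> is this condition, including the factor that l derivatives produce on the term of
  index j; it concerns only indices at which f and h can have coefficients.\<close>

lemma wsum_le_mult_deriv:
  assumes f: "val_ge f \<gamma>f" and h: "val_ge h \<gamma>h"
    and wn: "\<And>m. wa m \<ge> 0" "\<And>m. uf m \<ge> 0" "\<And>m. uh m \<ge> 0"
    and bf: "wsum_le uf f c" and bh: "wsum_le uh h d" and "d \<ge> 0" "M \<ge> 0"
    and w: "\<And>i j. \<gamma>f \<le> real_of_int i \<Longrightarrow> \<gamma>h \<le> real_of_int j \<Longrightarrow>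
      wa (i + j - int l) * (\<bar>real_of_int j\<bar> + real l) ^ l \<le> M * (uf i * uh j)"
  shows "wsum_le wa (f * (fls_deriv ^^ l) h) (M * (c * d))"
  unfolding wsum_le_def
proof (intro allI impI)
  fix A :: "int set" assume A: "finite A"
  show "(\<Sum>m\<in>A. norm (fls_nth (f * (fls_deriv ^^ l) h) m) * wa m) \<le> M * (c * d)"
  proof -
    \<comment> \<open>Bounds for the index i that are valid for every m in A at once.\<close>
    define lf where "lf = \<lceil>\<gamma>f\<rceil>"
    define lg where "lg = \<lceil>\<gamma>h\<rceil> - int l"
    define hi where "hi = Max A - lg"
    have f0: "fls_nth f k = 0" if "k < lf" for k
      using that val_geD[OF f, of k] unfolding lf_def by linarith
    have h0: "fls_nth h (k + int l) = 0" if "k < lg" for k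
      using that val_geD[OF h, of "k + int l"] unfolding lg_def by linarith
    have Dh0: "fls_nth ((fls_deriv ^^ l) h) k = 0" if "k < lg" for k
      using h0[OF that] by (simp add: fls_deriv_pow_nth)
    have term_le: "norm (fls_nth f i * fls_nth ((fls_deriv ^^ l) h) (m - i)) * wa m
       \<le> M * ((norm (fls_nth f i) * uf i) * (norm (fls_nth h (m - i + int l)) * uh (m - i + int l)))" for i m
    proof (cases "fls_nth f i = 0 \<or> fls_nth h (m - i + int l) = 0")
      case True
      then show ?thesis using \<open>M \<ge> 0\<close> wn by (auto simp: fls_deriv_pow_nth)
    next
      case False
      define j where "j = m - i + int l"
      have i: "\<gamma>f \<le> real_of_int i" using False val_geD[OF f, of i] by force
      have j: "\<gamma>h \<le> real_of_int j" using False val_geD[OF h, of j] by (force simp: j_def)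
      have m: "m = i + j - int l" by (simp add: j_def)
      have "norm (fls_nth f i * fls_nth ((fls_deriv ^^ l) h) (m - i)) * wa m
          \<le> norm (fls_nth f i) * ((\<bar>real_of_int j\<bar> + real l) ^ l * norm (fls_nth h j)) * wa m"
        using norm_fls_deriv_pow_nth_le[of l h "m - i"] wn
        by (intro mult_right_mono) (auto simp: norm_mult j_def intro!: mult_left_mono)
      also have "\<dots> = norm (fls_nth f i) * norm (fls_nth h j) * (wa (i + j - int l) * (\<bar>real_of_int j\<bar> + real l) ^ l)"
        by (simp add: m)
      also have "\<dots> \<le> norm (fls_nth f i) * norm (fls_nth h j) * (M * (uf i * uh j))"
        using w[OF i j] by (intro mult_left_mono) auto
      finally show ?thesis by (simp add: j_def mult_ac)
    qed
    have "(\<Sum>m\<in>A. norm (fls_nth (f * (fls_deriv ^^ l) h) m) * wa m)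
      \<le> (\<Sum>m\<in>A. \<Sum>i=lf..hi. M * ((norm (fls_nth f i) * uf i) * (norm (fls_nth h (m - i + int l)) * uh (m - i + int l))))"
    proof (rule sum_mono)
      fix m assume m: "m \<in> A"
      have "fls_nth (f * (fls_deriv ^^ l) h) m = (\<Sum>i=lf..hi. fls_nth f i * fls_nth ((fls_deriv ^^ l) h) (m - i))"
        using A m f0 Dh0 by (intro fls_times_nth_bounds[of _ _ lg]) (auto simp: hi_def)
      then have "norm (fls_nth (f * (fls_deriv ^^ l) h) m) * wa m
        \<le> (\<Sum>i=lf..hi. norm (fls_nth f i * fls_nth ((fls_deriv ^^ l) h) (m - i))) * wa m"
        using wn by (auto intro!: mult_right_mono norm_sum)
      also have "\<dots> \<le> (\<Sum>i=lf..hi. M * ((norm (fls_nth f i) * uf i) * (norm (fls_nth h (m - i + int l)) * uh (m - i + int l))))"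
        unfolding sum_distrib_right by (intro sum_mono term_le)
      finally show "norm (fls_nth (f * (fls_deriv ^^ l) h) m) * wa m \<le> \<dots>" .
    qed
    also have "\<dots> = M * (\<Sum>i=lf..hi. (norm (fls_nth f i) * uf i) *
        (\<Sum>m\<in>A. norm (fls_nth h (m - i + int l)) * uh (m - i + int l)))"
      unfolding sum_distrib_left by (rule sum.swap)
    also have "\<dots> \<le> M * (\<Sum>i=lf..hi. (norm (fls_nth f i) * uf i) * d)"
    proof (intro mult_left_mono sum_mono)
      fix i
      \<comment> \<open>For fixed i the map from m to m - i + l is injective, so the inner sum is a
        partial sum of the norm of h.\<close>
      have "(\<Sum>m\<in>A. norm (fls_nth h (m - i + int l)) * uh (m - i + int l))
          = (\<Sum>m\<in>(\<lambda>m. m - i + int l) ` A. norm (fls_nth h m) * uh m)"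
        by (subst sum.reindex) (auto simp: inj_on_def)
      also have "\<dots> \<le> d" using bh A by (simp add: wsum_le_def)
      finally show "(\<Sum>m\<in>A. norm (fls_nth h (m - i + int l)) * uh (m - i + int l)) \<le> d" .
    qed (use \<open>M \<ge> 0\<close> wn in auto)
    also have "\<dots> \<le> M * (c * d)"
      using bf \<open>d \<ge> 0\<close> \<open>M \<ge> 0\<close>
      by (auto simp: wsum_le_def simp flip: sum_distrib_right intro!: mult_left_mono mult_right_mono)
    finally show ?thesis .
  qed
qed

text \<open>
  The unknown \<open>X a\<close> has weight \<open>a - r\<close>: it will be a coefficient at \<open>\<partial>\<^sup>a\<close> of an operator whose
  dominant term is \<open>\<partial>\<^sup>r\<close>.
\<close>
locale gevrey_system =
  fixes s \<mu> \<epsilon> :: real and r n :: nat and p :: "nat \<Rightarrow> complex fls"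
    and k :: "nat \<Rightarrow> nat \<Rightarrow> nat \<Rightarrow> complex" and k' :: "nat \<Rightarrow> nat \<Rightarrow> complex"
  assumes s: "s > 0" and mu: "\<mu> > 0" and eps: "\<epsilon> > 0" and rn: "r \<le> n"
    and p_gevrey: "\<And>a. a \<le> n \<Longrightarrow> p a \<in> gevrey_series s"
    and p_val: "\<And>a. a \<le> n \<Longrightarrow> val_ge (p a) ((1 + 1 / s) * (real a - real r))"
    and p_val_strict: "\<And>a. a \<le> n \<Longrightarrow> val_ge (p a) ((1 + \<mu>) * (real a - real r) + \<epsilon>)"
begin

text \<open>\<open>\<gamma>\<close> and \<open>\<eta>\<close> are valuation lines through the vertex
  r, for the slopes 1/s and \<mu>. The first serves to measure Gevrey growth; the data exceed the
  second by \<open>\<epsilon>\<close>, which makes the iteration contracting.\<close>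

definition \<gamma> :: "nat \<Rightarrow> real" where "\<gamma> a = (1 + 1 / s) * (real a - real r)"
definition \<eta> :: "nat \<Rightarrow> real" where "\<eta> a = (1 + \<mu>) * (real a - real r)"

text \<open>An equation of operators, compared coefficient by coefficient: when the terms of indices
  b and c are composed, the number of derivatives that fall on \<open>X c\<close> determines the
  index a of the result. The linear sum has only terms with at least one derivative.\<close>

definition F :: "(nat \<Rightarrow> complex fls) \<Rightarrow> nat \<Rightarrow> complex fls" where
  "F X a = p a
    + (\<Sum>b\<le>n. \<Sum>c\<le>n. if a + r \<le> b + c
        then fls_const (k a b c) * (X b * (fls_deriv ^^ (b + c - (a + r))) (X c)) else 0)
    + (\<Sum>c\<le>n. if a < c then fls_const (k' a c) * (fls_deriv ^^ (c - a)) (X c) else 0)"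

definition admissible :: "(nat \<Rightarrow> complex fls) \<Rightarrow> bool" where
  "admissible X \<longleftrightarrow> (\<forall>a\<le>n. val_ge (X a) (\<gamma> a) \<and> val_ge (X a) (\<eta> a + \<epsilon>))"

definition close :: "real \<Rightarrow> (nat \<Rightarrow> complex fls) \<Rightarrow> (nat \<Rightarrow> complex fls) \<Rightarrow> bool" where
  "close h X Y \<longleftrightarrow> (\<forall>a\<le>n. val_ge (X a - Y a) (\<eta> a + h))"

text \<open>Each derivative costs 1, while the corresponding defect of the index is worth 1 + 1/s.
  The surplus of 1/s per derivative is what \<open>gevrey_weight_gain\<close> spends; along
  \<open>\<eta>\<close> the surplus is \<mu>.\<close>

lemma \<gamma>_balance: "a + r \<le> b + c \<Longrightarrow> \<gamma> b + \<gamma> c - real (b + c - (a + r)) = \<gamma> a + real (b + c - (a + r)) / s"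
  by (simp add: \<gamma>_def of_nat_diff field_simps) (simp add: algebra_simps add_divide_distrib diff_divide_distrib)

lemma \<eta>_balance: "a + r \<le> b + c \<Longrightarrow> \<eta> b + \<eta> c - real (b + c - (a + r)) = \<eta> a + real (b + c - (a + r)) * \<mu>"
  by (simp add: \<eta>_def of_nat_diff algebra_simps)

lemma \<gamma>_balance': "a \<le> c \<Longrightarrow> \<gamma> c - real (c - a) = \<gamma> a + real (c - a) / s"
  by (simp add: \<gamma>_def of_nat_diff field_simps) (simp add: algebra_simps add_divide_distrib diff_divide_distrib)

lemma \<eta>_balance': "a \<le> c \<Longrightarrow> \<eta> c - real (c - a) = \<eta> a + real (c - a) * \<mu>"
  by (simp add: \<eta>_def of_nat_diff algebra_simps)

lemma admissible_F:
  assumes X: "admissible X"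
  shows "admissible (F X)"
  unfolding admissible_def
proof (intro allI impI conjI)
  fix a assume a: "a \<le> n"
  have Xg: "\<And>b. b \<le> n \<Longrightarrow> val_ge (X b) (\<gamma> b)" and Xe: "\<And>b. b \<le> n \<Longrightarrow> val_ge (X b) (\<eta> b + \<epsilon>)"
    using X by (auto simp: admissible_def)
  show "val_ge (F X a) (\<gamma> a)" unfolding F_def
  proof (intro val_ge_add val_ge_sum)
    show "val_ge (p a) (\<gamma> a)" using p_val[OF a] by (simp add: \<gamma>_def)
    show "val_ge (if a + r \<le> b + c then fls_const (k a b c) * (X b * (fls_deriv ^^ (b + c - (a + r))) (X c)) else 0) (\<gamma> a)"
      if "b \<in> {..n}" "c \<in> {..n}" for b c
    proof (cases "a + r \<le> b + c")
      case True
      have "\<gamma> a \<le> \<gamma> b + (\<gamma> c - real (b + c - (a + r)))"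
      proof -
        have "0 \<le> real (b + c - (a + r)) / s" using s by simp
        then show ?thesis using \<gamma>_balance[OF True] by linarith
      qed
      then show ?thesis
        using that True val_ge_mult[OF Xg[of b] val_ge_deriv_pow[OF Xg[of c], of "b + c - (a + r)"]]
        by (auto intro!: val_ge_const_mult elim!: val_ge_mono)
    qed auto
    show "val_ge (if a < c then fls_const (k' a c) * (fls_deriv ^^ (c - a)) (X c) else 0) (\<gamma> a)"
      if "c \<in> {..n}" for c
      using that s \<gamma>_balance'[of a c] val_ge_deriv_pow[OF Xg[of c], of "c - a"]
      by (auto intro!: val_ge_const_mult elim!: val_ge_mono)
  qed
  show "val_ge (F X a) (\<eta> a + \<epsilon>)" unfolding F_def
  proof (intro val_ge_add val_ge_sum)
    show "val_ge (p a) (\<eta> a + \<epsilon>)" using p_val_strict[OF a] by (simp add: \<eta>_def)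
    show "val_ge (if a + r \<le> b + c then fls_const (k a b c) * (X b * (fls_deriv ^^ (b + c - (a + r))) (X c)) else 0) (\<eta> a + \<epsilon>)"
      if "b \<in> {..n}" "c \<in> {..n}" for b c
    proof (cases "a + r \<le> b + c")
      case True
      have "0 \<le> real (b + c - (a + r)) * \<mu>" using mu by simp
      then have "\<eta> a + \<epsilon> \<le> \<eta> b + \<epsilon> + (\<eta> c + \<epsilon> - real (b + c - (a + r)))"
        using eps \<eta>_balance[OF True] by simp
      then show ?thesis
        using that True val_ge_mult[OF Xe[of b] val_ge_deriv_pow[OF Xe[of c], of "b + c - (a + r)"]]
        by (auto intro!: val_ge_const_mult elim!: val_ge_mono)
    qed auto
    show "val_ge (if a < c then fls_const (k' a c) * (fls_deriv ^^ (c - a)) (X c) else 0) (\<eta> a + \<epsilon>)"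
      if "c \<in> {..n}" for c
    proof (cases "a < c")
      case True
      have "0 \<le> real (c - a) * \<mu>" using mu by simp
      then have "\<eta> a + \<epsilon> \<le> \<eta> c + \<epsilon> - real (c - a)" using \<eta>_balance'[of a c] True by simp
      then show ?thesis
        using that True val_ge_deriv_pow[OF Xe[of c], of "c - a"]
        by (auto intro!: val_ge_const_mult elim!: val_ge_mono)
    qed auto
  qed
qed

text \<open>In a difference of products the other factor is admissible, which gains
  \<open>\<epsilon>\<close>; a linear term has at least one derivative, which gains \<mu>. The
  smaller of the two is the rate of contraction.\<close>

lemma close_F:
  assumes X: "admissible X" and Y: "admissible Y" and XY: "close h X Y"
  shows "close (h + min \<epsilon> \<mu>) (F X) (F Y)"
  unfolding close_def
proof (intro allI impI)
  fix a assume a: "a \<le> n"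
  have Xe: "\<And>b. b \<le> n \<Longrightarrow> val_ge (X b) (\<eta> b + \<epsilon>)" and Ye: "\<And>b. b \<le> n \<Longrightarrow> val_ge (Y b) (\<eta> b + \<epsilon>)"
    using X Y by (auto simp: admissible_def)
  have D: "\<And>b. b \<le> n \<Longrightarrow> val_ge (X b - Y b) (\<eta> b + h)" using XY by (auto simp: close_def)
  have Dl: "(fls_deriv ^^ l) (f - g) = (fls_deriv ^^ l) f - (fls_deriv ^^ l) g" for l and f g :: "complex fls"
    by (induction l) (auto simp: fls_deriv_sub)
  have "F X a - F Y a =
      (\<Sum>b\<le>n. \<Sum>c\<le>n. if a + r \<le> b + c then fls_const (k a b c) *
         ((X b - Y b) * (fls_deriv ^^ (b + c - (a + r))) (X c) + Y b * (fls_deriv ^^ (b + c - (a + r))) (X c - Y c)) else 0)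
    + (\<Sum>c\<le>n. if a < c then fls_const (k' a c) * (fls_deriv ^^ (c - a)) (X c - Y c) else 0)"
    unfolding F_def add_diff_add sum_subtractf[symmetric]
    by (intro arg_cong2[of _ _ _ _ "(+)"] sum.cong refl) (auto simp: algebra_simps Dl intro!: sum.cong)
  moreover have "val_ge \<dots> (\<eta> a + (h + min \<epsilon> \<mu>))"
  proof (intro val_ge_add val_ge_sum)
    fix b c assume bc: "b \<in> {..n}" "c \<in> {..n}"
    show "val_ge (if a + r \<le> b + c then fls_const (k a b c) *
         ((X b - Y b) * (fls_deriv ^^ (b + c - (a + r))) (X c) + Y b * (fls_deriv ^^ (b + c - (a + r))) (X c - Y c)) else 0)
         (\<eta> a + (h + min \<epsilon> \<mu>))"
    proof (cases "a + r \<le> b + c")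
      case True
      have "0 \<le> real (b + c - (a + r)) * \<mu>" using mu by simp
      then have le: "\<eta> a + (h + min \<epsilon> \<mu>) \<le> \<eta> b + h + (\<eta> c + \<epsilon> - real (b + c - (a + r)))"
        "\<eta> a + (h + min \<epsilon> \<mu>) \<le> \<eta> b + \<epsilon> + (\<eta> c + h - real (b + c - (a + r)))"
        using \<eta>_balance[OF True] by (simp_all add: min_def split: if_splits)
      have "val_ge ((X b - Y b) * (fls_deriv ^^ (b + c - (a + r))) (X c)) (\<eta> a + (h + min \<epsilon> \<mu>))"
        using bc by (intro val_ge_mono[OF val_ge_mult[OF D val_ge_deriv_pow[OF Xe]] le(1)]) auto
      moreover have "val_ge (Y b * (fls_deriv ^^ (b + c - (a + r))) (X c - Y c)) (\<eta> a + (h + min \<epsilon> \<mu>))"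
        using bc by (intro val_ge_mono[OF val_ge_mult[OF Ye val_ge_deriv_pow[OF D]] le(2)]) auto
      ultimately show ?thesis using True by (simp add: val_ge_const_mult val_ge_add)
    qed auto
  next
    fix c assume c: "c \<in> {..n}"
    show "val_ge (if a < c then fls_const (k' a c) * (fls_deriv ^^ (c - a)) (X c - Y c) else 0) (\<eta> a + (h + min \<epsilon> \<mu>))"
    proof (cases "a < c")
      case True
      have "1 * \<mu> \<le> real (c - a) * \<mu>" using mu True by (intro mult_right_mono) auto
      then have "\<eta> a + (h + min \<epsilon> \<mu>) \<le> \<eta> c + h - real (c - a)"
        using \<eta>_balance'[of a c] True by (simp add: min_def split: if_splits)
      then show ?thesis
        using c True val_ge_deriv_pow[OF D[of c], of "c - a"] by (auto intro!: val_ge_const_mult elim!: val_ge_mono)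
    qed auto
  qed
  ultimately show "val_ge (F X a - F Y a) (\<eta> a + (h + min \<epsilon> \<mu>))" by simp
qed

section \<open>The formal solution as a coefficientwise limit\<close>

definition iter :: "nat \<Rightarrow> nat \<Rightarrow> complex fls" where "iter j = (F ^^ j) (\<lambda>_. 0)"

lemma iter_Suc: "iter (Suc j) = F (iter j)"
  by (simp add: iter_def)

lemma admissible_iter: "admissible (iter j)"
proof (induction j)
  case (Suc j)
  then show ?case by (simp add: iter_Suc admissible_F)
qed (simp add: iter_def admissible_def)

lemma close_iter_Suc: "close (real j * min \<epsilon> \<mu>) (iter j) (iter (Suc j))"
proof (induction j)
  case 0
  have "val_ge (- p a) (\<eta> a)" if "a \<le> n" for a
    using p_val_strict[OF that] eps by (auto simp: \<eta>_def elim!: val_ge_mono)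
  moreover have "F (\<lambda>_. 0) a = p a" for a
  proof -
    have "(fls_deriv ^^ l) 0 = (0 :: complex fls)" for l by (induction l) auto
    then show ?thesis by (simp add: F_def cong: if_cong)
  qed
  ultimately show ?case by (simp add: close_def iter_def)
next
  case (Suc j)
  show ?case using close_F[OF admissible_iter admissible_iter Suc]
    by (simp add: iter_Suc[symmetric] distrib_right add.commute)
qed

lemma close_trans: "close h X Y \<Longrightarrow> close h Y Z \<Longrightarrow> close h X Z"
  unfolding close_def using val_ge_add by fastforce

lemma close_mono: "close h X Y \<Longrightarrow> h' \<le> h \<Longrightarrow> close h' X Y"
  unfolding close_def by (meson add_left_mono val_ge_mono)

lemma close_sym: "close h X Y \<Longrightarrow> close h Y X"
  unfolding close_def by (metis minus_diff_eq val_ge_uminus)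

lemma close_iter: "close (real j * min \<epsilon> \<mu>) (iter j) (iter (j + i))"
proof (induction i)
  case (Suc i)
  have "close (real j * min \<epsilon> \<mu>) (iter (j + i)) (iter (j + Suc i))"
    using close_iter_Suc[of "j + i"] eps mu by (auto elim!: close_mono intro!: mult_right_mono)
  then show ?case using Suc close_trans by blast
qed (simp add: close_def)

text \<open>An iterate from which on the coefficient of index m in component a no longer changes, as
  the j-th iterate is correct below \<open>\<eta> a + real j * min \<epsilon> \<mu>\<close>.\<close>

definition stage :: "nat \<Rightarrow> int \<Rightarrow> nat" where
  "stage a m = nat \<lceil>(real_of_int m - \<eta> a) / min \<epsilon> \<mu>\<rceil> + 1"

definition sol :: "nat \<Rightarrow> complex fls" where
  "sol a = Abs_fls (\<lambda>m. fls_nth (iter (stage a m) a) m)"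

lemma stage_gt: "real_of_int m < \<eta> a + real (stage a m) * min \<epsilon> \<mu>"
proof -
  have "(real_of_int m - \<eta> a) / min \<epsilon> \<mu> < real (stage a m)" unfolding stage_def by linarith
  then show ?thesis using eps mu by (simp add: pos_divide_less_eq)
qed

lemma iter_stable:
  assumes "a \<le> n" "real_of_int m < \<eta> a + real j * min \<epsilon> \<mu>"
  shows "fls_nth (iter (j + i) a) m = fls_nth (iter j a) m"
  using close_iter[of j i] assms unfolding close_def val_ge_def by fastforce

lemma sol_nth:
  assumes a: "a \<le> n"
  shows "fls_nth (sol a) m = fls_nth (iter (stage a m) a) m"
  unfolding sol_def
proof (rule nth_Abs_fls_lower_bound[of "\<lfloor>\<gamma> a\<rfloor>"], intro allI impI)
  fix i assume "i < \<lfloor>\<gamma> a\<rfloor>"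
  then have "real_of_int i < \<gamma> a" by linarith
  then show "fls_nth (iter (stage a i) a) i = 0"
    using admissible_iter[of "stage a i"] a by (simp add: admissible_def val_ge_def)
qed

lemma sol_nth_iter:
  assumes a: "a \<le> n" and m: "real_of_int m < \<eta> a + real j * min \<epsilon> \<mu>"
  shows "fls_nth (sol a) m = fls_nth (iter j a) m"
proof (cases "stage a m \<le> j")
  case True
  then show ?thesis using iter_stable[OF a stage_gt, of m "j - stage a m"] sol_nth[OF a] by simp
next
  case False
  then show ?thesis using iter_stable[OF a m, of "stage a m - j"] sol_nth[OF a] by simp
qed

lemma admissible_sol: "admissible sol"
  using admissible_iter by (auto simp: admissible_def val_ge_def sol_nth)

lemma close_iter_sol: "close (real j * min \<epsilon> \<mu>) (iter j) sol"
  by (auto simp: close_def val_ge_def sol_nth_iter)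

text \<open>For every j both sides are close to \<open>iter (Suc j)\<close>, so the valuation of
  their difference exceeds every bound.\<close>

lemma sol_fixed:
  assumes a: "a \<le> n"
  shows "sol a = F sol a"
proof -
  have "val_ge (sol a - F sol a) (\<eta> a + real j * min \<epsilon> \<mu>)" for j
  proof -
    have "close (real (Suc j) * min \<epsilon> \<mu>) (iter (Suc j)) (F sol)"
      using close_F[OF admissible_iter admissible_sol close_iter_sol] by (simp add: iter_Suc distrib_right add.commute)
    then have "close (real (Suc j) * min \<epsilon> \<mu>) sol (F sol)"
      using close_iter_sol close_sym close_trans by blast
    then have "close (real j * min \<epsilon> \<mu>) sol (F sol)"
      using eps mu by (auto elim!: close_mono intro!: mult_right_mono)
    then show ?thesis using a by (simp add: close_def)
  qed
  moreover have "\<exists>j. c \<le> \<eta> a + real j * min \<epsilon> \<mu>" for c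
  proof -
    obtain j where "(c - \<eta> a) / min \<epsilon> \<mu> \<le> real j" using real_arch_simple by blast
    then show ?thesis using eps mu by (intro exI[of _ j]) (simp add: pos_divide_le_eq)
  qed
  ultimately have "sol a - F sol a = 0" by (intro val_ge_zeroI) blast
  then show ?thesis by simp
qed

text \<open>Division by the weight, with exponents counted from \<open>\<gamma>\<close>, makes a
  bounded norm mean Gevrey growth. The power of \<rho> counts exponents from \<open>\<eta>\<close>,
  above which the data lie strictly, so a small \<rho> makes the data small and leaves the Gevrey
  factor as it is.\<close>

definition wt :: "real \<Rightarrow> nat \<Rightarrow> int \<Rightarrow> real" where
  "wt \<rho> a m = \<rho> powr (real_of_int m - \<eta> a) / gevrey_weight s (real_of_int m - \<gamma> a)"

lemma wt_nonneg: "0 \<le> wt \<rho> a m"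
  by (simp add: wt_def gevrey_weight_def)

text \<open>Chosen so that the absolute value of j plus l is at most G0 * (1 + d), where d is the
  height of j above \<open>\<gamma> c\<close>: the first two summands bound the absolute value of
  \<open>\<gamma> c\<close> and l.\<close>

definition G0 :: real where "G0 = (1 + 1 / s) * real n + 2 * real n + 1"

text \<open>The balance along \<open>\<gamma>\<close> leaves room l / s in the Gevrey weight, just
  enough for l factors of the size of j. The balance along \<open>\<eta>\<close> leaves the power of
  \<rho>, which is later used for the linear terms.\<close>

lemma wt_ineq:
  assumes \<rho>: "0 < \<rho>" and bc: "b \<le> n" "c \<le> n" and le: "a + r \<le> b + c"
    and l: "l = b + c - (a + r)"
    and i: "\<gamma> b \<le> real_of_int i" and j: "\<gamma> c \<le> real_of_int j"
  shows "wt \<rho> a (i + j - int l) * (\<bar>real_of_int j\<bar> + real l) ^ l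
    \<le> G0 ^ (2 * n) * \<rho> powr (\<mu> * real l) * (wt \<rho> b i * wt \<rho> c j)"
proof -
  define d1 where "d1 = real_of_int i - \<gamma> b"
  define d2 where "d2 = real_of_int j - \<gamma> c"
  have d: "d1 \<ge> 0" "d2 \<ge> 0" using i j by (auto simp: d1_def d2_def)
  have G1: "G0 \<ge> 1" using s by (simp add: G0_def)
  have gw: "real_of_int (i + j - int l) - \<gamma> a = d1 + d2 + real l / s"
    using \<gamma>_balance[OF le] by (simp add: d1_def d2_def l)
  have gp: "\<rho> powr (real_of_int (i + j - int l) - \<eta> a)
      = \<rho> powr (\<mu> * real l) * (\<rho> powr (real_of_int i - \<eta> b) * \<rho> powr (real_of_int j - \<eta> c))"
    using \<eta>_balance[OF le] by (simp add: l algebra_simps flip: powr_add)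
  have "\<bar>\<gamma> c\<bar> \<le> (1 + 1 / s) * real n"
    unfolding \<gamma>_def abs_mult using s bc rn by (intro mult_mono) auto
  moreover have "real l \<le> 2 * real n" using bc by (simp add: l)
  ultimately have "\<bar>real_of_int j\<bar> + real l \<le> d2 + (G0 - 1)" using d by (simp add: d2_def G0_def)
  also have "\<dots> \<le> G0 * (1 + d2)"
    using G1 d mult_mono[of 1 G0 d2 d2] by (simp add: algebra_simps)
  finally have "(\<bar>real_of_int j\<bar> + real l) ^ l \<le> (G0 * (1 + d2)) ^ l" by (intro power_mono) auto
  also have "\<dots> = G0 ^ l * (1 + d2) ^ l" by (simp add: power_mult_distrib)
  also have "\<dots> \<le> G0 ^ (2 * n) * (1 + d2) ^ l"
    using G1 d bc by (intro mult_right_mono power_increasing) (auto simp: l)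
  finally have jl: "(\<bar>real_of_int j\<bar> + real l) ^ l \<le> G0 ^ (2 * n) * (1 + d2) ^ l" .
  define W where "W = gevrey_weight s (d1 + d2 + real l / s)"
  have W: "W > 0" "gevrey_weight s d1 > 0" "gevrey_weight s d2 > 0"
    unfolding W_def using s d by (auto intro!: gevrey_weight_pos)
  have "(1 + d2) ^ l / W \<le> 1 / (gevrey_weight s d1 * gevrey_weight s d2)"
    using gevrey_weight_gain[OF s d, of l] W by (simp add: W_def field_simps)
  note gain = this
  have "(\<bar>real_of_int j\<bar> + real l) ^ l / W \<le> G0 ^ (2 * n) * (1 + d2) ^ l / W"
    using jl W by (intro divide_right_mono) auto
  also have "\<dots> = G0 ^ (2 * n) * ((1 + d2) ^ l / W)" by simp
  also have "\<dots> \<le> G0 ^ (2 * n) * (1 / (gevrey_weight s d1 * gevrey_weight s d2))"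
    using gain G1 by (intro mult_left_mono) auto
  finally have "(\<bar>real_of_int j\<bar> + real l) ^ l / W \<le> G0 ^ (2 * n) * (1 / (gevrey_weight s d1 * gevrey_weight s d2))" .
  then have "\<rho> powr (real_of_int (i + j - int l) - \<eta> a) * ((\<bar>real_of_int j\<bar> + real l) ^ l / W)
    \<le> \<rho> powr (real_of_int (i + j - int l) - \<eta> a) * (G0 ^ (2 * n) * (1 / (gevrey_weight s d1 * gevrey_weight s d2)))"
    by (intro mult_left_mono) auto
  then show ?thesis
    unfolding wt_def gw W_def[symmetric] d1_def[symmetric] d2_def[symmetric] gp by (simp add: mult_ac)
qed

definition ball :: "real \<Rightarrow> real \<Rightarrow> (nat \<Rightarrow> complex fls) \<Rightarrow> bool" where
  "ball \<rho> R X \<longleftrightarrow> (\<forall>a\<le>n. wsum_le (wt \<rho> a) (X a) R)"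

text \<open>Bounds the sum of the structure constants for any single a; the leading 1 makes division
  by it harmless.\<close>

definition M0 :: real where
  "M0 = 1 + (\<Sum>a\<le>n. (\<Sum>b\<le>n. \<Sum>c\<le>n. norm (k a b c) * G0 ^ (2 * n)) + (\<Sum>c\<le>n. norm (k' a c) * G0 ^ (2 * n)))"

lemma G0_pos: "G0 ^ (2 * n) \<ge> 0"
  using s by (simp add: G0_def)

lemma M0_ge_1: "M0 \<ge> 1"
  using G0_pos by (simp add: M0_def sum_nonneg)

text \<open>With R = 1 / (4 * M0) the data take up R / 2. All other terms are bounded by constants
  times R * R and together take up at most M0 * R * R = R / 4.\<close>

lemma ball_F:
  assumes \<rho>: "0 < \<rho>" "\<rho> \<le> 1" "\<rho> powr \<mu> \<le> 1 / (4 * M0)"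
    and p: "\<And>a. a \<le> n \<Longrightarrow> wsum_le (wt \<rho> a) (p a) (1 / (8 * M0))"
    and X: "admissible X" "ball \<rho> (1 / (4 * M0)) X"
  shows "ball \<rho> (1 / (4 * M0)) (F X)"
  unfolding ball_def
proof (intro allI impI)
  fix a assume a: "a \<le> n"
  define R where "R = 1 / (4 * M0)"
  have R: "R > 0" "M0 * R = 1 / 4" using M0_ge_1 by (auto simp: R_def)
  have Xg: "\<And>b. b \<le> n \<Longrightarrow> val_ge (X b) (\<gamma> b)" and Xb: "\<And>b. b \<le> n \<Longrightarrow> wsum_le (wt \<rho> b) (X b) R"
    using X by (auto simp: admissible_def ball_def R_def)
  have \<gamma>r: "\<gamma> r = 0" "\<eta> r = 0" by (auto simp: \<gamma>_def \<eta>_def)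
  \<comment> \<open>Both lines pass through 0 at r, so the constant series has norm 1 there. The
    linear terms can then be treated as products with 1.\<close>
  have one: "wsum_le (wt \<rho> r) 1 1"
    unfolding wsum_le_def
  proof (intro allI impI)
    fix A :: "int set" assume A: "finite A"
    have "(\<Sum>m\<in>A. norm (fls_nth 1 m :: complex) * wt \<rho> r m) = (\<Sum>m\<in>A. if m = 0 then 1 else 0)"
      using \<rho> by (intro sum.cong) (auto simp: wt_def \<gamma>r gevrey_weight_def)
    also have "\<dots> \<le> 1" using A by simp
    finally show "(\<Sum>m\<in>A. norm (fls_nth 1 m :: complex) * wt \<rho> r m) \<le> 1" .
  qed
  have quad: "wsum_le (wt \<rho> a) (if a + r \<le> b + c then fls_const (k a b c) * (X b * (fls_deriv ^^ (b + c - (a + r))) (X c)) else 0)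
      (norm (k a b c) * G0 ^ (2 * n) * (R * R))" if "b \<le> n" "c \<le> n" for b c
  proof (cases "a + r \<le> b + c")
    case True
    define l where "l = b + c - (a + r)"
    have "wsum_le (wt \<rho> a) (X b * (fls_deriv ^^ l) (X c)) (G0 ^ (2 * n) * \<rho> powr (\<mu> * real l) * (R * R))"
      using that True R \<rho> G0_pos
      by (intro wsum_le_mult_deriv[OF Xg Xg wt_nonneg wt_nonneg wt_nonneg Xb Xb] wt_ineq) (auto simp: l_def)
    moreover have "\<rho> powr (\<mu> * real l) \<le> 1" using \<rho> mu by (intro powr_le1) auto
    then have "G0 ^ (2 * n) * \<rho> powr (\<mu> * real l) * (R * R) \<le> G0 ^ (2 * n) * 1 * (R * R)"
      using R G0_pos by (intro mult_right_mono mult_left_mono) auto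
    ultimately have "wsum_le (wt \<rho> a) (X b * (fls_deriv ^^ l) (X c)) (G0 ^ (2 * n) * (R * R))"
      by (simp add: wsum_le_mono)
    from wsum_le_const_mult[OF this, of "k a b c"] True show ?thesis by (simp add: l_def mult_ac)
  next
    case False
    then show ?thesis using G0_pos R by (auto intro!: wsum_le_0)
  qed
  have lin: "wsum_le (wt \<rho> a) (if a < c then fls_const (k' a c) * (fls_deriv ^^ (c - a)) (X c) else 0)
      (norm (k' a c) * G0 ^ (2 * n) * (R * R))" if "c \<le> n" for c
  proof (cases "a < c")
    case True
    define l where "l = c - a"
    have "wsum_le (wt \<rho> a) (1 * (fls_deriv ^^ l) (X c)) (G0 ^ (2 * n) * \<rho> powr (\<mu> * real l) * (1 * R))"
      using that True R \<rho> G0_pos rn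
      by (intro wsum_le_mult_deriv[OF _ Xg wt_nonneg wt_nonneg wt_nonneg one Xb] wt_ineq) (auto simp: l_def \<gamma>r intro: val_ge_1)
    \<comment> \<open>As l is at least 1, the power of \<rho> supplies the second factor R that a
      linear term lacks.\<close>
    moreover have "\<rho> powr (\<mu> * real l) \<le> R"
    proof -
      have "\<mu> * 1 \<le> \<mu> * real l" using mu True by (intro mult_left_mono) (auto simp: l_def)
      then have "\<rho> powr (\<mu> * real l) \<le> \<rho> powr \<mu>" using \<rho> by (intro powr_mono') auto
      then show ?thesis using \<rho> by (simp add: R_def)
    qed
    then have "G0 ^ (2 * n) * \<rho> powr (\<mu> * real l) * (1 * R) \<le> G0 ^ (2 * n) * R * (1 * R)"
      using R G0_pos by (intro mult_right_mono mult_left_mono) auto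
    ultimately have "wsum_le (wt \<rho> a) ((fls_deriv ^^ l) (X c)) (G0 ^ (2 * n) * R * R)"
      by (simp add: wsum_le_mono)
    from wsum_le_const_mult[OF this, of "k' a c"] True show ?thesis by (simp add: l_def mult_ac)
  next
    case False
    then show ?thesis using G0_pos R by (auto intro!: wsum_le_0)
  qed
  define S where "S = (\<Sum>b\<le>n. \<Sum>c\<le>n. norm (k a b c) * G0 ^ (2 * n)) + (\<Sum>c\<le>n. norm (k' a c) * G0 ^ (2 * n))"
  have "S \<le> M0"
  proof -
    have "S \<le> (\<Sum>a\<le>n. (\<Sum>b\<le>n. \<Sum>c\<le>n. norm (k a b c) * G0 ^ (2 * n)) + (\<Sum>c\<le>n. norm (k' a c) * G0 ^ (2 * n)))"
      unfolding S_def using a G0_pos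
      by (intro member_le_sum[of a "{..n}" "\<lambda>a. (\<Sum>b\<le>n. \<Sum>c\<le>n. norm (k a b c) * G0 ^ (2 * n)) + (\<Sum>c\<le>n. norm (k' a c) * G0 ^ (2 * n))"])
         (auto intro!: add_nonneg_nonneg sum_nonneg)
    then show ?thesis by (simp add: M0_def)
  qed
  have "wsum_le (wt \<rho> a) (F X a)
    (R / 2 + (\<Sum>b\<le>n. \<Sum>c\<le>n. norm (k a b c) * G0 ^ (2 * n) * (R * R)) + (\<Sum>c\<le>n. norm (k' a c) * G0 ^ (2 * n) * (R * R)))"
    unfolding F_def using p[OF a]
    by (intro wsum_le_add wsum_le_sum wt_nonneg quad lin) (auto simp: R_def)
  moreover have "R / 2 + (\<Sum>b\<le>n. \<Sum>c\<le>n. norm (k a b c) * G0 ^ (2 * n) * (R * R)) + (\<Sum>c\<le>n. norm (k' a c) * G0 ^ (2 * n) * (R * R))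
      = R / 2 + S * (R * R)"
    by (simp add: S_def sum_distrib_right distrib_right)
  moreover have "R / 2 + S * (R * R) \<le> R"
  proof -
    have "S * (R * R) \<le> M0 * (R * R)" using \<open>S \<le> M0\<close> R(1) by (intro mult_right_mono) auto
    also have "M0 * (R * R) = (M0 * R) * R" by (simp only: mult.assoc)
    also have "\<dots> = R / 4" unfolding R(2) by simp
    finally show ?thesis using R(1) by linarith
  qed
  ultimately show "wsum_le (wt \<rho> a) (F X a) (1 / (4 * M0))"
    unfolding R_def[symmetric] by (metis wsum_le_mono)
qed

text \<open>At a small radius the geometric growth of the Gevrey bound is beaten; passing from the
  weight at m to that at m - \<open>\<gamma> a\<close> costs a geometric factor as well.\<close>

lemma p_wsum:
  assumes a: "a \<le> n"
  shows "\<exists>\<rho>1 C. 0 < \<rho>1 \<and> wsum_le (wt \<rho>1 a) (p a) C"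
proof -
  obtain C B where CB: "C \<ge> 0" "B \<ge> 1"
    "\<And>m::nat. norm (fls_nth (p a) (int m)) \<le> C * B ^ m * gevrey_weight s (real m)"
    using gevrey_series_bound[OF s p_gevrey[OF a]] by blast
  have "\<exists>C1 B1. C1 \<ge> 1 \<and> B1 \<ge> 1 \<and> (\<forall>m::nat. \<gamma> a \<le> real m \<longrightarrow>
     gevrey_weight s (real m) \<le> C1 * B1 ^ m * gevrey_weight s (real m - \<gamma> a))"
  proof -
    obtain C1 B1 where CB1: "C1 \<ge> 1" "B1 \<ge> 1"
      "\<And>d. d \<ge> 0 \<Longrightarrow> d + \<gamma> a \<ge> 0 \<Longrightarrow> gevrey_weight s (d + \<gamma> a) \<le> C1 * B1 powr d * gevrey_weight s d"
      using gevrey_weight_shift_bound[OF s, of "\<gamma> a"] by blast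
    \<comment> \<open>The shift bound is geometric in m - \<open>\<gamma> a\<close>; this constant
      turns it into one geometric in m, whatever the sign of \<open>\<gamma> a\<close>.\<close>
    define C2 where "C2 = C1 * B1 powr \<bar>\<gamma> a\<bar>"
    have "gevrey_weight s (real m) \<le> C2 * B1 ^ m * gevrey_weight s (real m - \<gamma> a)" if "\<gamma> a \<le> real m" for m
    proof -
      have "B1 powr (real m - \<gamma> a) \<le> B1 powr (\<bar>\<gamma> a\<bar> + real m)"
        using CB1(1,2) by (intro powr_mono) auto
      also have "\<dots> = B1 powr \<bar>\<gamma> a\<bar> * B1 ^ m" using CB1(2) powr_realpow[of B1 m] by (simp add: powr_add)
      finally have *: "B1 powr (real m - \<gamma> a) \<le> B1 powr \<bar>\<gamma> a\<bar> * B1 ^ m" .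
      have "gevrey_weight s (real m - \<gamma> a + \<gamma> a) \<le> C1 * B1 powr (real m - \<gamma> a) * gevrey_weight s (real m - \<gamma> a)"
        using that by (intro CB1(3)) auto
      then have "gevrey_weight s (real m) \<le> C1 * B1 powr (real m - \<gamma> a) * gevrey_weight s (real m - \<gamma> a)"
        by simp
      also have "\<dots> \<le> C1 * (B1 powr \<bar>\<gamma> a\<bar> * B1 ^ m) * gevrey_weight s (real m - \<gamma> a)"
        using * CB1 gevrey_weight_ge_1[OF s, of "real m - \<gamma> a"] that
        by (intro mult_right_mono mult_left_mono) auto
      finally show ?thesis by (simp only: C2_def mult.assoc)
    qed
    moreover have "C2 \<ge> 1"
      
    proof -
      have "1 * 1 \<le> C1 * B1 powr \<bar>\<gamma> a\<bar>"
        using CB1(1,2) by (intro mult_mono ge_one_powr_ge_zero) auto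
      then show ?thesis by (simp add: C2_def)
    qed
    ultimately show ?thesis using CB1(2) by (intro exI[of _ C2] exI[of _ B1]) simp
  qed
  then obtain C1 B1 where *: "C1 \<ge> 1 \<and> B1 \<ge> 1 \<and> (\<forall>m::nat. \<gamma> a \<le> real m \<longrightarrow>
     gevrey_weight s (real m) \<le> C1 * B1 ^ m * gevrey_weight s (real m - \<gamma> a))" by (elim exE)
  then have CB1: "C1 \<ge> 1" "B1 \<ge> 1" by simp_all
  have CB1': "gevrey_weight s (real m) \<le> C1 * B1 ^ m * gevrey_weight s (real m - \<gamma> a)" if "\<gamma> a \<le> real m" for m
    using * that by simp
  \<comment> \<open>Cancels the growth rates B of the coefficients and B1 of the weights and leaves
    1/2 per index.\<close>
  define \<rho>1 where "\<rho>1 = 1 / (2 * B * B1)"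
  have \<rho>1: "\<rho>1 > 0" using CB(1,2) CB1(1,2) by (simp add: \<rho>1_def)
  define lo where "lo = \<lceil>\<gamma> a\<rceil>"
  define Cn where "Cn = (\<Sum>m\<in>{lo..<0}. norm (fls_nth (p a) m) * wt \<rho>1 a m)"
  define Cp where "Cp = C * C1 * \<rho>1 powr (- \<eta> a)"
  have Cp: "Cp \<ge> 0" using CB(1,2) CB1(1,2) by (simp add: Cp_def)
  have pos: "norm (fls_nth (p a) (int m)) * wt \<rho>1 a (int m) \<le> Cp * (1 / 2) ^ m" for m :: nat
  proof (cases "\<gamma> a \<le> real m")
    case True
    have gp: "gevrey_weight s (real m - \<gamma> a) > 0"
      using True s by (intro gevrey_weight_pos) auto
    have "norm (fls_nth (p a) (int m)) \<le> C * B ^ m * gevrey_weight s (real m)" by (rule CB(3))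
    also have "\<dots> \<le> C * B ^ m * (C1 * B1 ^ m * gevrey_weight s (real m - \<gamma> a))"
      using CB(1,2) by (intro mult_left_mono CB1'[OF True]) auto
    finally have "norm (fls_nth (p a) (int m)) \<le> C * B ^ m * (C1 * B1 ^ m * gevrey_weight s (real m - \<gamma> a))" .
    then have "norm (fls_nth (p a) (int m)) * wt \<rho>1 a (int m)
       \<le> C * B ^ m * (C1 * B1 ^ m * gevrey_weight s (real m - \<gamma> a)) * wt \<rho>1 a (int m)"
      using wt_nonneg by (intro mult_right_mono) auto
    also have "\<dots> = C * C1 * (B ^ m * B1 ^ m) * \<rho>1 powr (real m - \<eta> a)"
      using gp by (simp add: wt_def)
    also have "\<rho>1 powr (real m - \<eta> a) = \<rho>1 ^ m * \<rho>1 powr (- \<eta> a)"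
      by (simp only: powr_realpow[OF \<rho>1] diff_conv_add_uminus powr_add)
    also have "C * C1 * (B ^ m * B1 ^ m) * (\<rho>1 ^ m * \<rho>1 powr (- \<eta> a)) = Cp * (B * B1 * \<rho>1) ^ m"
      by (simp only: Cp_def power_mult_distrib mult_ac)
    also have "B * B1 * \<rho>1 = 1 / 2" using CB(1,2) CB1(1,2) by (simp add: \<rho>1_def)
    finally show ?thesis .
  next
    case False
    then show ?thesis using p_val[OF a] Cp by (simp add: val_ge_def \<gamma>_def)
  qed
  have "wsum_le (wt \<rho>1 a) (p a) (Cn + 2 * Cp)"
    unfolding wsum_le_def
  proof (intro allI impI)
    fix A :: "int set" assume A: "finite A"
    let ?f = "\<lambda>m. norm (fls_nth (p a) m) * wt \<rho>1 a m"
    have f0: "?f m \<ge> 0" for m by (simp add: wt_nonneg)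
    have A_eq: "(A \<inter> {..<0}) \<union> (A \<inter> {0..}) = A" by auto
    have "sum ?f ((A \<inter> {..<0}) \<union> (A \<inter> {0..})) = sum ?f (A \<inter> {..<0}) + sum ?f (A \<inter> {0..})"
    proof (rule sum.union_disjoint)
      show "(A \<inter> {..<0}) \<inter> (A \<inter> {0..}) = {}" by (rule equals0I) (simp, linarith)
    qed (simp_all add: A)
    then have "sum ?f A = sum ?f (A \<inter> {..<0}) + sum ?f (A \<inter> {0..})" by (simp only: A_eq)
    also have "sum ?f (A \<inter> {..<0}) \<le> Cn"
    proof -
      have z: "?f m = 0" if "m < lo" for m
        using that val_geD[OF p_val[OF a], of m] unfolding lo_def \<gamma>_def by (simp add: less_ceiling_iff)
      have "sum ?f (A \<inter> {..<0}) = sum ?f (A \<inter> {lo..<0})"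
      proof (rule sum.mono_neutral_right)
        show "\<forall>i\<in>A \<inter> {..<0} - A \<inter> {lo..<0}. ?f i = 0"
        proof
          fix i assume "i \<in> A \<inter> {..<0} - A \<inter> {lo..<0}"
          then have "i < lo" by auto
          then show "?f i = 0" by (rule z)
        qed
      qed (use A in auto)
      also have "\<dots> \<le> Cn" unfolding Cn_def using f0 by (intro sum_mono2) auto
      finally show ?thesis .
    qed
    also have "sum ?f (A \<inter> {0..}) \<le> 2 * Cp"
    proof -
      have fin: "finite (nat ` (A \<inter> {0..}))" using A by simp
      have "sum ?f (A \<inter> {0..}) = (\<Sum>m\<in>nat ` (A \<inter> {0..}). ?f (int m))"
        by (subst sum.reindex) (auto simp: inj_on_def intro!: sum.cong)
      also have "\<dots> \<le> (\<Sum>m\<in>nat ` (A \<inter> {0..}). Cp * (1 / 2) ^ m)" by (intro sum_mono pos)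
      also have "\<dots> \<le> suminf (\<lambda>m. Cp * (1 / 2) ^ m)"
        using Cp fin by (intro sum_le_suminf summable_mult summable_geometric) auto
      also have "\<dots> = 2 * Cp" by (subst suminf_mult) (auto simp: suminf_geometric)
      finally show ?thesis .
    qed
    finally show "sum ?f A \<le> Cn + 2 * Cp" by simp
  qed
  with \<rho>1 show ?thesis by blast
qed

text \<open>All terms have index at least \<open>\<eta> a + \<epsilon>\<close>, so passing from
  \<rho>1 to a smaller \<rho> multiplies each of them by at most
  \<open>(\<rho> / \<rho>1) powr \<epsilon>\<close>.\<close>

lemma p_wsum_small:
  assumes a: "a \<le> n" and d: "d > 0"
  shows "eventually (\<lambda>\<rho>. wsum_le (wt \<rho> a) (p a) d) (at_right 0)"
proof -
  obtain \<rho>1 C where \<rho>1: "0 < \<rho>1" and C: "wsum_le (wt \<rho>1 a) (p a) C"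
    using p_wsum[OF a] by blast
  define C' where "C' = max C 1"
  have C': "wsum_le (wt \<rho>1 a) (p a) C'" "C' > 0" using C by (auto simp: C'_def elim: wsum_le_mono)
  \<comment> \<open>Below this value the factor \<open>(\<rho> / \<rho>1) powr \<epsilon>\<close> is
    at most d / C'.\<close>
  define \<rho>2 where "\<rho>2 = min \<rho>1 (\<rho>1 * (d / C') powr (1 / \<epsilon>))"
  have \<rho>2: "\<rho>2 > 0" using \<rho>1 d C' by (simp add: \<rho>2_def)
  have "wsum_le (wt \<rho> a) (p a) d" if \<rho>: "0 < \<rho>" "\<rho> < \<rho>2" for \<rho>
    unfolding wsum_le_def
  proof (intro allI impI)
    fix A :: "int set" assume A: "finite A"
    have q: "(\<rho> / \<rho>1) powr \<epsilon> \<le> d / C'"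
    proof -
      have "\<rho> / \<rho>1 \<le> (d / C') powr (1 / \<epsilon>)" using \<rho> \<rho>1 by (simp add: \<rho>2_def field_simps)
      then have "(\<rho> / \<rho>1) powr \<epsilon> \<le> ((d / C') powr (1 / \<epsilon>)) powr \<epsilon>"
        using \<rho> \<rho>1 eps by (intro powr_mono2) auto
      then show ?thesis using eps d C' by (simp add: powr_powr)
    qed
    have "norm (fls_nth (p a) m) * wt \<rho> a m \<le> (d / C') * (norm (fls_nth (p a) m) * wt \<rho>1 a m)" for m
    proof (cases "real_of_int m < \<eta> a + \<epsilon>")
      case True
      then show ?thesis using p_val_strict[OF a] by (simp add: val_ge_def \<eta>_def)
    next
      case False
      have "(\<rho> / \<rho>1) powr (real_of_int m - \<eta> a) \<le> (\<rho> / \<rho>1) powr \<epsilon>"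
        using False \<rho> \<rho>1 by (intro powr_mono') (auto simp: \<rho>2_def)
      with q have "(\<rho> / \<rho>1) powr (real_of_int m - \<eta> a) \<le> d / C'" by simp
      then have "(\<rho> / \<rho>1) powr (real_of_int m - \<eta> a) * wt \<rho>1 a m \<le> d / C' * wt \<rho>1 a m"
        using wt_nonneg by (intro mult_right_mono) auto
      moreover have "wt \<rho> a m = (\<rho> / \<rho>1) powr (real_of_int m - \<eta> a) * wt \<rho>1 a m"
        using \<rho> \<rho>1 by (simp add: wt_def powr_divide)
      ultimately have "wt \<rho> a m \<le> d / C' * wt \<rho>1 a m" by simp
      from mult_left_mono[OF this, of "norm (fls_nth (p a) m)"] show ?thesis by (simp add: mult_ac)
    qed
    then have "(\<Sum>m\<in>A. norm (fls_nth (p a) m) * wt \<rho> a m) \<le> (d / C') * (\<Sum>m\<in>A. norm (fls_nth (p a) m) * wt \<rho>1 a m)"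
      unfolding sum_distrib_left by (intro sum_mono)
    also have "\<dots> \<le> (d / C') * C'"
      using C' A d by (intro mult_left_mono) (auto simp: wsum_le_def)
    finally show "(\<Sum>m\<in>A. norm (fls_nth (p a) m) * wt \<rho> a m) \<le> d" using C' by simp
  qed
  then show ?thesis using \<rho>2 by (auto simp: eventually_at_right_field)
qed

text \<open>For one small \<rho> all iterates stay in the ball. Every coefficient of the limit is a
  coefficient of some iterate and so inherits the bound on single terms.\<close>

lemma sol_gevrey:
  assumes a: "a \<le> n"
  shows "sol a \<in> gevrey_series s"
proof -
  define R where "R = 1 / (4 * M0)"
  have R: "R > 0" using M0_ge_1 by (simp add: R_def)
  have "\<forall>\<^sub>F \<rho> in at_right 0. \<rho> < min 1 (R powr (1 / \<mu>))"
    using R by (intro order_tendstoD(2)[OF tendsto_ident_at]) auto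
  moreover have "\<forall>\<^sub>F \<rho> in at_right (0::real). \<rho> > 0"
    by (simp add: eventually_at_right_less)
  moreover have "\<forall>\<^sub>F \<rho> in at_right 0. \<forall>a\<in>{..n}. wsum_le (wt \<rho> a) (p a) (1 / (8 * M0))"
    using M0_ge_1 by (intro eventually_ball_finite) (auto intro!: p_wsum_small)
  ultimately have "\<forall>\<^sub>F \<rho> in at_right (0::real). \<rho> < min 1 (R powr (1 / \<mu>)) \<and> \<rho> > 0 \<and>
      (\<forall>a\<in>{..n}. wsum_le (wt \<rho> a) (p a) (1 / (8 * M0)))"
    by eventually_elim auto
  from eventually_happens'[OF trivial_limit_at_right_real this] obtain \<rho>
    where *: "\<rho> < min 1 (R powr (1 / \<mu>)) \<and> \<rho> > 0 \<and>
      (\<forall>a\<in>{..n}. wsum_le (wt \<rho> a) (p a) (1 / (8 * M0)))" by (rule exE)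
  have \<rho>: "0 < \<rho>" "\<rho> < 1" "\<rho> < R powr (1 / \<mu>)" using * by (simp_all only: min_less_iff_conj)
  have p: "wsum_le (wt \<rho> a) (p a) (1 / (8 * M0))" if "a \<le> n" for a
    using * that by (simp only: atMost_iff Ball_def)
  have "\<rho> powr \<mu> \<le> (R powr (1 / \<mu>)) powr \<mu>" using \<rho> mu by (intro powr_mono2) auto
  then have \<rho>\<mu>: "\<rho> powr \<mu> \<le> 1 / (4 * M0)" using R mu by (simp add: powr_powr R_def)
  have it: "ball \<rho> R (iter j)" for j
  proof (induction j)
    case 0
    then show ?case using R by (simp add: ball_def iter_def wsum_le_0)
  next
    case (Suc j)
    then show ?case using ball_F[OF \<rho>(1) _ \<rho>\<mu> p admissible_iter] \<rho> by (simp add: iter_Suc R_def)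
  qed
  have bound: "norm (fls_nth (sol a) m) * wt \<rho> a m \<le> R" for m
  proof -
    have "wsum_le (wt \<rho> a) (iter (stage a m) a) R" using it a by (simp add: ball_def)
    then have "(\<Sum>m\<in>{m}. norm (fls_nth (iter (stage a m) a) m) * wt \<rho> a m) \<le> R"
      unfolding wsum_le_def by (elim allE[of _ "{m}"]) simp
    then show ?thesis by (simp add: sol_nth[OF a])
  qed
  obtain C1 B1 where CB1: "C1 \<ge> 1" "B1 \<ge> 1"
      "\<And>d. d \<ge> 0 \<Longrightarrow> d + (- \<gamma> a) \<ge> 0 \<Longrightarrow> gevrey_weight s (d + (- \<gamma> a)) \<le> C1 * B1 powr d * gevrey_weight s d"
    using gevrey_weight_shift_bound[OF s, of "- \<gamma> a"] by blast
  show ?thesis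
  proof (rule gevrey_seriesI[OF s, of "B1 * (1 / \<rho>)" _ "R * \<rho> powr \<eta> a * C1"])
    have "1 * 1 \<le> B1 * (1 / \<rho>)" using CB1(2) \<rho>(1,2) by (intro mult_mono) auto
    then show "1 \<le> B1 * (1 / \<rho>)" by simp
    fix m :: nat
    show "norm (fls_nth (sol a) (int m)) \<le> R * \<rho> powr \<eta> a * C1 * (B1 * (1 / \<rho>)) powr real m * gevrey_weight s (real m)"
    proof (cases "\<gamma> a \<le> real m")
      case True
      have gp: "gevrey_weight s (real m - \<gamma> a) > 0"
        using True s by (intro gevrey_weight_pos) auto
      have pe: "\<rho> powr (real m - \<eta> a) > 0" using \<rho>(1) by simp
      have 1: "norm (fls_nth (sol a) (int m)) \<le> R * gevrey_weight s (real m - \<gamma> a) / \<rho> powr (real m - \<eta> a)"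
      proof -
        have "x \<le> y * v / u" if "x * (u / v) \<le> y" "0 < u" "0 < v" for x y u v :: real
          using that by (simp add: pos_divide_le_eq pos_le_divide_eq)
        then show ?thesis using bound[of "int m"] gp pe unfolding wt_def by (metis of_int_of_nat_eq)
      qed
      have 2: "R * gevrey_weight s (real m - \<gamma> a) / \<rho> powr (real m - \<eta> a)
          \<le> R * (C1 * B1 powr (real m) * gevrey_weight s (real m)) / \<rho> powr (real m - \<eta> a)"
        using CB1(3)[of "real m"] True R pe by (intro divide_right_mono mult_left_mono) auto
      have "(B1 * (1 / \<rho>)) powr real m = B1 powr real m / \<rho> powr real m"
        using \<rho>(1) CB1(2) powr_divide[of B1 \<rho> "real m"] by simp
      then have 3: "R * (C1 * B1 powr (real m) * gevrey_weight s (real m)) / \<rho> powr (real m - \<eta> a)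
          = R * \<rho> powr \<eta> a * C1 * (B1 * (1 / \<rho>)) powr real m * gevrey_weight s (real m)"
        by (simp only: powr_diff) simp
      show ?thesis using 1 2 unfolding 3 by (rule order_trans)
    next
      case False
      then have "fls_nth (sol a) (int m) = 0"
        using admissible_sol a unfolding admissible_def val_ge_def by fastforce
      moreover have "0 \<le> R * \<rho> powr \<eta> a * C1 * (B1 * (1 / \<rho>)) powr real m * gevrey_weight s (real m)"
        using R CB1(1) gevrey_weight_pos[OF s, of "real m"] by (intro mult_nonneg_nonneg) auto
      ultimately show ?thesis by (simp only: norm_zero)
    qed
  qed
qed

theorem solution:
  "\<exists>X. (\<forall>a\<le>n. X a \<in> gevrey_series s \<and> val_ge (X a) (\<gamma> a) \<and> val_ge (X a) (\<eta> a + \<epsilon>) \<and> X a = F X a)"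
proof (intro exI[of _ sol] allI impI conjI)
  fix a assume a: "a \<le> n"
  show "sol a \<in> gevrey_series s" by (rule sol_gevrey[OF a])
  show "val_ge (sol a) (\<gamma> a)" "val_ge (sol a) (\<eta> a + \<epsilon>)"
    using admissible_sol a unfolding admissible_def by blast+
  show "sol a = F sol a" by (rule sol_fixed[OF a])
qed

end

subsection \<open>Factorisation of differential operators\<close>

text \<open>Differential operators are represented by their action on vectors: composition becomes
  iteration of D, and an identity of operators becomes an identity for every w.\<close>

locale diff_module =
  fixes sm :: "complex fls \<Rightarrow> 'b::ab_group_add \<Rightarrow> 'b" and D :: "'b \<Rightarrow> 'b"
  assumes sm_add_right: "sm a (x + y) = sm a x + sm a y"
    and sm_add_left: "sm (a + b) x = sm a x + sm b x"
    and sm_mult: "sm (a * b) x = sm a (sm b x)"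
    and sm_1: "sm 1 x = x"
    and D_add: "D (x + y) = D x + D y"
    and D_sm: "D (sm a x) = sm (fls_deriv a) x + sm a (D x)"
begin

lemma sm_0_left [simp]: "sm 0 x = 0"
  using sm_add_left[of 0 0 x] by simp

lemma sm_0_right [simp]: "sm a 0 = 0"
  using sm_add_right[of a 0 0] by simp

lemma sm_minus_left: "sm (- a) x = - sm a x"
  using sm_add_left[of a "- a" x] by (simp add: eq_neg_iff_add_eq_0 add.commute)

lemma sm_sum_right: "sm a (sum f A) = (\<Sum>i\<in>A. sm a (f i))"
  by (induction A rule: infinite_finite_induct) (auto simp: sm_add_right)

lemma sm_sum_left: "sm (sum f A) x = (\<Sum>i\<in>A. sm (f i) x)"
  by (induction A rule: infinite_finite_induct) (auto simp: sm_add_left)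

lemma D_0 [simp]: "D 0 = 0"
  using D_add[of 0 0] by simp

lemma D_sum: "D (sum f A) = (\<Sum>i\<in>A. D (f i))"
  by (induction A rule: infinite_finite_induct) (auto simp: D_add)

lemma Dpow_add: "(D ^^ k) (x + y) = (D ^^ k) x + (D ^^ k) y"
  by (induction k) (auto simp: D_add)

lemma Dpow_0 [simp]: "(D ^^ k) 0 = 0"
  by (induction k) auto

lemma Dpow_sum: "(D ^^ k) (sum f A) = (\<Sum>i\<in>A. (D ^^ k) (f i))"
  by (induction A rule: infinite_finite_induct) (auto simp: Dpow_add)

lemma Dpow_Dpow: "(D ^^ k) ((D ^^ l) x) = (D ^^ (k + l)) x"
  by (simp add: funpow_add)

lemma leibniz:
  "(D ^^ k) (sm a x) = (\<Sum>l\<le>k. sm (of_nat (k choose l) * (fls_deriv ^^ l) a) ((D ^^ (k - l)) x))"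
proof (induction k)
  case 0
  then show ?case by simp
next
  case (Suc k)
  let ?d = "\<lambda>l. (fls_deriv ^^ l) a"
  have D_term: "D (sm (of_nat m * f) y) = sm (of_nat m * fls_deriv f) y + sm (of_nat m * f) (D y)" for m f y
    by (simp add: D_sm)
  have "(D ^^ Suc k) (sm a x) = (\<Sum>l\<le>k. D (sm (of_nat (k choose l) * ?d l) ((D ^^ (k - l)) x)))"
    by (simp add: Suc D_sum)
  also have "\<dots> = (\<Sum>l\<le>k. sm (of_nat (k choose l) * ?d (Suc l)) ((D ^^ (k - l)) x))
      + (\<Sum>l\<le>k. sm (of_nat (k choose l) * ?d l) ((D ^^ (Suc k - l)) x))"
    unfolding D_term sum.distrib by (intro arg_cong2[of _ _ _ _ "(+)"] sum.cong refl) (auto simp: Suc_diff_le)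
  also have "(\<Sum>l\<le>k. sm (of_nat (k choose l) * ?d l) ((D ^^ (Suc k - l)) x))
      = (\<Sum>l\<le>Suc k. sm (of_nat (k choose l) * ?d l) ((D ^^ (Suc k - l)) x))"
    by (simp add: binomial_eq_0)
  also have "\<dots> = sm a ((D ^^ Suc k) x) + (\<Sum>l\<le>k. sm (of_nat (k choose Suc l) * ?d (Suc l)) ((D ^^ (k - l)) x))"
    by (subst sum.atMost_Suc_shift) simp
  also have "(\<Sum>l\<le>k. sm (of_nat (k choose l) * ?d (Suc l)) ((D ^^ (k - l)) x))
      + (sm a ((D ^^ Suc k) x) + (\<Sum>l\<le>k. sm (of_nat (k choose Suc l) * ?d (Suc l)) ((D ^^ (k - l)) x)))
    = sm a ((D ^^ Suc k) x) + (\<Sum>l\<le>k. sm (of_nat (Suc k choose Suc l) * ?d (Suc l)) ((D ^^ (k - l)) x))"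
    by (simp add: sm_add_left distrib_right sum.distrib algebra_simps)
  also have "\<dots> = (\<Sum>l\<le>Suc k. sm (of_nat (Suc k choose l) * ?d l) ((D ^^ (Suc k - l)) x))"
    by (subst sum.atMost_Suc_shift) simp
  finally show ?case .
qed

text \<open>The Leibniz rule arranged by the order a of the resulting derivative of w. The common
  range up to n allows the sums over all terms to be exchanged.\<close>

lemma expand:
  assumes "M + c \<le> n"
  shows "(D ^^ M) (sm f ((D ^^ c) w)) = (\<Sum>a\<le>n. if a \<le> M + c
      then sm (of_nat (M choose (M + c - a)) * (fls_deriv ^^ (M + c - a)) f) ((D ^^ a) w) else 0)"
proof -
  let ?g = "\<lambda>a. if a \<le> M + c
      then sm (of_nat (M choose (M + c - a)) * (fls_deriv ^^ (M + c - a)) f) ((D ^^ a) w) else 0"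
  have "(\<Sum>a\<le>n. ?g a) = (\<Sum>a\<in>{c..M + c}. ?g a)"
  proof (rule sum.mono_neutral_right)
    show "\<forall>i\<in>{..n} - {c..M + c}. ?g i = 0"
      by (auto simp: binomial_eq_0)
  qed (use assms in auto)
  also have "\<dots> = (\<Sum>l\<le>M. sm (of_nat (M choose l) * (fls_deriv ^^ l) f) ((D ^^ (M - l + c)) w))"
    by (rule sum.reindex_bij_witness[of _ "\<lambda>l. M + c - l" "\<lambda>a. M + c - a"]) auto
  finally show ?thesis by (simp add: leibniz Dpow_Dpow)
qed

end

text \<open>
  The two systems below express that \<open>\<partial>\<^sup>r + \<Sum> p a \<partial>\<^sup>a\<close> equals \<open>(1 + Q)(\<partial>\<^sup>r + C)\<close> or \<open>(\<partial>\<^sup>r + C)(1 + Q)\<close>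
  respectively, where \<open>C = \<Sum>c<r. X c \<partial>\<^sup>c\<close> and \<open>Q = \<Sum>b\<ge>r. X b \<partial>\<^sup>b\<^sup>-\<^sup>r\<close>.
\<close>

definition k1 :: "nat \<Rightarrow> nat \<Rightarrow> nat \<Rightarrow> nat \<Rightarrow> complex" where
  "k1 r a b c = (if r \<le> b \<and> c < r then - of_nat ((b - r) choose (b + c - (a + r))) else 0)"

definition k2 :: "nat \<Rightarrow> nat \<Rightarrow> nat \<Rightarrow> nat \<Rightarrow> complex" where
  "k2 r a b c = (if b < r \<and> r \<le> c then - of_nat (b choose (b + c - (a + r))) else 0)"

text \<open>Here the leading derivative of the left factor acts on the coefficients of the right
  factor. In the opposite order of the factors no such linear term arises.\<close>

definition k2' :: "nat \<Rightarrow> nat \<Rightarrow> nat \<Rightarrow> complex" where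
  "k2' r a c = (if r \<le> c then - of_nat (r choose (c - a)) else 0)"

definition low :: "nat \<Rightarrow> (nat \<Rightarrow> complex fls) \<Rightarrow> nat \<Rightarrow> complex fls" where
  "low r X c = (if c < r then X c else 0)"

definition high :: "nat \<Rightarrow> (nat \<Rightarrow> complex fls) \<Rightarrow> nat \<Rightarrow> complex fls" where
  "high r X b = (if r \<le> b then X b else 0)"

lemma low_plus_high: "low r X a + high r X a = X a"
  by (auto simp: low_def high_def)

lemma fls_deriv_pow_0 [simp]: "(fls_deriv ^^ l) 0 = (0 :: complex fls)"
  by (induction l) auto

context diff_module
begin

text \<open>At order a the product contributes \<open>X a\<close> itself and the Leibniz terms
  \<open>Q b c a\<close>; the system says that they add up to \<open>p a\<close>. The units of the
  two factors multiply to the derivative of order r.\<close>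

lemma factor_fast_right:
  fixes X p :: "nat \<Rightarrow> complex fls" and w :: 'b
  assumes rn: "r \<le> n"
    and X: "\<And>a. a \<le> n \<Longrightarrow> X a = p a
      + (\<Sum>b\<le>n. \<Sum>c\<le>n. if a + r \<le> b + c
          then fls_const (k1 r a b c) * (X b * (fls_deriv ^^ (b + c - (a + r))) (X c)) else 0)"
  defines "u \<equiv> (D ^^ r) w + (\<Sum>c\<le>n. sm (low r X c) ((D ^^ c) w))"
  shows "u + (\<Sum>b\<le>n. sm (high r X b) ((D ^^ (b - r)) u)) = (D ^^ r) w + (\<Sum>a\<le>n. sm (p a) ((D ^^ a) w))"
proof -
  define Q where "Q b c a = (if a + r \<le> b + c then sm (of_nat ((b - r) choose (b + c - (a + r)))
     * (high r X b * (fls_deriv ^^ (b + c - (a + r))) (low r X c))) ((D ^^ a) w) else 0)" for b c a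
  have Q: "sm (high r X b) ((D ^^ (b - r)) (sm (low r X c) ((D ^^ c) w))) = (\<Sum>a\<le>n. Q b c a)"
    if "b \<le> n" "c \<le> n" for b c
  proof (cases "r \<le> b \<and> c < r")
    case True
    then have "b - r + c \<le> n" using that by linarith
    moreover have "b - r + c - a = b + c - (a + r)" "a \<le> b - r + c \<longleftrightarrow> a + r \<le> b + c" for a
      using True by linarith+
    ultimately show ?thesis
      unfolding Q_def using expand[of "b - r" c n "low r X c" w]
      by (auto simp: sm_sum_right sm_mult[symmetric] mult.left_commute intro!: sum.cong)
  next
    case False
    then consider "high r X b = 0" | "low r X c = 0" by (auto simp: low_def high_def)
    then show ?thesis by cases (simp_all add: Q_def cong: if_cong)
  qed
  have Xa: "sm (X a) ((D ^^ a) w) = sm (p a) ((D ^^ a) w) - (\<Sum>b\<le>n. \<Sum>c\<le>n. Q b c a)" if "a \<le> n" for a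
  proof -
    have "sm (if a + r \<le> b + c
          then fls_const (k1 r a b c) * (X b * (fls_deriv ^^ (b + c - (a + r))) (X c)) else 0) ((D ^^ a) w)
       = - Q b c a" for b c
      by (auto simp: Q_def k1_def low_def high_def sm_minus_left fls_of_nat)
    then show ?thesis
      by (subst X[OF that]) (simp add: sm_add_left sm_sum_left sum_negf)
  qed
  have "(\<Sum>b\<le>n. sm (high r X b) ((D ^^ (b - r)) u))
      = (\<Sum>b\<le>n. sm (high r X b) ((D ^^ b) w)) + (\<Sum>b\<le>n. \<Sum>c\<le>n. \<Sum>a\<le>n. Q b c a)"
    unfolding u_def Dpow_add Dpow_sum sm_add_right sm_sum_right sum.distrib Dpow_Dpow
    by (intro arg_cong2[of _ _ _ _ "(+)"] sum.cong refl Q) (auto simp: high_def)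
  also have "(\<Sum>b\<le>n. \<Sum>c\<le>n. \<Sum>a\<le>n. Q b c a) = (\<Sum>a\<le>n. \<Sum>b\<le>n. \<Sum>c\<le>n. Q b c a)"
  proof -
    have "(\<Sum>b\<le>n. \<Sum>c\<le>n. \<Sum>a\<le>n. Q b c a) = (\<Sum>b\<le>n. \<Sum>a\<le>n. \<Sum>c\<le>n. Q b c a)"
      by (intro sum.cong refl sum.swap)
    also have "\<dots> = (\<Sum>a\<le>n. \<Sum>b\<le>n. \<Sum>c\<le>n. Q b c a)" by (rule sum.swap)
    finally show ?thesis .
  qed
  also have "\<dots> = (\<Sum>a\<le>n. sm (p a) ((D ^^ a) w)) - (\<Sum>a\<le>n. sm (X a) ((D ^^ a) w))"
    unfolding sum_subtractf[symmetric] by (intro sum.cong refl) (simp add: Xa)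
  also have "(\<Sum>a\<le>n. sm (X a) ((D ^^ a) w))
      = (\<Sum>a\<le>n. sm (low r X a) ((D ^^ a) w)) + (\<Sum>a\<le>n. sm (high r X a) ((D ^^ a) w))"
    by (simp add: sum.distrib[symmetric] sm_add_left[symmetric] low_plus_high)
  finally show ?thesis by (simp add: u_def algebra_simps)
qed

text \<open>As before, with additional terms \<open>R c a\<close> in which the derivative of order r
  hits a coefficient of the right factor. The part in which it does not is \<open>X c\<close> itself
  and is kept apart from them.\<close>

lemma factor_fast_left:
  fixes X p :: "nat \<Rightarrow> complex fls" and w :: 'b
  assumes rn: "r \<le> n"
    and X: "\<And>a. a \<le> n \<Longrightarrow> X a = p a
      + (\<Sum>b\<le>n. \<Sum>c\<le>n. if a + r \<le> b + c
          then fls_const (k2 r a b c) * (X b * (fls_deriv ^^ (b + c - (a + r))) (X c)) else 0)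
      + (\<Sum>c\<le>n. if a < c then fls_const (k2' r a c) * (fls_deriv ^^ (c - a)) (X c) else 0)"
  defines "v \<equiv> w + (\<Sum>c\<le>n. sm (high r X c) ((D ^^ (c - r)) w))"
  shows "(D ^^ r) v + (\<Sum>b\<le>n. sm (low r X b) ((D ^^ b) v)) = (D ^^ r) w + (\<Sum>a\<le>n. sm (p a) ((D ^^ a) w))"
proof -
  define Q where "Q b c a = (if a + r \<le> b + c then sm (of_nat (b choose (b + c - (a + r)))
     * (low r X b * (fls_deriv ^^ (b + c - (a + r))) (high r X c))) ((D ^^ a) w) else 0)" for b c a
  define R where "R c a = (if a < c then sm (of_nat (r choose (c - a))
     * (fls_deriv ^^ (c - a)) (high r X c)) ((D ^^ a) w) else 0)" for c a
  have Q: "sm (low r X b) ((D ^^ b) (sm (high r X c) ((D ^^ (c - r)) w))) = (\<Sum>a\<le>n. Q b c a)"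
    if "b \<le> n" "c \<le> n" for b c
  proof (cases "b < r \<and> r \<le> c")
    case True
    then have "b + (c - r) \<le> n" using that by linarith
    moreover have "b + (c - r) - a = b + c - (a + r)" "a \<le> b + (c - r) \<longleftrightarrow> a + r \<le> b + c" for a
      using True by linarith+
    ultimately show ?thesis
      unfolding Q_def using expand[of b "c - r" n "high r X c" w]
      by (auto simp: sm_sum_right sm_mult[symmetric] mult.left_commute intro!: sum.cong)
  next
    case False
    then consider "high r X c = 0" | "low r X b = 0" by (auto simp: low_def high_def)
    then show ?thesis by cases (simp_all add: Q_def cong: if_cong)
  qed
  have R: "(D ^^ r) (sm (high r X c) ((D ^^ (c - r)) w)) = sm (high r X c) ((D ^^ c) w) + (\<Sum>a\<le>n. R c a)"
    if "c \<le> n" for c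
  proof (cases "r \<le> c")
    case True
    then have rc: "r + (c - r) = c" by simp
    have "(D ^^ r) (sm (high r X c) ((D ^^ (c - r)) w)) = (\<Sum>a\<le>n. if a \<le> c
      then sm (of_nat (r choose (c - a)) * (fls_deriv ^^ (c - a)) (high r X c)) ((D ^^ a) w) else 0)"
      using expand[of r "c - r" n "high r X c" w] that unfolding rc by simp
    also have "\<dots> = (\<Sum>a\<le>n. (if a = c then sm (high r X c) ((D ^^ c) w) else 0) + R c a)"
      by (intro sum.cong refl) (auto simp: R_def)
    also have "\<dots> = sm (high r X c) ((D ^^ c) w) + (\<Sum>a\<le>n. R c a)"
      using that by (simp add: sum.distrib)
    finally show ?thesis .
  next
    case False
    then have "high r X c = 0" by (auto simp: high_def)
    then show ?thesis by (simp add: R_def cong: if_cong)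
  qed
  have Xa: "sm (X a) ((D ^^ a) w) = sm (p a) ((D ^^ a) w) - (\<Sum>b\<le>n. \<Sum>c\<le>n. Q b c a) - (\<Sum>c\<le>n. R c a)"
    if "a \<le> n" for a
  proof -
    have "sm (if a + r \<le> b + c
          then fls_const (k2 r a b c) * (X b * (fls_deriv ^^ (b + c - (a + r))) (X c)) else 0) ((D ^^ a) w)
       = - Q b c a" for b c
      by (auto simp: Q_def k2_def low_def high_def sm_minus_left fls_of_nat)
    moreover have "sm (if a < c then fls_const (k2' r a c) * (fls_deriv ^^ (c - a)) (X c) else 0) ((D ^^ a) w)
       = - R c a" for c
      by (auto simp: R_def k2'_def high_def sm_minus_left fls_of_nat)
    ultimately show ?thesis
      by (subst X[OF that]) (simp add: sm_add_left sm_sum_left sum_negf)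
  qed
  have "(\<Sum>b\<le>n. sm (low r X b) ((D ^^ b) v))
      = (\<Sum>b\<le>n. sm (low r X b) ((D ^^ b) w)) + (\<Sum>b\<le>n. \<Sum>c\<le>n. \<Sum>a\<le>n. Q b c a)"
    unfolding v_def Dpow_add Dpow_sum sm_add_right sm_sum_right sum.distrib
    by (intro arg_cong2[of _ _ _ _ "(+)"] sum.cong refl Q) auto
  also have "(\<Sum>b\<le>n. \<Sum>c\<le>n. \<Sum>a\<le>n. Q b c a) = (\<Sum>a\<le>n. \<Sum>b\<le>n. \<Sum>c\<le>n. Q b c a)"
  proof -
    have "(\<Sum>b\<le>n. \<Sum>c\<le>n. \<Sum>a\<le>n. Q b c a) = (\<Sum>b\<le>n. \<Sum>a\<le>n. \<Sum>c\<le>n. Q b c a)"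
      by (intro sum.cong refl sum.swap)
    also have "\<dots> = (\<Sum>a\<le>n. \<Sum>b\<le>n. \<Sum>c\<le>n. Q b c a)" by (rule sum.swap)
    finally show ?thesis .
  qed
  finally have 1: "(\<Sum>b\<le>n. sm (low r X b) ((D ^^ b) v))
      = (\<Sum>b\<le>n. sm (low r X b) ((D ^^ b) w)) + (\<Sum>a\<le>n. \<Sum>b\<le>n. \<Sum>c\<le>n. Q b c a)" .
  have "(D ^^ r) v = (D ^^ r) w + (\<Sum>c\<le>n. sm (high r X c) ((D ^^ c) w) + (\<Sum>a\<le>n. R c a))"
    unfolding v_def Dpow_add Dpow_sum by (intro arg_cong2[of _ _ _ _ "(+)"] sum.cong refl R) auto
  also have "\<dots> = (D ^^ r) w + (\<Sum>c\<le>n. sm (high r X c) ((D ^^ c) w)) + (\<Sum>a\<le>n. \<Sum>c\<le>n. R c a)"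
    by (subst sum.swap[of "\<lambda>a c. R c a"]) (simp add: sum.distrib add.assoc)
  finally have 2: "(D ^^ r) v = (D ^^ r) w + (\<Sum>c\<le>n. sm (high r X c) ((D ^^ c) w)) + (\<Sum>a\<le>n. \<Sum>c\<le>n. R c a)" .
  have "(\<Sum>a\<le>n. sm (low r X a) ((D ^^ a) w)) + (\<Sum>a\<le>n. sm (high r X a) ((D ^^ a) w))
      = (\<Sum>a\<le>n. sm (X a) ((D ^^ a) w))"
    by (simp add: sum.distrib[symmetric] sm_add_left[symmetric] low_plus_high)
  also have "\<dots> = (\<Sum>a\<le>n. sm (p a) ((D ^^ a) w)) - (\<Sum>a\<le>n. \<Sum>b\<le>n. \<Sum>c\<le>n. Q b c a) - (\<Sum>a\<le>n. \<Sum>c\<le>n. R c a)"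
    unfolding sum_subtractf[symmetric] by (intro sum.cong refl) (simp add: Xa)
  finally have 3: "(\<Sum>a\<le>n. sm (p a) ((D ^^ a) w)) = (\<Sum>a\<le>n. sm (low r X a) ((D ^^ a) w))
      + (\<Sum>a\<le>n. sm (high r X a) ((D ^^ a) w)) + (\<Sum>a\<le>n. \<Sum>b\<le>n. \<Sum>c\<le>n. Q b c a) + (\<Sum>a\<le>n. \<Sum>c\<le>n. R c a)"
    by (simp add: algebra_simps)
  show ?thesis unfolding 1 2 3 by (simp add: algebra_simps)
qed

end

section \<open>Linear algebra over a subfield of the Laurent series\<close>

locale fls_subfield =
  fixes K :: "complex fls set"
  assumes zero_mem: "0 \<in> K" and one_mem: "1 \<in> K"
    and add_mem: "\<And>a b. a \<in> K \<Longrightarrow> b \<in> K \<Longrightarrow> a + b \<in> K"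
    and mult_mem: "\<And>a b. a \<in> K \<Longrightarrow> b \<in> K \<Longrightarrow> a * b \<in> K"
    and uminus_mem: "\<And>a. a \<in> K \<Longrightarrow> - a \<in> K"
    and inverse_mem: "\<And>a. a \<in> K \<Longrightarrow> inverse a \<in> K"
begin

lemma sum_mem: "(\<And>i. i \<in> A \<Longrightarrow> f i \<in> K) \<Longrightarrow> sum f A \<in> K"
  by (induction A rule: infinite_finite_induct) (auto intro: zero_mem add_mem)

lemma prod_mem: "(\<And>i. i \<in> A \<Longrightarrow> f i \<in> K) \<Longrightarrow> prod f A \<in> K"
  by (induction A rule: infinite_finite_induct) (auto intro: one_mem mult_mem)

lemma diff_mem: "a \<in> K \<Longrightarrow> b \<in> K \<Longrightarrow> a - b \<in> K"
  using add_mem[of a "- b"] uminus_mem[of b] by simp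

lemma divide_mem: "a \<in> K \<Longrightarrow> b \<in> K \<Longrightarrow> a / b \<in> K"
  by (simp add: divide_inverse mult_mem inverse_mem)

lemma det_mem:
  assumes "M \<in> carrier_mat n n" "\<And>i j. i < n \<Longrightarrow> j < n \<Longrightarrow> index_mat M (i, j) \<in> K"
  shows "det M \<in> K"
proof -
  have "signof \<sigma> * (\<Prod>i = 0..<n. index_mat M (i, \<sigma> i)) \<in> K" if "\<sigma> permutes {0..<n}" for \<sigma>
  proof (intro mult_mem prod_mem)
    show "(signof \<sigma> :: complex fls) \<in> K"
      by (auto simp: sign_def intro: one_mem uminus_mem)
    show "index_mat M (i, \<sigma> i) \<in> K" if "i \<in> {0..<n}" for i
      using that \<open>\<sigma> permutes _\<close> permutes_in_image[of \<sigma> "{0..<n}" i] by (intro assms) auto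
  qed
  then show ?thesis using assms(1) by (auto simp: det_def intro!: sum_mem)
qed

text \<open>The inverse is the adjugate divided by the determinant, hence stays in K, although the
  kernel is tested with arbitrary Laurent series.\<close>

lemma inverse_matrix_exists:
  fixes M :: "nat \<Rightarrow> nat \<Rightarrow> complex fls"
  assumes M: "\<And>i j. i < n \<Longrightarrow> j < n \<Longrightarrow> M i j \<in> K"
    and inj: "\<And>y. (\<And>j. j < n \<Longrightarrow> (\<Sum>i<n. y i * M i j) = 0) \<Longrightarrow> (\<And>i. i < n \<Longrightarrow> y i = 0)"
  obtains N where "\<And>i j. i < n \<Longrightarrow> j < n \<Longrightarrow> N i j \<in> K"
    "\<And>i k. i < n \<Longrightarrow> k < n \<Longrightarrow> (\<Sum>j<n. M i j * N j k) = (if i = k then 1 else 0)"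
    "\<And>i k. i < n \<Longrightarrow> k < n \<Longrightarrow> (\<Sum>j<n. N i j * M j k) = (if i = k then 1 else 0)"
proof -
  define A where "A = mat n n (\<lambda>(i, j). M i j)"
  have A: "A \<in> carrier_mat n n" by (simp add: A_def)
  have "det A \<noteq> 0"
  proof
    assume "det A = 0"
    then have "det (transpose_mat A) = 0" using A by (simp add: det_transpose)
    then obtain v where v: "v \<in> carrier_vec n" "v \<noteq> 0\<^sub>v n" "transpose_mat A *\<^sub>v v = 0\<^sub>v n"
      using det_0_iff_vec_prod_zero_field[of "transpose_mat A" n] A by auto
    have "(\<Sum>i<n. vec_index v i * M i j) = 0" if "j < n" for j
    proof -
      have "0 = vec_index (transpose_mat A *\<^sub>v v) j" using v that by simp
      also have "\<dots> = (\<Sum>i<n. vec_index v i * M i j)"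
        using v(1) that A by (simp add: scalar_prod_def A_def atLeast0LessThan mult.commute)
      finally show ?thesis by simp
    qed
    then have "vec_index v i = 0" if "i < n" for i using inj[of "vec_index v"] that by blast
    then have "v = 0\<^sub>v n" using v(1) by (intro eq_vecI) auto
    with v show False by simp
  qed
  define N where "N i j = index_mat (adj_mat A) (i, j) * inverse (det A)" for i j
  have detK: "det A \<in> K" by (rule det_mem[OF A]) (auto simp: A_def M)
  have adj: "adj_mat A \<in> carrier_mat n n" "A * adj_mat A = det A \<cdot>\<^sub>m 1\<^sub>m n" "adj_mat A * A = det A \<cdot>\<^sub>m 1\<^sub>m n"
    using adj_mat[OF A] by auto
  have adjK: "index_mat (adj_mat A) (i, j) \<in> K" if "i < n" "j < n" for i j
  proof -
    have "index_mat (adj_mat A) (i, j) = cofactor A j i" using that A by (simp add: adj_mat_def)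
    also have "\<dots> = (-1) ^ (j + i) * det (mat_delete A j i)" by (simp add: cofactor_def)
    also have "\<dots> \<in> K"
    proof (rule mult_mem)
      show "(-1) ^ (j + i) \<in> K" by (cases "even (j + i)") (auto intro: one_mem uminus_mem)
      show "det (mat_delete A j i) \<in> K"
      proof (rule det_mem)
        show "mat_delete A j i \<in> carrier_mat (n - 1) (n - 1)" using A by (rule mat_delete_carrier)
        show "index_mat (mat_delete A j i) (a, b) \<in> K" if "a < n - 1" "b < n - 1" for a b
          using that A \<open>i < n\<close> \<open>j < n\<close> by (auto simp: mat_delete_def A_def intro!: M)
      qed
    qed
    finally show ?thesis .
  qed
  show thesis
  proof (rule that[of N])
    show "N i j \<in> K" if "i < n" "j < n" for i j
      using that by (auto simp: N_def intro!: mult_mem inverse_mem adjK detK)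
    show "(\<Sum>j<n. M i j * N j k) = (if i = k then 1 else 0)" if "i < n" "k < n" for i k
    proof -
      have "(\<Sum>j<n. M i j * index_mat (adj_mat A) (j, k)) = index_mat (A * adj_mat A) (i, k)"
        using that A adj(1) by (simp add: scalar_prod_def A_def atLeast0LessThan)
      also have "\<dots> = (if i = k then det A else 0)" using that by (simp add: adj(2))
      finally show ?thesis using \<open>det A \<noteq> 0\<close>
        by (simp add: N_def mult.assoc[symmetric] sum_distrib_right[symmetric])
    qed
    show "(\<Sum>j<n. N i j * M j k) = (if i = k then 1 else 0)" if "i < n" "k < n" for i k
    proof -
      have "(\<Sum>j<n. index_mat (adj_mat A) (i, j) * M j k) = index_mat (adj_mat A * A) (i, k)"
        using that A adj(1) by (simp add: scalar_prod_def A_def atLeast0LessThan)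
      also have "\<dots> = (if i = k then det A else 0)" using that by (simp add: adj(3))
      finally have "(\<Sum>j<n. index_mat (adj_mat A) (i, j) * M j k) * inverse (det A) = (if i = k then 1 else 0)"
        using \<open>det A \<noteq> 0\<close> by simp
      moreover have "(\<Sum>j<n. N i j * M j k) = (\<Sum>j<n. index_mat (adj_mat A) (i, j) * M j k) * inverse (det A)"
        unfolding N_def sum_distrib_right by (intro sum.cong refl) (simp only: mult_ac)
      ultimately show ?thesis by simp
    qed
  qed
qed

end

text \<open>Zero rows make the system square, and its determinant vanishes.\<close>

lemma underdetermined_kernel:
  fixes M :: "nat \<Rightarrow> nat \<Rightarrow> complex fls"
  assumes "n < m"
  obtains y where "\<And>i. i < n \<Longrightarrow> (\<Sum>j<m. M i j * y j) = 0" "\<exists>j<m. y j \<noteq> 0"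
proof -
  define A where "A = mat m m (\<lambda>(i, j). if i < n then M i j else 0)"
  have A: "A \<in> carrier_mat m m" by (simp add: A_def)
  have "(\<Prod>i = 0..<m. index_mat A (i, \<sigma> i)) = 0" if "\<sigma> permutes {0..<m}" for \<sigma>
    using that assms permutes_in_image[of \<sigma> "{0..<m}" n]
    by (intro prod_zero) (auto simp: A_def intro!: bexI[of _ n])
  then have "det A = 0" using A by (auto simp: det_def intro!: sum.neutral)
  then obtain v where v: "v \<in> carrier_vec m" "v \<noteq> 0\<^sub>v m" "A *\<^sub>v v = 0\<^sub>v m"
    using det_0_iff_vec_prod_zero_field[OF A] by auto
  show thesis
  proof (rule that[of "vec_index v"])
    show "(\<Sum>j<m. M i j * vec_index v j) = 0" if "i < n" for i
    proof -
      have "0 = vec_index (A *\<^sub>v v) i" using v that assms by simp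
      also have "\<dots> = (\<Sum>j<m. M i j * vec_index v j)"
        using v(1) that A assms by (simp add: scalar_prod_def A_def atLeast0LessThan)
      finally show ?thesis by simp
    qed
    show "\<exists>j<m. vec_index v j \<noteq> 0"
    proof (rule ccontr)
      assume "\<not> (\<exists>j<m. vec_index v j \<noteq> 0)"
      then have "v = 0\<^sub>v m" using v(1) by (intro eq_vecI) auto
      with v show False by simp
    qed
  qed
qed

subsection \<open>Splitting a companion system\<close>

lemma sum_fun_app: "(\<Sum>a\<in>A. f a) i = (\<Sum>a\<in>A. f a i)" for f :: "'a \<Rightarrow> 'b \<Rightarrow> 'c::comm_monoid_add"
  by (induction A rule: infinite_finite_induct) auto

declare plus_fun_def [simp del] zero_fun_def [simp del]

definition smul :: "complex fls \<Rightarrow> (nat \<Rightarrow> complex fls) \<Rightarrow> nat \<Rightarrow> complex fls" where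
  "smul a y = (\<lambda>i. a * y i)"

text \<open>Vectors are functions that vanish from n on. Pointwise addition then makes one type an
  abelian group that serves for every dimension.\<close>

definition vecs :: "nat \<Rightarrow> complex fls set \<Rightarrow> (nat \<Rightarrow> complex fls) set" where
  "vecs n S = {y. (\<forall>i<n. y i \<in> S) \<and> (\<forall>i\<ge>n. y i = 0)}"

definition conn :: "nat \<Rightarrow> (nat \<Rightarrow> nat \<Rightarrow> complex fls) \<Rightarrow> (nat \<Rightarrow> complex fls) \<Rightarrow> nat \<Rightarrow> complex fls" where
  "conn n A y = (\<lambda>i. fls_deriv (y i) + (if i < n then (\<Sum>j<n. A i j * y j) else 0))"

text \<open>Describes the module of the monic operator b with cyclic vector
  \<open>unit_fun 0\<close>; the columns are the images of the basis vectors.\<close>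

definition companion :: "nat \<Rightarrow> (nat \<Rightarrow> complex fls) \<Rightarrow> nat \<Rightarrow> nat \<Rightarrow> complex fls" where
  "companion n b i j = (if i = Suc j then 1 else 0) - (if Suc j = n then b i else 0)"

definition unit_fun :: "nat \<Rightarrow> nat \<Rightarrow> complex fls" where
  "unit_fun k = (\<lambda>i. if i = k then 1 else 0)"

text \<open>The poles grow by at most \<theta> per step. Slope \<kappa> corresponds to the rate 1 +
  \<kappa>, where the 1 is the cost of d/dx itself.\<close>

definition slow_vec :: "((nat \<Rightarrow> complex fls) \<Rightarrow> nat \<Rightarrow> complex fls) \<Rightarrow> real \<Rightarrow> (nat \<Rightarrow> complex fls) \<Rightarrow> bool" where
  "slow_vec D \<theta> y \<longleftrightarrow> (\<exists>C. \<forall>m i. val_ge ((D ^^ m) y i) (- \<theta> * real m - C))"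

lemma diff_module_conn: "diff_module smul (conn n A)"
  by unfold_locales
    (auto simp: smul_def conn_def fun_eq_iff algebra_simps sum.distrib sum_distrib_left)

lemma smul_apply: "smul a y i = a * y i"
  by (simp add: smul_def)

lemma vecs_sum: "(\<And>a. a \<in> A \<Longrightarrow> f a \<in> vecs n S) \<Longrightarrow> fls_subfield S \<Longrightarrow> sum f A \<in> vecs n S"
  by (auto simp: vecs_def sum_fun_app intro!: fls_subfield.sum_mem)

lemma vecs_smul: "a \<in> S \<Longrightarrow> y \<in> vecs n S \<Longrightarrow> fls_subfield S \<Longrightarrow> smul a y \<in> vecs n S"
  by (auto simp: vecs_def smul_def intro!: fls_subfield.mult_mem)

lemma vecs_add: "x \<in> vecs n S \<Longrightarrow> y \<in> vecs n S \<Longrightarrow> fls_subfield S \<Longrightarrow> x + y \<in> vecs n S"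
  by (auto simp: vecs_def intro!: fls_subfield.add_mem)

lemma vecs_minus: "y \<in> vecs n S \<Longrightarrow> fls_subfield S \<Longrightarrow> - y \<in> vecs n S"
  by (auto simp: vecs_def intro!: fls_subfield.uminus_mem)

lemma vecs_mono: "y \<in> vecs n S \<Longrightarrow> y \<in> vecs n UNIV"
  by (auto simp: vecs_def)

lemma vecs_conn:
  assumes "fls_subfield S" "\<And>a. a \<in> S \<Longrightarrow> fls_deriv a \<in> S" "\<And>i j. i < n \<Longrightarrow> j < n \<Longrightarrow> A i j \<in> S"
    and "y \<in> vecs n S"
  shows "conn n A y \<in> vecs n S"
  using assms by (auto simp: vecs_def conn_def intro!: fls_subfield.add_mem fls_subfield.sum_mem fls_subfield.mult_mem)

lemma fls_subfield_UNIV: "fls_subfield UNIV"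
  by unfold_locales auto

lemma vecs_conn_pow:
  assumes "fls_subfield S" "\<And>a. a \<in> S \<Longrightarrow> fls_deriv a \<in> S" "\<And>i j. i < n \<Longrightarrow> j < n \<Longrightarrow> A i j \<in> S"
    and "y \<in> vecs n S"
  shows "(conn n A ^^ m) y \<in> vecs n S"
  by (induction m) (auto intro!: vecs_conn assms)

lemma conn_unit_fun:
  assumes "Suc k < n"
  shows "conn n (companion n b) (unit_fun k) = unit_fun (Suc k)"
proof
  fix i
  have "(\<Sum>j<n. companion n b i j * unit_fun k j) = companion n b i k"
    using assms sum.remove[of "{..<n}" k "\<lambda>j. companion n b i j * unit_fun k j"]
    by (simp add: unit_fun_def)
  then show "conn n (companion n b) (unit_fun k) i = unit_fun (Suc k) i"
    using assms by (auto simp: conn_def companion_def unit_fun_def)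
qed

lemma conn_unit_fun_last:
  assumes "n > 0"
  shows "conn n (companion n b) (unit_fun (n - 1)) = (\<lambda>i. if i < n then - b i else 0)"
proof
  fix i
  have "(\<Sum>j<n. companion n b i j * unit_fun (n - 1) j) = companion n b i (n - 1)"
    using assms sum.remove[of "{..<n}" "n - 1" "\<lambda>j. companion n b i j * unit_fun (n - 1) j"]
    by (simp add: unit_fun_def)
  then show "conn n (companion n b) (unit_fun (n - 1)) i = (if i < n then - b i else 0)"
    using assms by (auto simp: conn_def companion_def unit_fun_def)
qed

lemma conn_pow_unit_fun: "k < n \<Longrightarrow> (conn n (companion n b) ^^ k) (unit_fun 0) = unit_fun k"
  by (induction k) (auto simp: conn_unit_fun)

lemma companion_relation:
  assumes "n > 0" "b n = 1"
  shows "(\<Sum>a\<le>n. smul (b a) ((conn n (companion n b) ^^ a) (unit_fun 0))) = 0"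
proof
  fix i
  have last: "(conn n (companion n b) ^^ n) (unit_fun 0) = (\<lambda>i. if i < n then - b i else 0)"
    using assms conn_pow_unit_fun[of "n - 1" n b] conn_unit_fun_last[of n b]
    by (cases n) auto
  have "(\<Sum>a\<le>n. smul (b a) ((conn n (companion n b) ^^ a) (unit_fun 0))) i
      = (\<Sum>a<n. b a * unit_fun a i) + (if i < n then - b i else 0)"
    using assms by (simp add: sum_fun_app smul_def lessThan_Suc_atMost[symmetric] last conn_pow_unit_fun)
  also have "(\<Sum>a<n. b a * unit_fun a i) = (if i < n then b i else 0)"
    by (simp add: unit_fun_def if_distrib cong: if_cong)
  finally show "(\<Sum>a\<le>n. smul (b a) ((conn n (companion n b) ^^ a) (unit_fun 0))) i = 0 i" by auto
qed

text \<open>Y solves the system for the factorisation with 1 + Q on the left, Z the one with it on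
  the right. The rates \<sigma> and \<tau> stand for 1 + 1/s and 1 + \<mu>, and the strict gain is
  attached to \<tau>. K is a differential subfield: here Gevrey growth enters only as membership in
  K.\<close>

locale companion_splitting = fls_subfield K for K :: "complex fls set" +
  fixes n r :: nat and b Y Z :: "nat \<Rightarrow> complex fls" and \<sigma> \<tau> \<epsilon> :: real
  assumes deriv_mem: "\<And>a. a \<in> K \<Longrightarrow> fls_deriv a \<in> K"
    and n0: "n > 0" and rn: "r \<le> n" and b_n: "b n = 1" and b_r: "b r \<noteq> 0"
    and b_mem: "\<And>a. a \<le> n \<Longrightarrow> b a \<in> K"
    and Y_mem: "\<And>a. a \<le> n \<Longrightarrow> Y a \<in> K" and Z_mem: "\<And>a. a \<le> n \<Longrightarrow> Z a \<in> K"
    and rates: "\<sigma> > 1" "\<tau> > 1" "\<epsilon> > 0"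
    and Y_\<sigma>: "\<And>a. a \<le> n \<Longrightarrow> val_ge (Y a) (\<sigma> * (real a - real r))"
    and Z_\<sigma>: "\<And>a. a \<le> n \<Longrightarrow> val_ge (Z a) (\<sigma> * (real a - real r))"
    and Y_\<tau>: "\<And>a. a \<le> n \<Longrightarrow> val_ge (Y a) (\<tau> * (real a - real r) + \<epsilon>)"
    and Z_\<tau>: "\<And>a. a \<le> n \<Longrightarrow> val_ge (Z a) (\<tau> * (real a - real r) + \<epsilon>)"
    and Y: "\<And>a. a \<le> n \<Longrightarrow> Y a = (if a = r then 0 else b a / b r)
      + (\<Sum>b\<le>n. \<Sum>c\<le>n. if a + r \<le> b + c
          then fls_const (k1 r a b c) * (Y b * (fls_deriv ^^ (b + c - (a + r))) (Y c)) else 0)"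
    and Z: "\<And>a. a \<le> n \<Longrightarrow> Z a = (if a = r then 0 else b a / b r)
      + (\<Sum>b\<le>n. \<Sum>c\<le>n. if a + r \<le> b + c
          then fls_const (k2 r a b c) * (Z b * (fls_deriv ^^ (b + c - (a + r))) (Z c)) else 0)
      + (\<Sum>c\<le>n. if a < c then fls_const (k2' r a c) * (fls_deriv ^^ (c - a)) (Z c) else 0)"
begin

abbreviation D :: "(nat \<Rightarrow> complex fls) \<Rightarrow> nat \<Rightarrow> complex fls" where "D \<equiv> conn n (companion n b)"
abbreviation w :: "nat \<Rightarrow> complex fls" where "w \<equiv> unit_fun 0"

sublocale dm: diff_module smul D
  by (rule diff_module_conn)

text \<open>u is the right factor of the first factorisation applied to w and is killed by 1 + Q; v
  is that of the second and is killed by an operator of order r. They will span the fast part, of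
  dimension n - r, and the slow part, of dimension r.\<close>

definition u :: "nat \<Rightarrow> complex fls" where "u = (D ^^ r) w + (\<Sum>c\<le>n. smul (low r Y c) ((D ^^ c) w))"
definition v :: "nat \<Rightarrow> complex fls" where "v = w + (\<Sum>c\<le>n. smul (high r Z c) ((D ^^ (c - r)) w))"
text \<open>Numbered so that \<open>z k\<close> is close to the k-th unit vector: u is already close
  to the derivative of order r of w.\<close>

definition z :: "nat \<Rightarrow> nat \<Rightarrow> complex fls" where "z k = (if k < r then (D ^^ k) v else (D ^^ (k - r)) u)"

lemma p_relation: "(D ^^ r) w + (\<Sum>a\<le>n. smul (if a = r then 0 else b a / b r) ((D ^^ a) w)) = 0"
proof -
  have "(D ^^ r) w + (\<Sum>a\<le>n. smul (if a = r then 0 else b a / b r) ((D ^^ a) w))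
      = (\<Sum>a\<le>n. (if a = r then smul 1 ((D ^^ a) w) else 0) + smul (if a = r then 0 else b a / b r) ((D ^^ a) w))"
    using rn by (simp add: sum.distrib dm.sm_1)
  also have "\<dots> = (\<Sum>a\<le>n. smul (inverse (b r)) (smul (b a) ((D ^^ a) w)))"
    using b_r by (intro sum.cong refl) (auto simp: smul_def field_simps)
  also have "\<dots> = 0"
    by (simp only: dm.sm_sum_right[symmetric] companion_relation[where n = n and b = b, OF n0 b_n] dm.sm_0_right)
  finally show ?thesis .
qed

lemma u_relation: "u + (\<Sum>b\<le>n. smul (high r Y b) ((D ^^ (b - r)) u)) = 0"
  unfolding u_def using dm.factor_fast_right[OF rn Y, of w] p_relation by simp

lemma v_relation: "(D ^^ r) v + (\<Sum>b\<le>n. smul (low r Z b) ((D ^^ b) v)) = 0"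
  unfolding v_def using dm.factor_fast_left[OF rn Z, of w] p_relation by simp

lemma companion_mem: "i < n \<Longrightarrow> j < n \<Longrightarrow> companion n b i j \<in> K"
  by (auto simp: companion_def intro!: diff_mem uminus_mem zero_mem one_mem b_mem)

lemma sub: "fls_subfield K" by unfold_locales

lemma w_vecs: "w \<in> vecs n K"
  using n0 by (auto simp: vecs_def unit_fun_def intro: zero_mem one_mem)

lemma Dpow_vecs: "y \<in> vecs n K \<Longrightarrow> (D ^^ m) y \<in> vecs n K"
  by (intro vecs_conn_pow sub deriv_mem companion_mem)

lemma Dpow_vecs_UNIV: "y \<in> vecs n UNIV \<Longrightarrow> (D ^^ m) y \<in> vecs n UNIV"
  by (intro vecs_conn_pow fls_subfield_UNIV) auto

lemma u_vecs: "u \<in> vecs n K"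
  unfolding u_def by (intro vecs_add vecs_sum vecs_smul Dpow_vecs w_vecs sub) (auto simp: low_def intro: Y_mem zero_mem)

lemma v_vecs: "v \<in> vecs n K"
  unfolding v_def by (intro vecs_add vecs_sum vecs_smul Dpow_vecs w_vecs sub) (auto simp: high_def intro: Z_mem zero_mem)

lemma z_vecs: "z k \<in> vecs n K"
  by (simp add: z_def Dpow_vecs u_vecs v_vecs)

text \<open>As M + c < n, only derivatives of w of order below n occur, and these are unit vectors.
  Each derivative that falls on f costs 1 but lowers the order of the unit vector by 1, which is
  worth \<tau> > 1.\<close>

lemma shifted_term_val:
  assumes Mc: "M + c < n" and f: "val_ge f (\<tau> * e + \<epsilon>)" and i: "i < n"
  shows "val_ge ((D ^^ M) (smul f ((D ^^ c) w)) i) (\<tau> * (e + real i - real M - real c) + \<epsilon>)"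
proof -
  have Dw: "(D ^^ a) w i = (if a = i then 1 else 0)" if "a < n" for a
    unfolding conn_pow_unit_fun[OF that] by (simp add: unit_fun_def)
  have "(D ^^ M) (smul f ((D ^^ c) w)) i = (\<Sum>a\<le>n. (if a \<le> M + c
      then smul (of_nat (M choose (M + c - a)) * (fls_deriv ^^ (M + c - a)) f) ((D ^^ a) w) else 0) i)"
    using dm.expand[of M c n f w] Mc by (simp add: sum_fun_app)
  also have "val_ge \<dots> (\<tau> * (e + real i - real M - real c) + \<epsilon>)"
  proof (rule val_ge_sum)
    fix a assume "a \<in> {..n}"
    show "val_ge ((if a \<le> M + c
      then smul (of_nat (M choose (M + c - a)) * (fls_deriv ^^ (M + c - a)) f) ((D ^^ a) w) else 0) i)
      (\<tau> * (e + real i - real M - real c) + \<epsilon>)"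
    proof (cases "a \<le> M + c \<and> a = i")
      case True
      define l where "l = M + c - i"
      have l: "real M + real c = real i + real l" using True by (simp add: l_def)
      have "real l \<le> \<tau> * real l" using rates mult_right_mono[of 1 \<tau> "real l"] by simp
      then have "\<tau> * (e + real i - real M - real c) + \<epsilon> \<le> \<tau> * e + \<epsilon> - real l"
        using l by (simp add: algebra_simps)
      then have "val_ge ((fls_deriv ^^ l) f) (\<tau> * (e + real i - real M - real c) + \<epsilon>)"
        by (rule val_ge_mono[OF val_ge_deriv_pow[OF f]])
      then have "val_ge (fls_const (of_nat (M choose l)) * (fls_deriv ^^ l) f) (\<tau> * (e + real i - real M - real c) + \<epsilon>)"
        by (rule val_ge_const_mult)
      then show ?thesis using True i
        by (simp add: l_def smul_apply Dw fls_of_nat)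
    next
      case False
      then show ?thesis using Mc by (auto simp: smul_apply Dw)
    qed
  qed
  finally show ?thesis .
qed

text \<open>In terms of valuations weighted by \<tau> times the index, the matrix of the
  \<open>z k\<close> is the identity plus an error of valuation at least \<epsilon>.\<close>

lemma z_near_unit:
  assumes k: "k < n" and i: "i < n"
  shows "val_ge (z k i - unit_fun k i) (\<tau> * (real i - real k) + \<epsilon>)"
proof (cases "k < r")
  case True
  have "z k i - unit_fun k i = (\<Sum>c\<le>n. (D ^^ k) (smul (high r Z c) ((D ^^ (c - r)) w)) i)"
    using True k by (simp add: z_def v_def dm.Dpow_add dm.Dpow_sum sum_fun_app conn_pow_unit_fun)
  also have "val_ge \<dots> (\<tau> * (real i - real k) + \<epsilon>)"
  proof (rule val_ge_sum)
    fix c assume c: "c \<in> {..n}"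
    show "val_ge ((D ^^ k) (smul (high r Z c) ((D ^^ (c - r)) w)) i) (\<tau> * (real i - real k) + \<epsilon>)"
    proof (cases "r \<le> c")
      case rc: True
      have "k + (c - r) < n" using True c rc by auto
      from shifted_term_val[OF this _ i, of "Z c" "real c - real r"] rc c Z_\<tau>[of c]
      show ?thesis by (simp add: high_def of_nat_diff)
    qed (simp add: high_def)
  qed
  finally show ?thesis .
next
  case False
  have kr: "k - r + r = k" using False by simp
  have "(D ^^ (k - r)) ((D ^^ r) w) = unit_fun k"
    by (simp only: dm.Dpow_Dpow kr conn_pow_unit_fun[OF k])
  then have "z k i - unit_fun k i = (\<Sum>c\<le>n. (D ^^ (k - r)) (smul (low r Y c) ((D ^^ c) w)) i)"
    using False by (simp add: z_def u_def dm.Dpow_add dm.Dpow_sum sum_fun_app)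
  also have "val_ge \<dots> (\<tau> * (real i - real k) + \<epsilon>)"
  proof (rule val_ge_sum)
    fix c assume c: "c \<in> {..n}"
    show "val_ge ((D ^^ (k - r)) (smul (low r Y c) ((D ^^ c) w)) i) (\<tau> * (real i - real k) + \<epsilon>)"
    proof (cases "c < r")
      case rc: True
      have "k - r + c < n" using False k rc by linarith
      from shifted_term_val[OF this _ i, of "Y c" "real c - real r"] rc c Y_\<tau>[of c] False
      show ?thesis by (simp add: low_def of_nat_diff algebra_simps)
    qed (simp add: low_def)
  qed
  finally show ?thesis .
qed

text \<open>A linear relation expresses y through the error of \<open>z_near_unit\<close>, which
  raises the weighted valuations of y by \<epsilon>. Iteration makes them exceed every
  bound.\<close>

lemma z_independent:
  assumes y: "\<And>j. j < n \<Longrightarrow> (\<Sum>k<n. y k * z k j) = 0" and "i < n"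
  shows "y i = 0"
proof -
  obtain \<delta>' where \<delta>': "\<forall>k\<in>{..<n}. val_ge (y k) \<delta>'" using val_ge_exists_family[of "{..<n}" y] by auto
  \<comment> \<open>Lowered by \<tau> n so that \<delta> + \<tau> k is a lower bound for every
    k.\<close>
  define \<delta> where "\<delta> = \<delta>' - \<tau> * real n"
  have "\<forall>k<n. val_ge (y k) (\<delta> + real m * \<epsilon> + \<tau> * real k)" for m
  proof (induction m)
    case 0
    have "val_ge (y k) (\<delta> + \<tau> * real k)" if "k < n" for k
    proof (rule val_ge_mono)
      show "val_ge (y k) \<delta>'" using \<delta>' that by simp
      show "\<delta> + \<tau> * real k \<le> \<delta>'"
        using that rates mult_left_mono[of "real k" "real n" \<tau>] by (simp add: \<delta>_def)
    qed
    then show ?case by simp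
  next
    case (Suc m)
    show ?case
    proof (intro allI impI)
      fix j assume j: "j < n"
      have "0 = (\<Sum>k<n. y k * unit_fun k j) + (\<Sum>k<n. y k * (z k j - unit_fun k j))"
        using y[OF j] by (simp add: sum.distrib[symmetric] algebra_simps)
      also have "(\<Sum>k<n. y k * unit_fun k j) = y j"
        using j by (simp add: unit_fun_def if_distrib cong: if_cong)
      finally have "y j = - (\<Sum>k<n. y k * (z k j - unit_fun k j))" by (simp add: eq_neg_iff_add_eq_0)
      moreover have "val_ge (\<Sum>k<n. y k * (z k j - unit_fun k j)) (\<delta> + real (Suc m) * \<epsilon> + \<tau> * real j)"
      proof (rule val_ge_sum)
        fix k assume k: "k \<in> {..<n}"
        have "val_ge (y k * (z k j - unit_fun k j)) (\<delta> + real m * \<epsilon> + \<tau> * real k + (\<tau> * (real j - real k) + \<epsilon>))"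
          using Suc k z_near_unit[of k j] j by (intro val_ge_mult) auto
        then show "val_ge (y k * (z k j - unit_fun k j)) (\<delta> + real (Suc m) * \<epsilon> + \<tau> * real j)"
          by (simp add: algebra_simps)
      qed
      ultimately show "val_ge (y j) (\<delta> + real (Suc m) * \<epsilon> + \<tau> * real j)" by simp
    qed
  qed
  then have v: "val_ge (y i) (\<delta> + real m * \<epsilon> + \<tau> * real i)" for m using assms(2) by blast
  have "\<exists>m. c \<le> \<delta> + real m * \<epsilon> + \<tau> * real i" for c
  proof -
    obtain m where "(c - \<delta> - \<tau> * real i) / \<epsilon> \<le> real m" using real_arch_simple by blast
    then show ?thesis using rates by (intro exI[of _ m]) (simp add: pos_divide_le_eq)
  qed
  with v show ?thesis by (intro val_ge_zeroI) blast
qed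

lemma z_inverse_exists:
  "\<exists>N. (\<forall>i<n. \<forall>j<n. N i j \<in> K) \<and>
    (\<forall>i<n. \<forall>k<n. (\<Sum>j<n. z i j * N j k) = (if i = k then 1 else 0)) \<and>
    (\<forall>i<n. \<forall>k<n. (\<Sum>j<n. N i j * z j k) = (if i = k then 1 else 0))"
proof -
  have "\<And>i j. i < n \<Longrightarrow> j < n \<Longrightarrow> z i j \<in> K"
    using z_vecs by (auto simp: vecs_def)
  then show ?thesis
  proof (rule inverse_matrix_exists[of n z])
    fix y i
    assume "\<And>j. j < n \<Longrightarrow> (\<Sum>i<n. y i * z i j) = 0" "i < n"
    then show "y i = 0" by (rule z_independent)
  qed blast+
qed

definition N :: "nat \<Rightarrow> nat \<Rightarrow> complex fls" where
  "N = (SOME N. (\<forall>i<n. \<forall>j<n. N i j \<in> K) \<and>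
    (\<forall>i<n. \<forall>k<n. (\<Sum>j<n. z i j * N j k) = (if i = k then 1 else 0)) \<and>
    (\<forall>i<n. \<forall>k<n. (\<Sum>j<n. N i j * z j k) = (if i = k then 1 else 0)))"

lemma N_mem: "i < n \<Longrightarrow> j < n \<Longrightarrow> N i j \<in> K"
  and z_N: "i < n \<Longrightarrow> k < n \<Longrightarrow> (\<Sum>j<n. z i j * N j k) = (if i = k then 1 else 0)"
  and N_z: "i < n \<Longrightarrow> k < n \<Longrightarrow> (\<Sum>j<n. N i j * z j k) = (if i = k then 1 else 0)"
  using someI_ex[OF z_inverse_exists] unfolding N_def[symmetric] by blast+

section \<open>The projector onto the slow part\<close>

definition T :: "(nat \<Rightarrow> complex fls) \<Rightarrow> nat \<Rightarrow> complex fls" where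
  "T y k = (\<Sum>i<n. y i * N i k)"

text \<open>The projection onto the span of the first r vectors along the remaining ones,
  \<open>T y\<close> being the coordinates of y in the basis z.\<close>

definition E :: "(nat \<Rightarrow> complex fls) \<Rightarrow> nat \<Rightarrow> complex fls" where
  "E y = (\<Sum>k<r. smul (T y k) (z k))"

lemma T_add: "T (x + y) k = T x k + T y k"
  by (simp add: T_def sum.distrib distrib_right)

lemma T_smul: "T (smul a y) k = a * T y k"
  by (simp add: T_def smul_def sum_distrib_left mult.assoc)

lemma T_0: "T 0 k = 0" by (simp add: T_def)

lemma T_sum: "T (sum f A) k = (\<Sum>a\<in>A. T (f a) k)"
  by (induction A rule: infinite_finite_induct) (simp_all only: sum.infinite sum.empty sum.insert T_0 T_add not_False_eq_True)

lemma T_z: "j < n \<Longrightarrow> k < n \<Longrightarrow> T (z j) k = (if j = k then 1 else 0)"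
  by (simp add: T_def z_N)

lemma reconstruct:
  assumes "y \<in> vecs n UNIV"
  shows "y = (\<Sum>k<n. smul (T y k) (z k))"
proof
  fix j
  show "y j = (\<Sum>k<n. smul (T y k) (z k)) j"
  proof (cases "j < n")
    case True
    have "(\<Sum>k<n. smul (T y k) (z k)) j = (\<Sum>k<n. \<Sum>i<n. y i * (N i k * z k j))"
      by (simp add: sum_fun_app smul_def T_def sum_distrib_right mult.assoc)
    also have "\<dots> = (\<Sum>i<n. y i * (\<Sum>k<n. N i k * z k j))"
      by (subst sum.swap) (simp add: sum_distrib_left)
    also have "\<dots> = (\<Sum>i<n. if i = j then y i else 0)"
      using True by (intro sum.cong refl) (auto simp: N_z)
    finally show ?thesis using True by simp
  next
    case False
    then show ?thesis using assms z_vecs by (auto simp: sum_fun_app smul_def vecs_def)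
  qed
qed

lemma E_add: "E (x + y) = E x + E y"
  by (simp add: E_def T_add dm.sm_add_left sum.distrib)

lemma E_smul: "E (smul a y) = smul a (E y)"
  by (simp add: E_def T_smul dm.sm_mult dm.sm_sum_right)

lemma E_0: "E 0 = 0" by (simp add: E_def T_0)

lemma E_minus: "E (- y) = - E y"
  using E_add[of y "- y"] by (simp add: E_0 eq_neg_iff_add_eq_0 add.commute)

lemma E_sum: "E (sum f A) = (\<Sum>a\<in>A. E (f a))"
  by (induction A rule: infinite_finite_induct) (simp_all only: sum.infinite sum.empty sum.insert E_0 E_add not_False_eq_True)

lemma E_z: "k < n \<Longrightarrow> E (z k) = (if k < r then z k else 0)"
proof -
  assume k: "k < n"
  have "E (z k) = (\<Sum>j<r. if j = k then z k else 0)"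
    unfolding E_def using k rn by (intro sum.cong refl) (auto simp: T_z dm.sm_1)
  then show ?thesis by simp
qed

lemma T_mem: "y \<in> vecs n K \<Longrightarrow> k < n \<Longrightarrow> T y k \<in> K"
  by (auto simp: T_def vecs_def intro!: sum_mem mult_mem N_mem)

lemma E_vecs: "y \<in> vecs n K \<Longrightarrow> E y \<in> vecs n K"
  unfolding E_def using rn by (intro vecs_sum vecs_smul z_vecs sub T_mem) auto

lemma E_vecs_UNIV: "E y \<in> vecs n UNIV"
  unfolding E_def by (intro vecs_sum vecs_smul vecs_mono[OF z_vecs] fls_subfield_UNIV) auto

lemma E_E: "E (E y) = E y"
proof -
  have "E (E y) = E (\<Sum>k<r. smul (T y k) (z k))" by (simp only: E_def)
  also have "\<dots> = (\<Sum>k<r. smul (T y k) (E (z k)))" by (simp only: E_sum E_smul)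
  also have "\<dots> = (\<Sum>k<r. smul (T y k) (z k))" using rn by (intro sum.cong refl) (simp add: E_z)
  finally show ?thesis by (simp only: E_def)
qed

lemma D_z: "Suc k < r \<or> (r \<le> k \<and> Suc k < n) \<Longrightarrow> D (z k) = z (Suc k)"
  by (auto simp: z_def Suc_diff_le)

text \<open>D takes each slow basis vector to the next one, except the last, for which the relation
  of v leads back into the slow span.\<close>

lemma E_D_z_slow:
  assumes "k < r"
  shows "E (D (z k)) = D (z k)"
proof (cases "Suc k < r")
  case True
  then show ?thesis using rn by (simp add: D_z E_z)
next
  case False
  then have "Suc k = r" using assms by simp
  then have "D (z k) = (D ^^ r) v" using assms by (auto simp: z_def)
  also have "\<dots> = - (\<Sum>b\<le>n. smul (low r Z b) ((D ^^ b) v))" using v_relation by (simp add: eq_neg_iff_add_eq_0)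
  also have "\<dots> = - (\<Sum>b\<le>n. smul (low r Z b) (z b))"
    by (intro arg_cong[of _ _ uminus] sum.cong refl) (auto simp: low_def z_def)
  finally have 1: "D (z k) = - (\<Sum>b\<le>n. smul (low r Z b) (z b))" .
  have "smul (low r Z b) (E (z b)) = smul (low r Z b) (z b)" for b
    using rn by (cases "b < r") (auto simp: low_def E_z)
  then show ?thesis by (simp add: 1 E_minus E_sum E_smul)
qed

text \<open>At the top index the nonlinear sum is empty, because b is at most n and c is below r; so
  \<open>Y n\<close> is the inverse of \<open>b r\<close>. The relation of u can then be solved for
  its highest derivative.\<close>

lemma Y_n: "r < n \<Longrightarrow> Y n \<noteq> 0"
proof -
  assume "r < n"
  have "Y n = (if n = r then 0 else b n / b r)"
    by (subst Y[OF order_refl]) (auto simp: k1_def intro!: sum.neutral)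
  then show ?thesis using \<open>r < n\<close> b_n b_r by simp
qed

text \<open>The additional 1 at k = r is the unit term of the factor 1 + Q.\<close>

lemma D_z_last:
  assumes "r < n"
  shows "smul (Y n) (D (z (n - 1))) = - (\<Sum>k\<in>{r..<n}. smul ((if k = r then 1 else 0) + Y k) (z k))"
proof -
  have Dz: "D (z (n - 1)) = (D ^^ (n - r)) u"
  proof -
    have "n - r = Suc (n - 1 - r)" "\<not> n - 1 < r" using assms by auto
    then show ?thesis by (simp only: z_def if_False funpow.simps o_apply)
  qed
  have "(\<Sum>b\<le>n. smul (high r Y b) ((D ^^ (b - r)) u)) = (\<Sum>b\<in>{r..n}. smul (Y b) ((D ^^ (b - r)) u))"
    by (rule sum.mono_neutral_cong_right) (auto simp: high_def)
  also have "{r..n} = insert n {r..<n}" using assms by auto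
  also have "(\<Sum>b\<in>insert n {r..<n}. smul (Y b) ((D ^^ (b - r)) u))
      = smul (Y n) ((D ^^ (n - r)) u) + (\<Sum>b\<in>{r..<n}. smul (Y b) ((D ^^ (b - r)) u))"
    by (rule sum.insert) auto
  finally have "u + (smul (Y n) (D (z (n - 1))) + (\<Sum>b\<in>{r..<n}. smul (Y b) ((D ^^ (b - r)) u))) = 0"
    using u_relation by (simp only: Dz)
  then have "smul (Y n) (D (z (n - 1))) = - (u + (\<Sum>b\<in>{r..<n}. smul (Y b) ((D ^^ (b - r)) u)))"
    by (simp add: eq_neg_iff_add_eq_0 algebra_simps)
  also have "u + (\<Sum>b\<in>{r..<n}. smul (Y b) ((D ^^ (b - r)) u))
      = (\<Sum>k\<in>{r..<n}. (if k = r then u else 0) + smul (Y k) (z k))"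
    using assms by (simp add: sum.distrib z_def)
  also have "\<dots> = (\<Sum>k\<in>{r..<n}. smul ((if k = r then 1 else 0) + Y k) (z k))"
    by (intro sum.cong refl) (auto simp: dm.sm_add_left dm.sm_1 z_def)
  finally show ?thesis .
qed

lemma E_D_z_fast:
  assumes "r \<le> k" "k < n"
  shows "E (D (z k)) = 0"
proof (cases "Suc k < n")
  case True
  then show ?thesis using assms by (simp add: D_z E_z)
next
  case False
  then have k: "k = n - 1" using assms by simp
  have r: "r < n" using assms by simp
  have "smul (Y n) (E (D (z k))) = - (\<Sum>k\<in>{r..<n}. smul ((if k = r then 1 else 0) + Y k) (E (z k)))"
    unfolding k E_smul[symmetric] D_z_last[OF r] by (simp only: E_minus E_sum E_smul)
  also have "\<dots> = 0" by (simp add: E_z)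
  finally have "smul (inverse (Y n)) (smul (Y n) (E (D (z k)))) = 0" by simp
  then show ?thesis using Y_n[OF r] by (simp add: dm.sm_mult[symmetric] dm.sm_1)
qed

lemma E_D:
  assumes y: "y \<in> vecs n UNIV"
  shows "E (D y) = D (E y)"
proof -
  have "D y = (\<Sum>k<n. smul (fls_deriv (T y k)) (z k) + smul (T y k) (D (z k)))"
    by (subst reconstruct[OF y]) (simp add: dm.D_sum dm.D_sm)
  then have "E (D y) = (\<Sum>k<n. smul (fls_deriv (T y k)) (E (z k)) + smul (T y k) (E (D (z k))))"
    by (simp add: E_sum E_add E_smul)
  also have "\<dots> = (\<Sum>k<r. smul (fls_deriv (T y k)) (z k) + smul (T y k) (D (z k)))"
    using rn by (intro sum.mono_neutral_cong_right) (auto simp: E_z E_D_z_slow E_D_z_fast)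
  also have "\<dots> = D (E y)" by (simp add: E_def dm.D_sum dm.D_sm)
  finally show ?thesis .
qed

section \<open>Growth of poles on the slow and on the fast part\<close>

lemma slow_vec_add:
  assumes "slow_vec D \<theta> x" "slow_vec D \<theta> y"
  shows "slow_vec D \<theta> (x + y)"
proof -
  obtain C1 C2 where C: "\<And>m i. val_ge ((D ^^ m) x i) (- \<theta> * real m - C1)" "\<And>m i. val_ge ((D ^^ m) y i) (- \<theta> * real m - C2)"
    using assms by (auto simp: slow_vec_def)
  have "val_ge ((D ^^ m) (x + y) i) (- \<theta> * real m - max C1 C2)" for m i
  proof -
    have "(D ^^ m) (x + y) i = (D ^^ m) x i + (D ^^ m) y i" by (simp add: dm.Dpow_add)
    then show ?thesis by (auto intro!: val_ge_add val_ge_mono[OF C(1)] val_ge_mono[OF C(2)])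
  qed
  then show ?thesis unfolding slow_vec_def by blast
qed

lemma slow_vec_0: "slow_vec D \<theta> 0"
  unfolding slow_vec_def by (intro exI[of _ 0]) simp

lemma slow_vec_sum: "(\<And>a. a \<in> A \<Longrightarrow> slow_vec D \<theta> (f a)) \<Longrightarrow> slow_vec D \<theta> (sum f A)"
proof (induction A rule: infinite_finite_induct)
  case (insert a A)
  then show ?case by (subst sum.insert) (auto intro: slow_vec_add)
next
  case (infinite A)
  then show ?case by (simp only: sum.infinite slow_vec_0 not_False_eq_True)
next
  case empty
  then show ?case by (simp only: sum.empty slow_vec_0)
qed

text \<open>Differentiating the scalar costs 1 per step, which a rate of at least 1 covers.\<close>

lemma slow_vec_smul:
  assumes "slow_vec D \<theta> y" "\<theta> \<ge> 1"
  shows "slow_vec D \<theta> (smul a y)"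
proof -
  obtain C where C: "\<And>m i. val_ge ((D ^^ m) y i) (- \<theta> * real m - C)"
    using assms by (auto simp: slow_vec_def)
  obtain c where c: "val_ge a c" using val_ge_exists by blast
  have "val_ge ((D ^^ m) (smul a y) i) (- \<theta> * real m - (C - c))" for m i
  proof -
    have "(D ^^ m) (smul a y) i
        = (\<Sum>l\<le>m. fls_const (of_nat (m choose l)) * ((fls_deriv ^^ l) a * (D ^^ (m - l)) y i))"
      by (simp add: dm.leibniz sum_fun_app smul_apply fls_of_nat mult.assoc)
    also have "val_ge \<dots> (- \<theta> * real m - (C - c))"
    proof (intro val_ge_sum val_ge_const_mult)
      fix l assume l: "l \<in> {..m}"
      have "val_ge ((fls_deriv ^^ l) a * (D ^^ (m - l)) y i) (c - real l + (- \<theta> * real (m - l) - C))"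
        by (intro val_ge_mult val_ge_deriv_pow c C)
      moreover have "real l \<le> \<theta> * real l" using assms(2) mult_right_mono[of 1 \<theta> "real l"] by simp
      ultimately show "val_ge ((fls_deriv ^^ l) a * (D ^^ (m - l)) y i) (- \<theta> * real m - (C - c))"
        using l by (elim val_ge_mono) (simp add: of_nat_diff algebra_simps)
    qed
    finally show ?thesis .
  qed
  then show ?thesis unfolding slow_vec_def by blast
qed

text \<open>D ^ m v is kept as a combination of the fixed vectors \<open>z k\<close>, with
  coefficients of valuation at least - \<theta> * (m - k). Applying D moves k up by one; at the last
  index the relation of v folds the term back with factors \<open>Z k\<close>, whose valuations fit
  this same weight.\<close>

lemma E_slow:
  assumes \<theta>: "\<theta> \<ge> 1" "\<And>c. c < r \<Longrightarrow> val_ge (Z c) (\<theta> * (real c - real r))"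
  shows "slow_vec D \<theta> (E y)"
proof (cases "r = 0")
  case True
  then have "E y = 0" unfolding E_def by (intro sum.neutral) simp
  then show ?thesis by (simp only: slow_vec_0)
next
  case False
  have "\<exists>a. (D ^^ m) v = (\<Sum>k<r. smul (a k) (z k)) \<and> (\<forall>k<r. val_ge (a k) (- \<theta> * (real m - real k)))" for m
  proof (induction m)
    case 0
    have "v = (\<Sum>k<r. if k = 0 then v else 0)" using False by simp
    also have "\<dots> = (\<Sum>k<r. smul (if k = 0 then 1 else 0) (z k))"
      using False by (intro sum.cong refl) (auto simp: z_def dm.sm_1)
    finally have "(D ^^ 0) v = (\<Sum>k<r. smul (if k = 0 then 1 else 0) (z k))" by simp
    then show ?case by (intro exI[of _ "\<lambda>k. if k = 0 then 1 else 0"]) (auto intro: val_ge_1)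
  next
    case (Suc m)
    then obtain a where a: "(D ^^ m) v = (\<Sum>k<r. smul (a k) (z k))"
      "\<And>k. k < r \<Longrightarrow> val_ge (a k) (- \<theta> * (real m - real k))" by blast
    \<comment> \<open>The derivative of the coefficient, the shift from the preceding basis vector,
      and the fold from index r - 1.\<close>
    define a' where "a' k = fls_deriv (a k) + (if k = 0 then 0 else a (k - 1)) - a (r - 1) * Z k" for k
    have Dlast: "D (z (r - 1)) = - (\<Sum>k<r. smul (Z k) (z k))"
    proof -
      have "(D ^^ r) v = - (\<Sum>b\<le>n. smul (low r Z b) ((D ^^ b) v))"
        using v_relation by (simp add: eq_neg_iff_add_eq_0)
      also have "(\<Sum>b\<le>n. smul (low r Z b) ((D ^^ b) v)) = (\<Sum>k<r. smul (Z k) (z k))"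
        using rn by (intro sum.mono_neutral_cong_right) (auto simp: low_def z_def)
      also have "(D ^^ r) v = D (z (r - 1))"
      proof -
        have zr: "z (r - 1) = (D ^^ (r - 1)) v" using False by (simp add: z_def)
        have "(D ^^ Suc (r - 1)) v = D (z (r - 1))" by (simp only: zr funpow.simps o_apply)
        moreover have "Suc (r - 1) = r" using False by simp
        ultimately show ?thesis by (simp only:)
      qed
      finally show ?thesis .
    qed
    have "(\<Sum>k<r. smul (a k) (D (z k))) = (\<Sum>k<Suc (r - 1). smul (a k) (D (z k)))" using False by simp
    also have "\<dots> = (\<Sum>k<r - 1. smul (a k) (z (Suc k))) + smul (a (r - 1)) (D (z (r - 1)))"
      unfolding sum.lessThan_Suc by (intro arg_cong2[of _ _ _ _ "(+)"] sum.cong refl) (simp_all add: D_z less_diff_conv)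
    also have "(\<Sum>k<r - 1. smul (a k) (z (Suc k))) = (\<Sum>k<Suc (r - 1). smul (if k = 0 then 0 else a (k - 1)) (z k))"
      by (subst sum.lessThan_Suc_shift) simp
    also have "Suc (r - 1) = r" using False by simp
    also have "smul (a (r - 1)) (D (z (r - 1))) = (\<Sum>k<r. smul (- (a (r - 1) * Z k)) (z k))"
      by (simp only: Dlast dm.sm_minus_left sum_negf dm.sm_mult dm.sm_sum_right[symmetric])
         (simp add: smul_def fun_eq_iff)
    finally have shifted: "(\<Sum>k<r. smul (a k) (D (z k))) = (\<Sum>k<r. smul (if k = 0 then 0 else a (k - 1)) (z k))
      + (\<Sum>k<r. smul (- (a (r - 1) * Z k)) (z k))" .
    have "(D ^^ Suc m) v = (\<Sum>k<r. smul (fls_deriv (a k)) (z k)) + (\<Sum>k<r. smul (a k) (D (z k)))"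
      by (simp only: funpow.simps o_apply a(1) dm.D_sum dm.D_sm sum.distrib)
    also have "\<dots> = (\<Sum>k<r. smul (a' k) (z k))"
      by (simp only: shifted dm.sm_add_left[symmetric] sum.distrib[symmetric] a'_def diff_conv_add_uminus add.assoc)
    finally have "(D ^^ Suc m) v = (\<Sum>k<r. smul (a' k) (z k))" .
    moreover have "val_ge (a' k) (- \<theta> * (real (Suc m) - real k))" if k: "k < r" for k
      unfolding a'_def
    proof (intro val_ge_diff val_ge_add)
      show "val_ge (fls_deriv (a k)) (- \<theta> * (real (Suc m) - real k))"
        using \<theta> by (intro val_ge_mono[OF val_ge_deriv[OF a(2)[OF k]]]) (simp add: algebra_simps)
      show "val_ge (if k = 0 then 0 else a (k - 1)) (- \<theta> * (real (Suc m) - real k))"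
        using a(2)[of "k - 1"] k by (auto simp: of_nat_diff algebra_simps)
      have "val_ge (a (r - 1) * Z k) (- \<theta> * (real m - real (r - 1)) + \<theta> * (real k - real r))"
        using False k by (intro val_ge_mult a(2) \<theta>(2)) auto
      then show "val_ge (a (r - 1) * Z k) (- \<theta> * (real (Suc m) - real k))"
        using False by (elim val_ge_mono) (simp add: of_nat_diff algebra_simps)
    qed
    ultimately show ?case by blast
  qed
  then obtain a where a: "\<And>m. (D ^^ m) v = (\<Sum>k<r. smul (a m k) (z k))"
    "\<And>m k. k < r \<Longrightarrow> val_ge (a m k) (- \<theta> * (real m - real k))" by metis
  obtain c where c: "\<forall>x\<in>{..<r} \<times> {..<n}. val_ge (case x of (k, i) \<Rightarrow> z k i) c"
    using val_ge_exists_family[of "{..<r} \<times> {..<n}" "\<lambda>x. case x of (k, i) \<Rightarrow> z k i"] by auto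
  have zc: "val_ge (z k i) c" if "k < r" for k i
    using that c z_vecs[of k] by (cases "i < n") (auto simp: vecs_def)
  have vs: "val_ge ((D ^^ m) v i) (- \<theta> * real m + c)" for m i
    unfolding a(1) sum_fun_app
  proof (rule val_ge_sum)
    fix k assume k: "k \<in> {..<r}"
    have "val_ge (a m k * z k i) (- \<theta> * (real m - real k) + c)"
      using k by (intro val_ge_mult a(2) zc) auto
    moreover have "0 \<le> \<theta> * real k" using \<theta> by simp
    ultimately show "val_ge (smul (a m k) (z k) i) (- \<theta> * real m + c)"
      by (simp add: smul_apply) (elim val_ge_mono, simp add: algebra_simps)
  qed
  have "slow_vec D \<theta> (z k)" if "k < r" for k
    unfolding slow_vec_def
  proof (intro exI allI)
    fix m i
    have "(D ^^ m) (z k) i = (D ^^ (m + k)) v i" using that by (simp add: z_def dm.Dpow_Dpow)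
    then show "val_ge ((D ^^ m) (z k) i) (- \<theta> * real m - (\<theta> * real k - c))"
      using vs[of "m + k" i] by (simp add: algebra_simps)
  qed
  then show ?thesis unfolding E_def using \<theta> by (intro slow_vec_sum slow_vec_smul) auto
qed

text \<open>On the kernel of E only the coordinates from r on survive, and D acts on them as the
  companion matrix of 1 + Q after division by its leading coefficient \<open>Y n\<close>.\<close>

lemma T_D:
  assumes y: "y \<in> vecs n UNIV" "E y = 0" and k: "r \<le> k" "k < n"
  shows "T (D y) k = fls_deriv (T y k) + (if r < k then T y (k - 1) else 0)
    - T y (n - 1) * ((if k = r then 1 else 0) + Y k) / Y n"
proof -
  have r: "r < n" using k by simp
  have low: "T y j = 0" if "j < r" for j
  proof -
    have "T (E y) j = T y j"
    proof -
      have "T (E y) j = (\<Sum>k<r. T y k * (if k = j then 1 else 0))"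
        unfolding E_def T_sum using that rn by (intro sum.cong refl) (simp add: T_smul T_z)
      then show ?thesis using that by (simp add: if_distrib cong: if_cong)
    qed
    then show ?thesis using y(2) by (simp add: T_0)
  qed
  have Dl: "D (z (n - 1)) = smul (- inverse (Y n)) (\<Sum>k\<in>{r..<n}. smul ((if k = r then 1 else 0) + Y k) (z k))"
  proof -
    have "smul (inverse (Y n)) (smul (Y n) (D (z (n - 1))))
      = smul (inverse (Y n)) (- (\<Sum>k\<in>{r..<n}. smul ((if k = r then 1 else 0) + Y k) (z k)))"
      by (simp only: D_z_last[OF r])
    moreover have "smul (inverse (Y n)) (smul (Y n) (D (z (n - 1)))) = D (z (n - 1))"
      using Y_n[OF r] by (simp add: dm.sm_mult[symmetric] dm.sm_1)
    ultimately show ?thesis by (simp add: smul_def fun_eq_iff)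
  qed
  have TDl: "T (D (z (n - 1))) k = - (((if k = r then 1 else 0) + Y k) / Y n)"
  proof -
    have "T (D (z (n - 1))) k = - inverse (Y n) * (\<Sum>j\<in>{r..<n}. ((if j = r then 1 else 0) + Y j) * (if j = k then 1 else 0))"
      unfolding Dl T_smul T_sum using k by (intro arg_cong2[of _ _ _ _ "(*)"] sum.cong refl) (simp add: T_z)
    also have "(\<Sum>j\<in>{r..<n}. ((if j = r then 1 else 0) + Y j) * (if j = k then 1 else 0)) = (if k = r then 1 else 0) + Y k"
      using k by (simp add: if_distrib cong: if_cong)
    finally show ?thesis by (simp add: divide_inverse)
  qed
  have "y = (\<Sum>j<n. smul (T y j) (z j))" by (rule reconstruct[OF y(1)])
  also have "\<dots> = (\<Sum>j\<in>{r..<n}. smul (T y j) (z j))"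
    by (intro sum.mono_neutral_right) (auto simp: low)
  finally have yr: "y = (\<Sum>j\<in>{r..<n}. smul (T y j) (z j))" .
  have "T (D y) k = (\<Sum>j\<in>{r..<n}. fls_deriv (T y j) * T (z j) k + T y j * T (D (z j)) k)"
    by (subst yr) (simp add: dm.D_sum dm.D_sm T_sum T_add T_smul)
  also have "\<dots> = (\<Sum>j\<in>{r..<n}. fls_deriv (T y j) * (if j = k then 1 else 0)) + (\<Sum>j\<in>{r..<n}. T y j * T (D (z j)) k)"
    using k by (simp add: sum.distrib T_z)
  also have "(\<Sum>j\<in>{r..<n}. fls_deriv (T y j) * (if j = k then 1 else 0)) = fls_deriv (T y k)"
    using k by (simp add: if_distrib cong: if_cong)
  also have "{r..<n} = insert (n - 1) {r..<n - 1}" using r by auto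
  also have "(\<Sum>j\<in>insert (n - 1) {r..<n - 1}. T y j * T (D (z j)) k)
      = T y (n - 1) * T (D (z (n - 1))) k + (\<Sum>j\<in>{r..<n - 1}. T y j * (if Suc j = k then 1 else 0))"
    using k by (subst sum.insert) (auto simp: D_z T_z intro!: sum.cong)
  also have "(\<Sum>j\<in>{r..<n - 1}. T y j * (if Suc j = k then 1 else 0)) = (if r < k then T y (k - 1) else 0)"
  proof -
    have "(\<Sum>j\<in>{r..<n - 1}. T y j * (if Suc j = k then 1 else 0))
        = (\<Sum>j\<in>{r..<n - 1}. if j = k - 1 then (if r < k then T y (k - 1) else 0) else 0)"
      using k by (intro sum.cong refl) auto
    also have "\<dots> = (if r < k then T y (k - 1) else 0)" using k by (auto simp: sum.delta)
    finally show ?thesis .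
  qed
  finally have "T (D y) k = fls_deriv (T y k) + (T y (n - 1) * T (D (z (n - 1))) k + (if r < k then T y (k - 1) else 0))" .
  then show ?thesis unfolding TDl by (simp only: mult_minus_right times_divide_eq_right) (simp only: diff_conv_add_uminus add.assoc add.commute[of "- _"])
qed

text \<open>The formula for \<open>T (D y)\<close> is solved for \<open>T y\<close>: the equation at
  r determines the last coordinate, the one at i + 1 then determines coordinate i. Read backwards, D
  thus improves valuations by \<theta>.\<close>

lemma D_expands:
  assumes y: "y \<in> vecs n UNIV" "E y = 0"
    and \<theta>: "\<theta> > 1" "\<And>k. r \<le> k \<Longrightarrow> k \<le> n \<Longrightarrow> val_ge (Y k) (\<theta> * (real k - real r))"
    and Dy: "\<And>k. r \<le> k \<Longrightarrow> k < n \<Longrightarrow> val_ge (T (D y) k) (e + \<theta> * (real k - real r))"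
    and k: "r \<le> k" "k < n"
  shows "val_ge (T y k) (e + \<theta> + \<theta> * (real k - real r))"
proof -
  have r: "r < n" using k by simp
  \<comment> \<open>Eliminates the last coordinate by means of the equation at r, in which 1 +
    \<open>Y r\<close> is a unit because \<open>Y r\<close> has positive valuation.\<close>
  define q where "q j = - Y j / (1 + Y r)" for j
  have small: "1 + Y r \<noteq> 0" "val_ge (inverse (1 + Y r)) 0"
    using one_plus_small[of "Y r" \<epsilon>] Y_\<tau>[OF rn] rates by auto
  have q_val: "val_ge (q j) (\<theta> * (real j - real r))" if "r \<le> j" "j \<le> n" for j
    using val_ge_mult[OF \<theta>(2)[OF that] small(2)] by (simp add: q_def divide_inverse)
  have rec: "T y i = (if Suc i < n then T (D y) (Suc i) - fls_deriv (T y (Suc i)) else 0)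
      + (T (D y) r - fls_deriv (T y r)) * q (Suc i)" if i: "r \<le> i" "i < n" for i
  proof -
    have "(T (D y) r - fls_deriv (T y r)) * q (Suc i) = T y (n - 1) * Y (Suc i) / Y n"
    proof -
      have "T (D y) r - fls_deriv (T y r) = - (T y (n - 1) * (1 + Y r) / Y n)"
        using T_D[OF y, of r] r by simp
      moreover have "- (t * c / d) * (- e / c) = t * e / d" if "c \<noteq> 0" for t c d e :: "complex fls"
        using that by simp
      ultimately show ?thesis using small(1) by (simp only: q_def)
    qed
    then show ?thesis
    proof (cases "Suc i < n")
      case True
      then show ?thesis using T_D[OF y, of "Suc i"] i \<open>(T (D y) r - _) * _ = _\<close> by simp
    next
      case False
      then have "Suc i = n" "n - 1 = i" using i by auto
      then show ?thesis using \<open>(T (D y) r - _) * _ = _\<close> Y_n[OF r] by simp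
    qed
  qed
  obtain \<delta>' where \<delta>': "\<forall>k\<in>{..<n}. val_ge (T y k) \<delta>'" using val_ge_exists_family[of "{..<n}" "T y"] by auto
  define \<delta> where "\<delta> = \<delta>' - \<theta> * real n"
  \<comment> \<open>The solved equations still contain derivatives of \<open>T y\<close>, each
    costing 1. One round therefore improves an initial bound by \<theta> - 1 only, until e +
    \<theta> is reached.\<close>
  define B where "B j = min (e + \<theta>) (\<delta> + real j * (\<theta> - 1))" for j :: nat
  have boot: "\<forall>i. r \<le> i \<longrightarrow> i < n \<longrightarrow> val_ge (T y i) (B j + \<theta> * (real i - real r))" for j
  proof (induction j)
    case 0
    have "val_ge (T y i) (B 0 + \<theta> * (real i - real r))" if "r \<le> i" "i < n" for i
    proof (rule val_ge_mono)
      show "val_ge (T y i) \<delta>'" using \<delta>' that by simp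
      have "\<theta> * (real i - real r) \<le> \<theta> * real n" using that \<theta> by (intro mult_left_mono) auto
      then show "B 0 + \<theta> * (real i - real r) \<le> \<delta>'" by (simp add: B_def \<delta>_def)
    qed
    then show ?case by blast
  next
    case (Suc j)
    show ?case
    proof (intro allI impI)
      fix i assume i: "r \<le> i" "i < n"
      have B: "B (Suc j) \<le> e + \<theta>" "B (Suc j) \<le> B j + \<theta> - 1"
        using \<theta> by (auto simp: B_def min_def algebra_simps split: if_splits)
      have S: "\<theta> * (real (Suc i) - real r) = \<theta> + \<theta> * (real i - real r)" by (simp add: algebra_simps)
      show "val_ge (T y i) (B (Suc j) + \<theta> * (real i - real r))"
        unfolding rec[OF i]
      proof (rule val_ge_add)
        show "val_ge (if Suc i < n then T (D y) (Suc i) - fls_deriv (T y (Suc i)) else 0) (B (Suc j) + \<theta> * (real i - real r))"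
        proof (cases "Suc i < n")
          case True
          have "val_ge (T (D y) (Suc i)) (B (Suc j) + \<theta> * (real i - real r))"
            using Dy[of "Suc i"] True i B S by (intro val_ge_mono[OF Dy]) auto
          moreover have "val_ge (fls_deriv (T y (Suc i))) (B (Suc j) + \<theta> * (real i - real r))"
            using Suc[rule_format, of "Suc i"] True i B S by (intro val_ge_mono[OF val_ge_deriv]) auto
          ultimately show ?thesis using True by (simp add: val_ge_diff)
        qed simp
        have "val_ge (T (D y) r - fls_deriv (T y r)) (B (Suc j) - \<theta>)"
        proof (rule val_ge_diff)
          show "val_ge (T (D y) r) (B (Suc j) - \<theta>)" using Dy[of r] r B by (auto elim!: val_ge_mono)
          show "val_ge (fls_deriv (T y r)) (B (Suc j) - \<theta>)"
            using val_ge_deriv[OF Suc[rule_format, of r]] r B \<theta> by (auto elim!: val_ge_mono)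
        qed
        from val_ge_mult[OF this q_val[of "Suc i"]]
        show "val_ge ((T (D y) r - fls_deriv (T y r)) * q (Suc i)) (B (Suc j) + \<theta> * (real i - real r))"
          using i S by simp
      qed
    qed
  qed
  obtain j where "(e + \<theta> - \<delta>) / (\<theta> - 1) \<le> real j" using real_arch_simple by blast
  then have "e + \<theta> \<le> \<delta> + real j * (\<theta> - 1)" using \<theta> by (simp add: pos_divide_le_eq)
  then have "B j = e + \<theta>" by (simp add: B_def)
  then show ?thesis using boot[of j] k by simp
qed

text \<open>A bound on the poles of D ^ m y at a rate \<theta>' < \<theta>, carried back m times by
  \<open>D_expands\<close>, gives y valuations of at least (\<theta> - \<theta>') * m minus a
  constant, for every m.\<close>

lemma kernel_not_slow:
  assumes y: "y \<in> vecs n UNIV" "E y = 0"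
    and \<theta>: "\<theta> > 1" "\<And>k. r \<le> k \<Longrightarrow> k \<le> n \<Longrightarrow> val_ge (Y k) (\<theta> * (real k - real r))"
    and slow: "slow_vec D \<theta>' y" "\<theta>' < \<theta>"
  shows "y = 0"
proof -
  have iterate: "val_ge (T y k) (e + real m * \<theta> + \<theta> * (real k - real r))"
    if "y \<in> vecs n UNIV" "E y = 0" "r \<le> k" "k < n"
      "\<And>k. r \<le> k \<Longrightarrow> k < n \<Longrightarrow> val_ge (T ((D ^^ m) y) k) (e + \<theta> * (real k - real r))" for m y k e
    using that
  proof (induction m arbitrary: y k)
    case (Suc m)
    have "val_ge (T (D y) k) (e + real m * \<theta> + \<theta> * (real k - real r))" if "r \<le> k" "k < n" for k
    proof (rule Suc.IH)
      show "D y \<in> vecs n UNIV" using Dpow_vecs_UNIV[OF Suc.prems(1), of 1] by simp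
      show "E (D y) = 0" by (simp only: E_D[OF Suc.prems(1)] Suc.prems(2) dm.D_0)
      show "val_ge (T ((D ^^ m) (D y)) k) (e + \<theta> * (real k - real r))" if "r \<le> k" "k < n" for k
        using Suc.prems(5)[OF that] by (simp add: funpow_swap1)
    qed (use that in auto)
    from D_expands[OF Suc.prems(1,2) \<theta> this Suc.prems(3,4)]
    show ?case by (simp add: algebra_simps)
  qed simp
  obtain C where C: "\<And>m i. val_ge ((D ^^ m) y i) (- \<theta>' * real m - C)"
    using slow by (auto simp: slow_vec_def)
  obtain c where c: "\<forall>x\<in>{..<n} \<times> {..<n}. val_ge (case x of (k, i) \<Rightarrow> N k i) c"
    using val_ge_exists_family[of "{..<n} \<times> {..<n}" "\<lambda>x. case x of (k, i) \<Rightarrow> N k i"] by auto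
  have T_val: "val_ge (T ((D ^^ m) y) k) (- \<theta>' * real m - C + c)" if "k < n" for m k
    unfolding T_def using that c by (intro val_ge_sum val_ge_mult C) auto
  have T0: "T y k = 0" if k: "k < n" for k
  proof (cases "r \<le> k")
    case True
    have v: "val_ge (T y k) ((\<theta> - \<theta>') * real m - C + c - \<theta> * real n)" for m
    proof -
      have "val_ge (T y k) ((- \<theta>' * real m - C + c - \<theta> * real n) + real m * \<theta> + \<theta> * (real k - real r))"
      proof (rule iterate[OF y True k])
        fix k assume k: "r \<le> k" "k < n"
        have "\<theta> * (real k - real r) \<le> \<theta> * real n" using k \<theta> by (intro mult_left_mono) auto
        then show "val_ge (T ((D ^^ m) y) k) ((- \<theta>' * real m - C + c - \<theta> * real n) + \<theta> * (real k - real r))"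
          by (intro val_ge_mono[OF T_val[OF k(2)]]) simp
      qed
      moreover have "0 \<le> \<theta> * (real k - real r)" using True \<theta> by simp
      ultimately show ?thesis by (elim val_ge_mono) (simp add: algebra_simps)
    qed
    have "\<exists>m. a \<le> (\<theta> - \<theta>') * real m - C + c - \<theta> * real n" for a
    proof -
      obtain m where "(a + C - c + \<theta> * real n) / (\<theta> - \<theta>') \<le> real m" using real_arch_simple by blast
      then show ?thesis using slow(2) by (intro exI[of _ m]) (simp add: pos_divide_le_eq algebra_simps)
    qed
    with v show ?thesis by (intro val_ge_zeroI) blast
  next
    case False
    have "T (E y) k = (\<Sum>j<r. T y j * (if j = k then 1 else 0))"
      unfolding E_def T_sum using k rn by (intro sum.cong refl) (simp add: T_smul T_z)
    also have "\<dots> = T y k" using False by (simp add: if_distrib cong: if_cong)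
    finally show ?thesis using y(2) by (simp add: T_0)
  qed
  have "y = (\<Sum>k<n. smul (T y k) (z k))" by (rule reconstruct[OF y(1)])
  also have "\<dots> = 0" by (intro sum.neutral) (auto simp: T0)
  finally show ?thesis .
qed

lemma E_nonzero: "r > 0 \<Longrightarrow> \<exists>y\<in>vecs n K. E y \<noteq> 0"
proof (intro bexI[of _ "z 0"])
  assume r: "r > 0"
  have "T (z 0) 0 = 1" using n0 by (simp add: T_z)
  then show "E (z 0) \<noteq> 0" using r n0 by (auto simp: E_z T_0)
qed (rule z_vecs)

lemma E_not_identity: "r < n \<Longrightarrow> \<exists>y\<in>vecs n K. E y \<noteq> y"
proof (intro bexI[of _ "z r"])
  assume r: "r < n"
  then have "T (z r) r = 1" by (simp add: T_z)
  then show "E (z r) \<noteq> z r" using r by (auto simp: E_z T_0)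
qed (rule z_vecs)

end

subsection \<open>Vertices and slopes of the Newton polygon\<close>

text \<open>Both lines through the vertex bound the coefficients. Indices below r profit from the
  flatter line and indices above r from the steeper one; hence the minimum for the slow part and the
  maximum for the fast part.\<close>

theorem companion_projector:
  fixes s \<mu> \<epsilon> :: real and b :: "nat \<Rightarrow> complex fls" and n r :: nat
  defines "K \<equiv> gevrey_series s" and "D \<equiv> conn n (companion n b)"
  assumes s: "s > 0" and K: "fls_subfield K" and \<mu>: "\<mu> > 0" and \<epsilon>: "\<epsilon> > 0"
    and n: "n > 0" "r \<le> n" and b: "\<And>a. a \<le> n \<Longrightarrow> b a \<in> K" "b n = 1" "b r \<noteq> 0"
    and val: "\<And>a. a \<le> n \<Longrightarrow> a \<noteq> r \<Longrightarrow> val_ge (b a / b r) ((1 + 1 / s) * (real a - real r))"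
    and val': "\<And>a. a \<le> n \<Longrightarrow> a \<noteq> r \<Longrightarrow> val_ge (b a / b r) ((1 + \<mu>) * (real a - real r) + \<epsilon>)"
  obtains E where
    "\<And>x y. E (x + y) = E x + E y" "\<And>a y. E (smul a y) = smul a (E y)"
    "\<And>y. y \<in> vecs n K \<Longrightarrow> E y \<in> vecs n K" "\<And>y. E y \<in> vecs n UNIV"
    "\<And>y. E (E y) = E y" "\<And>y. y \<in> vecs n UNIV \<Longrightarrow> E (D y) = D (E y)"
    "\<And>y. slow_vec D (1 + min (1 / s) \<mu>) (E y)"
    "\<And>y \<theta>. y \<in> vecs n UNIV \<Longrightarrow> E y = 0 \<Longrightarrow> slow_vec D \<theta> y \<Longrightarrow> \<theta> < 1 + max (1 / s) \<mu> \<Longrightarrow> y = 0"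
    "r > 0 \<Longrightarrow> \<exists>y\<in>vecs n K. E y \<noteq> 0" "r < n \<Longrightarrow> \<exists>y\<in>vecs n K. E y \<noteq> y"
proof -
  \<comment> \<open>The entry at r is removed because it is the leading 1 of the product of the
    factors, for which the strict bound by \<epsilon> would fail.\<close>
  define p where "p a = (if a = r then 0 else b a / b r)" for a
  have pK: "p a \<in> gevrey_series s" if "a \<le> n" for a
    using b(1)[OF that] b(1)[OF n(2)] K
    by (auto simp: p_def K_def intro: fls_subfield.divide_mem fls_subfield.zero_mem)
  interpret g1: gevrey_system s \<mu> \<epsilon> r n p "k1 r" "\<lambda>_ _. 0"
    by unfold_locales (use s \<mu> \<epsilon> n pK val val' in \<open>auto simp: p_def\<close>)
  interpret g2: gevrey_system s \<mu> \<epsilon> r n p "k2 r" "k2' r"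
    by unfold_locales (use s \<mu> \<epsilon> n pK val val' in \<open>auto simp: p_def\<close>)
  obtain Y where Y: "\<And>a. a \<le> n \<Longrightarrow> Y a \<in> gevrey_series s" "\<And>a. a \<le> n \<Longrightarrow> val_ge (Y a) (g1.\<gamma> a)"
    "\<And>a. a \<le> n \<Longrightarrow> val_ge (Y a) (g1.\<eta> a + \<epsilon>)" "\<And>a. a \<le> n \<Longrightarrow> Y a = g1.F Y a"
    using g1.solution by blast
  obtain Z where Z: "\<And>a. a \<le> n \<Longrightarrow> Z a \<in> gevrey_series s" "\<And>a. a \<le> n \<Longrightarrow> val_ge (Z a) (g2.\<gamma> a)"
    "\<And>a. a \<le> n \<Longrightarrow> val_ge (Z a) (g2.\<eta> a + \<epsilon>)" "\<And>a. a \<le> n \<Longrightarrow> Z a = g2.F Z a"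
    using g2.solution by blast
  interpret cs: companion_splitting K n r b Y Z "1 + 1 / s" "1 + \<mu>" \<epsilon>
  proof -
    interpret fls_subfield K by (rule K)
    show "companion_splitting K n r b Y Z (1 + 1 / s) (1 + \<mu>) \<epsilon>"
    proof unfold_locales
      fix a assume a: "a \<le> n"
      show "Y a = (if a = r then 0 else b a / b r)
        + (\<Sum>b\<le>n. \<Sum>c\<le>n. if a + r \<le> b + c
          then fls_const (k1 r a b c) * (Y b * (fls_deriv ^^ (b + c - (a + r))) (Y c)) else 0)"
        by (subst Y(4)[OF a]) (simp add: g1.F_def p_def cong: if_cong)
      show "Z a = (if a = r then 0 else b a / b r)
        + (\<Sum>b\<le>n. \<Sum>c\<le>n. if a + r \<le> b + c
          then fls_const (k2 r a b c) * (Z b * (fls_deriv ^^ (b + c - (a + r))) (Z c)) else 0)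
        + (\<Sum>c\<le>n. if a < c then fls_const (k2' r a c) * (fls_deriv ^^ (c - a)) (Z c) else 0)"
        by (subst Z(4)[OF a]) (simp add: g2.F_def p_def)
      show "val_ge (Y a) ((1 + 1 / s) * (real a - real r))" "val_ge (Y a) ((1 + \<mu>) * (real a - real r) + \<epsilon>)"
        using Y(2,3)[OF a] by (simp_all add: g1.\<gamma>_def g1.\<eta>_def)
      show "val_ge (Z a) ((1 + 1 / s) * (real a - real r))" "val_ge (Z a) ((1 + \<mu>) * (real a - real r) + \<epsilon>)"
        using Z(2,3)[OF a] by (simp_all add: g2.\<gamma>_def g2.\<eta>_def)
    qed (use s \<mu> \<epsilon> n b Y(1) Z(1) gevrey_series_deriv[OF s] in \<open>auto simp: K_def\<close>)
  qed
  have Y\<mu>: "val_ge (Y k) ((1 + \<mu>) * (real k - real r))" and Z\<mu>: "val_ge (Z k) ((1 + \<mu>) * (real k - real r))"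
    if "k \<le> n" for k
    using val_ge_mono[OF cs.Y_\<tau>[OF that], of "(1 + \<mu>) * (real k - real r)"]
      val_ge_mono[OF cs.Z_\<tau>[OF that], of "(1 + \<mu>) * (real k - real r)"] \<epsilon> by simp_all
  show thesis
  proof (rule that[of cs.E])
    show "slow_vec D (1 + min (1 / s) \<mu>) (cs.E y)" for y
      unfolding D_def
    proof (rule cs.E_slow)
      fix c assume "c < r"
      then have "c \<le> n" using n by simp
      then show "val_ge (Z c) ((1 + min (1 / s) \<mu>) * (real c - real r))"
        using cs.Z_\<sigma>[of c] Z\<mu>[of c] by (simp add: min_def)
    qed (use s \<mu> in auto)
    show "y = 0" if "y \<in> vecs n UNIV" "cs.E y = 0" "slow_vec D \<theta> y" "\<theta> < 1 + max (1 / s) \<mu>" for y \<theta>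
    proof (rule cs.kernel_not_slow)
      show "val_ge (Y k) ((1 + max (1 / s) \<mu>) * (real k - real r))" if "k \<le> n" for k
        using cs.Y_\<sigma>[OF that] Y\<mu>[OF that] by (simp add: max_def)
    qed (use that s \<mu> in \<open>auto simp: D_def\<close>)
  qed (auto simp: D_def cs.E_add cs.E_smul cs.E_vecs cs.E_vecs_UNIV cs.E_E cs.E_D intro: cs.E_nonzero cs.E_not_identity)
qed

text \<open>How far the corner contributed by \<open>b i\<close> lies above the line of slope
  \<kappa> through the origin.\<close>

definition height :: "(nat \<Rightarrow> complex fls) \<Rightarrow> real \<Rightarrow> nat \<Rightarrow> real" where
  "height b \<kappa> i = real_of_int (fls_subdegree (b i)) - real i - \<kappa> * real i"

text \<open>Only finitely many heights occur, so the least one is isolated; the leading coefficient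
  1 ensures that there is one.\<close>

lemma height_gap:
  assumes "b n = 1"
  obtains m d where "d > 0" "\<exists>i\<le>n. b i \<noteq> 0 \<and> height b \<kappa> i = m"
    "\<And>i. i \<le> n \<Longrightarrow> b i \<noteq> 0 \<Longrightarrow> height b \<kappa> i = m \<or> m + d \<le> height b \<kappa> i"
proof -
  define A where "A = {i. i \<le> n \<and> b i \<noteq> 0}"
  define m where "m = Min (height b \<kappa> ` A)"
  define H where "H = {h \<in> height b \<kappa> ` A. h > m}"
  \<comment> \<open>If all heights agree, any positive gap will do.\<close>
  define d where "d = (if H = {} then 1 else Min H - m)"
  have A: "finite A" "A \<noteq> {}" using assms by (auto simp: A_def)
  have H: "finite H" using A by (simp add: H_def)
  have "d > 0" using H Min_in[OF H] by (auto simp: d_def H_def)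
  moreover have "m \<in> height b \<kappa> ` A" unfolding m_def using A by (intro Min_in) auto
  then have "\<exists>i\<le>n. b i \<noteq> 0 \<and> height b \<kappa> i = m" by (auto simp: A_def)
  moreover have "height b \<kappa> i = m \<or> m + d \<le> height b \<kappa> i" if "i \<le> n" "b i \<noteq> 0" for i
  proof -
    have i: "height b \<kappa> i \<in> height b \<kappa> ` A" using that by (auto simp: A_def)
    then have "m \<le> height b \<kappa> i" unfolding m_def using A by (intro Min_le) auto
    moreover have "m + d \<le> height b \<kappa> i" if "m < height b \<kappa> i"
    proof -
      have "height b \<kappa> i \<in> H" using i that by (simp add: H_def)
      then show ?thesis using Min_le[OF H, of "height b \<kappa> i"] by (auto simp: d_def)
    qed
    ultimately show ?thesis by force
  qed
  ultimately show thesis using that by blast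
qed

lemma val_quotient:
  assumes "b r \<noteq> 0" "b a \<noteq> 0 \<Longrightarrow> c \<le> height b \<kappa> a - height b \<kappa> r + (1 + \<kappa>) * (real a - real r)"
  shows "val_ge (b a / b r) c"
proof (cases "b a = 0")
  case False
  then have "fls_subdegree (b a / b r) = fls_subdegree (b a) - fls_subdegree (b r)"
    using assms(1) by (simp add: fls_divide_subdegree)
  moreover have "b a / b r \<noteq> 0" using False assms(1) by simp
  ultimately show ?thesis using assms(2)[OF False] by (simp add: val_ge_iff height_def algebra_simps)
qed simp

text \<open>
  The vertex where a supporting line of slope \<open>\<kappa>\<close> leaves the polygon. Tilting the line slightly makes
  the vertex strictly dominant.
\<close>
lemma last_vertex:
  assumes b: "b n = 1" and "\<kappa> > 0"
  obtains r \<mu> \<epsilon> where "r \<le> n" "b r \<noteq> 0" "\<mu> > \<kappa>" "\<epsilon> > 0"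
    "\<And>a. a \<le> n \<Longrightarrow> a \<noteq> r \<Longrightarrow> val_ge (b a / b r) ((1 + \<kappa>) * (real a - real r))"
    "\<And>a. a \<le> n \<Longrightarrow> a \<noteq> r \<Longrightarrow> val_ge (b a / b r) ((1 + \<mu>) * (real a - real r) + \<epsilon>)"
    "\<And>i. i \<le> n \<Longrightarrow> b i \<noteq> 0 \<Longrightarrow> height b \<kappa> r \<le> height b \<kappa> i"
    "\<And>i. i \<le> n \<Longrightarrow> b i \<noteq> 0 \<Longrightarrow> r < i \<Longrightarrow> height b \<kappa> r < height b \<kappa> i"
proof -
  obtain m d where d: "d > 0" and ex: "\<exists>i\<le>n. b i \<noteq> 0 \<and> height b \<kappa> i = m"
    and gap: "\<And>i. i \<le> n \<Longrightarrow> b i \<noteq> 0 \<Longrightarrow> height b \<kappa> i = m \<or> m + d \<le> height b \<kappa> i"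
    using height_gap[of b n \<kappa>, OF b] by metis
  have ge: "m \<le> height b \<kappa> i" if "i \<le> n" "b i \<noteq> 0" for i
    using gap[OF that] d by linarith
  define R where "R = {i. i \<le> n \<and> b i \<noteq> 0 \<and> height b \<kappa> i = m}"
  define r where "r = Max R"
  have R: "finite R" "R \<noteq> {}" using ex by (auto simp: R_def)
  have "r \<in> R" unfolding r_def by (rule Max_in[OF R])
  then have r: "r \<le> n" "b r \<noteq> 0" "height b \<kappa> r = m" by (auto simp: R_def)
  have above: "m + d \<le> height b \<kappa> i" if "i \<le> n" "b i \<noteq> 0" "r < i" for i
  proof -
    have "i \<notin> R" using Max_ge[OF R(1), of i] that by (auto simp: r_def)
    then show ?thesis using gap[of i] that by (auto simp: R_def)
  qed
  \<comment> \<open>The tilt moves the line by at most \<delta> n, hence d / 2, at any vertex; the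
    other half of d pays for the strict gain \<delta>.\<close>
  define \<delta> where "\<delta> = d / (2 * (real n + 1))"
  have \<delta>: "\<delta> > 0" "\<delta> * real n \<le> d / 2" "\<delta> \<le> d / 2" using d by (auto simp: \<delta>_def field_simps)
  show thesis
  proof (rule that[of r "\<kappa> + \<delta>" \<delta>])
    show "val_ge (b a / b r) ((1 + \<kappa>) * (real a - real r))" if "a \<le> n" "a \<noteq> r" for a
    proof (rule val_quotient[of _ _ _ _ \<kappa>])
      assume "b a \<noteq> 0"
      then show "(1 + \<kappa>) * (real a - real r) \<le> height b \<kappa> a - height b \<kappa> r + (1 + \<kappa>) * (real a - real r)"
        using ge[OF that(1)] r(3) by simp
    qed (rule r)
    show "val_ge (b a / b r) ((1 + (\<kappa> + \<delta>)) * (real a - real r) + \<delta>)" if a: "a \<le> n" "a \<noteq> r" for a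
    proof (rule val_quotient[of _ _ _ _ \<kappa>])
      assume ba: "b a \<noteq> 0"
      have tilt: "(1 + (\<kappa> + \<delta>)) * (real a - real r) = (1 + \<kappa>) * (real a - real r) + \<delta> * (real a - real r)"
        by (simp add: algebra_simps)
      show "(1 + (\<kappa> + \<delta>)) * (real a - real r) + \<delta> \<le> height b \<kappa> a - height b \<kappa> r + (1 + \<kappa>) * (real a - real r)"
      proof (cases "a < r")
        case True
        then have "\<delta> * (real a - real r) \<le> \<delta> * (- 1)" using \<delta> by (intro mult_left_mono) auto
        then show ?thesis unfolding tilt using ge[OF a(1) ba] r(3) by linarith
      next
        case False
        have "\<delta> * (real a - real r) \<le> \<delta> * real n" using \<delta> a False by (intro mult_left_mono) auto
        moreover have "m + d \<le> height b \<kappa> a" using False a by (intro above[OF a(1) ba]) simp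
        ultimately show ?thesis unfolding tilt using r(3) \<delta> by linarith
      qed
    qed (rule r)
    show "height b \<kappa> r \<le> height b \<kappa> i" if "i \<le> n" "b i \<noteq> 0" for i
      using ge[OF that] r(3) by linarith
    show "height b \<kappa> r < height b \<kappa> i" if "i \<le> n" "b i \<noteq> 0" "r < i" for i
      using above[OF that] r(3) d by linarith
  qed (use r \<delta> in auto)
qed

text \<open>The mirror image of \<open>last_vertex\<close>: the line is tilted towards smaller
  slopes, so that the vertices after r are lifted by the tilt and those before r by the gap of
  heights.\<close>

lemma first_vertex:
  assumes b: "b n = 1" and \<kappa>: "\<kappa> > 0"
  obtains r \<mu> \<epsilon> where "r \<le> n" "b r \<noteq> 0" "0 < \<mu>" "\<mu> < \<kappa>" "\<epsilon> > 0"
    "\<And>a. a \<le> n \<Longrightarrow> a \<noteq> r \<Longrightarrow> val_ge (b a / b r) ((1 + \<kappa>) * (real a - real r))"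
    "\<And>a. a \<le> n \<Longrightarrow> a \<noteq> r \<Longrightarrow> val_ge (b a / b r) ((1 + \<mu>) * (real a - real r) + \<epsilon>)"
    "\<And>i. i \<le> n \<Longrightarrow> b i \<noteq> 0 \<Longrightarrow> height b \<kappa> r \<le> height b \<kappa> i"
    "\<And>i. i \<le> n \<Longrightarrow> b i \<noteq> 0 \<Longrightarrow> i < r \<Longrightarrow> height b \<kappa> r < height b \<kappa> i"
proof -
  obtain m d where d: "d > 0" and ex: "\<exists>i\<le>n. b i \<noteq> 0 \<and> height b \<kappa> i = m"
    and gap: "\<And>i. i \<le> n \<Longrightarrow> b i \<noteq> 0 \<Longrightarrow> height b \<kappa> i = m \<or> m + d \<le> height b \<kappa> i"
    using height_gap[of b n \<kappa>, OF b] by metis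
  have ge: "m \<le> height b \<kappa> i" if "i \<le> n" "b i \<noteq> 0" for i
    using gap[OF that] d by linarith
  define R where "R = {i. i \<le> n \<and> b i \<noteq> 0 \<and> height b \<kappa> i = m}"
  define r where "r = Min R"
  have R: "finite R" "R \<noteq> {}" using ex by (auto simp: R_def)
  have "r \<in> R" unfolding r_def by (rule Min_in[OF R])
  then have r: "r \<le> n" "b r \<noteq> 0" "height b \<kappa> r = m" by (auto simp: R_def)
  have below: "m + d \<le> height b \<kappa> i" if "i \<le> n" "b i \<noteq> 0" "i < r" for i
  proof -
    have "i \<notin> R" using Min_le[OF R(1), of i] that by (auto simp: r_def)
    then show ?thesis using gap[of i] that by (auto simp: R_def)
  qed
  \<comment> \<open>At most \<kappa> / 2 as well, so that the tilted slope stays positive.\<close>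
  define \<delta> where "\<delta> = min (\<kappa> / 2) (d / (2 * (real n + 1)))"
  have "\<delta> * real n \<le> d / (2 * (real n + 1)) * real n" by (intro mult_right_mono) (auto simp: \<delta>_def)
  also have "\<dots> \<le> d / 2" using d by (auto simp: field_simps)
  finally have \<delta>: "\<delta> > 0" "\<delta> < \<kappa>" "\<delta> * real n \<le> d / 2" using d \<kappa> by (auto simp: \<delta>_def)
  have "d / (2 * (real n + 1)) \<le> d / 2" using d by (auto simp: field_simps)
  moreover have "\<delta> \<le> d / (2 * (real n + 1))" by (simp add: \<delta>_def)
  ultimately have \<delta>2: "\<delta> \<le> d / 2" by linarith
  show thesis
  proof (rule that[of r "\<kappa> - \<delta>" \<delta>])
    show "val_ge (b a / b r) ((1 + \<kappa>) * (real a - real r))" if "a \<le> n" "a \<noteq> r" for a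
    proof (rule val_quotient[of _ _ _ _ \<kappa>])
      assume "b a \<noteq> 0"
      then show "(1 + \<kappa>) * (real a - real r) \<le> height b \<kappa> a - height b \<kappa> r + (1 + \<kappa>) * (real a - real r)"
        using ge[OF that(1)] r(3) by simp
    qed (rule r)
    show "val_ge (b a / b r) ((1 + (\<kappa> - \<delta>)) * (real a - real r) + \<delta>)" if a: "a \<le> n" "a \<noteq> r" for a
    proof (rule val_quotient[of _ _ _ _ \<kappa>])
      assume ba: "b a \<noteq> 0"
      have tilt: "(1 + (\<kappa> - \<delta>)) * (real a - real r) = (1 + \<kappa>) * (real a - real r) + \<delta> * (real r - real a)"
        by (simp add: algebra_simps)
      show "(1 + (\<kappa> - \<delta>)) * (real a - real r) + \<delta> \<le> height b \<kappa> a - height b \<kappa> r + (1 + \<kappa>) * (real a - real r)"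
      proof (cases "r < a")
        case True
        then have "\<delta> * (real r - real a) \<le> \<delta> * (- 1)" using \<delta> by (intro mult_left_mono) auto
        then show ?thesis unfolding tilt using ge[OF a(1) ba] r(3) by linarith
      next
        case False
        have "\<delta> * (real r - real a) \<le> \<delta> * real n" using \<delta> r by (intro mult_left_mono) auto
        moreover have "m + d \<le> height b \<kappa> a" using False a by (intro below[OF a(1) ba]) simp
        ultimately show ?thesis unfolding tilt using r(3) \<delta> \<delta>2 by linarith
      qed
    qed (rule r)
    show "height b \<kappa> r \<le> height b \<kappa> i" if "i \<le> n" "b i \<noteq> 0" for i
      using ge[OF that] r(3) by linarith
    show "height b \<kappa> r < height b \<kappa> i" if "i \<le> n" "b i \<noteq> 0" "i < r" for i
      using below[OF that] r(3) d by linarith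
  qed (use r \<delta> in auto)
qed

section \<open>Slopes seen from a supporting line\<close>

lemma newton_polygon_subset:
  assumes "convex C" "\<And>i u v. i \<le> n \<Longrightarrow> b i \<noteq> 0 \<Longrightarrow> 0 \<le> u \<Longrightarrow> u \<le> real i \<Longrightarrow>
      height b 0 i \<le> v \<Longrightarrow> (u, v) \<in> C"
  shows "newton_polygon n b \<subseteq> C"
  unfolding newton_polygon_def using assms by (intro hull_minimal) (auto simp: height_def)

lemma newton_polygon_vertex: "i \<le> n \<Longrightarrow> b i \<noteq> 0 \<Longrightarrow> (real i, height b 0 i) \<in> newton_polygon n b"
  unfolding newton_polygon_def by (rule hull_inc) (auto simp: height_def)

lemma height_split: "height b \<kappa> i = height b 0 i - \<kappa> * real i"
  by (simp add: height_def)

lemma convex_lexicographic_halfplane: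
  fixes a c \<kappa> d :: real
  shows "convex {(x, y). a * x \<le> d \<and> c \<le> y - \<kappa> * x \<and> (a * x = d \<or> c < y - \<kappa> * x)}" (is "convex ?C")
proof (rule convexI)
  fix p q :: "real \<times> real" and u v :: real
  assume p: "p \<in> ?C" and q: "q \<in> ?C" and uv: "0 \<le> u" "0 \<le> v" "u + v = 1"
  obtain x1 y1 x2 y2 where pq: "p = (x1, y1)" "q = (x2, y2)" by fastforce
  define g1 where "g1 = y1 - \<kappa> * x1 - c"
  define g2 where "g2 = y2 - \<kappa> * x2 - c"
  define h1 where "h1 = d - a * x1"
  define h2 where "h2 = d - a * x2"
  have P: "0 \<le> h1" "0 \<le> g1" "h1 = 0 \<or> 0 < g1" using p by (auto simp: pq g1_def h1_def)
  have Q: "0 \<le> h2" "0 \<le> g2" "h2 = 0 \<or> 0 < g2" using q by (auto simp: pq g2_def h2_def)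
  have v: "v = 1 - u" using uv by simp
  have H: "d - a * (u * x1 + v * x2) = u * h1 + v * h2"
    by (simp add: h1_def h2_def v algebra_simps)
  have G: "(u * y1 + v * y2) - \<kappa> * (u * x1 + v * x2) - c = u * g1 + v * g2"
    by (simp add: g1_def g2_def v algebra_simps)
  have pos: "0 \<le> u * h1" "0 \<le> v * h2" "0 \<le> u * g1" "0 \<le> v * g2" using uv P Q by auto
  have "u * h1 + v * h2 = 0 \<or> 0 < u * g1 + v * g2"
  proof (rule ccontr)
    assume "\<not> ?thesis"
    then have *: "u * h1 + v * h2 \<noteq> 0" "u * g1 = 0" "v * g2 = 0" using pos by linarith+
    then have "u * h1 = 0" "v * h2 = 0" using P Q by auto
    with * show False by simp
  qed
  then show "u *\<^sub>R p + v *\<^sub>R q \<in> ?C"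
    using H G pos by (auto simp: pq)
qed

lemma polygon_slopesE:
  assumes "\<sigma> \<in> polygon_slopes P"
  obtains p q where "p \<in> P" "q \<in> P" "fst p < fst q" "snd q - snd p = \<sigma> * (fst q - fst p)"
    "\<And>x. x \<in> P \<Longrightarrow> \<sigma> * (fst x - fst p) \<le> snd x - snd p"
  using assms unfolding polygon_slopes_def by blast

text \<open>If n were the vertex, the polygon would lie left of it and above the line of slope
  \<kappa> through it. The supporting line of a steeper edge would then pass above the
  vertex.\<close>

lemma slopes_above_imp_last_vertex_less:
  assumes b: "b n = 1" and r: "r \<le> n" and \<sigma>: "\<sigma> \<in> polygon_slopes (newton_polygon n b)" "\<sigma> > \<kappa>"
    and \<kappa>: "\<kappa> > 0" and min: "\<And>i. i \<le> n \<Longrightarrow> b i \<noteq> 0 \<Longrightarrow> height b \<kappa> r \<le> height b \<kappa> i"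
  shows "r < n"
proof (rule ccontr)
  assume "\<not> r < n"
  then have rn: "r = n" using r by simp
  let ?C = "{(x, y). x \<le> real n \<and> height b \<kappa> n \<le> y - \<kappa> * x}"
  have "convex ?C"
  proof -
    have "?C = {p. (1, 0) \<bullet> p \<le> real n} \<inter> {p. (- \<kappa>, 1) \<bullet> p \<ge> height b \<kappa> n}"
      by (auto simp: inner_prod_def)
    then show ?thesis by (simp only: convex_Int convex_halfspace_le convex_halfspace_ge)
  qed
  moreover have "(u, v) \<in> ?C" if "i \<le> n" "b i \<noteq> 0" "0 \<le> u" "u \<le> real i" "height b 0 i \<le> v" for i u v
  proof -
    have "\<kappa> * u \<le> \<kappa> * real i" using that \<kappa> by (intro mult_left_mono) auto
    then show ?thesis using that min[of i] by (auto simp: rn height_split[of b \<kappa> i])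
  qed
  ultimately have sub: "newton_polygon n b \<subseteq> ?C" by (rule newton_polygon_subset)
  obtain p q where pq: "p \<in> newton_polygon n b" "q \<in> newton_polygon n b" "fst p < fst q"
    and slope: "snd q - snd p = \<sigma> * (fst q - fst p)"
    and supp: "\<And>x. x \<in> newton_polygon n b \<Longrightarrow> \<sigma> * (fst x - fst p) \<le> snd x - snd p"
    using polygon_slopesE[OF \<sigma>(1)] by metis
  have "\<sigma> * (real n - fst p) \<le> height b 0 n - snd p"
    using supp[OF newton_polygon_vertex[of n n b]] b by simp
  also have "\<dots> \<le> \<kappa> * (real n - fst p)"
    using subsetD[OF sub pq(1)] by (auto simp: height_split[of b \<kappa> n] algebra_simps)
  finally have "\<sigma> * (real n - fst p) \<le> \<kappa> * (real n - fst p)" .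
  moreover have "fst p < real n" using subsetD[OF sub pq(2)] pq(3) by auto
  ultimately show False using \<sigma>(2) by simp
qed

text \<open>The same argument, with the left end of the edge strictly above the line since it lies
  left of n; so an edge of slope exactly \<kappa> is excluded too.\<close>

lemma slopes_ge_imp_first_vertex_less:
  assumes b: "b n = 1" and r: "r \<le> n" and \<sigma>: "\<sigma> \<in> polygon_slopes (newton_polygon n b)" "\<sigma> \<ge> \<kappa>"
    and \<kappa>: "\<kappa> > 0" and min: "\<And>i. i \<le> n \<Longrightarrow> b i \<noteq> 0 \<Longrightarrow> i < r \<Longrightarrow> height b \<kappa> r < height b \<kappa> i"
  shows "r < n"
proof (rule ccontr)
  assume "\<not> r < n"
  then have rn: "r = n" using r by simp
  let ?C = "{(x, y). 1 * x \<le> real n \<and> height b \<kappa> n \<le> y - \<kappa> * x \<and> (1 * x = real n \<or> height b \<kappa> n < y - \<kappa> * x)}"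
  have "(u, v) \<in> ?C" if "i \<le> n" "b i \<noteq> 0" "0 \<le> u" "u \<le> real i" "height b 0 i \<le> v" for i u v
  proof (cases "i < n")
    case True
    have "\<kappa> * u \<le> \<kappa> * real i" using that \<kappa> by (intro mult_left_mono) auto
    then show ?thesis using that True min[of i] by (auto simp: rn height_split[of b \<kappa> i])
  next
    case False
    then have i: "i = n" using that by simp
    have "\<kappa> * u < \<kappa> * real n" if "u \<noteq> real n" using that \<open>u \<le> real i\<close> \<kappa> i by simp
    then show ?thesis using that by (cases "u = real n") (auto simp: i height_split[of b \<kappa> n])
  qed
  then have sub: "newton_polygon n b \<subseteq> ?C"
    by (rule newton_polygon_subset[OF convex_lexicographic_halfplane])
  obtain p q where pq: "p \<in> newton_polygon n b" "q \<in> newton_polygon n b" "fst p < fst q"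
    and slope: "snd q - snd p = \<sigma> * (fst q - fst p)"
    and supp: "\<And>x. x \<in> newton_polygon n b \<Longrightarrow> \<sigma> * (fst x - fst p) \<le> snd x - snd p"
    using polygon_slopesE[OF \<sigma>(1)] by metis
  have less: "fst p < real n" using subsetD[OF sub pq(2)] pq(3) by auto
  have "\<sigma> * (real n - fst p) \<le> height b 0 n - snd p"
    using supp[OF newton_polygon_vertex[of n n b]] b by simp
  also have "\<dots> < \<kappa> * (real n - fst p)"
    using subsetD[OF sub pq(1)] less by (auto simp: height_split[of b \<kappa> n] algebra_simps)
  finally have "\<sigma> * (real n - fst p) < \<kappa> * (real n - fst p)" .
  then show False using \<sigma>(2) less by (simp add: mult_less_cancel_right)
qed

text \<open>Reflected: if the vertex were at abscissa 0, the right end of a flatter edge would fall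
  below the line of slope \<kappa>.\<close>

lemma slopes_below_imp_first_vertex_pos:
  assumes \<sigma>: "\<sigma> \<in> polygon_slopes (newton_polygon n b)" "\<sigma> < \<kappa>" and br: "b r \<noteq> 0"
    and \<kappa>: "\<kappa> > 0" and min: "\<And>i. i \<le> n \<Longrightarrow> b i \<noteq> 0 \<Longrightarrow> height b \<kappa> r \<le> height b \<kappa> i"
  shows "r > 0"
proof (rule ccontr)
  assume "\<not> r > 0"
  then have r0: "r = 0" by simp
  let ?C = "{(x, y). 0 \<le> x \<and> height b \<kappa> 0 \<le> y - \<kappa> * x}"
  have "convex ?C"
  proof -
    have "?C = {p. (1, 0) \<bullet> p \<ge> 0} \<inter> {p. (- \<kappa>, 1) \<bullet> p \<ge> height b \<kappa> 0}"
      by (auto simp: inner_prod_def)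
    then show ?thesis by (simp only: convex_Int convex_halfspace_le convex_halfspace_ge)
  qed
  moreover have "(u, v) \<in> ?C" if "i \<le> n" "b i \<noteq> 0" "0 \<le> u" "u \<le> real i" "height b 0 i \<le> v" for i u v
  proof -
    have "\<kappa> * u \<le> \<kappa> * real i" using that \<kappa> by (intro mult_left_mono) auto
    then show ?thesis using that min[of i] by (auto simp: r0 height_split[of b \<kappa> i])
  qed
  ultimately have sub: "newton_polygon n b \<subseteq> ?C" by (rule newton_polygon_subset)
  obtain p q where pq: "p \<in> newton_polygon n b" "q \<in> newton_polygon n b" "fst p < fst q"
    and slope: "snd q - snd p = \<sigma> * (fst q - fst p)"
    and supp: "\<And>x. x \<in> newton_polygon n b \<Longrightarrow> \<sigma> * (fst x - fst p) \<le> snd x - snd p"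
    using polygon_slopesE[OF \<sigma>(1)] by metis
  have "\<sigma> * (0 - fst p) \<le> height b 0 0 - snd p"
    using supp[OF newton_polygon_vertex[of 0 n b]] br r0 by simp
  then have "snd q \<le> height b 0 0 + \<sigma> * fst q" using slope by (simp add: algebra_simps)
  moreover have "0 < fst q" "height b 0 0 + \<kappa> * fst q \<le> snd q"
    using subsetD[OF sub pq(1)] subsetD[OF sub pq(2)] pq(3) by (auto simp: height_split[of b \<kappa> 0])
  ultimately have "\<kappa> * fst q \<le> \<sigma> * fst q" by linarith
  then show False using \<sigma>(2) \<open>0 < fst q\<close> by simp
qed

lemma slopes_le_imp_last_vertex_pos:
  assumes \<sigma>: "\<sigma> \<in> polygon_slopes (newton_polygon n b)" "\<sigma> \<le> \<kappa>" and br: "b r \<noteq> 0"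
    and \<kappa>: "\<kappa> > 0" and min: "\<And>i. i \<le> n \<Longrightarrow> b i \<noteq> 0 \<Longrightarrow> r < i \<Longrightarrow> height b \<kappa> r < height b \<kappa> i"
  shows "r > 0"
proof (rule ccontr)
  assume "\<not> r > 0"
  then have r0: "r = 0" by simp
  let ?C = "{(x, y). - 1 * x \<le> 0 \<and> height b \<kappa> 0 \<le> y - \<kappa> * x \<and> (- 1 * x = 0 \<or> height b \<kappa> 0 < y - \<kappa> * x)}"
  have "(u, v) \<in> ?C" if "i \<le> n" "b i \<noteq> 0" "0 \<le> u" "u \<le> real i" "height b 0 i \<le> v" for i u v
  proof (cases "0 < i")
    case True
    have "\<kappa> * u \<le> \<kappa> * real i" using that \<kappa> by (intro mult_left_mono) auto
    then show ?thesis using that True min[of i] by (auto simp: r0 height_split[of b \<kappa> i])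
  next
    case False
    then show ?thesis using that by (auto simp: height_split[of b \<kappa> 0])
  qed
  then have sub: "newton_polygon n b \<subseteq> ?C"
    by (rule newton_polygon_subset[OF convex_lexicographic_halfplane])
  obtain p q where pq: "p \<in> newton_polygon n b" "q \<in> newton_polygon n b" "fst p < fst q"
    and slope: "snd q - snd p = \<sigma> * (fst q - fst p)"
    and supp: "\<And>x. x \<in> newton_polygon n b \<Longrightarrow> \<sigma> * (fst x - fst p) \<le> snd x - snd p"
    using polygon_slopesE[OF \<sigma>(1)] by metis
  have "\<sigma> * (0 - fst p) \<le> height b 0 0 - snd p"
    using supp[OF newton_polygon_vertex[of 0 n b]] br r0 by simp
  then have "snd q \<le> height b 0 0 + \<sigma> * fst q" using slope by (simp add: algebra_simps)
  moreover have "0 < fst q" "height b 0 0 + \<kappa> * fst q < snd q"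
    using subsetD[OF sub pq(1)] subsetD[OF sub pq(2)] pq(3) by (auto simp: height_split[of b \<kappa> 0])
  ultimately have "\<kappa> * fst q < \<sigma> * fst q" by linarith
  then show False using \<sigma>(2) \<open>0 < fst q\<close> by (simp add: mult_less_cancel_right)
qed

lemma newton_polygon_0: "b 0 \<noteq> 0 \<Longrightarrow> polygon_slopes (newton_polygon 0 b) = {}"
proof -
  have "newton_polygon 0 b \<subseteq> {(x, y). x = 0}"
    by (rule newton_polygon_subset) (auto simp: convex_def)
  then have "fst p = 0" if "p \<in> newton_polygon 0 b" for p
    using that by (cases p) auto
  then have "\<sigma> \<notin> polygon_slopes (newton_polygon 0 b)" for \<sigma>
    by (metis polygon_slopesE less_irrefl)
  then show ?thesis by blast
qed

subsection \<open>Connections in coordinates\<close>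

lemma fls_subring_simps [simp]:
  "carrier (fls_subring S) = S" "x \<otimes>\<^bsub>fls_subring S\<^esub> y = x * y" "\<one>\<^bsub>fls_subring S\<^esub> = 1"
  "\<zero>\<^bsub>fls_subring S\<^esub> = 0" "x \<oplus>\<^bsub>fls_subring S\<^esub> y = x + y"
  by (auto simp: fls_subring_def)

lemma fls_subfield_of_field:
  assumes "field (fls_subring S)"
  shows "fls_subfield S"
proof -
  interpret R: field "fls_subring S" by (rule assms)
  show ?thesis
  proof
    show "0 \<in> S" "1 \<in> S" using R.zero_closed R.one_closed by simp_all
    show "a + b \<in> S" "a * b \<in> S" if "a \<in> S" "b \<in> S" for a b
      using R.a_closed[of a b] R.m_closed[of a b] that by simp_all
    show "- a \<in> S" if "a \<in> S" for a
    proof -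
      have "a + (\<ominus>\<^bsub>fls_subring S\<^esub> a) = 0" using R.r_neg[of a] that by simp
      then have "\<ominus>\<^bsub>fls_subring S\<^esub> a = - a" by (simp add: eq_neg_iff_add_eq_0 add.commute)
      then show ?thesis using R.a_inv_closed[of a] that by simp
    qed
    show "inverse a \<in> S" if "a \<in> S" for a
    proof (cases "a = 0")
      case False
      then have u: "a \<in> Units (fls_subring S)" using that by (simp add: R.field_Units)
      have "a * (inv\<^bsub>fls_subring S\<^esub> a) = 1" using R.Units_r_inv[OF u] by simp
      then have "inv\<^bsub>fls_subring S\<^esub> a = inverse a" using inverse_unique by metis
      then show ?thesis using R.Units_inv_closed[OF u] by simp
    qed (use that in simp)
  qed
qed

definition coords :: "complex fls set \<Rightarrow> (complex fls, 'v, 'm) module_scheme \<Rightarrow> nat \<Rightarrow>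
    ('v \<Rightarrow> nat \<Rightarrow> complex fls) \<Rightarrow> bool" where
  "coords S V n \<phi> \<longleftrightarrow> bij_betw \<phi> (carrier V) (vecs n S) \<and>
     (\<forall>v\<in>carrier V. \<forall>w\<in>carrier V. \<phi> (v \<oplus>\<^bsub>V\<^esub> w) = \<phi> v + \<phi> w) \<and>
     (\<forall>a\<in>S. \<forall>v\<in>carrier V. \<phi> (a \<odot>\<^bsub>V\<^esub> v) = smul a (\<phi> v))"

definition coord_conn :: "complex fls set \<Rightarrow> (complex fls, 'v, 'm) module_scheme \<Rightarrow> ('v \<Rightarrow> 'v) \<Rightarrow>
    nat \<Rightarrow> (nat \<Rightarrow> nat \<Rightarrow> complex fls) \<Rightarrow> ('v \<Rightarrow> nat \<Rightarrow> complex fls) \<Rightarrow> bool" where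
  "coord_conn S V nabla n A \<phi> \<longleftrightarrow> coords S V n \<phi> \<and> (\<forall>i<n. \<forall>j<n. A i j \<in> S) \<and>
     (\<forall>v\<in>carrier V. \<phi> (nabla v) = conn n A (\<phi> v))"

lemma coords_exist:
  assumes V: "vectorspace (fls_subring S) V" and fd: "vectorspace.fin_dim (fls_subring S) V"
  shows "\<exists>n \<phi>. coords S V n \<phi>"
proof -
  interpret V: vectorspace "fls_subring S" V by (rule V)
  obtain B where B: "finite B" "V.basis B" using V.finite_basis_exists[OF fd] by blast
  have BC: "B \<subseteq> carrier V" using B(2) by (simp add: V.basis_def)
  have crit: "\<exists>!a. a \<in> B \<rightarrow>\<^sub>E S \<and> V.lincomb a B = v" if "v \<in> carrier V" for v
    using V.basis_criterion[OF B(1) BC] B(2) that by simp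
  define n where "n = card B"
  obtain e where e: "bij_betw e {0..<n} B" using ex_bij_betw_nat_finite[OF B(1)] by (auto simp: n_def)
  define g where "g = the_inv_into {0..<n} e"
  have ge: "g (e i) = i" if "i < n" for i
    using e that by (auto simp: g_def bij_betw_def intro!: the_inv_into_f_f)
  have eg: "e (g v) = v" "g v < n" if "v \<in> B" for v
    using e that f_the_inv_into_f[of e "{0..<n}" v] the_inv_into_into[of e "{0..<n}" v "{0..<n}"]
    by (auto simp: g_def bij_betw_def)
  define \<psi> where "\<psi> y = V.lincomb (\<lambda>v. y (g v)) B" for y :: "nat \<Rightarrow> complex fls"
  have mem: "(\<lambda>v. y (g v)) \<in> B \<rightarrow> S" if "y \<in> vecs n S" for y
    using that eg(2) by (auto simp: vecs_def)
  have sf: "fls_subfield S" by (rule fls_subfield_of_field) (rule V.field_axioms)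
  have \<psi>C: "\<psi> y \<in> carrier V" if "y \<in> vecs n S" for y
    unfolding \<psi>_def by (rule V.lincomb_closed) (use BC mem[OF that] in auto)
  have restr: "V.lincomb (restrict a B) B = V.lincomb a B" if "a \<in> B \<rightarrow> S" for a
    unfolding V.lincomb_def by (rule V.finsum_cong') (use BC that in \<open>auto intro!: V.smult_closed\<close>)
  have \<psi>add: "\<psi> (y + z) = \<psi> y \<oplus>\<^bsub>V\<^esub> \<psi> z" if "y \<in> vecs n S" "z \<in> vecs n S" for y z
    using V.lincomb_sum[OF B(1) BC, of "\<lambda>v. y (g v)" "\<lambda>v. z (g v)"] mem that
    by (simp add: \<psi>_def)
  have \<psi>smul: "\<psi> (smul a y) = a \<odot>\<^bsub>V\<^esub> \<psi> y" if "a \<in> S" "y \<in> vecs n S" for a y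
    using V.lincomb_smult[OF BC, of "\<lambda>v. y (g v)" a] mem that by (simp add: \<psi>_def smul_def)
  have bij: "bij_betw \<psi> (vecs n S) (carrier V)"
  proof (rule bij_betwI')
    fix y z assume yz: "y \<in> vecs n S" "z \<in> vecs n S"
    show "\<psi> y = \<psi> z \<longleftrightarrow> y = z"
    proof
      assume eq: "\<psi> y = \<psi> z"
      let ?a = "restrict (\<lambda>v. y (g v)) B" and ?b = "restrict (\<lambda>v. z (g v)) B"
      have "?a \<in> B \<rightarrow>\<^sub>E S \<and> V.lincomb ?a B = \<psi> y" "?b \<in> B \<rightarrow>\<^sub>E S \<and> V.lincomb ?b B = \<psi> y"
        using mem[OF yz(1)] mem[OF yz(2)] eq by (auto simp: restr \<psi>_def)
      then have ab: "?a = ?b" using crit[OF \<psi>C[OF yz(1)]] by blast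
      show "y = z"
      proof
        fix i show "y i = z i"
        proof (cases "i < n")
          case True
          then have "e i \<in> B" using e by (auto simp: bij_betw_def)
          then show ?thesis using fun_cong[OF ab, of "e i"] ge[OF True] by simp
        next
          case False
          then show ?thesis using yz by (simp add: vecs_def)
        qed
      qed
    qed simp
  next
    fix v assume "v \<in> carrier V"
    then obtain a where a: "a \<in> B \<rightarrow>\<^sub>E S" "V.lincomb a B = v" using crit by blast
    define y where "y i = (if i < n then a (e i) else 0)" for i
    have "y \<in> vecs n S" using a(1) e by (auto simp: y_def vecs_def bij_betw_def PiE_def)
    moreover have "v = \<psi> y"
      unfolding \<psi>_def a(2)[symmetric] V.lincomb_def
      by (rule V.finsum_cong') (use BC a(1) eg in \<open>auto simp: y_def intro!: V.smult_closed\<close>)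
    ultimately show "\<exists>y\<in>vecs n S. v = \<psi> y" by blast
  qed (rule \<psi>C)
  define \<phi> where "\<phi> = the_inv_into (vecs n S) \<psi>"
  have b\<phi>: "bij_betw \<phi> (carrier V) (vecs n S)" unfolding \<phi>_def by (rule bij_betw_the_inv_into[OF bij])
  have \<phi>\<psi>: "\<phi> (\<psi> y) = y" if "y \<in> vecs n S" for y
    using that bij unfolding \<phi>_def bij_betw_def by (intro the_inv_into_f_f) auto
  have \<psi>\<phi>: "\<psi> (\<phi> v) = v" "\<phi> v \<in> vecs n S" if "v \<in> carrier V" for v
    using that bij b\<phi> f_the_inv_into_f_bij_betw[OF bij] unfolding \<phi>_def bij_betw_def by auto
  have "\<phi> (v \<oplus>\<^bsub>V\<^esub> w) = \<phi> v + \<phi> w" if "v \<in> carrier V" "w \<in> carrier V" for v w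
    using that \<psi>add[of "\<phi> v" "\<phi> w"] \<psi>\<phi> \<phi>\<psi>[of "\<phi> v + \<phi> w"] vecs_add[OF _ _ sf, of "\<phi> v" n "\<phi> w"] by simp
  moreover have "\<phi> (a \<odot>\<^bsub>V\<^esub> v) = smul a (\<phi> v)" if "a \<in> S" "v \<in> carrier V" for a v
    using that \<psi>smul[of a "\<phi> v"] \<psi>\<phi> \<phi>\<psi>[of "smul a (\<phi> v)"] vecs_smul[OF _ _ sf, of a "\<phi> v" n] by simp
  ultimately have "coords S V n \<phi>" using b\<phi> by (simp add: coords_def)
  then show ?thesis by blast
qed

lemma unit_fun_vecs: "fls_subfield S \<Longrightarrow> j < n \<Longrightarrow> unit_fun j \<in> vecs n S"
  by (auto simp: vecs_def unit_fun_def fls_subfield.zero_mem fls_subfield.one_mem)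

text \<open>Stated for additive maps so as to apply to a connection, which is not linear over S. The
  truncations \<open>t m\<close> build up y one entry at a time.\<close>

lemma additive_expand:
  fixes g :: "(nat \<Rightarrow> complex fls) \<Rightarrow> 'b::ab_group_add"
  assumes S: "fls_subfield S"
    and add: "\<And>x y. x \<in> vecs n S \<Longrightarrow> y \<in> vecs n S \<Longrightarrow> g (x + y) = g x + g y"
    and y: "y \<in> vecs n S"
  shows "g y = (\<Sum>j<n. g (smul (y j) (unit_fun j)))"
proof -
  define t where "t m = (\<lambda>i. if i < m then y i else 0)" for m
  have t: "t m \<in> vecs n S" for m
    using y fls_subfield.zero_mem[OF S] by (auto simp: t_def vecs_def)
  have "g (t m) = (\<Sum>j<m. g (smul (y j) (unit_fun j)))" if "m \<le> n" for m
    using that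
  proof (induction m)
    case 0
    have "t 0 + t 0 = t 0" by (auto simp: t_def)
    then have "g (t 0) = g (t 0) + g (t 0)" using add[OF t t, of 0 0] by simp
    then show ?case by simp
  next
    case (Suc m)
    have u: "smul (y m) (unit_fun m) \<in> vecs n S"
      using Suc.prems y by (intro vecs_smul unit_fun_vecs S) (auto simp: vecs_def)
    have "t (Suc m) = t m + smul (y m) (unit_fun m)"
      by (auto simp: t_def smul_def unit_fun_def fun_eq_iff less_Suc_eq)
    then have "g (t (Suc m)) = g (t m) + g (smul (y m) (unit_fun m))"
      by (simp only: add[OF t u])
    also have "g (t m) = (\<Sum>j<m. g (smul (y j) (unit_fun j)))" using Suc by simp
    finally show ?case by (simp only: sum.lessThan_Suc)
  qed
  moreover have "t n = y" using y by (auto simp: t_def vecs_def fun_eq_iff)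
  ultimately show ?thesis by force
qed

lemma coordsD:
  assumes "coords S V n \<phi>"
  shows "\<And>v. v \<in> carrier V \<Longrightarrow> \<phi> v \<in> vecs n S"
    "\<And>v w. v \<in> carrier V \<Longrightarrow> w \<in> carrier V \<Longrightarrow> \<phi> (v \<oplus>\<^bsub>V\<^esub> w) = \<phi> v + \<phi> w"
    "\<And>a v. a \<in> S \<Longrightarrow> v \<in> carrier V \<Longrightarrow> \<phi> (a \<odot>\<^bsub>V\<^esub> v) = smul a (\<phi> v)"
    "\<And>v w. v \<in> carrier V \<Longrightarrow> w \<in> carrier V \<Longrightarrow> \<phi> v = \<phi> w \<Longrightarrow> v = w"
    "\<And>y. y \<in> vecs n S \<Longrightarrow> the_inv_into (carrier V) \<phi> y \<in> carrier V"
    "\<And>y. y \<in> vecs n S \<Longrightarrow> \<phi> (the_inv_into (carrier V) \<phi> y) = y"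
proof -
  have b: "bij_betw \<phi> (carrier V) (vecs n S)" using assms by (simp add: coords_def)
  then have i: "inj_on \<phi> (carrier V)" and im: "\<phi> ` carrier V = vecs n S" by (auto simp: bij_betw_def)
  show "\<And>v. v \<in> carrier V \<Longrightarrow> \<phi> v \<in> vecs n S" using im by blast
  show "\<And>v w. v \<in> carrier V \<Longrightarrow> w \<in> carrier V \<Longrightarrow> \<phi> (v \<oplus>\<^bsub>V\<^esub> w) = \<phi> v + \<phi> w"
    "\<And>a v. a \<in> S \<Longrightarrow> v \<in> carrier V \<Longrightarrow> \<phi> (a \<odot>\<^bsub>V\<^esub> v) = smul a (\<phi> v)"
    using assms by (simp_all add: coords_def)
  show "\<And>v w. v \<in> carrier V \<Longrightarrow> w \<in> carrier V \<Longrightarrow> \<phi> v = \<phi> w \<Longrightarrow> v = w"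
    using i by (auto dest: inj_onD)
  show "\<And>y. y \<in> vecs n S \<Longrightarrow> the_inv_into (carrier V) \<phi> y \<in> carrier V"
    using the_inv_into_into[OF i _ subset_refl] im by blast
  show "\<And>y. y \<in> vecs n S \<Longrightarrow> \<phi> (the_inv_into (carrier V) \<phi> y) = y"
    by (rule f_the_inv_into_f_bij_betw[OF b]) blast
qed

text \<open>The columns of A are the images of the unit vectors, and the Leibniz rule supplies the
  derivatives of the coordinates.\<close>

lemma coord_conn_exists:
  assumes V: "vs_connection (fls_subring S) V nabla" and \<phi>: "coords S V n \<phi>"
    and deriv: "\<And>a. a \<in> S \<Longrightarrow> fls_deriv a \<in> S"
  shows "\<exists>A. coord_conn S V nabla n A \<phi>"
proof -
  interpret V: vs_connection "fls_subring S" V nabla by (rule V)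
  have sf: "fls_subfield S" by (rule fls_subfield_of_field) (rule V.field_axioms)
  note \<phi>D = coordsD[OF \<phi>]
  define \<psi> where "\<psi> = the_inv_into (carrier V) \<phi>"
  note \<psi>D = \<phi>D(5,6)[folded \<psi>_def]
  have \<psi>\<phi>: "\<psi> (\<phi> v) = v" if "v \<in> carrier V" for v
    using \<phi>D(4)[OF \<psi>D(1)[OF \<phi>D(1)[OF that]] that] \<psi>D(2)[OF \<phi>D(1)[OF that]] by blast
  have \<psi>add: "\<psi> (x + y) = \<psi> x \<oplus>\<^bsub>V\<^esub> \<psi> y" if xy: "x \<in> vecs n S" "y \<in> vecs n S" for x y
  proof -
    have "\<phi> (\<psi> x \<oplus>\<^bsub>V\<^esub> \<psi> y) = x + y" using \<phi>D(2)[OF \<psi>D(1) \<psi>D(1)] \<psi>D(2) xy by simp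
    then show ?thesis using \<psi>\<phi>[of "\<psi> x \<oplus>\<^bsub>V\<^esub> \<psi> y"] \<psi>D(1) xy by simp
  qed
  have \<psi>smul: "\<psi> (smul a y) = a \<odot>\<^bsub>V\<^esub> \<psi> y" if a: "a \<in> S" "y \<in> vecs n S" for a y
  proof -
    have "\<phi> (a \<odot>\<^bsub>V\<^esub> \<psi> y) = smul a y" using \<phi>D(3)[OF a(1) \<psi>D(1)] \<psi>D(2) a by simp
    then show ?thesis using \<psi>\<phi>[of "a \<odot>\<^bsub>V\<^esub> \<psi> y"] \<psi>D(1) a by (simp add: V.smult_closed)
  qed
  define D where "D y = \<phi> (nabla (\<psi> y))" for y
  have D_vecs: "D y \<in> vecs n S" if "y \<in> vecs n S" for y
    unfolding D_def by (intro \<phi>D(1) V.nabla_closed \<psi>D(1) that)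
  have D_add: "D (x + y) = D x + D y" if "x \<in> vecs n S" "y \<in> vecs n S" for x y
    unfolding D_def \<psi>add[OF that] using that
    by (simp add: V.nabla_add \<psi>D(1) \<phi>D(2) V.nabla_closed)
  have D_smul: "D (smul a y) = smul (fls_deriv a) y + smul a (D y)" if "a \<in> S" "y \<in> vecs n S" for a y
    unfolding D_def \<psi>smul[OF that] using that deriv[OF that(1)] V.nabla_leibniz[of a "\<psi> y"] \<psi>D(1)[of y]
    by (simp add: \<phi>D(2,3) \<psi>D(2) V.nabla_closed V.smult_closed)
  define A where "A i j = D (unit_fun j) i" for i j
  have A: "A i j \<in> S" if "i < n" "j < n" for i j
    using D_vecs[OF unit_fun_vecs[OF sf that(2)]] that by (simp add: A_def vecs_def)
  have D_conn: "D y = conn n A y" if y: "y \<in> vecs n S" for y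
  proof
    fix i
    have "D y = (\<Sum>j<n. D (smul (y j) (unit_fun j)))" by (rule additive_expand[OF sf D_add y])
    also have "\<dots> = (\<Sum>j<n. smul (fls_deriv (y j)) (unit_fun j) + smul (y j) (D (unit_fun j)))"
      using y by (intro sum.cong refl D_smul unit_fun_vecs sf) (auto simp: vecs_def)
    finally have Dy: "D y i = (\<Sum>j<n. fls_deriv (y j) * unit_fun j i) + (\<Sum>j<n. y j * A i j)"
      by (simp add: sum_fun_app smul_def A_def sum.distrib)
    show "D y i = conn n A y i"
    proof (cases "i < n")
      case True
      have "(\<Sum>j<n. fls_deriv (y j) * unit_fun j i) = fls_deriv (y i)"
        using True by (simp add: unit_fun_def if_distrib cong: if_cong)
      then show ?thesis using Dy True by (simp add: conn_def mult.commute)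
    next
      case False
      then show ?thesis using D_vecs[OF y] y by (simp add: vecs_def conn_def)
    qed
  qed
  have "coord_conn S V nabla n A \<phi>"
    unfolding coord_conn_def
  proof (intro conjI \<phi> allI impI ballI A)
    fix v assume v: "v \<in> carrier V"
    show "\<phi> (nabla v) = conn n A (\<phi> v)"
      using D_conn[OF \<phi>D(1)[OF v]] by (simp add: D_def \<psi>\<phi>[OF v])
  qed
  then show ?thesis by blast
qed

section \<open>Slow vectors without coordinates\<close>

definition functional :: "complex fls set \<Rightarrow> (complex fls, 'v, 'm) module_scheme \<Rightarrow> ('v \<Rightarrow> complex fls) \<Rightarrow> bool" where
  "functional S V f \<longleftrightarrow> (\<forall>v\<in>carrier V. \<forall>w\<in>carrier V. f (v \<oplus>\<^bsub>V\<^esub> w) = f v + f w) \<and>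
     (\<forall>a\<in>S. \<forall>v\<in>carrier V. f (a \<odot>\<^bsub>V\<^esub> v) = a * f v)"

text \<open>A coordinate-free version of \<^const>\<open>slow_vec\<close>, so that it can be compared along linear maps.\<close>
definition slow :: "complex fls set \<Rightarrow> (complex fls, 'v, 'm) module_scheme \<Rightarrow> ('v \<Rightarrow> 'v) \<Rightarrow> real \<Rightarrow> 'v \<Rightarrow> bool" where
  "slow S V nabla \<theta> v \<longleftrightarrow> (\<forall>f. functional S V f \<longrightarrow>
     (\<exists>C. \<forall>m. val_ge (f ((nabla ^^ m) v)) (- \<theta> * real m - C)))"

text \<open>Coordinates are functionals, and conversely a functional is a combination of the
  coordinates with fixed Laurent series as coefficients, which affects only the constant C.\<close>

lemma slow_iff_coords:
  assumes V: "vs_connection (fls_subring S) V nabla" and cc: "coord_conn S V nabla n A \<phi>"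
    and v: "v \<in> carrier V"
  shows "slow S V nabla \<theta> v \<longleftrightarrow> slow_vec (conn n A) \<theta> (\<phi> v)"
proof -
  interpret V: vs_connection "fls_subring S" V nabla by (rule V)
  have sf: "fls_subfield S" by (rule fls_subfield_of_field) (rule V.field_axioms)
  have \<phi>: "coords S V n \<phi>" using cc by (simp add: coord_conn_def)
  note \<phi>D = coordsD[OF \<phi>]
  have pow: "(nabla ^^ m) v \<in> carrier V \<and> \<phi> ((nabla ^^ m) v) = (conn n A ^^ m) (\<phi> v)" for m
    using cc by (induction m) (auto simp: v V.nabla_closed coord_conn_def)
  show ?thesis
  proof
    assume slow: "slow S V nabla \<theta> v"
    have "\<exists>C. \<forall>m. val_ge ((conn n A ^^ m) (\<phi> v) i) (- \<theta> * real m - C)" for i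
    proof -
      have "functional S V (\<lambda>v. \<phi> v i)" by (simp add: functional_def \<phi>D(2,3) smul_apply)
      then have "\<exists>C. \<forall>m. val_ge (\<phi> ((nabla ^^ m) v) i) (- \<theta> * real m - C)"
        using slow unfolding slow_def by fast
      then show ?thesis using pow by simp
    qed
    then obtain C where C: "\<And>i m. val_ge ((conn n A ^^ m) (\<phi> v) i) (- \<theta> * real m - C i)" by metis
    \<comment> \<open>One constant for the n coordinates together; the entries from n on
      vanish.\<close>
    define C' where "C' = (\<Sum>i<n. \<bar>C i\<bar>)"
    have "val_ge ((conn n A ^^ m) (\<phi> v) i) (- \<theta> * real m - C')" for m i
    proof (cases "i < n")
      case True
      then have "\<bar>C i\<bar> \<le> C'" unfolding C'_def by (intro member_le_sum) auto
      then show ?thesis by (intro val_ge_mono[OF C]) linarith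
    next
      case False
      then show ?thesis using pow[of m] \<phi>D(1)[of "(nabla ^^ m) v"] by (simp add: vecs_def)
    qed
    then show "slow_vec (conn n A) \<theta> (\<phi> v)" unfolding slow_vec_def by fast
  next
    assume "slow_vec (conn n A) \<theta> (\<phi> v)"
    then obtain C where C: "\<And>m i. val_ge ((conn n A ^^ m) (\<phi> v) i) (- \<theta> * real m - C)"
      by (auto simp: slow_vec_def)
    show "slow S V nabla \<theta> v"
      unfolding slow_def
    proof (intro allI impI)
      fix f assume f: "functional S V f"
      define \<psi> where "\<psi> = the_inv_into (carrier V) \<phi>"
      note \<psi>D = \<phi>D(5,6)[folded \<psi>_def]
      have \<psi>\<phi>: "\<psi> (\<phi> u) = u" if "u \<in> carrier V" for u
        using \<phi>D(4)[OF \<psi>D(1)[OF \<phi>D(1)[OF that]] that] \<psi>D(2)[OF \<phi>D(1)[OF that]] by blast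
      have add: "f (\<psi> (x + y)) = f (\<psi> x) + f (\<psi> y)" if xy: "x \<in> vecs n S" "y \<in> vecs n S" for x y
      proof -
        have c: "\<psi> x \<in> carrier V" "\<psi> y \<in> carrier V" using \<psi>D(1) xy by auto
        have "\<phi> (\<psi> x \<oplus>\<^bsub>V\<^esub> \<psi> y) = x + y" using \<phi>D(2)[OF c] \<psi>D(2) xy by simp
        then have "\<psi> (x + y) = \<psi> x \<oplus>\<^bsub>V\<^esub> \<psi> y" using \<psi>\<phi>[OF V.a_closed[OF c]] by simp
        then show ?thesis using f c by (simp add: functional_def)
      qed
      have expand: "f u = (\<Sum>j<n. \<phi> u j * f (\<psi> (unit_fun j)))" if u: "u \<in> carrier V" for u
      proof -
        have "f (\<psi> (\<phi> u)) = (\<Sum>j<n. f (\<psi> (smul (\<phi> u j) (unit_fun j))))"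
          by (rule additive_expand[OF sf add \<phi>D(1)[OF u]])
        also have "\<dots> = (\<Sum>j<n. \<phi> u j * f (\<psi> (unit_fun j)))"
        proof (intro sum.cong refl)
          fix j assume j: "j \<in> {..<n}"
          have a: "\<phi> u j \<in> S" using \<phi>D(1)[OF u] j by (simp add: vecs_def)
          have c: "\<psi> (unit_fun j) \<in> carrier V" using j by (intro \<psi>D(1) unit_fun_vecs sf) simp
          have "\<phi> (\<phi> u j \<odot>\<^bsub>V\<^esub> \<psi> (unit_fun j)) = smul (\<phi> u j) (unit_fun j)"
            using \<phi>D(3)[OF a c] \<psi>D(2)[OF unit_fun_vecs[OF sf]] j by simp
          then have "\<psi> (smul (\<phi> u j) (unit_fun j)) = \<phi> u j \<odot>\<^bsub>V\<^esub> \<psi> (unit_fun j)"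
            using \<psi>\<phi>[of "\<phi> u j \<odot>\<^bsub>V\<^esub> \<psi> (unit_fun j)"] V.smult_closed[of "\<phi> u j" "\<psi> (unit_fun j)"] a c by simp
          then show "f (\<psi> (smul (\<phi> u j) (unit_fun j))) = \<phi> u j * f (\<psi> (unit_fun j))"
            using f a c by (simp add: functional_def)
        qed
        finally show ?thesis by (simp add: \<psi>\<phi>[OF u])
      qed
      obtain c where c: "\<forall>j\<in>{..<n}. val_ge (f (\<psi> (unit_fun j))) c"
        using val_ge_exists_family[of "{..<n}" "\<lambda>j. f (\<psi> (unit_fun j))"] by auto
      have "val_ge (f ((nabla ^^ m) v)) (- \<theta> * real m - (C - c))" for m
      proof -
        have "val_ge (\<Sum>j<n. (conn n A ^^ m) (\<phi> v) j * f (\<psi> (unit_fun j))) ((- \<theta> * real m - C) + c)"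
          using c by (intro val_ge_sum val_ge_mult C) auto
        then show ?thesis using pow[of m] expand[of "(nabla ^^ m) v"] by (simp add: algebra_simps)
      qed
      then show "\<exists>C. \<forall>m. val_ge (f ((nabla ^^ m) v)) (- \<theta> * real m - C)" by fast
    qed
  qed
qed

text \<open>Functionals on W pull back along h, so injectivity or surjectivity of h is irrelevant
  and both inclusions and projections are covered.\<close>

lemma slow_map:
  assumes closed: "\<And>v. v \<in> carrier V \<Longrightarrow> nabla v \<in> carrier V"
    and h: "\<And>v. v \<in> carrier V \<Longrightarrow> h v \<in> carrier W"
    "\<And>v w. v \<in> carrier V \<Longrightarrow> w \<in> carrier V \<Longrightarrow> h (v \<oplus>\<^bsub>V\<^esub> w) = h v \<oplus>\<^bsub>W\<^esub> h w"
    "\<And>a v. a \<in> S \<Longrightarrow> v \<in> carrier V \<Longrightarrow> h (a \<odot>\<^bsub>V\<^esub> v) = a \<odot>\<^bsub>W\<^esub> h v"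
    "\<And>v. v \<in> carrier V \<Longrightarrow> h (nabla v) = nabla' (h v)"
    and v: "v \<in> carrier V" "slow S V nabla \<theta> v"
  shows "slow S W nabla' \<theta> (h v)"
  unfolding slow_def
proof (intro allI impI)
  fix f assume f: "functional S W f"
  have "functional S V (\<lambda>v. f (h v))" using f h(1-3) by (simp add: functional_def)
  then have "\<exists>C. \<forall>m. val_ge (f (h ((nabla ^^ m) v))) (- \<theta> * real m - C)"
    using v(2) unfolding slow_def by fast
  moreover have "(nabla ^^ m) v \<in> carrier V \<and> h ((nabla ^^ m) v) = (nabla' ^^ m) (h v)" for m
    by (induction m) (auto simp: v closed h)
  ultimately show "\<exists>C. \<forall>m. val_ge (f ((nabla' ^^ m) (h v))) (- \<theta> * real m - C)" by simp
qed

section \<open>Direct summands stable under the connection\<close>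

definition sub_module :: "(complex fls, 'v, 'm) module_scheme \<Rightarrow> 'v set \<Rightarrow> (complex fls, 'v) module" where
  "sub_module V U = \<lparr>carrier = U, mult = mult V, one = one V, zero = zero V, add = add V, smult = smult V\<rparr>"

lemma sub_module_simps [simp]:
  "carrier (sub_module V U) = U" "\<zero>\<^bsub>sub_module V U\<^esub> = \<zero>\<^bsub>V\<^esub>"
  "x \<oplus>\<^bsub>sub_module V U\<^esub> y = x \<oplus>\<^bsub>V\<^esub> y" "a \<odot>\<^bsub>sub_module V U\<^esub> x = a \<odot>\<^bsub>V\<^esub> x"
  by (simp_all add: sub_module_def)

text \<open>Complementary idempotents that commute with the connection. The summands are their
  images, so that statements about them can be made inside V.\<close>

definition conn_splitting :: "complex fls set \<Rightarrow> (complex fls, 'v, 'm) module_scheme \<Rightarrow> ('v \<Rightarrow> 'v) \<Rightarrow>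
    ('v \<Rightarrow> 'v) \<Rightarrow> ('v \<Rightarrow> 'v) \<Rightarrow> bool" where
  "conn_splitting S V nabla P Q \<longleftrightarrow>
     (\<forall>v\<in>carrier V. P v \<in> carrier V \<and> Q v \<in> carrier V \<and> P v \<oplus>\<^bsub>V\<^esub> Q v = v \<and>
        P (P v) = P v \<and> Q (Q v) = Q v \<and> P (Q v) = \<zero>\<^bsub>V\<^esub> \<and> Q (P v) = \<zero>\<^bsub>V\<^esub> \<and>
        P (nabla v) = nabla (P v) \<and> Q (nabla v) = nabla (Q v)) \<and>
     (\<forall>v\<in>carrier V. \<forall>w\<in>carrier V. P (v \<oplus>\<^bsub>V\<^esub> w) = P v \<oplus>\<^bsub>V\<^esub> P w \<and> Q (v \<oplus>\<^bsub>V\<^esub> w) = Q v \<oplus>\<^bsub>V\<^esub> Q w) \<and>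
     (\<forall>a\<in>S. \<forall>v\<in>carrier V. P (a \<odot>\<^bsub>V\<^esub> v) = a \<odot>\<^bsub>V\<^esub> P v \<and> Q (a \<odot>\<^bsub>V\<^esub> v) = a \<odot>\<^bsub>V\<^esub> Q v)"

lemma conn_splittingD:
  assumes "conn_splitting S V nabla P Q"
  shows "\<And>v. v \<in> carrier V \<Longrightarrow> P v \<in> carrier V" "\<And>v. v \<in> carrier V \<Longrightarrow> Q v \<in> carrier V"
    "\<And>v. v \<in> carrier V \<Longrightarrow> P v \<oplus>\<^bsub>V\<^esub> Q v = v"
    "\<And>v. v \<in> carrier V \<Longrightarrow> P (P v) = P v" "\<And>v. v \<in> carrier V \<Longrightarrow> Q (Q v) = Q v"
    "\<And>v. v \<in> carrier V \<Longrightarrow> P (Q v) = \<zero>\<^bsub>V\<^esub>" "\<And>v. v \<in> carrier V \<Longrightarrow> Q (P v) = \<zero>\<^bsub>V\<^esub>"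
    "\<And>v. v \<in> carrier V \<Longrightarrow> P (nabla v) = nabla (P v)" "\<And>v. v \<in> carrier V \<Longrightarrow> Q (nabla v) = nabla (Q v)"
    "\<And>v w. v \<in> carrier V \<Longrightarrow> w \<in> carrier V \<Longrightarrow> P (v \<oplus>\<^bsub>V\<^esub> w) = P v \<oplus>\<^bsub>V\<^esub> P w"
    "\<And>v w. v \<in> carrier V \<Longrightarrow> w \<in> carrier V \<Longrightarrow> Q (v \<oplus>\<^bsub>V\<^esub> w) = Q v \<oplus>\<^bsub>V\<^esub> Q w"
    "\<And>a v. a \<in> S \<Longrightarrow> v \<in> carrier V \<Longrightarrow> P (a \<odot>\<^bsub>V\<^esub> v) = a \<odot>\<^bsub>V\<^esub> P v"
    "\<And>a v. a \<in> S \<Longrightarrow> v \<in> carrier V \<Longrightarrow> Q (a \<odot>\<^bsub>V\<^esub> v) = a \<odot>\<^bsub>V\<^esub> Q v"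
  using assms unfolding conn_splitting_def by simp_all

lemma conn_splitting_sym:
  assumes V: "vs_connection (fls_subring S) V nabla" and PQ: "conn_splitting S V nabla P Q"
  shows "conn_splitting S V nabla Q P"
proof -
  interpret V: vs_connection "fls_subring S" V nabla by (rule V)
  note D = conn_splittingD[OF PQ]
  have "Q v \<oplus>\<^bsub>V\<^esub> P v = v" if "v \<in> carrier V" for v
    using D(3)[OF that] V.a_comm[OF D(1)[OF that] D(2)[OF that]] by simp
  then show ?thesis using D unfolding conn_splitting_def by simp
qed

text \<open>P acts as the identity on its image, which gives stability under all operations, and
  takes a finite generating set of V to one of the image.\<close>

lemma splitting_image_conn:
  assumes V: "vs_connection (fls_subring S) V nabla" and fd: "vectorspace.fin_dim (fls_subring S) V"
    and PQ: "conn_splitting S V nabla P Q"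
  shows "vs_connection (fls_subring S) (sub_module V (P ` carrier V)) nabla"
    and "vectorspace.fin_dim (fls_subring S) (sub_module V (P ` carrier V))"
proof -
  interpret V: vs_connection "fls_subring S" V nabla by (rule V)
  note D = conn_splittingD[OF PQ]
  define U where "U = P ` carrier V"
  have UC: "u \<in> carrier V" if "u \<in> U" for u using that D(1) by (auto simp: U_def)
  have fixP: "P u = u" if "u \<in> U" for u using that D(4) by (auto simp: U_def)
  have inU: "u \<in> U" if "u \<in> carrier V" "P u = u" for u
  proof -
    have "P u \<in> U" using that(1) by (simp add: U_def)
    then show ?thesis by (simp only: that(2))
  qed
  have P0: "P \<zero>\<^bsub>V\<^esub> = \<zero>\<^bsub>V\<^esub>"
    using D(4)[OF D(2)[OF V.zero_closed]] D(6)[OF V.zero_closed] by simp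
  have addU: "v \<oplus>\<^bsub>V\<^esub> w \<in> U" if "v \<in> U" "w \<in> U" for v w
    by (rule inU) (simp_all only: V.a_closed[OF UC[OF that(1)] UC[OF that(2)]]
        D(10)[OF UC[OF that(1)] UC[OF that(2)]] fixP[OF that(1)] fixP[OF that(2)])
  have smultC: "a \<odot>\<^bsub>V\<^esub> v \<in> carrier V" if "a \<in> S" "v \<in> carrier V" for a v
    by (rule V.smult_closed) (simp_all add: that)
  have smultU: "a \<odot>\<^bsub>V\<^esub> v \<in> U" if "a \<in> S" "v \<in> U" for a v
    by (rule inU) (simp_all only: smultC[OF that(1) UC[OF that(2)]] D(12)[OF that(1) UC[OF that(2)]] fixP[OF that(2)])
  have ag: "abelian_group (sub_module V U)"
  proof (rule abelian_groupI)
    fix x assume "x \<in> carrier (sub_module V U)"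
    then have x: "x \<in> U" by simp
    have "P (\<ominus>\<^bsub>V\<^esub> x) \<oplus>\<^bsub>V\<^esub> P x = P (\<ominus>\<^bsub>V\<^esub> x \<oplus>\<^bsub>V\<^esub> x)"
      by (rule D(10)[symmetric]) (use UC[OF x] in auto)
    then have "P (\<ominus>\<^bsub>V\<^esub> x) \<oplus>\<^bsub>V\<^esub> x = \<zero>\<^bsub>V\<^esub>"
      by (simp only: V.l_neg[OF UC[OF x]] P0 fixP[OF x])
    moreover have "P (\<ominus>\<^bsub>V\<^esub> x) \<in> U" unfolding U_def using UC[OF x] by simp
    ultimately show "\<exists>y\<in>carrier (sub_module V U). y \<oplus>\<^bsub>sub_module V U\<^esub> x = \<zero>\<^bsub>sub_module V U\<^esub>" by auto
  next
    show "\<zero>\<^bsub>sub_module V U\<^esub> \<in> carrier (sub_module V U)" using inU[OF V.zero_closed P0] by simp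
  next
    fix x y assume "x \<in> carrier (sub_module V U)" "y \<in> carrier (sub_module V U)"
    then have xy: "x \<in> U" "y \<in> U" by simp_all
    show "x \<oplus>\<^bsub>sub_module V U\<^esub> y \<in> carrier (sub_module V U)" using addU[OF xy] by simp
    show "x \<oplus>\<^bsub>sub_module V U\<^esub> y = y \<oplus>\<^bsub>sub_module V U\<^esub> x"
      using V.a_comm[OF UC[OF xy(1)] UC[OF xy(2)]] by simp
    fix z assume "z \<in> carrier (sub_module V U)"
    then have z: "z \<in> U" by simp
    show "x \<oplus>\<^bsub>sub_module V U\<^esub> y \<oplus>\<^bsub>sub_module V U\<^esub> z = x \<oplus>\<^bsub>sub_module V U\<^esub> (y \<oplus>\<^bsub>sub_module V U\<^esub> z)"
      using V.a_assoc[OF UC[OF xy(1)] UC[OF xy(2)] UC[OF z]] by simp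
  next
    fix x assume "x \<in> carrier (sub_module V U)"
    then show "\<zero>\<^bsub>sub_module V U\<^esub> \<oplus>\<^bsub>sub_module V U\<^esub> x = x" using V.l_zero[OF UC, of x] by simp
  qed
  have ma: "module_axioms (fls_subring S) (sub_module V U)"
  proof (rule module_axioms.intro)
    fix a b x y assume "a \<in> carrier (fls_subring S)" "b \<in> carrier (fls_subring S)"
      "x \<in> carrier (sub_module V U)" "y \<in> carrier (sub_module V U)"
    then have m: "a \<in> S" "b \<in> S" "x \<in> carrier V" "y \<in> carrier V" by (simp_all add: UC)
    show "(a \<oplus>\<^bsub>fls_subring S\<^esub> b) \<odot>\<^bsub>sub_module V U\<^esub> x =
        a \<odot>\<^bsub>sub_module V U\<^esub> x \<oplus>\<^bsub>sub_module V U\<^esub> b \<odot>\<^bsub>sub_module V U\<^esub> x"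
      using V.smult_l_distr[of a b x] m by simp
    show "a \<odot>\<^bsub>sub_module V U\<^esub> (x \<oplus>\<^bsub>sub_module V U\<^esub> y) =
        a \<odot>\<^bsub>sub_module V U\<^esub> x \<oplus>\<^bsub>sub_module V U\<^esub> a \<odot>\<^bsub>sub_module V U\<^esub> y"
      using V.smult_r_distr[of a x y] m by simp
    show "(a \<otimes>\<^bsub>fls_subring S\<^esub> b) \<odot>\<^bsub>sub_module V U\<^esub> x =
        a \<odot>\<^bsub>sub_module V U\<^esub> (b \<odot>\<^bsub>sub_module V U\<^esub> x)"
      using V.smult_assoc1[of a b x] m by simp
  next
    fix a x assume "a \<in> carrier (fls_subring S)" "x \<in> carrier (sub_module V U)"
    then show "a \<odot>\<^bsub>sub_module V U\<^esub> x \<in> carrier (sub_module V U)" by (simp add: smultU)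
  next
    fix x assume "x \<in> carrier (sub_module V U)"
    then show "\<one>\<^bsub>fls_subring S\<^esub> \<odot>\<^bsub>sub_module V U\<^esub> x = x"
      using V.smult_one[OF UC, of x] by simp
  qed
  have cr: "cring (fls_subring S)" using V.module_axioms by (simp add: module_def)
  have vs: "vectorspace (fls_subring S) (sub_module V U)"
    by (intro vectorspace.intro module.intro cr ag ma V.field_axioms)
  then interpret U: vectorspace "fls_subring S" "sub_module V U" .
  have "vs_connection (fls_subring S) (sub_module V U) nabla"
  proof
    fix v assume "v \<in> carrier (sub_module V U)"
    then have v: "v \<in> U" by simp
    note vC = UC[OF v]
    have "P (nabla v) = nabla v" by (simp only: D(8)[OF vC] fixP[OF v])
    then show "nabla v \<in> carrier (sub_module V U)"
      using inU[OF V.nabla_closed[OF vC]] by simp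
    show "nabla (fls_const c \<odot>\<^bsub>sub_module V U\<^esub> v) = fls_const c \<odot>\<^bsub>sub_module V U\<^esub> nabla v" for c
      using V.nabla_const[OF vC] by simp
    show "nabla (a \<odot>\<^bsub>sub_module V U\<^esub> v) = fls_deriv a \<odot>\<^bsub>sub_module V U\<^esub> v
        \<oplus>\<^bsub>sub_module V U\<^esub> a \<odot>\<^bsub>sub_module V U\<^esub> nabla v" if "a \<in> carrier (fls_subring S)" for a
      using V.nabla_leibniz[OF that vC] by simp
    fix w assume "w \<in> carrier (sub_module V U)"
    then have wC: "w \<in> carrier V" by (simp add: UC)
    show "nabla (v \<oplus>\<^bsub>sub_module V U\<^esub> w) = nabla v \<oplus>\<^bsub>sub_module V U\<^esub> nabla w"
      using V.nabla_add[OF vC wC] by simp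
  qed
  then show "vs_connection (fls_subring S) (sub_module V (P ` carrier V)) nabla" by (simp only: U_def)
  obtain B where B: "finite B" "B \<subseteq> carrier V" "V.span B = carrier V"
    using fd unfolding V.fin_dim_def by blast
  have fin: "finite (P ` B)" "P ` B \<subseteq> carrier (sub_module V U)" using B by (auto simp: U_def)
  have sp: "submodule (fls_subring S) (U.span (P ` B)) (sub_module V U)"
    by (rule U.span_is_submodule[OF fin(2)])
  have inB: "P x \<in> U.span (P ` B)" if "x \<in> B" for x using U.in_own_span[OF fin(2)] that by blast
  have step: "P (\<Oplus>\<^bsub>V\<^esub>x\<in>A. a x \<odot>\<^bsub>V\<^esub> x) \<in> U.span (P ` B)" if "finite A" "A \<subseteq> B" "a \<in> A \<rightarrow> S" for A a
    using that
  proof (induction A rule: finite_induct)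
    case empty
    show ?case using submodule.zero_closed[OF sp] by (simp add: P0)
  next
    case (insert x A)
    have xC: "x \<in> carrier V" "a x \<in> S" "x \<in> B" using insert.prems B(2) by auto
    have AC: "(\<lambda>x. a x \<odot>\<^bsub>V\<^esub> x) \<in> A \<rightarrow> carrier V"
    proof
      fix y assume "y \<in> A"
      then have "y \<in> carrier V" "a y \<in> S" using insert.prems B(2) by auto
      then show "a y \<odot>\<^bsub>V\<^esub> y \<in> carrier V" by (intro smultC)
    qed
    have e: "(\<Oplus>\<^bsub>V\<^esub>x\<in>insert x A. a x \<odot>\<^bsub>V\<^esub> x) = a x \<odot>\<^bsub>V\<^esub> x \<oplus>\<^bsub>V\<^esub> (\<Oplus>\<^bsub>V\<^esub>x\<in>A. a x \<odot>\<^bsub>V\<^esub> x)"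
      by (rule V.finsum_insert[OF insert.hyps AC smultC[OF xC(2,1)]])
    have "P (\<Oplus>\<^bsub>V\<^esub>x\<in>insert x A. a x \<odot>\<^bsub>V\<^esub> x) = a x \<odot>\<^bsub>V\<^esub> P x \<oplus>\<^bsub>V\<^esub> P (\<Oplus>\<^bsub>V\<^esub>x\<in>A. a x \<odot>\<^bsub>V\<^esub> x)"
      by (simp only: e D(10)[OF smultC[OF xC(2,1)] V.finsum_closed[OF AC]] D(12)[OF xC(2,1)])
    moreover have "a x \<odot>\<^bsub>V\<^esub> P x \<in> U.span (P ` B)"
      using submodule.smult_closed[OF sp, of "a x" "P x"] inB[OF xC(3)] xC(2) by simp
    moreover have "P (\<Oplus>\<^bsub>V\<^esub>x\<in>A. a x \<odot>\<^bsub>V\<^esub> x) \<in> U.span (P ` B)" by (rule insert.IH) (use insert.prems in auto)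
    ultimately show ?case using submodule.m_closed[OF sp] by simp
  qed
  have "U \<subseteq> U.span (P ` B)"
  proof
    fix u assume "u \<in> U"
    then obtain v where v: "v \<in> carrier V" "u = P v" by (auto simp: U_def)
    then have "v \<in> V.span B" using B by simp
    then obtain a A where "v = V.lincomb a A" "finite A" "A \<subseteq> B" "a \<in> A \<rightarrow> S"
      by (auto simp: V.span_def)
    then show "u \<in> U.span (P ` B)" using step[of A a] v(2) by (simp add: V.lincomb_def)
  qed
  moreover have "U.span (P ` B) \<subseteq> U" using U.span_is_subset2[OF fin(2)] by simp
  ultimately have "U.span (P ` B) = carrier (sub_module V U)" by simp
  then have "U.fin_dim" unfolding U.fin_dim_def using fin by blast
  then show "vectorspace.fin_dim (fls_subring S) (sub_module V (P ` carrier V))" by (simp only: U_def)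
qed

lemma splitting_iso:
  assumes V: "vs_connection (fls_subring S) V nabla" and fd: "vectorspace.fin_dim (fls_subring S) V"
    and PQ: "conn_splitting S V nabla P Q"
  shows "connection_iso (fls_subring S) V nabla
    (direct_sum (sub_module V (P ` carrier V)) (sub_module V (Q ` carrier V))) (map_prod nabla nabla) (\<lambda>v. (P v, Q v))"
proof -
  interpret V: vs_connection "fls_subring S" V nabla by (rule V)
  note D = conn_splittingD[OF PQ]
  let ?A = "sub_module V (P ` carrier V)" and ?B = "sub_module V (Q ` carrier V)"
  have vA: "vectorspace (fls_subring S) ?A"
    using splitting_image_conn(1)[OF V fd PQ] by (simp add: vs_connection_def)
  have vB: "vectorspace (fls_subring S) ?B"
    using splitting_image_conn(1)[OF V fd conn_splitting_sym[OF V PQ]] by (simp add: vs_connection_def)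
  have vAB: "vectorspace (fls_subring S) (direct_sum ?A ?B)" by (rule direct_sum_is_vs[OF vA vB])
  have hom: "(\<lambda>v. (P v, Q v)) \<in> module_hom (fls_subring S) V (direct_sum ?A ?B)"
    using D(10-13) by (auto simp: module_hom_def direct_sum_def)
  have lin: "linear_map (fls_subring S) V (direct_sum ?A ?B) (\<lambda>v. (P v, Q v))"
    using vAB hom V.vectorspace_axioms
    by (simp add: linear_map_def mod_hom_def mod_hom_axioms_def vectorspace_def)
  have bij: "bij_betw (\<lambda>v. (P v, Q v)) (carrier V) (carrier (direct_sum ?A ?B))"
  proof (rule bij_betwI')
    fix v w assume vw: "v \<in> carrier V" "w \<in> carrier V"
    show "(P v, Q v) = (P w, Q w) \<longleftrightarrow> v = w" using D(3)[OF vw(1)] D(3)[OF vw(2)] by (metis prod.inject)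
  next
    fix v assume "v \<in> carrier V"
    then show "(P v, Q v) \<in> carrier (direct_sum ?A ?B)" by (simp add: direct_sum_def)
  next
    fix x assume "x \<in> carrier (direct_sum ?A ?B)"
    then obtain a b where ab: "a \<in> carrier V" "b \<in> carrier V" "x = (P a, Q b)" by (auto simp: direct_sum_def)
    have c: "P a \<in> carrier V" "Q b \<in> carrier V" using D(1,2) ab by auto
    have "P (P a \<oplus>\<^bsub>V\<^esub> Q b) = P a"
      by (simp only: D(10)[OF c] D(4)[OF ab(1)] D(6)[OF ab(2)] V.r_zero[OF c(1)])
    moreover have "Q (P a \<oplus>\<^bsub>V\<^esub> Q b) = Q b"
      by (simp only: D(11)[OF c] D(5)[OF ab(2)] D(7)[OF ab(1)] V.l_zero[OF c(2)])
    ultimately show "\<exists>v\<in>carrier V. x = (P v, Q v)"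
      using ab(3) V.a_closed[OF c] by (intro bexI[of _ "P a \<oplus>\<^bsub>V\<^esub> Q b"]) simp_all
  qed
  show ?thesis unfolding connection_iso_def using lin bij D(8,9) by simp
qed

text \<open>Refines the first summand of a decomposition, so that two successive splittings can be
  composed.\<close>

lemma connection_iso_direct_sum_left:
  assumes f: "connection_iso (fls_subring S) V nabla (direct_sum A B) (map_prod nA nB) (\<lambda>v. (P v, Q v))"
    and g: "connection_iso (fls_subring S) A nA A' nA' h"
    and B: "vectorspace (fls_subring S) B"
  shows "connection_iso (fls_subring S) V nabla (direct_sum A' B) (map_prod nA' nB) (\<lambda>v. (h (P v), Q v))"
proof -
  have lf: "linear_map (fls_subring S) V (direct_sum A B) (\<lambda>v. (P v, Q v))" and
    bf: "bij_betw (\<lambda>v. (P v, Q v)) (carrier V) (carrier (direct_sum A B))" and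
    cf: "\<And>v. v \<in> carrier V \<Longrightarrow> (P (nabla v), Q (nabla v)) = (nA (P v), nB (Q v))"
    using f by (auto simp: connection_iso_def)
  have lg: "linear_map (fls_subring S) A A' h" and bg: "bij_betw h (carrier A) (carrier A')"
    and cg: "\<And>v. v \<in> carrier A \<Longrightarrow> h (nA v) = nA' (h v)"
    using g by (auto simp: connection_iso_def)
  have vV: "vectorspace (fls_subring S) V" and vA': "vectorspace (fls_subring S) A'"
    using lf lg by (auto simp: linear_map_def)
  have v: "vectorspace (fls_subring S) (direct_sum A' B)" by (rule direct_sum_is_vs[OF vA' B])
  have hf: "(\<lambda>v. (P v, Q v)) \<in> module_hom (fls_subring S) V (direct_sum A B)"
    and hg: "h \<in> module_hom (fls_subring S) A A'"
    using lf lg by (auto simp: linear_map_def mod_hom_def mod_hom_axioms_def)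
  have PQ: "P v \<in> carrier A" "Q v \<in> carrier B" if "v \<in> carrier V" for v
    using hf that by (auto simp: module_hom_def direct_sum_def)
  have hom: "(\<lambda>v. (h (P v), Q v)) \<in> module_hom (fls_subring S) V (direct_sum A' B)"
    using hf hg PQ by (auto simp: module_hom_def direct_sum_def)
  have lin: "linear_map (fls_subring S) V (direct_sum A' B) (\<lambda>v. (h (P v), Q v))"
    using vV v hom by (simp add: linear_map_def mod_hom_def mod_hom_axioms_def vectorspace_def)
  have "bij_betw (map_prod h id) (carrier A \<times> carrier B) (carrier A' \<times> carrier B)"
    using bg by (intro bij_betw_map_prod) auto
  then have "bij_betw (map_prod h id \<circ> (\<lambda>v. (P v, Q v))) (carrier V) (carrier (direct_sum A' B))"
    using bf by (intro bij_betw_trans[OF bf]) (simp add: direct_sum_def)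
  then have "bij_betw (\<lambda>v. (h (P v), Q v)) (carrier V) (carrier (direct_sum A' B))"
    by (simp add: comp_def)
  then show ?thesis unfolding connection_iso_def using lin cf cg PQ by simp
qed

text \<open>E and 1 - E are carried over by the coordinates. Both respect vectors over S, so they
  define maps of V itself.\<close>

lemma splitting_of_projector:
  assumes V: "vs_connection (fls_subring S) V nabla" and cc: "coord_conn S V nabla n A \<phi>"
    and E: "\<And>x y. E (x + y) = E x + E y" "\<And>a y. E (smul a y) = smul a (E y)"
    "\<And>y. y \<in> vecs n S \<Longrightarrow> E y \<in> vecs n S" "\<And>y. E (E y) = E y"
    "\<And>y. y \<in> vecs n UNIV \<Longrightarrow> E (conn n A y) = conn n A (E y)"
  obtains P Q where "conn_splitting S V nabla P Q"
    "\<And>v. v \<in> carrier V \<Longrightarrow> \<phi> (P v) = E (\<phi> v)" "\<And>v. v \<in> carrier V \<Longrightarrow> \<phi> (Q v) = \<phi> v - E (\<phi> v)"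
proof -
  interpret V: vs_connection "fls_subring S" V nabla by (rule V)
  have sf: "fls_subfield S" by (rule fls_subfield_of_field) (rule V.field_axioms)
  interpret dm: diff_module smul "conn n A" by (rule diff_module_conn)
  have \<phi>: "coords S V n \<phi>" using cc by (simp add: coord_conn_def)
  have \<phi>n: "\<phi> (nabla v) = conn n A (\<phi> v)" if "v \<in> carrier V" for v using cc that by (simp add: coord_conn_def)
  note \<phi>D = coordsD[OF \<phi>]
  define \<psi> where "\<psi> = the_inv_into (carrier V) \<phi>"
  note \<psi>D = \<phi>D(5,6)[folded \<psi>_def]
  define P where "P v = \<psi> (E (\<phi> v))" for v
  define Q where "Q v = \<psi> (\<phi> v - E (\<phi> v))" for v
  have mem: "E (\<phi> v) \<in> vecs n S" "\<phi> v - E (\<phi> v) \<in> vecs n S" if "v \<in> carrier V" for v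
    using E(3)[OF \<phi>D(1)[OF that]] \<phi>D(1)[OF that] by (auto simp: vecs_def intro!: fls_subfield.diff_mem[OF sf])
  have PC: "P v \<in> carrier V" "\<phi> (P v) = E (\<phi> v)" if "v \<in> carrier V" for v
    unfolding P_def using \<psi>D mem that by auto
  have QC: "Q v \<in> carrier V" "\<phi> (Q v) = \<phi> v - E (\<phi> v)" if "v \<in> carrier V" for v
    unfolding Q_def using \<psi>D mem that by auto
  have E_diff: "E (x - y) = E x - E y" for x y
    using E(1)[of "x - y" y] by (simp add: eq_diff_eq)
  have \<phi>0: "\<phi> \<zero>\<^bsub>V\<^esub> = 0" using \<phi>D(2)[of "\<zero>\<^bsub>V\<^esub>" "\<zero>\<^bsub>V\<^esub>"] by simp
  have conn_diff: "conn n A (x - y) = conn n A x - conn n A y" for x y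
    using dm.D_add[of "x - y" y] by (simp add: eq_diff_eq)
  have smul_diff: "smul a (x - y) = smul a x - smul a y" for a x y
    by (simp add: smul_def fun_eq_iff right_diff_distrib)
  have "conn_splitting S V nabla P Q"
    unfolding conn_splitting_def
  proof (intro conjI ballI)
    fix v assume v: "v \<in> carrier V"
    note c = PC[OF v] QC[OF v]
    show "P v \<in> carrier V" "Q v \<in> carrier V" using c by auto
    show "P v \<oplus>\<^bsub>V\<^esub> Q v = v" by (rule \<phi>D(4)) (use c v in \<open>auto simp: \<phi>D(2)\<close>)
    show "P (P v) = P v" by (rule \<phi>D(4)) (use c v PC in \<open>auto simp: E(4)\<close>)
    show "Q (Q v) = Q v" by (rule \<phi>D(4)) (use c v QC in \<open>auto simp: E(4) E_diff\<close>)
    show "P (Q v) = \<zero>\<^bsub>V\<^esub>" by (rule \<phi>D(4)) (use c v PC in \<open>auto simp: E(4) E_diff \<phi>0\<close>)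
    show "Q (P v) = \<zero>\<^bsub>V\<^esub>" by (rule \<phi>D(4)) (use c v QC in \<open>auto simp: E(4) \<phi>0\<close>)
    have Ec: "E (conn n A (\<phi> v)) = conn n A (E (\<phi> v))" by (rule E(5)[OF vecs_mono[OF \<phi>D(1)[OF v]]])
    show "P (nabla v) = nabla (P v)"
      by (rule \<phi>D(4)) (use c v PC V.nabla_closed in \<open>auto simp: \<phi>n Ec\<close>)
    show "Q (nabla v) = nabla (Q v)"
      by (rule \<phi>D(4)) (use c v QC V.nabla_closed in \<open>auto simp: \<phi>n Ec conn_diff\<close>)
  next
    fix v w assume v: "v \<in> carrier V" "w \<in> carrier V"
    note c = PC[OF v(1)] QC[OF v(1)] PC[OF v(2)] QC[OF v(2)]
    show "P (v \<oplus>\<^bsub>V\<^esub> w) = P v \<oplus>\<^bsub>V\<^esub> P w"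
      by (rule \<phi>D(4)) (use c v PC in \<open>auto simp: \<phi>D(2) E(1)\<close>)
    show "Q (v \<oplus>\<^bsub>V\<^esub> w) = Q v \<oplus>\<^bsub>V\<^esub> Q w"
      by (rule \<phi>D(4)) (use c v QC in \<open>auto simp: \<phi>D(2) E(1)\<close>)
  next
    fix a v assume v: "a \<in> S" "v \<in> carrier V"
    note c = PC[OF v(2)] QC[OF v(2)]
    have av: "a \<odot>\<^bsub>V\<^esub> u \<in> carrier V" if "u \<in> carrier V" for u using V.smult_closed[of a u] v(1) that by simp
    show "P (a \<odot>\<^bsub>V\<^esub> v) = a \<odot>\<^bsub>V\<^esub> P v"
      by (rule \<phi>D(4)) (use c v PC av in \<open>auto simp: \<phi>D(3) E(2)\<close>)
    show "Q (a \<odot>\<^bsub>V\<^esub> v) = a \<odot>\<^bsub>V\<^esub> Q v"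
      by (rule \<phi>D(4)) (use c v QC av in \<open>auto simp: \<phi>D(3) E(2) smul_diff\<close>)
  qed
  then show thesis using that PC(2) QC(2) by blast
qed

subsection \<open>The formal connection in coordinates\<close>

lemma field_of_fls_subfield:
  assumes "fls_subfield S"
  shows "field (fls_subring S)"
proof -
  interpret fls_subfield S by (rule assms)
  have "cring (fls_subring S)"
  proof (rule cringI)
    show "abelian_group (fls_subring S)"
    proof (rule abelian_groupI)
      fix x assume "x \<in> carrier (fls_subring S)"
      then show "\<exists>y\<in>carrier (fls_subring S). y \<oplus>\<^bsub>fls_subring S\<^esub> x = \<zero>\<^bsub>fls_subring S\<^esub>"
        by (intro bexI[of _ "- x"]) (simp_all add: uminus_mem)
    qed (simp_all add: add_mem zero_mem add.assoc add.commute)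
    show "Group.comm_monoid (fls_subring S)"
      by (rule comm_monoidI) (simp_all add: mult_mem one_mem mult.assoc mult.commute)
  qed (simp add: distrib_right)
  moreover have "Units (fls_subring S) = carrier (fls_subring S) - {\<zero>\<^bsub>fls_subring S\<^esub>}"
  proof -
    have "\<exists>y\<in>S. y * x = 1 \<and> x * y = 1" if "x \<in> S" "x \<noteq> 0" for x
      using that inverse_mem[of x] by (intro bexI[of _ "inverse x"]) auto
    then show ?thesis by (auto simp: Units_def)
  qed
  ultimately show ?thesis by (rule cring.cring_fieldI)
qed

text \<open>The map that sends f tensor v to f times the coordinates of v, defined on the free group
  before the quotient is taken.\<close>

definition tensor_coord :: "('v \<Rightarrow> nat \<Rightarrow> complex fls) \<Rightarrow> (complex fls \<times> 'v \<Rightarrow>\<^sub>0 int) \<Rightarrow> nat \<Rightarrow> complex fls" where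
  "tensor_coord \<phi> p = (\<Sum>k\<in>Poly_Mapping.keys p. smul (of_int (Poly_Mapping.lookup p k) * fst k) (\<phi> (snd k)))"

lemma tensor_coord_superset:
  assumes "finite I" "Poly_Mapping.keys p \<subseteq> I"
  shows "tensor_coord \<phi> p = (\<Sum>k\<in>I. smul (of_int (Poly_Mapping.lookup p k) * fst k) (\<phi> (snd k)))"
  unfolding tensor_coord_def
  by (rule sum.mono_neutral_left) (use assms in \<open>auto simp: in_keys_iff smul_def zero_fun_def\<close>)

lemma tensor_coord_diff: "tensor_coord \<phi> (p - q) = tensor_coord \<phi> p - tensor_coord \<phi> q"
proof -
  let ?I = "Poly_Mapping.keys p \<union> Poly_Mapping.keys q"
  have I: "finite ?I" "Poly_Mapping.keys p \<subseteq> ?I" "Poly_Mapping.keys q \<subseteq> ?I" "Poly_Mapping.keys (p - q) \<subseteq> ?I"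
    using keys_diff[of p q] by auto
  have "smul (of_int (Poly_Mapping.lookup (p - q) k) * fst k) (\<phi> (snd k))
    = smul (of_int (Poly_Mapping.lookup p k) * fst k) (\<phi> (snd k)) - smul (of_int (Poly_Mapping.lookup q k) * fst k) (\<phi> (snd k))" for k
    by (simp add: smul_def fun_eq_iff lookup_minus left_diff_distrib)
  then show ?thesis
    by (simp only: tensor_coord_superset[OF I(1,2)] tensor_coord_superset[OF I(1,3)]
        tensor_coord_superset[OF I(1,4)] sum_subtractf)
qed

lemma tensor_coord_0: "tensor_coord \<phi> 0 = 0"
  by (simp add: tensor_coord_def)

lemma tensor_coord_uminus: "tensor_coord \<phi> (- p) = - tensor_coord \<phi> p"
  using tensor_coord_diff[of \<phi> 0 p] by (simp add: tensor_coord_0)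

lemma tensor_coord_add: "tensor_coord \<phi> (p + q) = tensor_coord \<phi> p + tensor_coord \<phi> q"
  using tensor_coord_diff[of \<phi> p "- q"] by (simp add: tensor_coord_uminus)

lemma tensor_coord_of: "tensor_coord \<phi> (frag_of (f, v)) = smul f (\<phi> v)"
  by (simp add: tensor_coord_def)

lemma tensor_coord_sum: "tensor_coord \<phi> (sum h I) = (\<Sum>i\<in>I. tensor_coord \<phi> (h i))"
  by (induction I rule: infinite_finite_induct)
     (simp_all only: sum.infinite sum.empty sum.insert tensor_coord_0 tensor_coord_add not_False_eq_True)

locale tensor_coordinates =
  fixes S :: "complex fls set" and V :: "(complex fls, 'v, 'm) module_scheme" and nabla :: "'v \<Rightarrow> 'v"
    and n :: nat and A :: "nat \<Rightarrow> nat \<Rightarrow> complex fls" and \<phi> :: "'v \<Rightarrow> nat \<Rightarrow> complex fls"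
  assumes V: "vs_connection (fls_subring S) V nabla" and cc: "coord_conn S V nabla n A \<phi>"
begin

sublocale V: vs_connection "fls_subring S" V nabla by (rule V)

lemma sf: "fls_subfield S" by (rule fls_subfield_of_field) (rule V.field_axioms)

lemma coords: "coords S V n \<phi>" using cc by (simp add: coord_conn_def)

lemmas \<phi>D = coordsD[OF coords]

definition e :: "nat \<Rightarrow> 'v" where "e j = the_inv_into (carrier V) \<phi> (unit_fun j)"

lemma e: "j < n \<Longrightarrow> e j \<in> carrier V" "j < n \<Longrightarrow> \<phi> (e j) = unit_fun j"
  unfolding e_def by (intro \<phi>D(5,6) unit_fun_vecs sf; assumption)+

abbreviation "\<Phi> \<equiv> tensor_coord \<phi>"
definition C :: "(complex fls \<times> 'v \<Rightarrow>\<^sub>0 int) set" where "C = {p. Poly_Mapping.keys p \<subseteq> UNIV \<times> carrier V}"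
abbreviation "null \<equiv> tensor_null (fls_subring S) V"

lemma C_eq: "carrier (tensor_free V) = C"
  by (auto simp: tensor_free_def C_def)

lemma group_free: "group (tensor_free V)"
  by (simp add: tensor_free_def)

lemma C_0: "0 \<in> C" and C_of: "v \<in> carrier V \<Longrightarrow> frag_of (f, v) \<in> C"
  by (auto simp: C_def)

lemma C_add: "p \<in> C \<Longrightarrow> q \<in> C \<Longrightarrow> p + q \<in> C"
  using keys_add[of p q] by (auto simp: C_def)

lemma C_diff: "p \<in> C \<Longrightarrow> q \<in> C \<Longrightarrow> p - q \<in> C"
  using keys_diff[of p q] by (auto simp: C_def)

lemma C_uminus: "p \<in> C \<Longrightarrow> - p \<in> C"
  by (simp add: C_def)

lemma C_sum: "(\<And>i. i \<in> I \<Longrightarrow> h i \<in> C) \<Longrightarrow> sum h I \<in> C"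
  by (induction I rule: infinite_finite_induct) (auto intro: C_0 C_add)

lemma \<Phi>_vecs:
  assumes "p \<in> C"
  shows "\<Phi> p \<in> vecs n UNIV"
  unfolding tensor_coord_def
proof (intro vecs_sum vecs_smul fls_subfield_UNIV)
  fix k assume "k \<in> Poly_Mapping.keys p"
  then have "snd k \<in> carrier V" using assms by (auto simp: C_def)
  then show "\<phi> (snd k) \<in> vecs n UNIV" by (rule vecs_mono[OF \<phi>D(1)])
qed simp

abbreviation "rels \<equiv> {frag_of (f + g, v) - frag_of (f, v) - frag_of (g, v) | f g v. v \<in> carrier V} \<union>
      {frag_of (f, v \<oplus>\<^bsub>V\<^esub> w) - frag_of (f, v) - frag_of (f, w) | f v w.
         v \<in> carrier V \<and> w \<in> carrier V} \<union>
      {frag_of (f * a, v) - frag_of (f, a \<odot>\<^bsub>V\<^esub> v) | f a v. a \<in> carrier (fls_subring S) \<and> v \<in> carrier V}"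

lemma rels: "p \<in> rels \<Longrightarrow> p \<in> C \<and> \<Phi> p = 0"
proof -
  assume "p \<in> rels"
  then consider f g v where "p = frag_of (f + g, v) - frag_of (f, v) - frag_of (g, v)" "v \<in> carrier V"
    | f v w where "p = frag_of (f, v \<oplus>\<^bsub>V\<^esub> w) - frag_of (f, v) - frag_of (f, w)" "v \<in> carrier V" "w \<in> carrier V"
    | f a v where "p = frag_of (f * a, v) - frag_of (f, a \<odot>\<^bsub>V\<^esub> v)" "a \<in> S" "v \<in> carrier V"
    by auto
  then show ?thesis
  proof cases
    case 1
    then show ?thesis by (simp add: C_diff C_of tensor_coord_diff tensor_coord_of smul_def fun_eq_iff distrib_right)
  next
    case 2
    then show ?thesis
      by (simp add: C_diff C_of V.a_closed tensor_coord_diff tensor_coord_of \<phi>D(2) smul_def fun_eq_iff distrib_left)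
  next
    case 3
    have "a \<odot>\<^bsub>V\<^esub> v \<in> carrier V" by (rule V.smult_closed) (use 3 in simp_all)
    with 3 show ?thesis
      by (simp add: C_diff C_of tensor_coord_diff tensor_coord_of \<phi>D(3) smul_def fun_eq_iff mult.assoc)
  qed
qed

lemma null_sub: "p \<in> null \<Longrightarrow> p \<in> C \<and> \<Phi> p = 0"
  unfolding tensor_null_def
proof (induction rule: generate.induct)
  case one
  then show ?case by (simp add: tensor_free_def C_0 tensor_coord_0)
next
  case (incl h)
  then show ?case by (rule rels)
next
  case (inv h)
  then have h: "h \<in> C" "\<Phi> h = 0" using rels[OF inv] by auto
  then have "inv\<^bsub>tensor_free V\<^esub> h = - h" by (simp add: tensor_free_def C_def)
  then show ?case using h by (simp add: C_uminus tensor_coord_uminus)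
next
  case (eng h1 h2)
  then show ?case by (simp add: tensor_free_def C_add tensor_coord_add)
qed

lemma null_subgroup: "subgroup null (tensor_free V)"
  unfolding tensor_null_def
  by (rule group.generate_is_subgroup[OF group_free], rule subsetI, drule rels) (simp add: C_eq)

lemma null_0: "0 \<in> null"
  using subgroup.one_closed[OF null_subgroup] by (simp add: tensor_free_def)

lemma null_add: "p \<in> null \<Longrightarrow> q \<in> null \<Longrightarrow> p + q \<in> null"
  using subgroup.m_closed[OF null_subgroup, of p q] by (simp add: tensor_free_def)

lemma null_uminus:
  assumes "p \<in> null"
  shows "- p \<in> null"
proof -
  have "inv\<^bsub>tensor_free V\<^esub> p = - p" using null_sub[OF assms] by (simp add: tensor_free_def C_def)
  then show ?thesis using subgroup.m_inv_closed[OF null_subgroup assms] by simp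
qed

lemma null_diff: "p \<in> null \<Longrightarrow> q \<in> null \<Longrightarrow> p - q \<in> null"
  using null_add[of p "- q"] null_uminus[of q] by simp

lemma null_sum: "(\<And>i. i \<in> I \<Longrightarrow> h i \<in> null) \<Longrightarrow> sum h I \<in> null"
  by (induction I rule: infinite_finite_induct) (auto intro: null_0 null_add)

lemma null_rels: "p \<in> rels \<Longrightarrow> p \<in> null"
  unfolding tensor_null_def by (rule generate.incl)

lemma null_rel1: "v \<in> carrier V \<Longrightarrow> frag_of (f + g, v) - frag_of (f, v) - frag_of (g, v) \<in> null"
  by (rule null_rels) blast

lemma null_rel2: "v \<in> carrier V \<Longrightarrow> w \<in> carrier V \<Longrightarrow>
    frag_of (f, v \<oplus>\<^bsub>V\<^esub> w) - frag_of (f, v) - frag_of (f, w) \<in> null"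
  by (rule null_rels) blast

lemma null_rel3: "a \<in> S \<Longrightarrow> v \<in> carrier V \<Longrightarrow> frag_of (f * a, v) - frag_of (f, a \<odot>\<^bsub>V\<^esub> v) \<in> null"
  by (rule null_rels) auto

text \<open>The additivity relation for 0 + 0 is the negative of this generator.\<close>

lemma null_zero_left: "v \<in> carrier V \<Longrightarrow> frag_of (0, v) \<in> null"
  using null_uminus[OF null_rel1[of v 0 0]] by simp

lemma null_zero_right: "frag_of (f, \<zero>\<^bsub>V\<^esub>) \<in> null"
  using null_uminus[OF null_rel2[of "\<zero>\<^bsub>V\<^esub>" "\<zero>\<^bsub>V\<^esub>" f]] by simp

text \<open>The vector is assembled from its coordinates one at a time, and each coordinate is moved
  across the tensor sign by the third family of relations.\<close>

lemma normal_form_of: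
  assumes v: "v \<in> carrier V"
  shows "frag_of (f, v) - (\<Sum>j<n. frag_of (f * \<phi> v j, e j)) \<in> null"
proof -
  define t where "t m = (\<lambda>i. if i < m then \<phi> v i else 0)" for m
  define \<psi> where "\<psi> = the_inv_into (carrier V) \<phi>"
  note \<psi>D = \<phi>D(5,6)[folded \<psi>_def]
  have t: "t m \<in> vecs n S" for m
    using \<phi>D(1)[OF v] fls_subfield.zero_mem[OF sf] by (auto simp: t_def vecs_def)
  have "frag_of (f, \<psi> (t m)) - (\<Sum>j<m. frag_of (f * \<phi> v j, e j)) \<in> null" if "m \<le> n" for m
    using that
  proof (induction m)
    case 0
    have "t 0 = 0" by (simp add: t_def fun_eq_iff)
    moreover have "\<phi> \<zero>\<^bsub>V\<^esub> = 0" using \<phi>D(2)[of "\<zero>\<^bsub>V\<^esub>" "\<zero>\<^bsub>V\<^esub>"] by simp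
    ultimately have "\<psi> (t 0) = \<zero>\<^bsub>V\<^esub>" using \<phi>D(4)[OF \<psi>D(1)[OF t[of 0]] V.zero_closed] \<psi>D(2)[OF t[of 0]] by simp
    then show ?case by (simp add: null_zero_right)
  next
    case (Suc m)
    then have m: "m < n" by simp
    have a: "\<phi> v m \<in> S" using \<phi>D(1)[OF v] m by (simp add: vecs_def)
    have ae: "\<phi> v m \<odot>\<^bsub>V\<^esub> e m \<in> carrier V" by (rule V.smult_closed) (use a e(1)[OF m] in simp_all)
    have "\<phi> (\<psi> (t m) \<oplus>\<^bsub>V\<^esub> \<phi> v m \<odot>\<^bsub>V\<^esub> e m) = t m + smul (\<phi> v m) (unit_fun m)"
      by (simp only: \<phi>D(2)[OF \<psi>D(1)[OF t] ae] \<psi>D(2)[OF t] \<phi>D(3)[OF a e(1)[OF m]] e(2)[OF m])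
    also have "\<dots> = t (Suc m)"
      by (auto simp: t_def smul_def unit_fun_def fun_eq_iff less_Suc_eq)
    finally have "\<psi> (t m) \<oplus>\<^bsub>V\<^esub> \<phi> v m \<odot>\<^bsub>V\<^esub> e m = \<psi> (t (Suc m))"
      using \<phi>D(4)[OF V.a_closed[OF \<psi>D(1)[OF t] ae] \<psi>D(1)[OF t[of "Suc m"]]] \<psi>D(2)[OF t[of "Suc m"]] by simp
    then have 1: "frag_of (f, \<psi> (t (Suc m))) - frag_of (f, \<psi> (t m)) - frag_of (f, \<phi> v m \<odot>\<^bsub>V\<^esub> e m) \<in> null"
      using null_rel2[OF \<psi>D(1)[OF t[of m]] ae, of f] by simp
    have 2: "frag_of (f * \<phi> v m, e m) - frag_of (f, \<phi> v m \<odot>\<^bsub>V\<^esub> e m) \<in> null"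
      by (rule null_rel3[OF a e(1)[OF m]])
    have 3: "frag_of (f, \<psi> (t m)) - (\<Sum>j<m. frag_of (f * \<phi> v j, e j)) \<in> null" by (rule Suc.IH) (use m in simp)
    have "frag_of (f, \<psi> (t (Suc m))) - (\<Sum>j<Suc m. frag_of (f * \<phi> v j, e j))
      = (frag_of (f, \<psi> (t (Suc m))) - frag_of (f, \<psi> (t m)) - frag_of (f, \<phi> v m \<odot>\<^bsub>V\<^esub> e m))
        - (frag_of (f * \<phi> v m, e m) - frag_of (f, \<phi> v m \<odot>\<^bsub>V\<^esub> e m))
        + (frag_of (f, \<psi> (t m)) - (\<Sum>j<m. frag_of (f * \<phi> v j, e j)))"
      by (simp add: algebra_simps)
    then show ?case using null_add[OF null_diff[OF 1 2] 3] by metis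
  qed
  from this[of n] have "frag_of (f, \<psi> (t n)) - (\<Sum>j<n. frag_of (f * \<phi> v j, e j)) \<in> null" by simp
  moreover have "t n = \<phi> v" using \<phi>D(1)[OF v] by (auto simp: t_def vecs_def fun_eq_iff)
  moreover have "\<psi> (\<phi> v) = v" using \<phi>D(4)[OF \<psi>D(1)[OF \<phi>D(1)[OF v]] v] \<psi>D(2)[OF \<phi>D(1)[OF v]] by blast
  ultimately show ?thesis by simp
qed

lemma normal_form:
  assumes "p \<in> C"
  shows "p - (\<Sum>j<n. frag_of (\<Phi> p j, e j)) \<in> null"
proof -
  have "Poly_Mapping.keys p \<subseteq> UNIV \<times> carrier V" using assms by (simp add: C_def)
  then show ?thesis
  proof (induction p rule: frag_induction)
    case zero
    have "(\<Sum>j<n. frag_of (0, e j)) \<in> null" by (intro null_sum null_zero_left e) simp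
    from null_uminus[OF this] show ?case by (simp add: tensor_coord_0)
  next
    case (one x)
    then obtain f v where x: "x = (f, v)" "v \<in> carrier V" by auto
    then show ?case using normal_form_of[OF x(2), of f] by (simp add: tensor_coord_of smul_def)
  next
    case (diff a b)
    have "frag_of (\<Phi> a j, e j) - frag_of (\<Phi> a j - \<Phi> b j, e j) - frag_of (\<Phi> b j, e j) \<in> null" if "j < n" for j
      using null_rel1[OF e(1)[OF that], of "\<Phi> a j - \<Phi> b j" "\<Phi> b j"] by simp
    then have "(\<Sum>j<n. frag_of (\<Phi> a j, e j) - frag_of (\<Phi> a j - \<Phi> b j, e j) - frag_of (\<Phi> b j, e j)) \<in> null"
      by (intro null_sum) simp
    then have 1: "(\<Sum>j<n. frag_of (\<Phi> a j, e j)) - (\<Sum>j<n. frag_of (\<Phi> a j - \<Phi> b j, e j)) - (\<Sum>j<n. frag_of (\<Phi> b j, e j)) \<in> null"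
      by (simp only: sum_subtractf)
    have "a - b - (\<Sum>j<n. frag_of (\<Phi> (a - b) j, e j))
      = (a - (\<Sum>j<n. frag_of (\<Phi> a j, e j))) - (b - (\<Sum>j<n. frag_of (\<Phi> b j, e j)))
        + ((\<Sum>j<n. frag_of (\<Phi> a j, e j)) - (\<Sum>j<n. frag_of (\<Phi> a j - \<Phi> b j, e j)) - (\<Sum>j<n. frag_of (\<Phi> b j, e j)))"
      by (simp add: tensor_coord_diff algebra_simps)
    then show ?case using null_add[OF null_diff[OF diff] 1] by metis
  qed
qed

text \<open>By the normal form an element with zero coordinates is, modulo relations, a sum of
  generators with left factor 0. Hence coordinates decide equality in the tensor product.\<close>

lemma null_eq: "null = {p \<in> C. \<Phi> p = 0}"
proof
  show "null \<subseteq> {p \<in> C. \<Phi> p = 0}" using null_sub by blast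
  show "{p \<in> C. \<Phi> p = 0} \<subseteq> null"
  proof
    fix p assume p: "p \<in> {p \<in> C. \<Phi> p = 0}"
    have "(\<Sum>j<n. frag_of (0, e j)) \<in> null" by (intro null_sum null_zero_left e) simp
    moreover have "p - (\<Sum>j<n. frag_of (0, e j)) \<in> null" using normal_form[of p] p by simp
    ultimately show "p \<in> null" using null_add by fastforce
  qed
qed

text \<open>The coset with coordinate vector y: cosets are the fibres of the coordinate map, so
  computing in the quotient becomes computing with vectors.\<close>

definition fib :: "(nat \<Rightarrow> complex fls) \<Rightarrow> (complex fls \<times> 'v \<Rightarrow>\<^sub>0 int) set" where
  "fib y = {p \<in> C. \<Phi> p = y}"

lemma lift:
  assumes y: "y \<in> vecs n UNIV"
  shows "(\<Sum>j<n. frag_of (y j, e j)) \<in> fib y"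
proof -
  have "\<Phi> (\<Sum>j<n. frag_of (y j, e j)) = (\<Sum>j<n. smul (y j) (unit_fun j))"
    by (simp add: tensor_coord_sum tensor_coord_of e(2))
  also have "\<dots> = y"
    by (rule additive_expand[where g = "\<lambda>x. x", OF fls_subfield_UNIV _ y, symmetric]) simp
  finally show ?thesis unfolding fib_def by (auto intro!: C_sum C_of e)
qed

lemma fib_inj: "y \<in> vecs n UNIV \<Longrightarrow> fib y = fib z \<Longrightarrow> y = z"
  using lift[of y] by (auto simp: fib_def)

lemma coset_eq_fib:
  assumes "p \<in> C"
  shows "null #>\<^bsub>tensor_free V\<^esub> p = fib (\<Phi> p)"
proof -
  have "null #>\<^bsub>tensor_free V\<^esub> p = {h + p | h. h \<in> null}" by (auto simp: r_coset_def tensor_free_def)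
  also have "\<dots> = fib (\<Phi> p)"
  proof (intro equalityI subsetI)
    fix q assume "q \<in> {h + p | h. h \<in> null}"
    then show "q \<in> fib (\<Phi> p)" using assms by (auto simp: fib_def null_eq C_add tensor_coord_add)
  next
    fix q assume "q \<in> fib (\<Phi> p)"
    then have "q - p \<in> null" using assms by (auto simp: fib_def null_eq C_diff tensor_coord_diff)
    then show "q \<in> {h + p | h. h \<in> null}" by (intro CollectI exI[of _ "q - p"]) simp
  qed
  finally show ?thesis .
qed

section \<open>The formal space as a space of coordinate vectors\<close>

abbreviation "W \<equiv> formal_space (fls_subring S) V"
abbreviation "D \<equiv> conn n A"

lemma W_carrier: "carrier W = fib ` vecs n UNIV"
proof -
  have "carrier W = (\<lambda>p. null #>\<^bsub>tensor_free V\<^esub> p) ` C"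
    by (auto simp: formal_space_def FactGroup_def RCOSETS_def C_eq)
  also have "\<dots> = fib ` vecs n UNIV"
  proof (intro equalityI subsetI)
    fix X assume "X \<in> (\<lambda>p. null #>\<^bsub>tensor_free V\<^esub> p) ` C"
    then show "X \<in> fib ` vecs n UNIV" using \<Phi>_vecs by (auto simp: coset_eq_fib)
  next
    fix X assume "X \<in> fib ` vecs n UNIV"
    then obtain y where y: "y \<in> vecs n UNIV" "X = fib y" by blast
    from lift[OF y(1)] have p: "(\<Sum>j<n. frag_of (y j, e j)) \<in> C" "\<Phi> (\<Sum>j<n. frag_of (y j, e j)) = y"
      by (auto simp: fib_def)
    then show "X \<in> (\<lambda>p. null #>\<^bsub>tensor_free V\<^esub> p) ` C"
      using y(2) coset_eq_fib[OF p(1)] by (intro image_eqI[OF _ p(1)]) simp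
  qed
  finally show ?thesis .
qed

lemma W_zero: "\<zero>\<^bsub>W\<^esub> = fib 0"
  by (simp add: formal_space_def FactGroup_def fib_def null_eq)

lemma W_add:
  assumes "y \<in> vecs n UNIV" "z \<in> vecs n UNIV"
  shows "fib y \<oplus>\<^bsub>W\<^esub> fib z = fib (y + z)"
proof -
  have "fib y \<oplus>\<^bsub>W\<^esub> fib z = {p + q | p q. p \<in> fib y \<and> q \<in> fib z}"
    by (auto simp: formal_space_def FactGroup_def set_mult_def tensor_free_def)
  also have "\<dots> = fib (y + z)"
  proof (intro equalityI subsetI)
    fix r assume "r \<in> {p + q | p q. p \<in> fib y \<and> q \<in> fib z}"
    then show "r \<in> fib (y + z)" by (auto simp: fib_def C_add tensor_coord_add)
  next
    fix r assume r: "r \<in> fib (y + z)"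
    define p where "p = (\<Sum>j<n. frag_of (y j, e j))"
    have p: "p \<in> fib y" unfolding p_def by (rule lift[OF assms(1)])
    have "r - p \<in> fib z" using r p by (auto simp: fib_def C_diff tensor_coord_diff)
    then show "r \<in> {p + q | p q. p \<in> fib y \<and> q \<in> fib z}"
      using p by (intro CollectI exI[of _ p] exI[of _ "r - p"]) simp
  qed
  finally show ?thesis .
qed

text \<open>The union over all representatives is a single coset because the map acts on coordinates
  through L, and because the fibre is not empty.\<close>

lemma induced:
  assumes y: "y \<in> vecs n UNIV"
    and h: "\<And>f v. v \<in> carrier V \<Longrightarrow> h f v \<in> C \<and> \<Phi> (h f v) = L (smul f (\<phi> v))"
    and L: "L 0 = 0" "\<And>x z. L (x - z) = L x - L z"
  shows "tensor_induced (fls_subring S) V h (fib y) = fib (L y)"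
proof -
  have ext: "frag_extend (\<lambda>(f, v). h f v) p \<in> C \<and> \<Phi> (frag_extend (\<lambda>(f, v). h f v) p) = L (\<Phi> p)" if "p \<in> C" for p
  proof -
    have "Poly_Mapping.keys p \<subseteq> UNIV \<times> carrier V" using that by (simp add: C_def)
    then show ?thesis
    proof (induction p rule: frag_induction)
      case zero
      show ?case by (simp only: frag_extend_0 C_0 tensor_coord_0 L(1) simp_thms)
    next
      case (one x)
      then obtain f v where x: "x = (f, v)" "v \<in> carrier V" by auto
      then show ?case using h[OF x(2), of f] by (simp add: tensor_coord_of)
    next
      case (diff a b)
      then show ?case by (simp only: frag_extend_diff C_diff tensor_coord_diff L(2) simp_thms)
    qed
  qed
  have "null #>\<^bsub>tensor_free V\<^esub> frag_extend (\<lambda>(f, v). h f v) p = fib (L y)" if "p \<in> fib y" for p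
    using that ext[of p] coset_eq_fib by (auto simp: fib_def)
  moreover have "fib y \<noteq> {}" using lift[OF y] by blast
  ultimately show ?thesis unfolding tensor_induced_def by auto
qed

lemma W_smult:
  assumes "y \<in> vecs n UNIV"
  shows "g \<odot>\<^bsub>W\<^esub> fib y = fib (smul g y)"
proof -
  have "tensor_induced (fls_subring S) V (\<lambda>f v. frag_of (g * f, v)) (fib y) = fib (smul g y)"
  proof (rule induced[OF assms])
    show "frag_of (g * f, v) \<in> C \<and> \<Phi> (frag_of (g * f, v)) = smul g (smul f (\<phi> v))" if "v \<in> carrier V" for f v
      using that by (simp add: C_of tensor_coord_of smul_def mult.assoc)
    show "smul g 0 = 0" by (simp add: smul_def fun_eq_iff)
    show "smul g (x - z) = smul g x - smul g z" for x z by (simp add: smul_def fun_eq_iff right_diff_distrib)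
  qed
  then show ?thesis by (simp add: formal_space_def)
qed

lemma W_nabla:
  assumes "y \<in> vecs n UNIV"
  shows "formal_nabla (fls_subring S) V nabla (fib y) = fib (D y)"
  unfolding formal_nabla_def
proof (rule induced[OF assms])
  interpret dm: diff_module smul D by (rule diff_module_conn)
  show "frag_of (fls_deriv f, v) + frag_of (f, nabla v) \<in> C \<and>
      \<Phi> (frag_of (fls_deriv f, v) + frag_of (f, nabla v)) = D (smul f (\<phi> v))" if v: "v \<in> carrier V" for f v
  proof -
    have "\<phi> (nabla v) = D (\<phi> v)" using cc v by (simp add: coord_conn_def)
    then show ?thesis using v V.nabla_closed[OF v]
      by (simp add: C_of C_add tensor_coord_add tensor_coord_of dm.D_sm)
  qed
  show "D 0 = 0" by (rule dm.D_0)
  show "D (x - z) = D x - D z" for x z using dm.D_add[of "x - z" z] by (simp add: eq_diff_eq)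
qed

lemma smul_vecs: "y \<in> vecs n UNIV \<Longrightarrow> smul g y \<in> vecs n UNIV"
  by (intro vecs_smul fls_subfield_UNIV) auto

lemma add_vecs: "y \<in> vecs n UNIV \<Longrightarrow> z \<in> vecs n UNIV \<Longrightarrow> y + z \<in> vecs n UNIV"
  by (intro vecs_add fls_subfield_UNIV)

lemma W_abelian: "abelian_group W"
proof (rule abelian_groupI)
  fix X assume "X \<in> carrier W"
  then obtain x where X: "X = fib x" "x \<in> vecs n UNIV" by (auto simp: W_carrier)
  have m: "- x \<in> vecs n UNIV" by (rule vecs_minus[OF X(2) fls_subfield_UNIV])
  show "\<exists>Y\<in>carrier W. Y \<oplus>\<^bsub>W\<^esub> X = \<zero>\<^bsub>W\<^esub>"
    using m X by (intro bexI[of _ "fib (- x)"]) (simp_all add: W_add W_zero W_carrier)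
next
  have "(0 :: nat \<Rightarrow> complex fls) \<in> vecs n UNIV" by (simp add: vecs_def)
  then show "\<zero>\<^bsub>W\<^esub> \<in> carrier W" by (auto simp: W_zero W_carrier)
next
  fix X Y assume "X \<in> carrier W" "Y \<in> carrier W"
  then obtain x y where XY: "X = fib x" "x \<in> vecs n UNIV" "Y = fib y" "y \<in> vecs n UNIV" by (auto simp: W_carrier)
  show "X \<oplus>\<^bsub>W\<^esub> Y \<in> carrier W" using XY add_vecs[of x y] by (auto simp: W_add W_carrier)
  show "X \<oplus>\<^bsub>W\<^esub> Y = Y \<oplus>\<^bsub>W\<^esub> X" using XY by (simp add: W_add add.commute)
  fix Z assume "Z \<in> carrier W"
  then obtain z where Z: "Z = fib z" "z \<in> vecs n UNIV" by (auto simp: W_carrier)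
  show "X \<oplus>\<^bsub>W\<^esub> Y \<oplus>\<^bsub>W\<^esub> Z = X \<oplus>\<^bsub>W\<^esub> (Y \<oplus>\<^bsub>W\<^esub> Z)"
    using XY Z add_vecs by (simp add: W_add add.assoc)
next
  fix X assume "X \<in> carrier W"
  then obtain x where X: "X = fib x" "x \<in> vecs n UNIV" by (auto simp: W_carrier)
  have "(0 :: nat \<Rightarrow> complex fls) \<in> vecs n UNIV" by (simp add: vecs_def)
  then show "\<zero>\<^bsub>W\<^esub> \<oplus>\<^bsub>W\<^esub> X = X" using X by (simp add: W_zero W_add)
qed

lemma W_vectorspace: "vectorspace laurent_field W"
proof -
  have f: "field laurent_field" by (rule field_of_fls_subfield[OF fls_subfield_UNIV])
  then have c: "cring laurent_field" by (simp add: field_def domain_def)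
  have "module_axioms laurent_field W"
  proof (rule module_axioms.intro)
    fix a b X Y assume "X \<in> carrier W" "Y \<in> carrier W"
    then obtain x y where XY: "X = fib x" "x \<in> vecs n UNIV" "Y = fib y" "y \<in> vecs n UNIV" by (auto simp: W_carrier)
    note simps = W_add W_smult smul_vecs add_vecs
    show "(a \<oplus>\<^bsub>laurent_field\<^esub> b) \<odot>\<^bsub>W\<^esub> X = a \<odot>\<^bsub>W\<^esub> X \<oplus>\<^bsub>W\<^esub> b \<odot>\<^bsub>W\<^esub> X"
      using XY by (simp add: simps) (simp add: smul_def fun_eq_iff distrib_right plus_fun_def)
    show "a \<odot>\<^bsub>W\<^esub> (X \<oplus>\<^bsub>W\<^esub> Y) = a \<odot>\<^bsub>W\<^esub> X \<oplus>\<^bsub>W\<^esub> a \<odot>\<^bsub>W\<^esub> Y"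
      using XY by (simp add: simps) (simp add: smul_def fun_eq_iff distrib_left plus_fun_def)
    show "(a \<otimes>\<^bsub>laurent_field\<^esub> b) \<odot>\<^bsub>W\<^esub> X = a \<odot>\<^bsub>W\<^esub> (b \<odot>\<^bsub>W\<^esub> X)"
      using XY by (simp add: simps) (simp add: smul_def mult.assoc)
  next
    fix a X assume "X \<in> carrier W"
    then show "a \<odot>\<^bsub>W\<^esub> X \<in> carrier W" using smul_vecs by (auto simp: W_carrier W_smult)
  next
    fix X assume "X \<in> carrier W"
    then show "\<one>\<^bsub>laurent_field\<^esub> \<odot>\<^bsub>W\<^esub> X = X" by (auto simp: W_carrier W_smult smul_def)
  qed
  then show ?thesis by (intro vectorspace.intro module.intro c W_abelian f)
qed

sublocale W: vectorspace laurent_field W by (rule W_vectorspace)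

lemma W_finsum:
  assumes "finite I" "\<And>i. i \<in> I \<Longrightarrow> h i \<in> vecs n UNIV"
  shows "(\<Oplus>\<^bsub>W\<^esub>i\<in>I. fib (h i)) = fib (\<Sum>i\<in>I. h i)"
  using assms
proof (induction I rule: finite_induct)
  case empty
  show ?case by (simp only: W.finsum_empty sum.empty W_zero)
next
  case (insert i I)
  have s: "(\<Sum>i\<in>I. h i) \<in> vecs n UNIV" using insert.prems by (intro vecs_sum fls_subfield_UNIV) auto
  have "(\<Oplus>\<^bsub>W\<^esub>i\<in>insert i I. fib (h i)) = fib (h i) \<oplus>\<^bsub>W\<^esub> (\<Oplus>\<^bsub>W\<^esub>i\<in>I. fib (h i))"
    by (rule W.finsum_insert) (use insert in \<open>auto simp: W_carrier\<close>)
  also have "\<dots> = fib (h i) \<oplus>\<^bsub>W\<^esub> fib (\<Sum>i\<in>I. h i)" using insert by simp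
  also have "\<dots> = fib (h i + (\<Sum>i\<in>I. h i))" using insert.prems s by (intro W_add) auto
  finally show ?case using insert.hyps by (simp only: sum.insert not_False_eq_True)
qed

text \<open>A basis means existence and uniqueness of combinations. Existence is the spanning
  clause, and uniqueness compared with the zero combination is independence.\<close>

lemma formal_cyclic:
  assumes "cyclic_operator W (formal_nabla (fls_subring S) V nabla) w m b"
  obtains y where "y \<in> vecs n UNIV"
    "\<And>x. x \<in> vecs n UNIV \<Longrightarrow> \<exists>c. x = (\<Sum>i<m. smul (c i) ((D ^^ i) y))"
    "\<And>c i. (\<Sum>i<m. smul (c i) ((D ^^ i) y)) = 0 \<Longrightarrow> i < m \<Longrightarrow> c i = 0"
    "b m = 1" "(\<Sum>i\<le>m. smul (b i) ((D ^^ i) y)) = 0"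
proof -
  let ?N = "formal_nabla (fls_subring S) V nabla"
  have w: "w \<in> carrier W" and inj: "inj_on (\<lambda>i. (?N ^^ i) w) {..<m}"
    and basis: "W.basis ((\<lambda>i. (?N ^^ i) w) ` {..<m})" and bm: "b m = 1"
    and rel: "(\<Oplus>\<^bsub>W\<^esub>i\<in>{..m}. b i \<odot>\<^bsub>W\<^esub> (?N ^^ i) w) = \<zero>\<^bsub>W\<^esub>"
    using assms by (auto simp: cyclic_operator_def)
  obtain y where y: "y \<in> vecs n UNIV" "w = fib y" using w by (auto simp: W_carrier)
  have Dy: "(D ^^ i) y \<in> vecs n UNIV" for i
    by (rule vecs_conn_pow[OF fls_subfield_UNIV _ _ y(1)]) auto
  have N: "(?N ^^ i) w = fib ((D ^^ i) y)" for i
    by (induction i) (simp_all add: y(2) W_nabla Dy)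
  define B where "B = (\<lambda>i. fib ((D ^^ i) y)) ` {..<m}"
  have inj': "inj_on (\<lambda>i. fib ((D ^^ i) y)) {..<m}" using inj by (simp add: N)
  have BC: "B \<subseteq> carrier W" "finite B" using Dy by (auto simp: B_def W_carrier)
  have "W.basis B" using basis by (simp add: N B_def)
  then have crit: "\<exists>!a. a \<in> B \<rightarrow>\<^sub>E UNIV \<and> W.lincomb a B = v" if "v \<in> carrier W" for v
    using W.basis_criterion[OF BC(2,1)] that by simp
  have lin: "W.lincomb a B = fib (\<Sum>i<m. smul (a (fib ((D ^^ i) y))) ((D ^^ i) y))" for a
  proof -
    have "W.lincomb a B = (\<Oplus>\<^bsub>W\<^esub>i\<in>{..<m}. a (fib ((D ^^ i) y)) \<odot>\<^bsub>W\<^esub> fib ((D ^^ i) y))"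
      unfolding W.lincomb_def B_def
      by (rule W.finsum_reindex[OF _ inj']) (use BC(1) in \<open>auto simp: B_def\<close>)
    also have "\<dots> = (\<Oplus>\<^bsub>W\<^esub>i\<in>{..<m}. fib (smul (a (fib ((D ^^ i) y))) ((D ^^ i) y)))"
      by (simp add: W_smult Dy)
    also have "\<dots> = fib (\<Sum>i<m. smul (a (fib ((D ^^ i) y))) ((D ^^ i) y))"
      by (rule W_finsum) (auto intro: smul_vecs Dy)
    finally show ?thesis .
  qed
  have sums: "(\<Sum>i\<in>I. smul (c i) ((D ^^ i) y)) \<in> vecs n UNIV" for c I
    by (intro vecs_sum fls_subfield_UNIV smul_vecs Dy)
  show thesis
  proof (rule that[OF y(1) _ _ bm])
    fix x assume x: "x \<in> vecs n UNIV"
    then have "fib x \<in> carrier W" by (simp add: W_carrier)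
    then obtain a where "W.lincomb a B = fib x" using crit by blast
    then have "fib x = fib (\<Sum>i<m. smul (a (fib ((D ^^ i) y))) ((D ^^ i) y))" by (simp only: lin)
    then have "x = (\<Sum>i<m. smul (a (fib ((D ^^ i) y))) ((D ^^ i) y))" by (rule fib_inj[OF x])
    then show "\<exists>c. x = (\<Sum>i<m. smul (c i) ((D ^^ i) y))" by (rule exI[of _ "\<lambda>i. a (fib ((D ^^ i) y))"])
  next
    fix c i assume c: "(\<Sum>i<m. smul (c i) ((D ^^ i) y)) = 0" and i: "i < m"
    \<comment> \<open>\<open>lincomb\<close> indexes coefficients by basis vectors; injectivity of
      the sequence of derivatives translates them from the index i.\<close>
    define a where "a = restrict (\<lambda>v. c (the_inv_into {..<m} (\<lambda>i. fib ((D ^^ i) y)) v)) B"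
    have ai: "a (fib ((D ^^ i) y)) = c i" if "i < m" for i
      using that the_inv_into_f_f[OF inj', of i] by (simp add: a_def B_def)
    have "W.lincomb a B = fib 0"
      unfolding lin by (rule arg_cong[of _ _ fib]) (use c ai in simp)
    moreover have "W.lincomb (restrict (\<lambda>_. 0) B) B = fib 0"
      unfolding lin by (rule arg_cong[of _ _ fib], rule sum.neutral) (auto simp: B_def smul_def zero_fun_def)
    moreover have "a \<in> B \<rightarrow>\<^sub>E UNIV" "restrict (\<lambda>_. 0) B \<in> B \<rightarrow>\<^sub>E UNIV" by (auto simp: a_def)
    moreover have "fib 0 \<in> carrier W" using W.zero_closed by (simp add: W_zero)
    ultimately have "a = restrict (\<lambda>_. 0) B" using crit by blast
    then have "a (fib ((D ^^ i) y)) = 0" using i by (simp add: B_def)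
    then show "c i = 0" using ai[OF i] by simp
  next
    have "(\<Oplus>\<^bsub>W\<^esub>i\<in>{..m}. b i \<odot>\<^bsub>W\<^esub> (?N ^^ i) w) = (\<Oplus>\<^bsub>W\<^esub>i\<in>{..m}. fib (smul (b i) ((D ^^ i) y)))"
      by (simp add: N W_smult Dy)
    also have "\<dots> = fib (\<Sum>i\<le>m. smul (b i) ((D ^^ i) y))"
      by (rule W_finsum) (auto intro: smul_vecs Dy)
    finally have "fib (\<Sum>i\<le>m. smul (b i) ((D ^^ i) y)) = fib 0" using rel by (simp only: W_zero)
    then show "(\<Sum>i\<le>m. smul (b i) ((D ^^ i) y)) = 0" by (rule fib_inj[OF sums])
  qed
qed

end

subsection \<open>Gevrey cyclic vectors\<close>

text \<open>Fewer equations than unknowns in either case: m > n gives a relation among the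
  \<open>z i\<close>, and n > m one among the unit vectors. The order of a cyclic operator is
  therefore the dimension.\<close>

lemma basis_length:
  fixes z :: "nat \<Rightarrow> nat \<Rightarrow> complex fls"
  assumes z: "\<And>i. z i \<in> vecs n UNIV"
    and span: "\<And>x. x \<in> vecs n UNIV \<Longrightarrow> \<exists>c. x = (\<Sum>i<m. smul (c i) (z i))"
    and indep: "\<And>c i. (\<Sum>i<m. smul (c i) (z i)) = 0 \<Longrightarrow> i < m \<Longrightarrow> c i = 0"
  shows "m = n"
proof (rule antisym)
  show "m \<le> n"
  proof (rule ccontr)
    assume "\<not> m \<le> n"
    then have "n < m" by simp
    then obtain c where c: "\<And>i. i < n \<Longrightarrow> (\<Sum>j<m. z j i * c j) = 0" "\<exists>j<m. c j \<noteq> 0"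
      using underdetermined_kernel[of n m "\<lambda>i j. z j i"] by metis
    have "(\<Sum>j<m. smul (c j) (z j)) i = 0" for i
    proof (cases "i < n")
      case True
      from c(1)[OF this] show ?thesis by (simp add: sum_fun_app smul_def mult.commute)
    next
      case False
      then show ?thesis using z by (simp add: sum_fun_app smul_def vecs_def)
    qed
    then have "(\<Sum>j<m. smul (c j) (z j)) = 0" by (simp add: fun_eq_iff)
    from indep[OF this] c(2) show False by metis
  qed
  show "n \<le> m"
  proof (rule ccontr)
    assume "\<not> n \<le> m"
    then have mn: "m < n" by simp
    have "\<forall>k. \<exists>c. k < n \<longrightarrow> unit_fun k = (\<Sum>i<m. smul (c i) (z i))"
      using span[OF unit_fun_vecs[OF fls_subfield_UNIV]] by metis
    then obtain c where c: "\<And>k. k < n \<Longrightarrow> unit_fun k = (\<Sum>i<m. smul (c k i) (z i))" by metis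
    obtain y where y: "\<And>i. i < m \<Longrightarrow> (\<Sum>k<n. c k i * y k) = 0" "\<exists>k<n. y k \<noteq> 0"
      using underdetermined_kernel[OF mn, of "\<lambda>i k. c k i"] by metis
    have "y j = 0" if "j < n" for j
    proof -
      have "y j = (\<Sum>k<n. y k * unit_fun k j)"
        using that by (simp add: unit_fun_def if_distrib[of "\<lambda>x. _ * x"] cong: if_cong)
      also have "\<dots> = (\<Sum>k<n. \<Sum>i<m. y k * (c k i * z i j))"
      proof (rule sum.cong)
        fix k assume "k \<in> {..<n}"
        then have "unit_fun k j = (\<Sum>i<m. smul (c k i) (z i)) j" using c[of k] by (metis lessThan_iff)
        then show "y k * unit_fun k j = (\<Sum>i<m. y k * (c k i * z i j))"
          by (simp add: sum_fun_app smul_def sum_distrib_left)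
      qed simp
      also have "\<dots> = (\<Sum>i<m. \<Sum>k<n. y k * (c k i * z i j))" by (rule sum.swap)
      also have "\<dots> = (\<Sum>i<m. (\<Sum>k<n. c k i * y k) * z i j)"
        by (simp add: sum_distrib_left mult_ac)
      also have "\<dots> = 0" using y(1) by simp
      finally show ?thesis .
    qed
    then show False using y(2) by metis
  qed
qed

lemma inverse_matrix_ex:
  fixes M :: "nat \<Rightarrow> nat \<Rightarrow> complex fls"
  assumes "fls_subfield K" and M: "\<forall>i<n. \<forall>j<n. M i j \<in> K"
    and inj: "\<forall>y. (\<forall>j<n. (\<Sum>i<n. y i * M i j) = 0) \<longrightarrow> (\<forall>i<n. y i = 0)"
  shows "\<exists>N. (\<forall>i<n. \<forall>j<n. N i j \<in> K) \<and>
    (\<forall>i<n. \<forall>k<n. (\<Sum>j<n. M i j * N j k) = (if i = k then 1 else 0)) \<and>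
    (\<forall>i<n. \<forall>k<n. (\<Sum>j<n. N i j * M j k) = (if i = k then 1 else 0))"
proof (rule fls_subfield.inverse_matrix_exists[OF assms(1), of n M])
  show "M i j \<in> K" if "i < n" "j < n" for i j using M that by blast
  show "y i = 0" if "\<And>j. j < n \<Longrightarrow> (\<Sum>i<n. y i * M i j) = 0" "i < n" for y i
    using inj[rule_format, of y i] that by metis
  show ?thesis if "\<And>i j. i < n \<Longrightarrow> j < n \<Longrightarrow> N i j \<in> K"
    "\<And>i k. i < n \<Longrightarrow> k < n \<Longrightarrow> (\<Sum>j<n. M i j * N j k) = (if i = k then 1 else 0)"
    "\<And>i k. i < n \<Longrightarrow> k < n \<Longrightarrow> (\<Sum>j<n. N i j * M j k) = (if i = k then 1 else 0)" for N
    by (intro exI[of _ N] conjI allI impI that)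
qed

lemma gevrey_series_approx:
  assumes "s > 0"
  shows "\<exists>g\<in>gevrey_series s. val_ge (f - g) c"
proof -
  define a where "a k = (if k \<le> \<lceil>c\<rceil> then fls_nth f k else 0)" for k
  have a: "fls_nth (Abs_fls a) k = a k" for k
    by (rule nth_Abs_fls_lower_bound[of "fls_subdegree f"]) (simp add: a_def)
  have "Abs_fls a \<in> gevrey_series s"
    by (rule gevrey_series_finite[OF assms, of "\<lceil>c\<rceil>"]) (simp add: a a_def)
  moreover have "val_ge (f - Abs_fls a) c"
    unfolding val_ge_def by (auto simp: a a_def) linarith
  ultimately show ?thesis by blast
qed

lemma vecs_gevrey_approx:
  assumes s: "s > 0" and sf: "fls_subfield (gevrey_series s)" and y: "y \<in> vecs n UNIV"
  shows "\<exists>x\<in>vecs n (gevrey_series s). \<forall>i. val_ge (x i - y i) c"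
proof -
  have "\<forall>f. \<exists>g. g \<in> gevrey_series s \<and> val_ge (f - g) c" using gevrey_series_approx[OF s] by blast
  from choice[OF this] obtain g where g: "\<And>f. g f \<in> gevrey_series s" "\<And>f. val_ge (f - g f) c" by blast
  define x where "x i = (if i < n then g (y i) else 0)" for i
  have "x \<in> vecs n (gevrey_series s)" by (simp add: vecs_def x_def g)
  moreover have "val_ge (x i - y i) c" for i
  proof (cases "i < n")
    case True
    then show ?thesis using g(2)[of "y i"] val_ge_uminus[of "x i - y i" c] by (simp add: x_def)
  next
    case False
    then show ?thesis using y by (simp add: x_def vecs_def)
  qed
  ultimately show ?thesis by blast
qed

section \<open>Stability of a cyclic vector and its operator under small changes\<close>

lemma val_ge_conn:
  assumes A: "\<And>i j. i < n \<Longrightarrow> j < n \<Longrightarrow> val_ge (A i j) (- \<alpha>)" and \<alpha>: "\<alpha> \<ge> 0"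
    and d: "\<And>i. val_ge (d i) c"
  shows "val_ge (conn n A d i) (c - (1 + \<alpha>))"
proof -
  have "val_ge (fls_deriv (d i)) (c - (1 + \<alpha>))"
    by (rule val_ge_mono[OF val_ge_deriv[OF d]]) (use \<alpha> in simp)
  moreover have "val_ge (\<Sum>j<n. A i j * d j) (c - (1 + \<alpha>))" if "i < n"
    by (rule val_ge_sum, rule val_ge_mono[OF val_ge_mult[OF A[OF that] d]]) (use \<alpha> in auto)
  ultimately show ?thesis unfolding conn_def by (auto intro: val_ge_add)
qed

lemma val_ge_conn_pow:
  assumes A: "\<And>i j. i < n \<Longrightarrow> j < n \<Longrightarrow> val_ge (A i j) (- \<alpha>)" and \<alpha>: "\<alpha> \<ge> 0"
    and d: "\<And>i. val_ge (d i) c"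
  shows "val_ge ((conn n A ^^ m) d i) (c - real m * (1 + \<alpha>))"
proof (induction m arbitrary: i)
  case 0
  show ?case using d by simp
next
  case (Suc m)
  have "val_ge (conn n A ((conn n A ^^ m) d) i) (c - real m * (1 + \<alpha>) - (1 + \<alpha>))"
    by (rule val_ge_conn[OF A \<alpha> Suc.IH]) simp_all
  moreover have "c - real m * (1 + \<alpha>) - (1 + \<alpha>) = c - real (Suc m) * (1 + \<alpha>)"
    by (simp add: algebra_simps)
  ultimately show ?case by (simp only: funpow.simps o_apply)
qed

text \<open>Finitely many series have some common bound to start from, and unit improvements reach
  L.\<close>

lemma val_ge_bootstrap:
  fixes t :: "nat \<Rightarrow> complex fls"
  assumes step: "\<And>c. (\<And>i. i < n \<Longrightarrow> val_ge (t i) c) \<Longrightarrow> (\<And>i. i < n \<Longrightarrow> val_ge (t i) (min (c + 1) L))"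
    and i: "i < n"
  shows "val_ge (t i) L"
proof -
  obtain c where c: "\<forall>i\<in>{..<n}. val_ge (t i) c" using val_ge_exists_family[of "{..<n}" t] by blast
  have k: "\<forall>i<n. val_ge (t i) (min (c + real k) L)" for k
  proof (induction k)
    case 0
    show ?case using c by (auto intro: val_ge_mono)
  next
    case (Suc k)
    have "val_ge (t i) (min (min (c + real k) L + 1) L)" if "i < n" for i
      by (rule step[OF _ that]) (use Suc.IH in blast)
    then have "val_ge (t i) (min (c + real (Suc k)) L)" if "i < n" for i
      by (rule val_ge_mono) (use that in auto)
    then show ?case by blast
  qed
  obtain k :: nat where "L - c \<le> real k" using real_arch_simple by blast
  then show ?thesis using k[of k] i by (auto intro: val_ge_mono)
qed

text \<open>With the inverse N of M, t equals (g - t (M' - M)) N. The error M' - M beats the poles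
  of N by 1, so the term in t improves any bound by 1. For g = 0 it follows that M' has no
  kernel.\<close>

lemma perturbed_system_val:
  fixes t :: "nat \<Rightarrow> complex fls"
  assumes inv: "\<And>i k. i < n \<Longrightarrow> k < n \<Longrightarrow> (\<Sum>j<n. M i j * N j k) = (if i = k then 1 else 0)"
    and N: "\<And>i j. i < n \<Longrightarrow> j < n \<Longrightarrow> val_ge (N i j) (- \<beta>)"
    and e: "\<And>i j. i < n \<Longrightarrow> j < n \<Longrightarrow> val_ge (M' i j - M i j) (\<beta> + 1)"
    and t: "\<And>k. k < n \<Longrightarrow> (\<Sum>j<n. t j * M' j k) = g k"
    and g: "\<And>k. k < n \<Longrightarrow> val_ge (g k) G" and i: "i < n"
  shows "val_ge (t i) (G - \<beta>)"
proof (rule val_ge_bootstrap[OF _ i])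
  fix c i assume c: "\<And>i. i < n \<Longrightarrow> val_ge (t i) c" and i: "i < n"
  have "t i = (\<Sum>j<n. t j * (\<Sum>k<n. M j k * N k i))"
    using i by (simp add: inv if_distrib[of "\<lambda>x. _ * x"] cong: if_cong)
  also have "\<dots> = (\<Sum>j<n. \<Sum>k<n. t j * M j k * N k i)"
    by (simp add: sum_distrib_left mult.assoc)
  also have "\<dots> = (\<Sum>k<n. \<Sum>j<n. t j * M j k * N k i)" by (rule sum.swap)
  also have "\<dots> = (\<Sum>k<n. (g k - (\<Sum>j<n. t j * (M' j k - M j k))) * N k i)"
    by (intro sum.cong refl)
      (simp add: t[symmetric] right_diff_distrib sum_subtractf sum_distrib_right)
  finally have eq: "t i = (\<Sum>k<n. (g k - (\<Sum>j<n. t j * (M' j k - M j k))) * N k i)" .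
  have "val_ge ((g k - (\<Sum>j<n. t j * (M' j k - M j k))) * N k i) (min (c + 1) (G - \<beta>))" if k: "k < n" for k
  proof -
    have "val_ge (\<Sum>j<n. t j * (M' j k - M j k)) (c + (\<beta> + 1))"
      by (intro val_ge_sum val_ge_mult c e k) simp_all
    then have "val_ge (g k - (\<Sum>j<n. t j * (M' j k - M j k))) (min (c + (\<beta> + 1)) G)"
      by (intro val_ge_diff) (auto intro: val_ge_mono g[OF k])
    from val_ge_mult[OF this N[OF k i]] show ?thesis
      by (rule val_ge_mono) auto
  qed
  then show "val_ge (t i) (min (c + 1) (G - \<beta>))"
    unfolding eq by (intro val_ge_sum) simp
qed

text \<open>A nonzero coefficient keeps its leading term. A zero coefficient may become nonzero, but
  then its valuation is at least c \<ge> 0 and its points already lie in the quadrant contributed by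
  the coefficient 1 at n.\<close>

lemma newton_polygon_perturb:
  assumes b: "b n = 1" "b' n = 1" and c: "c \<ge> 0"
    and d: "\<And>i. i < n \<Longrightarrow> val_ge (b' i - b i) c"
    and large: "\<And>i. i < n \<Longrightarrow> b i \<noteq> 0 \<Longrightarrow> real_of_int (fls_subdegree (b i)) < c"
  shows "newton_polygon n b' = newton_polygon n b"
proof -
  have same: "b' i \<noteq> 0 \<and> fls_subdegree (b' i) = fls_subdegree (b i)" if "i \<le> n" "b i \<noteq> 0" for i
  proof (cases "i = n")
    case False
    then have i: "i < n" using that by simp
    have nth: "fls_nth (b' i) k = fls_nth (b i) k" if "k \<le> fls_subdegree (b i)" for k
      using val_geD[OF d[OF i], of k] large[OF i \<open>b i \<noteq> 0\<close>] that by simp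
    have "fls_nth (b' i) (fls_subdegree (b i)) \<noteq> 0" using nth[of "fls_subdegree (b i)"] that by simp
    moreover have "fls_nth (b' i) k = 0" if "k < fls_subdegree (b i)" for k using nth[of k] that by simp
    ultimately show ?thesis using fls_subdegree_eqI by fastforce
  qed (use b in simp)
  have "{(u, v). \<exists>i\<le>n. b' i \<noteq> 0 \<and> 0 \<le> u \<and> u \<le> real i \<and> real_of_int (fls_subdegree (b' i)) - real i \<le> v}
      = {(u, v). \<exists>i\<le>n. b i \<noteq> 0 \<and> 0 \<le> u \<and> u \<le> real i \<and> real_of_int (fls_subdegree (b i)) - real i \<le> v}"
    (is "?L = ?R")
  proof (intro equalityI subsetI)
    fix p assume "p \<in> ?L"
    then obtain u v i where p: "p = (u, v)" "i \<le> n" "b' i \<noteq> 0" "0 \<le> u" "u \<le> real i"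
      "real_of_int (fls_subdegree (b' i)) - real i \<le> v" by auto
    show "p \<in> ?R"
    proof (cases "b i = 0")
      case True
      then have "i < n" using p(2) b by (cases "i = n") auto
      then have "val_ge (b' i) c" using d[of i] True by simp
      then have "real n \<ge> real i" "fls_subdegree (b' i) \<ge> 0" using p(2,3) c by (auto simp: val_ge_iff)
      then have "u \<le> real n" "real_of_int (fls_subdegree (b n)) - real n \<le> v" using p b by simp_all
      then show ?thesis using p b by auto
    next
      case False
      then show ?thesis using p same[of i] by auto
    qed
  next
    fix p assume "p \<in> ?R"
    then obtain u v i where p: "p = (u, v)" "i \<le> n" "b i \<noteq> 0" "0 \<le> u" "u \<le> real i"
      "real_of_int (fls_subdegree (b i)) - real i \<le> v" by auto
    then show "p \<in> ?L" using same[of i] by auto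
  qed
  then show ?thesis by (simp only: newton_polygon_def)
qed

lemma gevrey_cyclic_approx:
  fixes s :: real and n :: nat and A :: "nat \<Rightarrow> nat \<Rightarrow> complex fls"
  defines "S \<equiv> gevrey_series s" and "D \<equiv> conn n A"
  assumes s: "s > 0" and sf: "fls_subfield S" and A: "\<And>i j. i < n \<Longrightarrow> j < n \<Longrightarrow> A i j \<in> S"
    and y: "y \<in> vecs n UNIV"
    and indep: "\<And>c i. (\<Sum>i<n. smul (c i) ((D ^^ i) y)) = 0 \<Longrightarrow> i < n \<Longrightarrow> c i = 0"
    and b: "b n = 1" and rel: "(\<Sum>i\<le>n. smul (b i) ((D ^^ i) y)) = 0"
  obtains x N b' where "x \<in> vecs n S" "\<And>i j. i < n \<Longrightarrow> j < n \<Longrightarrow> N i j \<in> S"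
    "\<And>i k. i < n \<Longrightarrow> k < n \<Longrightarrow> (\<Sum>j<n. (D ^^ i) x j * N j k) = (if i = k then 1 else 0)"
    "\<And>i k. i < n \<Longrightarrow> k < n \<Longrightarrow> (\<Sum>j<n. N i j * (D ^^ j) x k) = (if i = k then 1 else 0)"
    "\<And>i. b' i \<in> S" "b' n = 1" "\<And>k. k < n \<Longrightarrow> (\<Sum>j<n. b' j * (D ^^ j) x k) = - (D ^^ n) x k"
    "newton_polygon n b' = newton_polygon n b"
proof -
  interpret S: fls_subfield S by (rule sf)
  interpret dm: diff_module smul D unfolding D_def by (rule diff_module_conn)
  have deriv: "fls_deriv a \<in> S" if "a \<in> S" for a using that unfolding S_def by (rule gevrey_series_deriv[OF s])
  define M where "M j k = (D ^^ j) y k" for j k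
  have Dy: "(D ^^ j) y \<in> vecs n UNIV" for j
    unfolding D_def by (rule vecs_conn_pow[OF fls_subfield_UNIV _ _ y]) auto
  have inj: "t i = 0" if t: "\<And>k. k < n \<Longrightarrow> (\<Sum>j<n. t j * M j k) = 0" and i: "i < n" for t i
  proof (rule indep[OF _ i])
    have "(\<Sum>j<n. smul (t j) ((D ^^ j) y)) k = 0" for k
    proof (cases "k < n")
      case True
      from t[OF this] show ?thesis by (simp add: sum_fun_app smul_def M_def)
    next
      case False
      then show ?thesis using Dy by (simp add: sum_fun_app smul_def vecs_def)
    qed
    then show "(\<Sum>j<n. smul (t j) ((D ^^ j) y)) = 0" by (simp add: fun_eq_iff)
  qed
  have "\<forall>t. (\<forall>k<n. (\<Sum>j<n. t j * M j k) = 0) \<longrightarrow> (\<forall>i<n. t i = 0)"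
    by (intro allI impI, rule inj) simp_all
  then have "\<exists>N. (\<forall>i<n. \<forall>j<n. N i j \<in> UNIV) \<and>
      (\<forall>i<n. \<forall>k<n. (\<Sum>j<n. M i j * N j k) = (if i = k then 1 else 0)) \<and>
      (\<forall>i<n. \<forall>k<n. (\<Sum>j<n. N i j * M j k) = (if i = k then 1 else 0))"
    by (intro inverse_matrix_ex[OF fls_subfield_UNIV]) simp_all
  then obtain Mi where *: "(\<forall>i<n. \<forall>j<n. Mi i j \<in> UNIV) \<and>
      (\<forall>i<n. \<forall>k<n. (\<Sum>j<n. M i j * Mi j k) = (if i = k then 1 else 0)) \<and>
      (\<forall>i<n. \<forall>k<n. (\<Sum>j<n. Mi i j * M j k) = (if i = k then 1 else 0))" ..
  note Mi = *[THEN conjunct2, THEN conjunct1, rule_format]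
  obtain \<beta>' where \<beta>': "\<forall>p\<in>{..<n} \<times> {..<n}. val_ge (Mi (fst p) (snd p)) \<beta>'"
    using val_ge_exists_family[of "{..<n} \<times> {..<n}" "\<lambda>p. Mi (fst p) (snd p)"] by auto
  define \<beta> where "\<beta> = max 0 (- \<beta>')"
  have \<beta>: "val_ge (Mi i j) (- \<beta>)" if "i < n" "j < n" for i j
    by (rule val_ge_mono[of _ \<beta>']) (use \<beta>' that in \<open>auto simp: \<beta>_def\<close>)
  obtain \<alpha>' where \<alpha>': "\<forall>p\<in>{..<n} \<times> {..<n}. val_ge (A (fst p) (snd p)) \<alpha>'"
    using val_ge_exists_family[of "{..<n} \<times> {..<n}" "\<lambda>p. A (fst p) (snd p)"] by auto
  define \<alpha> where "\<alpha> = max 0 (- \<alpha>')"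
  have \<alpha>: "val_ge (A i j) (- \<alpha>)" if "i < n" "j < n" for i j
    by (rule val_ge_mono[of _ \<alpha>']) (use \<alpha>' that in \<open>auto simp: \<alpha>_def\<close>)
  obtain \<gamma>' where \<gamma>': "\<forall>i\<in>{..<n}. val_ge (b i) \<gamma>'" using val_ge_exists_family[of "{..<n}" b] by auto
  define \<gamma> where "\<gamma> = max 0 (- \<gamma>')"
  have \<gamma>: "val_ge (b i) (- \<gamma>)" if "i < n" for i
    by (rule val_ge_mono[of _ \<gamma>']) (use \<gamma>' that in \<open>auto simp: \<gamma>_def\<close>)
  \<comment> \<open>Nonnegative and larger than all valuations of the b i, as
    \<open>newton_polygon_perturb\<close> requires.\<close>
  define c where "c = (\<Sum>i<n. \<bar>real_of_int (fls_subdegree (b i))\<bar>) + 1"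
  have c0: "c \<ge> 0" unfolding c_def by (intro add_nonneg_nonneg sum_nonneg) auto
  have c: "real_of_int (fls_subdegree (b i)) < c" if "i < n" for i
    using member_le_sum[of i "{..<n}" "\<lambda>i. \<bar>real_of_int (fls_subdegree (b i))\<bar>"] that
    unfolding c_def by simp
  \<comment> \<open>The accuracy needed for the derivatives of x: \<beta> and \<gamma> bound the
    poles of the inverse matrix and of b, c is the accuracy wanted for the new coefficients, and 1
    is the margin in \<open>perturbed_system_val\<close>.\<close>
  define H where "H = \<beta> + \<gamma> + c + 1"
  have nonneg: "\<alpha> \<ge> 0" "\<beta> \<ge> 0" "\<gamma> \<ge> 0" by (auto simp: \<alpha>_def \<beta>_def \<gamma>_def)
  \<comment> \<open>Each application of D may lose 1 + \<alpha>, and at most n of them are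
    made.\<close>
  obtain x where x: "x \<in> vecs n S" "\<And>i. val_ge (x i - y i) (H + real n * (1 + \<alpha>))"
    using vecs_gevrey_approx[OF s sf[unfolded S_def] y, of "H + real n * (1 + \<alpha>)"] unfolding S_def by blast
  have Dx: "(D ^^ j) x \<in> vecs n S" for j
    unfolding D_def by (rule vecs_conn_pow[OF sf deriv A x(1)])
  have diff: "(D ^^ j) x - (D ^^ j) y = (D ^^ j) (x - y)" for j
    using dm.Dpow_add[of j "x - y" y] by (simp only: diff_add_cancel diff_eq_eq)
  have close: "val_ge ((D ^^ j) x k - (D ^^ j) y k) H" if "j \<le> n" for j k
  proof -
    have "val_ge ((D ^^ j) (x - y) k) (H + real n * (1 + \<alpha>) - real j * (1 + \<alpha>))"
      unfolding D_def by (rule val_ge_conn_pow) (use \<alpha> nonneg x(2) in auto)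
    moreover have "real j * (1 + \<alpha>) \<le> real n * (1 + \<alpha>)"
      using that nonneg by (intro mult_right_mono) auto
    ultimately have "val_ge ((D ^^ j) (x - y) k) H" by (elim val_ge_mono) simp
    then show ?thesis using fun_cong[OF diff[of j], of k] by simp
  qed
  define M' where "M' j k = (D ^^ j) x k" for j k
  have pert: "val_ge (M' i j - M i j) (\<beta> + 1)" if "i < n" "j < n" for i j
    unfolding M'_def M_def by (rule val_ge_mono[OF close]) (use that nonneg c0 in \<open>auto simp: H_def\<close>)
  have inj': "t i = 0" if t: "\<And>k. k < n \<Longrightarrow> (\<Sum>j<n. t j * M' j k) = 0" and i: "i < n" for t i
  proof (rule val_ge_zeroI)
    fix c
    have "val_ge (t i) (c + \<beta> - \<beta>)"
      by (rule perturbed_system_val[OF Mi \<beta> pert t _ i]) simp_all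
    then show "\<exists>d\<ge>c. val_ge (t i) d" by (intro exI[of _ c]) simp
  qed
  have M'S: "M' i j \<in> S" if "j < n" for i j using Dx[of i] that by (simp add: M'_def vecs_def)
  have "\<forall>t. (\<forall>k<n. (\<Sum>j<n. t j * M' j k) = 0) \<longrightarrow> (\<forall>i<n. t i = 0)"
    by (intro allI impI, rule inj') simp_all
  moreover have "\<forall>i<n. \<forall>j<n. M' i j \<in> S" using M'S by blast
  ultimately have "\<exists>N. (\<forall>i<n. \<forall>j<n. N i j \<in> S) \<and>
      (\<forall>i<n. \<forall>k<n. (\<Sum>j<n. M' i j * N j k) = (if i = k then 1 else 0)) \<and>
      (\<forall>i<n. \<forall>k<n. (\<Sum>j<n. N i j * M' j k) = (if i = k then 1 else 0))"
    by (intro inverse_matrix_ex[OF sf])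
  then obtain N where *: "(\<forall>i<n. \<forall>j<n. N i j \<in> S) \<and>
      (\<forall>i<n. \<forall>k<n. (\<Sum>j<n. M' i j * N j k) = (if i = k then 1 else 0)) \<and>
      (\<forall>i<n. \<forall>k<n. (\<Sum>j<n. N i j * M' j k) = (if i = k then 1 else 0))" ..
  note N = *[THEN conjunct1, rule_format] *[THEN conjunct2, THEN conjunct1, rule_format]
    *[THEN conjunct2, THEN conjunct2, rule_format]
  \<comment> \<open>For j < n, minus the coordinates of the n-th derivative of x in the basis of its
    lower derivatives.\<close>
  define b' where "b' j = (if j < n then - (\<Sum>k<n. (D ^^ n) x k * N k j) else 1)" for j
  have b'S: "b' j \<in> S" for j
    using M'S[of _ n] N(1) unfolding b'_def M'_def
    by (auto intro!: S.uminus_mem S.sum_mem S.mult_mem S.one_mem)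
  have b'rel: "(\<Sum>j<n. b' j * M' j k) = - (D ^^ n) x k" if k: "k < n" for k
  proof -
    have "(\<Sum>j<n. b' j * M' j k) = - (\<Sum>j<n. \<Sum>l<n. (D ^^ n) x l * N l j * M' j k)"
      by (simp add: b'_def sum_distrib_right sum_negf)
    also have "(\<Sum>j<n. \<Sum>l<n. (D ^^ n) x l * N l j * M' j k) = (\<Sum>l<n. \<Sum>j<n. (D ^^ n) x l * N l j * M' j k)"
      by (rule sum.swap)
    also have "\<dots> = (\<Sum>l<n. (D ^^ n) x l * (\<Sum>j<n. N l j * M' j k))"
      by (simp add: sum_distrib_left mult.assoc)
    also have "\<dots> = (D ^^ n) x k"
      using k by (simp add: N(3) if_distrib[of "\<lambda>x. _ * x"] cong: if_cong)
    finally show ?thesis .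
  qed
  have brel: "(\<Sum>j<n. b j * M j k) = - (D ^^ n) y k" for k
  proof -
    have "(\<Sum>i\<le>n. smul (b i) ((D ^^ i) y)) k = 0" by (simp only: rel zero_fun_def)
    then show ?thesis using b
      by (simp add: sum_fun_app smul_def M_def lessThan_Suc_atMost[symmetric] eq_neg_iff_add_eq_0)
  qed
  have b'b: "val_ge (b' i - b i) c" if i: "i < n" for i
  proof -
    \<comment> \<open>The right-hand side of the system for b' - b that results from subtracting the
      relations for x and y.\<close>
    define g where "g k = - ((D ^^ n) x k - (D ^^ n) y k) - (\<Sum>j<n. b j * (M' j k - M j k))" for k
    have "(\<Sum>j<n. (b' j - b j) * M' j k) = g k" if k: "k < n" for k
    proof -
      have "(\<Sum>j<n. (b' j - b j) * M' j k)
          = (\<Sum>j<n. b' j * M' j k) - (\<Sum>j<n. b j * (M' j k - M j k)) - (\<Sum>j<n. b j * M j k)"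
        by (simp add: sum_subtractf[symmetric] algebra_simps)
      then show ?thesis by (simp add: b'rel[OF k] brel g_def)
    qed
    moreover have "val_ge (g k) (H - \<gamma>)" if k: "k < n" for k
    proof -
      have "val_ge ((D ^^ n) x k - (D ^^ n) y k) (H - \<gamma>)"
        by (rule val_ge_mono[OF close]) (use nonneg in auto)
      moreover have "val_ge (\<Sum>j<n. b j * (M' j k - M j k)) (H - \<gamma>)"
      proof (rule val_ge_sum)
        fix j assume "j \<in> {..<n}"
        then have "val_ge (b j * ((D ^^ j) x k - (D ^^ j) y k)) (- \<gamma> + H)"
          by (intro val_ge_mult \<gamma> close) auto
        then show "val_ge (b j * (M' j k - M j k)) (H - \<gamma>)" by (simp add: M'_def M_def)
      qed
      ultimately show ?thesis unfolding g_def by (intro val_ge_diff) (simp_all only: val_ge_uminus)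
    qed
    ultimately have "val_ge (b' i - b i) (H - \<gamma> - \<beta>)"
      by (intro perturbed_system_val[OF Mi \<beta> pert _ _ i, of "\<lambda>j. b' j - b j" g]) simp_all
    then show ?thesis by (rule val_ge_mono) (simp add: H_def)
  qed
  have b'n: "b' n = 1" by (simp add: b'_def)
  have "newton_polygon n b' = newton_polygon n b"
    by (rule newton_polygon_perturb[of b n b' c, OF b b'n c0]) (use b'b c in auto)
  then show thesis
  proof (rule that[of x N b', rotated -1])
    show "x \<in> vecs n S" by (rule x(1))
    show "N i j \<in> S" if "i < n" "j < n" for i j using that by (rule N(1))
    show "(\<Sum>j<n. (D ^^ i) x j * N j k) = (if i = k then 1 else 0)" if "i < n" "k < n" for i k
      using N(2)[OF that] by (simp only: M'_def)
    show "(\<Sum>j<n. N i j * (D ^^ j) x k) = (if i = k then 1 else 0)" if "i < n" "k < n" for i k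
      using N(3)[OF that] by (simp only: M'_def)
    show "b' i \<in> S" for i by (rule b'S)
    show "b' n = 1" by (rule b'n)
    show "(\<Sum>j<n. b' j * (D ^^ j) x k) = - (D ^^ n) x k" if "k < n" for k
      using b'rel[OF that] by (simp only: M'_def)
  qed
qed

section \<open>Companion coordinates from a cyclic vector\<close>

lemma coords_compose:
  assumes \<phi>: "coords S V n \<phi>"
    and T: "\<And>y. y \<in> vecs n S \<Longrightarrow> T y \<in> vecs n S" "\<And>y. y \<in> vecs n S \<Longrightarrow> R y \<in> vecs n S"
    "\<And>y. y \<in> vecs n S \<Longrightarrow> R (T y) = y" "\<And>y. y \<in> vecs n S \<Longrightarrow> T (R y) = y"
    "\<And>x y. T (x + y) = T x + T y" "\<And>a y. T (smul a y) = smul a (T y)"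
  shows "coords S V n (\<lambda>v. T (\<phi> v))"
proof -
  have "bij_betw T (vecs n S) (vecs n S)"
    by (rule bij_betwI[where g = R]) (use T(1-4) in auto)
  then have "bij_betw (T \<circ> \<phi>) (carrier V) (vecs n S)"
    using \<phi> by (intro bij_betw_trans[of \<phi> _ "vecs n S"]) (simp_all add: coords_def)
  then show ?thesis
    using \<phi> T(5,6) by (simp add: coords_def o_def)
qed

text \<open>The Leibniz rule gives the derivatives and a shift of the index; \<open>rel\<close>
  replaces the term of index n.\<close>

lemma conn_companion_combination:
  fixes z :: "nat \<Rightarrow> nat \<Rightarrow> complex fls"
  assumes D: "diff_module smul D" and z: "\<And>i. D (z i) = z (Suc i)"
    and rel: "z n = (\<Sum>j<n. smul (- b j) (z j))" and c: "c \<in> vecs n UNIV"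
  shows "D (\<Sum>i<n. smul (c i) (z i)) = (\<Sum>i<n. smul (conn n (companion n b) c i) (z i))"
proof (cases n)
  case 0
  then show ?thesis using diff_module.D_0[OF D] by simp
next
  case (Suc m)
  interpret dm: diff_module smul D by (rule D)
  have cc: "conn n (companion n b) c i = fls_deriv (c i) + (if i = 0 then 0 else c (i - 1)) - b i * c m" if "i < n" for i
  proof -
    have "(\<Sum>j<n. companion n b i j * c j)
        = (\<Sum>j<n. if i = Suc j then c j else 0) - (\<Sum>j<n. if j = m then b i * c j else 0)"
      unfolding sum_subtractf[symmetric] by (rule sum.cong) (auto simp: companion_def Suc left_diff_distrib)
    also have "(\<Sum>j<n. if j = m then b i * c j else 0) = b i * c m" by (simp add: Suc)
    also have "(\<Sum>j<n. if i = Suc j then c j else 0) = (if i = 0 then 0 else c (i - 1))"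
      using that by (cases i) (simp_all add: sum.delta')
    finally show ?thesis using that by (simp add: conn_def)
  qed
  show ?thesis
  proof
    fix k
    have "D (\<Sum>i<n. smul (c i) (z i)) = (\<Sum>i<n. smul (fls_deriv (c i)) (z i) + smul (c i) (z (Suc i)))"
      by (simp only: dm.D_sum dm.D_sm z)
    then have "D (\<Sum>i<n. smul (c i) (z i)) k = (\<Sum>i<n. fls_deriv (c i) * z i k) + (\<Sum>i<n. c i * z (Suc i) k)"
      by (simp only: sum_fun_app smul_def plus_fun_def sum.distrib)
    also have "(\<Sum>i<n. c i * z (Suc i) k) = (\<Sum>i<m. c i * z (Suc i) k) + c m * z n k"
      by (simp add: Suc)
    also have "(\<Sum>i<m. c i * z (Suc i) k) = (\<Sum>i<n. (if i = 0 then 0 else c (i - 1)) * z i k)"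
      unfolding Suc by (subst sum.lessThan_Suc_shift) simp
    also have "z n k = (\<Sum>j<n. - b j * z j k)"
      using fun_cong[OF rel, of k] by (simp add: sum_fun_app smul_def)
    also have "c m * (\<Sum>j<n. - b j * z j k) = (\<Sum>j<n. - (b j * c m) * z j k)"
      unfolding sum_distrib_left by (rule sum.cong) (simp_all add: mult_ac)
    also have "(\<Sum>i<n. fls_deriv (c i) * z i k) + ((\<Sum>i<n. (if i = 0 then 0 else c (i - 1)) * z i k)
          + (\<Sum>j<n. - (b j * c m) * z j k)) = (\<Sum>i<n. conn n (companion n b) c i * z i k)"
      unfolding sum.distrib[symmetric] by (rule sum.cong) (simp_all add: cc algebra_simps)
    also have "\<dots> = (\<Sum>i<n. smul (conn n (companion n b) c i) (z i)) k"
      by (simp only: sum_fun_app smul_def)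
    finally show "D (\<Sum>i<n. smul (c i) (z i)) k = (\<Sum>i<n. smul (conn n (companion n b) c i) (z i)) k" .
  qed
qed

text \<open>T changes to the basis of derivatives of x. Its matrix N has entries in S, so the new
  coordinates are again coordinates over S.\<close>

lemma coord_conn_cyclic:
  fixes S V nabla n A \<phi> x N b
  defines "D \<equiv> conn n A"
  assumes cc: "coord_conn S V nabla n A \<phi>" and sf: "fls_subfield S"
    and deriv: "\<And>a. a \<in> S \<Longrightarrow> fls_deriv a \<in> S"
    and x: "x \<in> vecs n S" and N: "\<And>i j. i < n \<Longrightarrow> j < n \<Longrightarrow> N i j \<in> S"
    "\<And>i k. i < n \<Longrightarrow> k < n \<Longrightarrow> (\<Sum>j<n. (D ^^ i) x j * N j k) = (if i = k then 1 else 0)"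
    "\<And>i k. i < n \<Longrightarrow> k < n \<Longrightarrow> (\<Sum>j<n. N i j * (D ^^ j) x k) = (if i = k then 1 else 0)"
    and b: "\<And>i. b i \<in> S" "\<And>k. k < n \<Longrightarrow> (\<Sum>j<n. b j * (D ^^ j) x k) = - (D ^^ n) x k"
  shows "\<exists>\<phi>'. coord_conn S V nabla n (companion n b) \<phi>'"
proof -
  interpret S: fls_subfield S by (rule sf)
  have \<phi>: "coords S V n \<phi>" and A: "\<And>i j. i < n \<Longrightarrow> j < n \<Longrightarrow> A i j \<in> S"
    and \<phi>n: "\<And>v. v \<in> carrier V \<Longrightarrow> \<phi> (nabla v) = D (\<phi> v)"
    using cc by (simp_all add: coord_conn_def D_def)
  have z: "(D ^^ i) x \<in> vecs n S" for i
    unfolding D_def by (rule vecs_conn_pow[OF sf deriv A x])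
  have dm: "diff_module smul D" unfolding D_def by (rule diff_module_conn)
  define T where "T y = (\<lambda>k. if k < n then (\<Sum>i<n. y i * N i k) else 0)" for y :: "nat \<Rightarrow> complex fls"
  define R where "R c = (\<Sum>k<n. smul (c k) ((D ^^ k) x))" for c :: "nat \<Rightarrow> complex fls"
  have TS: "T y \<in> vecs n S" if "y \<in> vecs n S" for y
    using that N(1) by (auto simp: vecs_def T_def intro!: S.sum_mem S.mult_mem)
  have RS: "R c \<in> vecs n S" if "c \<in> vecs n S" for c
    unfolding R_def by (intro vecs_sum vecs_smul sf z) (use that in \<open>simp add: vecs_def\<close>)
  have RT: "R (T y) = y" if y: "y \<in> vecs n S" for y
  proof
    fix k
    show "R (T y) k = y k"
    proof (cases "k < n")
      case True
      have "R (T y) k = (\<Sum>j<n. \<Sum>i<n. y i * N i j * (D ^^ j) x k)"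
        by (simp add: R_def T_def sum_fun_app smul_def sum_distrib_right)
      also have "\<dots> = (\<Sum>i<n. \<Sum>j<n. y i * N i j * (D ^^ j) x k)" by (rule sum.swap)
      also have "\<dots> = (\<Sum>i<n. y i * (\<Sum>j<n. N i j * (D ^^ j) x k))" by (simp add: sum_distrib_left mult.assoc)
      also have "\<dots> = y k" using True by (simp add: N(3) if_distrib[of "\<lambda>x. _ * x"] cong: if_cong)
      finally show ?thesis .
    next
      case False
      then show ?thesis using y z by (simp add: R_def sum_fun_app smul_def vecs_def)
    qed
  qed
  have TR: "T (R c) = c" if c: "c \<in> vecs n UNIV" for c
  proof
    fix k
    show "T (R c) k = c k"
    proof (cases "k < n")
      case True
      have "T (R c) k = (\<Sum>j<n. \<Sum>i<n. c i * (D ^^ i) x j * N j k)"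
        using True by (simp add: R_def T_def sum_fun_app smul_def sum_distrib_right)
      also have "\<dots> = (\<Sum>i<n. \<Sum>j<n. c i * (D ^^ i) x j * N j k)" by (rule sum.swap)
      also have "\<dots> = (\<Sum>i<n. c i * (\<Sum>j<n. (D ^^ i) x j * N j k))" by (simp add: sum_distrib_left mult.assoc)
      also have "\<dots> = c k" using True by (simp add: N(2) if_distrib[of "\<lambda>x. _ * x"] cong: if_cong)
      finally show ?thesis .
    next
      case False
      then show ?thesis using c by (simp add: T_def vecs_def)
    qed
  qed
  have "(D ^^ n) x = (\<Sum>j<n. smul (- b j) ((D ^^ j) x))"
  proof
    fix k
    show "(D ^^ n) x k = (\<Sum>j<n. smul (- b j) ((D ^^ j) x)) k"
    proof (cases "k < n")
      case True
      then show ?thesis using b(2)[OF True] by (simp add: sum_fun_app smul_def sum_negf)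
    next
      case False
      then show ?thesis using z by (simp add: sum_fun_app smul_def vecs_def)
    qed
  qed
  then have DR: "D (R c) = R (conn n (companion n b) c)" if "c \<in> vecs n UNIV" for c
    unfolding R_def using that by (intro conn_companion_combination[OF dm]) simp_all
  have "T (\<phi> (nabla v)) = conn n (companion n b) (T (\<phi> v))" if v: "v \<in> carrier V" for v
  proof -
    have y: "\<phi> v \<in> vecs n S" by (rule coordsD(1)[OF \<phi> v])
    have t: "T (\<phi> v) \<in> vecs n UNIV" by (rule vecs_mono[OF TS[OF y]])
    have "T (\<phi> (nabla v)) = T (D (R (T (\<phi> v))))" by (simp only: \<phi>n[OF v] RT[OF y])
    also have "\<dots> = conn n (companion n b) (T (\<phi> v))"
      unfolding DR[OF t] by (rule TR) (rule vecs_conn[OF fls_subfield_UNIV _ _ t], auto)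
    finally show ?thesis .
  qed
  moreover have "coords S V n (\<lambda>v. T (\<phi> v))"
  proof (rule coords_compose[OF \<phi> TS RS RT])
    show "T (R y) = y" if "y \<in> vecs n S" for y by (rule TR[OF vecs_mono[OF that]])
    show "T (x + y) = T x + T y" for x y
      by (simp add: T_def fun_eq_iff distrib_right sum.distrib)
    show "T (smul a y) = smul a (T y)" for a y
      by (simp add: T_def smul_def fun_eq_iff sum_distrib_left mult.assoc)
  qed
  moreover have "companion n b i j \<in> S" for i j
    using b(1) by (auto simp: companion_def intro!: S.diff_mem S.uminus_mem S.one_mem S.zero_mem)
  ultimately show ?thesis unfolding coord_conn_def by blast
qed

text \<open>Stated for one slope at a time, since different slopes may be witnessed by different
  cyclic vectors.\<close>

theorem formal_slope_polygon:
  fixes s :: real and V :: "(complex fls, 'v, 'm) module_scheme"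
  defines "S \<equiv> gevrey_series s"
  assumes s: "s > 0" and V: "vs_connection (fls_subring S) V nabla"
    and fd: "vectorspace.fin_dim (fls_subring S) V"
    and \<sigma>: "\<sigma> \<in> formal_slopes (fls_subring S) V nabla"
  shows "\<exists>n b \<phi>. n > 0 \<and> coord_conn S V nabla n (companion n b) \<phi> \<and> b n = 1 \<and> (\<forall>i. b i \<in> S) \<and>
    \<sigma> \<in> polygon_slopes (newton_polygon n b)"
proof -
  interpret V: vs_connection "fls_subring S" V nabla by (rule V)
  have sf: "fls_subfield S" by (rule fls_subfield_of_field) (rule V.field_axioms)
  have deriv: "fls_deriv a \<in> S" if "a \<in> S" for a using that unfolding S_def by (rule gevrey_series_deriv[OF s])
  obtain n \<phi> where "coords S V n \<phi>" using coords_exist[OF V.vectorspace_axioms fd] by blast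
  from coord_conn_exists[OF V this deriv] obtain A where cc: "coord_conn S V nabla n A \<phi>" by blast
  then have A: "\<And>i j. i < n \<Longrightarrow> j < n \<Longrightarrow> A i j \<in> S" by (simp add: coord_conn_def)
  interpret tc: tensor_coordinates S V nabla n A \<phi> by (unfold_locales; rule V cc)
  obtain w m b where cyc: "cyclic_operator (formal_space (fls_subring S) V) (formal_nabla (fls_subring S) V nabla) w m b"
    and pol: "\<sigma> \<in> polygon_slopes (newton_polygon m b)"
    using \<sigma> unfolding formal_slopes_def connection_slopes_def by blast
  show ?thesis
  proof (rule tc.formal_cyclic[OF cyc])
    fix y assume y: "y \<in> vecs n UNIV"
      and span: "\<And>x. x \<in> vecs n UNIV \<Longrightarrow> \<exists>c. x = (\<Sum>i<m. smul (c i) ((conn n A ^^ i) y))"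
      and indep: "\<And>c i. (\<Sum>i<m. smul (c i) ((conn n A ^^ i) y)) = 0 \<Longrightarrow> i < m \<Longrightarrow> c i = 0"
      and bm: "b m = 1" and rel: "(\<Sum>i\<le>m. smul (b i) ((conn n A ^^ i) y)) = 0"
    have mn: "m = n"
    proof (rule basis_length[of "\<lambda>i. (conn n A ^^ i) y"])
      show "(conn n A ^^ i) y \<in> vecs n UNIV" for i
        by (rule vecs_conn_pow[OF fls_subfield_UNIV _ _ y]) auto
    qed (fact span, fact indep)
    have n: "n > 0"
    proof (rule ccontr)
      assume "\<not> n > 0"
      then show False using pol bm newton_polygon_0[of b] by (simp add: mn)
    qed
    show ?thesis
    proof (rule gevrey_cyclic_approx[of s n A y b, folded S_def])
      show "s > 0" "fls_subfield S" "y \<in> vecs n UNIV" by (fact s sf y)+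
      show "A i j \<in> S" if "i < n" "j < n" for i j using that by (rule A)
      show "c i = 0" if "(\<Sum>i<n. smul (c i) ((conn n A ^^ i) y)) = 0" "i < n" for c i
        using indep[unfolded mn, OF that] .
      show "b n = 1" "(\<Sum>i\<le>n. smul (b i) ((conn n A ^^ i) y)) = 0" by (fact bm[unfolded mn] rel[unfolded mn])+
      fix x N b' assume x: "x \<in> vecs n S" "\<And>i j. i < n \<Longrightarrow> j < n \<Longrightarrow> N i j \<in> S"
        "\<And>i k. i < n \<Longrightarrow> k < n \<Longrightarrow> (\<Sum>j<n. (conn n A ^^ i) x j * N j k) = (if i = k then 1 else 0)"
        "\<And>i k. i < n \<Longrightarrow> k < n \<Longrightarrow> (\<Sum>j<n. N i j * (conn n A ^^ j) x k) = (if i = k then 1 else 0)"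
        "\<And>i. b' i \<in> S" "b' n = 1" "\<And>k. k < n \<Longrightarrow> (\<Sum>j<n. b' j * (conn n A ^^ j) x k) = - (conn n A ^^ n) x k"
        "newton_polygon n b' = newton_polygon n b"
      obtain \<phi>' where "coord_conn S V nabla n (companion n b') \<phi>'"
        using coord_conn_cyclic[of S V nabla n A \<phi> x N b'] cc sf deriv x(1-5,7) by blast
      moreover have "\<sigma> \<in> polygon_slopes (newton_polygon n b')" using pol by (simp only: x(8) mn)
      ultimately show ?thesis using n x(5,6) by (intro exI[of _ n] exI[of _ b'] exI[of _ \<phi>'] conjI allI)
    qed
  qed
qed

subsection \<open>The decomposition\<close>

text \<open>The last two clauses turn the position of the vertex into nonzero vectors. A slope on
  the wrong side will be refuted by comparing the growth of such a vector.\<close>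

lemma vertex_splitting:
  fixes s \<mu> \<epsilon> :: real and V :: "(complex fls, 'v, 'm) module_scheme"
  defines "S \<equiv> gevrey_series s"
  assumes s: "s > 0" and V: "vs_connection (fls_subring S) V nabla"
    and cc: "coord_conn S V nabla n (companion n b) \<phi>"
    and n: "n > 0" "r \<le> n" and b: "\<And>i. b i \<in> S" "b n = 1" "b r \<noteq> 0" and \<mu>: "\<mu> > 0" and \<epsilon>: "\<epsilon> > 0"
    and val: "\<And>a. a \<le> n \<Longrightarrow> a \<noteq> r \<Longrightarrow> val_ge (b a / b r) ((1 + 1 / s) * (real a - real r))"
    and val': "\<And>a. a \<le> n \<Longrightarrow> a \<noteq> r \<Longrightarrow> val_ge (b a / b r) ((1 + \<mu>) * (real a - real r) + \<epsilon>)"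
  shows "\<exists>P Q. conn_splitting S V nabla P Q \<and>
    (\<forall>v\<in>carrier V. slow S V nabla (1 + min (1 / s) \<mu>) (P v)) \<and>
    (\<forall>v\<in>carrier V. \<forall>\<theta><1 + max (1 / s) \<mu>. slow S V nabla \<theta> (Q v) \<longrightarrow> Q v = \<zero>\<^bsub>V\<^esub>) \<and>
    (r > 0 \<longrightarrow> (\<exists>v\<in>carrier V. P v \<noteq> \<zero>\<^bsub>V\<^esub>)) \<and> (r < n \<longrightarrow> (\<exists>v\<in>carrier V. Q v \<noteq> \<zero>\<^bsub>V\<^esub>))"
proof -
  interpret V: vs_connection "fls_subring S" V nabla by (rule V)
  have sf: "fls_subfield S" by (rule fls_subfield_of_field) (rule V.field_axioms)
  have \<phi>: "coords S V n \<phi>" using cc by (simp add: coord_conn_def)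
  note \<phi>D = coordsD[OF \<phi>]
  have \<phi>0: "\<phi> \<zero>\<^bsub>V\<^esub> = 0" using \<phi>D(2)[of "\<zero>\<^bsub>V\<^esub>" "\<zero>\<^bsub>V\<^esub>"] by simp
  have surj: "\<exists>v\<in>carrier V. \<phi> v = y" if "y \<in> vecs n S" for y using \<phi>D(5,6)[OF that] by blast
  note slow_iff = slow_iff_coords[OF V cc]
  show ?thesis
  proof (rule companion_projector[of s \<mu> \<epsilon> n r b, folded S_def])
    show "s > 0" "fls_subfield S" "\<mu> > 0" "\<epsilon> > 0" "n > 0" "r \<le> n" "b n = 1" "b r \<noteq> 0"
      by (fact s sf \<mu> \<epsilon> n b)+
    show "b a \<in> S" for a by (rule b)
    show "val_ge (b a / b r) ((1 + 1 / s) * (real a - real r))" if "a \<le> n" "a \<noteq> r" for a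
      using that by (rule val)
    show "val_ge (b a / b r) ((1 + \<mu>) * (real a - real r) + \<epsilon>)" if "a \<le> n" "a \<noteq> r" for a
      using that by (rule val')
    fix E assume E: "\<And>x y. E (x + y) = E x + E y" "\<And>a y. E (smul a y) = smul a (E y)"
      "\<And>y. y \<in> vecs n S \<Longrightarrow> E y \<in> vecs n S" "\<And>y. E y \<in> vecs n UNIV" "\<And>y. E (E y) = E y"
      "\<And>y. y \<in> vecs n UNIV \<Longrightarrow> E (conn n (companion n b) y) = conn n (companion n b) (E y)"
      and Eslow: "\<And>y. slow_vec (conn n (companion n b)) (1 + min (1 / s) \<mu>) (E y)"
      and Eker: "\<And>y \<theta>. y \<in> vecs n UNIV \<Longrightarrow> E y = 0 \<Longrightarrow> slow_vec (conn n (companion n b)) \<theta> y \<Longrightarrow>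
        \<theta> < 1 + max (1 / s) \<mu> \<Longrightarrow> y = 0"
      and Epos: "r > 0 \<Longrightarrow> \<exists>y\<in>vecs n S. E y \<noteq> 0" and Eless: "r < n \<Longrightarrow> \<exists>y\<in>vecs n S. E y \<noteq> y"
    show ?thesis
    proof (rule splitting_of_projector[OF V cc E(1,2,3,5,6)])
      fix P Q assume PQ: "conn_splitting S V nabla P Q" and P: "\<And>v. v \<in> carrier V \<Longrightarrow> \<phi> (P v) = E (\<phi> v)"
        and Q: "\<And>v. v \<in> carrier V \<Longrightarrow> \<phi> (Q v) = \<phi> v - E (\<phi> v)"
      note D = conn_splittingD[OF PQ]
      have 1: "slow S V nabla (1 + min (1 / s) \<mu>) (P v)" if v: "v \<in> carrier V" for v
        unfolding slow_iff[OF D(1)[OF v]] P[OF v] by (rule Eslow)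
      have 2: "Q v = \<zero>\<^bsub>V\<^esub>" if v: "v \<in> carrier V" and \<theta>: "\<theta> < 1 + max (1 / s) \<mu>" "slow S V nabla \<theta> (Q v)" for v \<theta>
      proof -
        have "E (\<phi> (Q v)) = 0"
          using P[OF D(2)[OF v]] D(6)[OF v] \<phi>0 by simp
        from Eker[OF vecs_mono[OF \<phi>D(1)[OF D(2)[OF v]]] this _ \<theta>(1)]
        have "\<phi> (Q v) = 0" using \<theta>(2) slow_iff[OF D(2)[OF v]] by simp
        then show ?thesis using \<phi>D(4)[OF D(2)[OF v] V.zero_closed] \<phi>0 by simp
      qed
      have 3: "\<exists>v\<in>carrier V. P v \<noteq> \<zero>\<^bsub>V\<^esub>" if "r > 0"
      proof -
        obtain y where y: "y \<in> vecs n S" "E y \<noteq> 0" using Epos[OF \<open>r > 0\<close>] by blast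
        obtain v where v: "v \<in> carrier V" "\<phi> v = y" using surj[OF y(1)] by blast
        have "P v \<noteq> \<zero>\<^bsub>V\<^esub>" using P[OF v(1)] v(2) y(2) \<phi>0 by auto
        then show ?thesis using v(1) by blast
      qed
      have 4: "\<exists>v\<in>carrier V. Q v \<noteq> \<zero>\<^bsub>V\<^esub>" if "r < n"
      proof -
        obtain y where y: "y \<in> vecs n S" "E y \<noteq> y" using Eless[OF \<open>r < n\<close>] by blast
        obtain v where v: "v \<in> carrier V" "\<phi> v = y" using surj[OF y(1)] by blast
        have "Q v \<noteq> \<zero>\<^bsub>V\<^esub>" using Q[OF v(1)] v(2) y(2) \<phi>0 by auto
        then show ?thesis using v(1) by blast
      qed
      show ?thesis using PQ 1 2 3 4 by blast
    qed
  qed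
qed

text \<open>At the last vertex \<mu> > 1/s, so the second part excludes even vectors of rate exactly
  1 + 1/s.\<close>

lemma splitting_at_or_below:
  fixes s :: real and V :: "(complex fls, 'v, 'm) module_scheme"
  defines "S \<equiv> gevrey_series s"
  assumes s: "s > 0" and V: "vs_connection (fls_subring S) V nabla"
    and fd: "vectorspace.fin_dim (fls_subring S) V" and \<sigma>: "\<sigma> \<in> formal_slopes (fls_subring S) V nabla"
  shows "\<exists>P Q. conn_splitting S V nabla P Q \<and>
    (\<forall>v\<in>carrier V. slow S V nabla (1 + 1 / s) (P v)) \<and>
    (\<forall>v\<in>carrier V. slow S V nabla (1 + 1 / s) (Q v) \<longrightarrow> Q v = \<zero>\<^bsub>V\<^esub>) \<and>
    (\<sigma> \<le> 1 / s \<longrightarrow> (\<exists>v\<in>carrier V. P v \<noteq> \<zero>\<^bsub>V\<^esub>)) \<and> (1 / s < \<sigma> \<longrightarrow> (\<exists>v\<in>carrier V. Q v \<noteq> \<zero>\<^bsub>V\<^esub>))"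
proof -
  obtain n b \<phi> where n: "n > 0" and cc: "coord_conn S V nabla n (companion n b) \<phi>" and b: "b n = 1" "\<And>i. b i \<in> S"
    and pol: "\<sigma> \<in> polygon_slopes (newton_polygon n b)"
    using formal_slope_polygon[of s V nabla \<sigma>, folded S_def, OF s V fd \<sigma>] by metis
  have \<kappa>: "1 / s > 0" using s by simp
  show ?thesis
  proof (rule last_vertex[where b = b and n = n, OF b(1) \<kappa>])
    fix r \<mu> \<epsilon> assume r: "r \<le> n" "b r \<noteq> 0" and \<mu>: "\<mu> > 1 / s" and \<epsilon>: "\<epsilon> > 0"
      and val: "\<And>a. a \<le> n \<Longrightarrow> a \<noteq> r \<Longrightarrow> val_ge (b a / b r) ((1 + 1 / s) * (real a - real r))"
      and val': "\<And>a. a \<le> n \<Longrightarrow> a \<noteq> r \<Longrightarrow> val_ge (b a / b r) ((1 + \<mu>) * (real a - real r) + \<epsilon>)"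
      and min: "\<And>i. i \<le> n \<Longrightarrow> b i \<noteq> 0 \<Longrightarrow> height b (1 / s) r \<le> height b (1 / s) i"
      and min': "\<And>i. i \<le> n \<Longrightarrow> b i \<noteq> 0 \<Longrightarrow> r < i \<Longrightarrow> height b (1 / s) r < height b (1 / s) i"
    have \<mu>0: "\<mu> > 0" and mm: "min (1 / s) \<mu> = 1 / s" "max (1 / s) \<mu> = \<mu>" using \<mu> \<kappa> by linarith+
    have 1: "r > 0" if "\<sigma> \<le> 1 / s" by (rule slopes_le_imp_last_vertex_pos[OF pol that r(2) \<kappa> min'])
    have 2: "r < n" if "1 / s < \<sigma>" by (rule slopes_above_imp_last_vertex_less[OF b(1) r(1) pol that \<kappa> min])
    have "\<exists>P Q. conn_splitting S V nabla P Q \<and>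
      (\<forall>v\<in>carrier V. slow S V nabla (1 + 1 / s) (P v)) \<and>
      (\<forall>v\<in>carrier V. \<forall>\<theta><1 + \<mu>. slow S V nabla \<theta> (Q v) \<longrightarrow> Q v = \<zero>\<^bsub>V\<^esub>) \<and>
      (r > 0 \<longrightarrow> (\<exists>v\<in>carrier V. P v \<noteq> \<zero>\<^bsub>V\<^esub>)) \<and> (r < n \<longrightarrow> (\<exists>v\<in>carrier V. Q v \<noteq> \<zero>\<^bsub>V\<^esub>))"
      using vertex_splitting[of s V nabla n b \<phi> r \<mu> \<epsilon>, folded S_def, unfolded mm,
          OF s V cc n r(1) b(2) b(1) r(2) \<mu>0 \<epsilon> val val'] .
    moreover have "1 + 1 / s < 1 + \<mu>" using \<mu> by simp
    ultimately show ?thesis using 1 2 by blast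
  qed
qed

text \<open>At the first vertex \<mu> < 1/s, so the first part has a common rate strictly below 1 +
  1/s.\<close>

lemma splitting_below:
  fixes s :: real and V :: "(complex fls, 'v, 'm) module_scheme"
  defines "S \<equiv> gevrey_series s"
  assumes s: "s > 0" and V: "vs_connection (fls_subring S) V nabla"
    and fd: "vectorspace.fin_dim (fls_subring S) V" and \<sigma>: "\<sigma> \<in> formal_slopes (fls_subring S) V nabla"
  shows "\<exists>P Q \<mu>. conn_splitting S V nabla P Q \<and> \<mu> < 1 / s \<and>
    (\<forall>v\<in>carrier V. slow S V nabla (1 + \<mu>) (P v)) \<and>
    (\<forall>v\<in>carrier V. \<forall>\<theta><1 + 1 / s. slow S V nabla \<theta> (Q v) \<longrightarrow> Q v = \<zero>\<^bsub>V\<^esub>) \<and>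
    (\<sigma> < 1 / s \<longrightarrow> (\<exists>v\<in>carrier V. P v \<noteq> \<zero>\<^bsub>V\<^esub>)) \<and> (1 / s \<le> \<sigma> \<longrightarrow> (\<exists>v\<in>carrier V. Q v \<noteq> \<zero>\<^bsub>V\<^esub>))"
proof -
  obtain n b \<phi> where n: "n > 0" and cc: "coord_conn S V nabla n (companion n b) \<phi>" and b: "b n = 1" "\<And>i. b i \<in> S"
    and pol: "\<sigma> \<in> polygon_slopes (newton_polygon n b)"
    using formal_slope_polygon[of s V nabla \<sigma>, folded S_def, OF s V fd \<sigma>] by metis
  have \<kappa>: "1 / s > 0" using s by simp
  show ?thesis
  proof (rule first_vertex[where b = b and n = n, OF b(1) \<kappa>])
    fix r \<mu> \<epsilon> assume r: "r \<le> n" "b r \<noteq> 0" and \<mu>: "0 < \<mu>" "\<mu> < 1 / s" and \<epsilon>: "\<epsilon> > 0"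
      and val: "\<And>a. a \<le> n \<Longrightarrow> a \<noteq> r \<Longrightarrow> val_ge (b a / b r) ((1 + 1 / s) * (real a - real r))"
      and val': "\<And>a. a \<le> n \<Longrightarrow> a \<noteq> r \<Longrightarrow> val_ge (b a / b r) ((1 + \<mu>) * (real a - real r) + \<epsilon>)"
      and min: "\<And>i. i \<le> n \<Longrightarrow> b i \<noteq> 0 \<Longrightarrow> height b (1 / s) r \<le> height b (1 / s) i"
      and min': "\<And>i. i \<le> n \<Longrightarrow> b i \<noteq> 0 \<Longrightarrow> i < r \<Longrightarrow> height b (1 / s) r < height b (1 / s) i"
    have mm: "min (1 / s) \<mu> = \<mu>" "max (1 / s) \<mu> = 1 / s" using \<mu> by linarith+
    have 1: "r > 0" if "\<sigma> < 1 / s" by (rule slopes_below_imp_first_vertex_pos[OF pol that r(2) \<kappa> min])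
    have 2: "r < n" if "1 / s \<le> \<sigma>" by (rule slopes_ge_imp_first_vertex_less[OF b(1) r(1) pol that \<kappa> min'])
    have "\<exists>P Q. conn_splitting S V nabla P Q \<and>
      (\<forall>v\<in>carrier V. slow S V nabla (1 + \<mu>) (P v)) \<and>
      (\<forall>v\<in>carrier V. \<forall>\<theta><1 + 1 / s. slow S V nabla \<theta> (Q v) \<longrightarrow> Q v = \<zero>\<^bsub>V\<^esub>) \<and>
      (r > 0 \<longrightarrow> (\<exists>v\<in>carrier V. P v \<noteq> \<zero>\<^bsub>V\<^esub>)) \<and> (r < n \<longrightarrow> (\<exists>v\<in>carrier V. Q v \<noteq> \<zero>\<^bsub>V\<^esub>))"
      using vertex_splitting[of s V nabla n b \<phi> r \<mu> \<epsilon>, folded S_def, unfolded mm,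
          OF s V cc n r(1) b(2) b(1) r(2) \<mu>(1) \<epsilon> val val'] .
    then show ?thesis using 1 2 \<mu>(2) by blast
  qed
qed

section \<open>Trivial splittings and the growth of vectors in summands\<close>

lemma formal_slopes_sub_module_carrier:
  "formal_slopes K (sub_module V (carrier V)) nabla = formal_slopes K V nabla"
proof -
  let ?U = "sub_module V (carrier V)"
  have free: "tensor_free ?U = tensor_free V" by (simp only: tensor_free_def sub_module_simps)
  have null: "tensor_null K ?U = tensor_null K V" by (simp only: tensor_null_def free sub_module_simps)
  have induced: "tensor_induced K ?U = tensor_induced K V"
    by (intro ext) (simp only: tensor_induced_def free null)
  show ?thesis by (simp only: formal_slopes_def formal_space_def formal_nabla_def free null induced)
qed

lemma trivial_splitting:
  assumes V: "vs_connection (fls_subring S) V nabla"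
  shows "conn_splitting S V nabla (\<lambda>v. v) (\<lambda>_. \<zero>\<^bsub>V\<^esub>)"
proof -
  interpret V: vs_connection "fls_subring S" V nabla by (rule V)
  have "nabla \<zero>\<^bsub>V\<^esub> \<oplus>\<^bsub>V\<^esub> nabla \<zero>\<^bsub>V\<^esub> = nabla \<zero>\<^bsub>V\<^esub>"
    using V.nabla_add[of "\<zero>\<^bsub>V\<^esub>" "\<zero>\<^bsub>V\<^esub>"] by simp
  then have "nabla \<zero>\<^bsub>V\<^esub> = \<zero>\<^bsub>V\<^esub>" using V.nabla_closed[of "\<zero>\<^bsub>V\<^esub>"] V.add.l_cancel_one by fastforce
  then show ?thesis by (simp add: conn_splitting_def V.smult_r_null)
qed

text \<open>A slope would produce a nonzero vector in one of the two parts of a splitting.\<close>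

lemma formal_slopes_zero_space:
  assumes s: "s > 0" and V: "vs_connection (gevrey_field s) V nabla"
    and fd: "vectorspace.fin_dim (gevrey_field s) V" and zero: "\<And>v. v \<in> carrier V \<Longrightarrow> v = \<zero>\<^bsub>V\<^esub>"
  shows "formal_slopes (gevrey_field s) V nabla = {}"
proof (rule ccontr)
  assume "formal_slopes (gevrey_field s) V nabla \<noteq> {}"
  then obtain \<sigma> where \<sigma>: "\<sigma> \<in> formal_slopes (gevrey_field s) V nabla" by blast
  obtain P Q where PQ: "conn_splitting (gevrey_series s) V nabla P Q"
    and "\<sigma> \<le> 1 / s \<longrightarrow> (\<exists>v\<in>carrier V. P v \<noteq> \<zero>\<^bsub>V\<^esub>)" "1 / s < \<sigma> \<longrightarrow> (\<exists>v\<in>carrier V. Q v \<noteq> \<zero>\<^bsub>V\<^esub>)"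
    using splitting_at_or_below[OF s V fd \<sigma>] by blast
  then obtain v where v: "v \<in> carrier V" "P v \<noteq> \<zero>\<^bsub>V\<^esub> \<or> Q v \<noteq> \<zero>\<^bsub>V\<^esub>" by (cases "\<sigma> \<le> 1 / s") auto
  have "P v = \<zero>\<^bsub>V\<^esub>" "Q v = \<zero>\<^bsub>V\<^esub>" using zero conn_splittingD(1,2)[OF PQ v(1)] by blast+
  then show False using v(2) by blast
qed

text \<open>The inclusion and the projection P are both linear and commute with the connection, so
  growth can be compared in both directions.\<close>

lemma slow_sub_module_iff:
  assumes V: "vs_connection (fls_subring S) V nabla" and PQ: "conn_splitting S V nabla P Q"
    and w: "w \<in> P ` carrier V"
  shows "slow S (sub_module V (P ` carrier V)) nabla \<theta> w \<longleftrightarrow> slow S V nabla \<theta> w"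
proof -
  interpret V: vs_connection "fls_subring S" V nabla by (rule V)
  note D = conn_splittingD[OF PQ]
  have wV: "w \<in> carrier V" and Pw: "P w = w" using w D(1,4) by auto
  have sub: "v \<in> carrier V" if "v \<in> P ` carrier V" for v using that D(1) by auto
  have closed: "nabla v \<in> P ` carrier V" if v: "v \<in> P ` carrier V" for v
  proof -
    obtain u where "u \<in> carrier V" "v = P u" using v by blast
    then have "nabla v = P (nabla u)" "nabla u \<in> carrier V" using D(8) V.nabla_closed by auto
    then show ?thesis by blast
  qed
  show ?thesis
  proof
    assume "slow S (sub_module V (P ` carrier V)) nabla \<theta> w"
    then show "slow S V nabla \<theta> w"
      by (rule slow_map[where h = "\<lambda>v. v", rotated -1]) (simp_all add: closed sub w)
  next
    assume *: "slow S V nabla \<theta> w"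
    have "slow S (sub_module V (P ` carrier V)) nabla \<theta> (P w)"
      by (rule slow_map[where h = P, OF _ _ _ _ _ wV *]) (simp_all add: V.nabla_closed D)
    then show "slow S (sub_module V (P ` carrier V)) nabla \<theta> w" by (simp only: Pw)
  qed
qed

text \<open>A slope of at most 1/s in the second summand would yield a nonzero vector of rate 1 +
  1/s there, which is excluded. For the first summand a rate is recorded, because rates pass to
  further summands; the claim is conditional because the identity, taken when V has no slopes, comes
  with no bound on rates.\<close>

lemma split_above:
  fixes s :: real and V :: "(complex fls, 'v, 'm) module_scheme"
  defines "S \<equiv> gevrey_series s"
  assumes s: "s > 0" and V: "vs_connection (fls_subring S) V nabla"
    and fd: "vectorspace.fin_dim (fls_subring S) V"
  shows "\<exists>P Q. conn_splitting S V nabla P Q \<and>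
    (formal_slopes (fls_subring S) (sub_module V (P ` carrier V)) nabla \<noteq> {} \<longrightarrow>
      (\<forall>v\<in>carrier V. slow S V nabla (1 + 1 / s) (P v))) \<and>
    (\<forall>\<sigma>\<in>formal_slopes (fls_subring S) (sub_module V (Q ` carrier V)) nabla. 1 / s < \<sigma>)"
proof (cases "formal_slopes (fls_subring S) V nabla = {}")
  case True
  let ?P = "\<lambda>v. v" and ?Q = "\<lambda>_. \<zero>\<^bsub>V\<^esub>"
  have PQ: "conn_splitting S V nabla ?P ?Q" by (rule trivial_splitting[OF V])
  have "formal_slopes (fls_subring S) (sub_module V (?Q ` carrier V)) nabla = {}"
    using splitting_image_conn[OF V fd conn_splitting_sym[OF V PQ]] unfolding S_def
    by (rule formal_slopes_zero_space[OF s]) auto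
  moreover have "formal_slopes (fls_subring S) (sub_module V (?P ` carrier V)) nabla = {}"
    using True by (simp add: formal_slopes_sub_module_carrier)
  ultimately show ?thesis using PQ by blast
next
  case False
  then obtain \<sigma>\<^sub>0 where "\<sigma>\<^sub>0 \<in> formal_slopes (fls_subring S) V nabla" by blast
  from splitting_at_or_below[OF s V[unfolded S_def] fd[unfolded S_def] this[unfolded S_def], folded S_def]
  obtain P Q where PQ: "conn_splitting S V nabla P Q"
    and P: "\<forall>v\<in>carrier V. slow S V nabla (1 + 1 / s) (P v)"
    and Q: "\<forall>v\<in>carrier V. slow S V nabla (1 + 1 / s) (Q v) \<longrightarrow> Q v = \<zero>\<^bsub>V\<^esub>" by blast
  note D = conn_splittingD[OF PQ]
  note QP = conn_splitting_sym[OF V PQ]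
  let ?W = "sub_module V (Q ` carrier V)"
  note W = splitting_image_conn[OF V fd QP]
  have "1 / s < \<sigma>" if \<sigma>: "\<sigma> \<in> formal_slopes (fls_subring S) ?W nabla" for \<sigma>
  proof (rule ccontr)
    assume "\<not> 1 / s < \<sigma>"
    with splitting_at_or_below[OF s W[unfolded S_def] \<sigma>[unfolded S_def], folded S_def]
    obtain P' Q' v where PQ': "conn_splitting S ?W nabla P' Q'"
      and P': "\<forall>v\<in>carrier ?W. slow S ?W nabla (1 + 1 / s) (P' v)" and v: "v \<in> carrier ?W" "P' v \<noteq> \<zero>\<^bsub>?W\<^esub>"
      by (meson not_less)
    have w: "P' v \<in> Q ` carrier V" using conn_splittingD(1)[OF PQ' v(1)] by simp
    then have "slow S V nabla (1 + 1 / s) (P' v)" using P' v(1) slow_sub_module_iff[OF V QP w] by blast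
    moreover have "P' v \<in> carrier V" "Q (P' v) = P' v" using w D(2,5) by auto
    ultimately have "P' v = \<zero>\<^bsub>V\<^esub>" using Q by metis
    then show False using v(2) by simp
  qed
  then show ?thesis using PQ P by blast
qed

text \<open>The gap between the rates 1 + \<mu> and 1 + 1/s excludes slopes on the wrong side in
  both summands. The clause that V has slopes is carried along in order to discharge the condition
  in \<open>split_above\<close>.\<close>

lemma split_below:
  fixes s :: real and V :: "(complex fls, 'v, 'm) module_scheme"
  defines "S \<equiv> gevrey_series s"
  assumes s: "s > 0" and V: "vs_connection (fls_subring S) V nabla"
    and fd: "vectorspace.fin_dim (fls_subring S) V"
  shows "\<exists>P Q. conn_splitting S V nabla P Q \<and>
    (\<forall>\<sigma>\<in>formal_slopes (fls_subring S) (sub_module V (P ` carrier V)) nabla. \<sigma> < 1 / s) \<and>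
    (\<forall>\<sigma>\<in>formal_slopes (fls_subring S) (sub_module V (Q ` carrier V)) nabla.
      1 / s \<le> \<sigma> \<and> formal_slopes (fls_subring S) V nabla \<noteq> {})"
proof (cases "formal_slopes (fls_subring S) V nabla = {}")
  case True
  let ?P = "\<lambda>v. v" and ?Q = "\<lambda>_. \<zero>\<^bsub>V\<^esub>"
  have PQ: "conn_splitting S V nabla ?P ?Q" by (rule trivial_splitting[OF V])
  have "formal_slopes (fls_subring S) (sub_module V (?Q ` carrier V)) nabla = {}"
    using splitting_image_conn[OF V fd conn_splitting_sym[OF V PQ]] unfolding S_def
    by (rule formal_slopes_zero_space[OF s]) auto
  moreover have "formal_slopes (fls_subring S) (sub_module V (?P ` carrier V)) nabla = {}"
    using True by (simp add: formal_slopes_sub_module_carrier)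
  ultimately show ?thesis using PQ by blast
next
  case False
  then obtain \<sigma>\<^sub>0 where "\<sigma>\<^sub>0 \<in> formal_slopes (fls_subring S) V nabla" by blast
  from splitting_below[OF s V[unfolded S_def] fd[unfolded S_def] this[unfolded S_def], folded S_def]
  obtain P Q \<mu> where PQ: "conn_splitting S V nabla P Q" and \<mu>: "\<mu> < 1 / s"
    and P: "\<forall>v\<in>carrier V. slow S V nabla (1 + \<mu>) (P v)"
    and Q: "\<forall>v\<in>carrier V. \<forall>\<theta><1 + 1 / s. slow S V nabla \<theta> (Q v) \<longrightarrow> Q v = \<zero>\<^bsub>V\<^esub>" by blast
  note D = conn_splittingD[OF PQ]
  note QP = conn_splitting_sym[OF V PQ]
  let ?U = "sub_module V (P ` carrier V)" and ?W = "sub_module V (Q ` carrier V)"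
  note U = splitting_image_conn[OF V fd PQ] and W = splitting_image_conn[OF V fd QP]
  have 1: "\<sigma> < 1 / s" if \<sigma>: "\<sigma> \<in> formal_slopes (fls_subring S) ?U nabla" for \<sigma>
  proof (rule ccontr)
    assume "\<not> \<sigma> < 1 / s"
    with splitting_below[OF s U[unfolded S_def] \<sigma>[unfolded S_def], folded S_def]
    obtain P' Q' v where PQ': "conn_splitting S ?U nabla P' Q'"
      and Q': "\<forall>v\<in>carrier ?U. \<forall>\<theta><1 + 1 / s. slow S ?U nabla \<theta> (Q' v) \<longrightarrow> Q' v = \<zero>\<^bsub>?U\<^esub>"
      and v: "v \<in> carrier ?U" "Q' v \<noteq> \<zero>\<^bsub>?U\<^esub>"
      by (meson not_less)
    have w: "Q' v \<in> P ` carrier V" using conn_splittingD(2)[OF PQ' v(1)] by simp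
    then have "slow S V nabla (1 + \<mu>) (Q' v)" using P by auto
    then have "slow S ?U nabla (1 + \<mu>) (Q' v)" using slow_sub_module_iff[OF V PQ w] by blast
    moreover have "1 + \<mu> < 1 + 1 / s" using \<mu> by simp
    ultimately show False using Q' v by blast
  qed
  have 2: "1 / s \<le> \<sigma>" if \<sigma>: "\<sigma> \<in> formal_slopes (fls_subring S) ?W nabla" for \<sigma>
  proof (rule ccontr)
    assume "\<not> 1 / s \<le> \<sigma>"
    with splitting_below[OF s W[unfolded S_def] \<sigma>[unfolded S_def], folded S_def]
    obtain P' Q' \<mu>' v where PQ': "conn_splitting S ?W nabla P' Q'" and \<mu>': "\<mu>' < 1 / s"
      and P': "\<forall>v\<in>carrier ?W. slow S ?W nabla (1 + \<mu>') (P' v)" and v: "v \<in> carrier ?W" "P' v \<noteq> \<zero>\<^bsub>?W\<^esub>"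
      by (meson not_less)
    have w: "P' v \<in> Q ` carrier V" using conn_splittingD(1)[OF PQ' v(1)] by simp
    then have "slow S V nabla (1 + \<mu>') (P' v)" using P' v(1) slow_sub_module_iff[OF V QP w] by blast
    moreover have "P' v \<in> carrier V" "Q (P' v) = P' v" using w D(2,5) by auto
    moreover have "1 + \<mu>' < 1 + 1 / s" using \<mu>' by simp
    ultimately have "P' v = \<zero>\<^bsub>V\<^esub>" using Q by metis
    then show False using v(2) by simp
  qed
  show ?thesis using PQ 1 2 False by blast
qed

theorem mainTheorem4:
  fixes s :: real
    and V :: "(complex fls, 'v, 'm) module_scheme"
    and nabla :: "'v \<Rightarrow> 'v"
  assumes "s > 0"
    and "vs_connection (gevrey_field s) V nabla"
    and "vectorspace.fin_dim (gevrey_field s) V"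
  shows "\<exists>(V1 :: (complex fls, 'v) module) (V2 :: (complex fls, 'v) module)
          (V3 :: (complex fls, 'v) module) nabla1 nabla2 nabla3 \<phi>.
    vs_connection (gevrey_field s) V1 nabla1 \<and> vectorspace.fin_dim (gevrey_field s) V1 \<and>
    vs_connection (gevrey_field s) V2 nabla2 \<and> vectorspace.fin_dim (gevrey_field s) V2 \<and>
    vs_connection (gevrey_field s) V3 nabla3 \<and> vectorspace.fin_dim (gevrey_field s) V3 \<and>
    (\<forall>\<sigma>\<in>formal_slopes (gevrey_field s) V1 nabla1. \<sigma> < 1 / s) \<and>
    (\<forall>\<sigma>\<in>formal_slopes (gevrey_field s) V2 nabla2. \<sigma> = 1 / s) \<and>
    (\<forall>\<sigma>\<in>formal_slopes (gevrey_field s) V3 nabla3. \<sigma> > 1 / s) \<and>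
    connection_iso (gevrey_field s) V nabla
      (direct_sum (direct_sum V1 V2) V3) (map_prod (map_prod nabla1 nabla2) nabla3) \<phi>"
proof -
  note s = assms(1) and V = assms(2) and fd = assms(3)
  let ?S = "gevrey_series s" and ?K = "gevrey_field s"
  obtain P Q where PQ: "conn_splitting ?S V nabla P Q"
    and P: "formal_slopes ?K (sub_module V (P ` carrier V)) nabla \<noteq> {} \<longrightarrow>
      (\<forall>v\<in>carrier V. slow ?S V nabla (1 + 1 / s) (P v))"
    and Q: "\<forall>\<sigma>\<in>formal_slopes ?K (sub_module V (Q ` carrier V)) nabla. 1 / s < \<sigma>"
    using split_above[OF s V fd] by blast
  define U where "U = sub_module V (P ` carrier V)"
  define V3 where "V3 = sub_module V (Q ` carrier V)"
  note U = splitting_image_conn[OF V fd PQ, folded U_def]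
  note V3 = splitting_image_conn[OF V fd conn_splitting_sym[OF V PQ], folded V3_def]
  obtain P' Q' where PQ': "conn_splitting ?S U nabla P' Q'"
    and P': "\<forall>\<sigma>\<in>formal_slopes ?K (sub_module U (P' ` carrier U)) nabla. \<sigma> < 1 / s"
    and Q': "\<forall>\<sigma>\<in>formal_slopes ?K (sub_module U (Q' ` carrier U)) nabla. 1 / s \<le> \<sigma> \<and> formal_slopes ?K U nabla \<noteq> {}"
    using split_below[OF s U] by blast
  note QP' = conn_splitting_sym[OF U(1) PQ']
  define V1 where "V1 = sub_module U (P' ` carrier U)"
  define V2 where "V2 = sub_module U (Q' ` carrier U)"
  note V1 = splitting_image_conn[OF U PQ', folded V1_def]
  note V2 = splitting_image_conn[OF U QP', folded V2_def]
  \<comment> \<open>The upper bound comes from the first splitting: vectors of V2 lie in its slow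
    part, whereas a slope above 1/s would give a nonzero vector that is not of rate 1 + 1/s.\<close>
  have slopes2: "\<sigma> = 1 / s" if \<sigma>: "\<sigma> \<in> formal_slopes ?K V2 nabla" for \<sigma>
  proof (rule antisym)
    show "1 / s \<le> \<sigma>" using Q' \<sigma> by (simp add: V2_def)
    show "\<sigma> \<le> 1 / s"
    proof (rule ccontr)
      assume "\<not> \<sigma> \<le> 1 / s"
      with splitting_at_or_below[OF s V2 \<sigma>]
      obtain P2 Q2 v where PQ2: "conn_splitting ?S V2 nabla P2 Q2"
        and Q2: "\<forall>v\<in>carrier V2. slow ?S V2 nabla (1 + 1 / s) (Q2 v) \<longrightarrow> Q2 v = \<zero>\<^bsub>V2\<^esub>"
        and v: "v \<in> carrier V2" "Q2 v \<noteq> \<zero>\<^bsub>V2\<^esub>"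
        by (meson not_less)
      have w: "Q2 v \<in> Q' ` carrier U" using conn_splittingD(2)[OF PQ2 v(1)] by (simp only: V2_def sub_module_simps)
      have wU: "Q2 v \<in> P ` carrier V"
      proof -
        from w obtain u where "Q2 v = Q' u" "u \<in> carrier U" by (rule imageE)
        then have "Q2 v \<in> carrier U" by (simp only: conn_splittingD(2)[OF PQ'])
        then show ?thesis by (simp only: U_def sub_module_simps)
      qed
      \<comment> \<open>Makes the conditional rate bound from the first splitting available.\<close>
      have "formal_slopes ?K U nabla \<noteq> {}" using Q' \<sigma> by (simp add: V2_def)
      then have "slow ?S V nabla (1 + 1 / s) (Q2 v)" using P wU by (metis U_def imageE)
      then have "slow ?S U nabla (1 + 1 / s) (Q2 v)" unfolding U_def slow_sub_module_iff[OF V PQ wU] .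
      then have "slow ?S V2 nabla (1 + 1 / s) (Q2 v)" unfolding V2_def slow_sub_module_iff[OF U(1) QP' w] .
      then show False using Q2 v by blast
    qed
  qed
  have slopes1: "\<sigma> < 1 / s" if "\<sigma> \<in> formal_slopes ?K V1 nabla" for \<sigma>
    by (rule bspec[OF P'[folded V1_def] that])
  have slopes3: "\<sigma> > 1 / s" if "\<sigma> \<in> formal_slopes ?K V3 nabla" for \<sigma>
    by (rule bspec[OF Q[folded V3_def] that])
  have "connection_iso ?K V nabla (direct_sum U V3) (map_prod nabla nabla) (\<lambda>v. (P v, Q v))"
    unfolding U_def V3_def by (rule splitting_iso[OF V fd PQ])
  moreover have "connection_iso ?K U nabla (direct_sum V1 V2) (map_prod nabla nabla) (\<lambda>v. (P' v, Q' v))"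
    unfolding V1_def V2_def by (rule splitting_iso[OF U PQ'])
  moreover have "vectorspace ?K V3" using V3(1) by (rule vs_connection.axioms(1))
  ultimately have iso: "connection_iso ?K V nabla (direct_sum (direct_sum V1 V2) V3)
      (map_prod (map_prod nabla nabla) nabla) (\<lambda>v. ((P' (P v), Q' (P v)), Q v))"
    by (rule connection_iso_direct_sum_left)
  show ?thesis
    by (intro exI[of _ V1] exI[of _ V2] exI[of _ V3] exI[of _ nabla]
        exI[of _ "\<lambda>v. ((P' (P v), Q' (P v)), Q v)"] conjI V1 V2 V3 ballI slopes1 slopes2 slopes3 iso)
qed

end
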